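(* Let $M>1.225$. There exist constants $c_0,C>0$ (possibly depending on $M$) such that for all $L>0$, $\mu>0$ and $E_B<0$ with $L^2|E_B|\ge 1$ and $\mu/|E_B|\ge c_0$, the ground state energy $E(\mu,E_B)=\min\sigma(H)$ of the Hamiltonian $H$ on $L^2(\Omega)\otimes\mathscr H_{N(\mu)}$ satisfies $$\big|E(\mu,E_B)-E_0(\mu)-e_{\rm P}(\mu,E_B)\big|\le C\,\frac{|e_{\rm P}(\mu,E_B)|}{\log(\mu/|E_B|)}.$$
   Context: Let $M>0$ be the mass ratio, $m=1+1/M$, $L>0$, $\Omega=[-L/2,L/2]^2$ with periodic boundary conditions, $\kappa=2\pi/L$, and for $k\in\kappa\mathbb Z^2$ let $\varphi_k(x)=L^{-1}e^{ikx}$. Let $\mathcal F$ be the fermionic Fock space over $L^2(\Omega)$ with vacuum $|0\rangle$, $\mathscr H_n=\bigwedge^nL^2(\Omega)$ its $n$-particle sector, and $a_k,a_k^*$ the annihilation and creation operators of $\varphi_k$ (satisfying the canonical anticommutation relations). All sums over momenta run over $\kappa\mathbb Z^2$ with the indicated restrictions. For $\mu>0$ let $N(\mu)=\#\{k\in\kappa\mathbb Z^2:k^2\le\mu\}$ and $E_0(\mu)=\sum_{k^2\le\mu}k^2$. Let $E_B<0$. For $n\in\mathbb N$ set $g_n^{-1}=\sum_{k^2\le n}\frac{1}{mk^2-E_B}$ and define on $L^2(\Omega)\otimes\mathscr H_{N(\mu)}$ (the variable $y\in\Omega$ being the impurity coordinate) $$H_n=-\tfrac1M\Delta_y+\sum_k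 k^2a_k^*a_k-g_n\sum_{k^2,l^2\le n}e^{i(k-l)y}a_l^*a_k.$$ It is known that there is a self-adjoint, bounded below operator $H$ with purely discrete spectrum such that $H_n\to H$ in strong resolvent sense; this $H$ is the Hamiltonian in question. For $q\in\mathbb R^2$ and $\tau>-\mu$ define $$G(q,\tau)=\frac{1}{L^2}\sum_k\Big(\frac{1}{mk^2-E_B}-\frac{\chi_{(\mu,\infty)}(k^2)}{\frac1M(q-k)^2+k^2+\tau}\Big),$$ where $\chi_{(\mu,\infty)}$ is the indicator of $(\mu,\infty)$. The polaron energy $e_{\rm P}(\mu,E_B)<0$ is the lowest negative solution $e$ of the polaron equation $e=-\frac{1}{L^2}\sum_{k^2\le\mu}\frac{1}{G(k,-k^2-e)}$ (such a lowest negative solution exists). *)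

theory Defs
  imports "HOL-Analysis.Analysis"
begin

text \<open>
  Concrete model. Momenta kappa*j with j in Z^2 are encoded by their lattice index
  j :: int \<times> int. The Hilbert space L^2(Omega) tensor wedge^N L^2(Omega) is
  represented (unitarily) in the orthonormal basis phi_p(y) tensor
  a^*_{k_1}...a^*_{k_N}|0>, k_1 < ... < k_N (lexicographic order on Z^2),
  indexed by configurations (p, S) with S a set of N lattice points.
\<close>

type_synonym lat = "int \<times> int"
type_synonym cfg = "lat \<times> lat set"
type_synonym vec = "cfg \<Rightarrow> complex"
type_synonym op = "vec set \<times> (vec \<Rightarrow> vec)"

definition kap :: "real \<Rightarrow> real" where "kap L = 2 * pi / L"

definition msq :: "real \<Rightarrow> lat \<Rightarrow> real" where
  "msq L j = (kap L)^2 * ((real_of_int (fst j))^2 + (real_of_int (snd j))^2)"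

definition ball_lat :: "real \<Rightarrow> real \<Rightarrow> lat set" where
  "ball_lat L r = {j. msq L j \<le> r}"

definition Nmu :: "real \<Rightarrow> real \<Rightarrow> nat" where
  "Nmu L \<mu> = card (ball_lat L \<mu>)"

definition E0 :: "real \<Rightarrow> real \<Rightarrow> real" where
  "E0 L \<mu> = (\<Sum>j\<in>ball_lat L \<mu>. msq L j)"

definition mred :: "real \<Rightarrow> real" where "mred M = 1 + 1 / M"

definition lat_less :: "lat \<Rightarrow> lat \<Rightarrow> bool" where
  "lat_less i j \<longleftrightarrow> fst i < fst j \<or> (fst i = fst j \<and> snd i < snd j)"

text \<open>sign picked up by moving past the creation operators of S below j\<close>
definition sgn_lat :: "lat set \<Rightarrow> lat \<Rightarrow> complex" where
  "sgn_lat S j = (-1) ^ card {i\<in>S. lat_less i j}"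

definition Cfg :: "nat \<Rightarrow> cfg set" where
  "Cfg N = {(p, S). finite S \<and> card S = N}"

definition l2 :: "nat \<Rightarrow> vec set" where
  "l2 N = {\<psi>. (\<forall>c. c \<notin> Cfg N \<longrightarrow> \<psi> c = 0) \<and> (\<lambda>c. (cmod (\<psi> c))^2) summable_on UNIV}"

definition inner_l2 :: "vec \<Rightarrow> vec \<Rightarrow> complex" where
  "inner_l2 \<phi> \<psi> = infsum (\<lambda>c. cnj (\<phi> c) * \<psi> c) UNIV"

definition norm_l2 :: "vec \<Rightarrow> real" where
  "norm_l2 \<psi> = sqrt (infsum (\<lambda>c. (cmod (\<psi> c))^2) UNIV)"

definition selfadjoint :: "nat \<Rightarrow> op \<Rightarrow> bool" where
  "selfadjoint N H \<longleftrightarrow> (let D = fst H; A = snd H in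
     D \<subseteq> l2 N \<and> (\<lambda>c. 0) \<in> D
     \<and> (\<forall>\<phi>\<in>D. \<forall>\<psi>\<in>D. \<forall>a b. (\<lambda>c. a * \<phi> c + b * \<psi> c) \<in> D
          \<and> A (\<lambda>c. a * \<phi> c + b * \<psi> c) = (\<lambda>c. a * A \<phi> c + b * A \<psi> c))
     \<and> (\<forall>\<psi>\<in>l2 N. \<forall>\<epsilon>>0. \<exists>\<phi>\<in>D. norm_l2 (\<lambda>c. \<psi> c - \<phi> c) < \<epsilon>)
     \<and> A ` D \<subseteq> l2 N
     \<and> (\<forall>\<phi>\<in>D. \<forall>\<psi>\<in>D. inner_l2 \<phi> (A \<psi>) = inner_l2 (A \<phi>) \<psi>)
     \<and> (\<forall>\<phi>\<in>l2 N. (\<exists>\<eta>\<in>l2 N. \<forall>\<psi>\<in>D. inner_l2 \<phi> (A \<psi>) = inner_l2 \<eta> \<psi>) \<longrightarrow> \<phi> \<in> D))"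

definition resolv :: "op \<Rightarrow> complex \<Rightarrow> vec \<Rightarrow> vec" where
  "resolv H z \<psi> = (THE \<phi>. \<phi> \<in> fst H \<and> (\<lambda>c. snd H \<phi> c - z * \<phi> c) = \<psi>)"

definition srs_conv :: "nat \<Rightarrow> (nat \<Rightarrow> op) \<Rightarrow> op \<Rightarrow> bool" where
  "srs_conv N Hs H \<longleftrightarrow> (\<forall>z. Im z \<noteq> 0 \<longrightarrow> (\<forall>\<psi>\<in>l2 N.
     (\<lambda>n. norm_l2 (\<lambda>c. resolv (Hs n) z \<psi> c - resolv H z \<psi> c)) \<longlonglongrightarrow> 0))"

definition spectrum_op :: "nat \<Rightarrow> op \<Rightarrow> complex set" where
  "spectrum_op N H = {z. \<not> ((\<forall>\<psi>\<in>l2 N. \<exists>\<phi>\<in>fst H. (\<lambda>c. snd H \<phi> c - z * \<phi> c) = \<psi>)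
      \<and> (\<exists>C. \<forall>\<phi>\<in>fst H. norm_l2 \<phi> \<le> C * norm_l2 (\<lambda>c. snd H \<phi> c - z * \<phi> c)))}"

text \<open>diagonal kinetic energy -(1/M)Delta_y + sum_k k^2 a_k^* a_k on the basis vector (p,S)\<close>
definition kin :: "real \<Rightarrow> real \<Rightarrow> cfg \<Rightarrow> real" where
  "kin M L c = msq L (fst c) / M + (\<Sum>k\<in>snd c. msq L k)"

definition gcoup :: "real \<Rightarrow> real \<Rightarrow> real \<Rightarrow> nat \<Rightarrow> real" where
  "gcoup M L EB n = 1 / (\<Sum>k\<in>ball_lat L (real n). 1 / (mred M * msq L k - EB))"

text \<open>(sum_{k^2,l^2<=n} e^{i(k-l)y} a_l^* a_k psi) at basis vector (p',S')\<close>
definition Vint :: "real \<Rightarrow> nat \<Rightarrow> vec \<Rightarrow> vec" where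
  "Vint L n \<psi> c' = (let p' = fst c'; S' = snd c' in
     (\<Sum>k\<in>ball_lat L (real n). \<Sum>l\<in>ball_lat L (real n).
        if l \<in> S' \<and> (k = l \<or> k \<notin> S') then
          (let S = insert k (S' - {l}) in
             sgn_lat S k * sgn_lat (S - {k}) l * \<psi> (p' - k + l, S))
        else 0))"

definition Hn :: "real \<Rightarrow> real \<Rightarrow> real \<Rightarrow> nat \<Rightarrow> nat \<Rightarrow> op" where
  "Hn M L EB N n =
    ({\<psi>\<in>l2 N. (\<lambda>c. complex_of_real (kin M L c) * \<psi> c) \<in> l2 N},
     (\<lambda>\<psi> c. if c \<in> Cfg N then complex_of_real (kin M L c) * \<psi> c
              - complex_of_real (gcoup M L EB n) * Vint L n \<psi> c else 0))"

text \<open>the limiting Hamiltonian H (determined up to its values off its domain)\<close>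
definition Hlim :: "real \<Rightarrow> real \<Rightarrow> real \<Rightarrow> real \<Rightarrow> op" where
  "Hlim M L \<mu> EB = (SOME H. selfadjoint (Nmu L \<mu>) H
      \<and> srs_conv (Nmu L \<mu>) (Hn M L EB (Nmu L \<mu>)) H)"

definition Egs :: "real \<Rightarrow> real \<Rightarrow> real \<Rightarrow> real \<Rightarrow> real" where
  "Egs M L \<mu> EB = Inf {x. complex_of_real x \<in> spectrum_op (Nmu L \<mu>) (Hlim M L \<mu> EB)}"

definition Gfun :: "real \<Rightarrow> real \<Rightarrow> real \<Rightarrow> real \<Rightarrow> real \<times> real \<Rightarrow> real \<Rightarrow> real" where
  "Gfun M L \<mu> EB q \<tau> = (1 / L^2) * infsum (\<lambda>j::lat.
      1 / (mred M * msq L j - EB)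
      - (if msq L j > \<mu> then
           1 / (((fst q - kap L * real_of_int (fst j))^2 + (snd q - kap L * real_of_int (snd j))^2) / M
                + msq L j + \<tau>)
         else 0)) UNIV"

definition latvec :: "real \<Rightarrow> lat \<Rightarrow> real \<times> real" where
  "latvec L j = (kap L * real_of_int (fst j), kap L * real_of_int (snd j))"

definition polaron_eq :: "real \<Rightarrow> real \<Rightarrow> real \<Rightarrow> real \<Rightarrow> real \<Rightarrow> bool" where
  "polaron_eq M L \<mu> EB e \<longleftrightarrow>
     e = - (1 / L^2) * (\<Sum>j\<in>ball_lat L \<mu>. 1 / Gfun M L \<mu> EB (latvec L j) (- msq L j - e))"

definition eP :: "real \<Rightarrow> real \<Rightarrow> real \<Rightarrow> real \<Rightarrow> real" where
  "eP M L \<mu> EB = (LEAST e. e < 0 \<and> polaron_eq M L \<mu> EB e)"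

end

theory Submission
  imports Defs
begin

text \<open>
  The operators \<open>b\<^sub>k = e\<^bsup>iky\<^esup> a\<^sub>k\<close> satisfy the canonical anticommutation relations, and
  \<open>H\<^sub>n = T - g\<^sub>n A\<^sub>n\<^sup>* A\<^sub>n\<close> with \<open>A\<^sub>n\<close> the sum of the \<open>b\<^sub>k\<close> over \<open>k\<^sup>2 \<le> n\<close>.

  Upper bound: with \<open>e\<close> the polaron energy and \<open>w\<close> the superposition of the one-hole states of the Fermi
  sea with weights \<open>1 / G(q, -q\<^sup>2 - e)\<close>, the vectors \<open>(T - E\<^sub>0 - e)\<^sup>-\<^sup>1 A\<^sub>n\<^sup>* w\<close> converge to a nonzero limit and
  their energy expectation tends to \<open>E\<^sub>0 + e\<close>, because \<open>e\<close> solves the polaron equation. Hence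
  \<open>E \<le> E\<^sub>0 + e\<close> without error term.

  Lower bound: \<open>A\<^sub>n\<close> is split at \<open>k\<^sup>2 = 10 \<mu>\<close>. For the high modes, normal ordering of
  \<open>A\<^sub>n (T - E)\<^sup>-\<^sup>1 A\<^sub>n\<^sup>*\<close> leaves a diagonal sum, controlled by pairing \<open>k\<close> with \<open>-k\<close>, and a remainder with a
  positive Cauchy kernel. For the low modes, pairs are ordered by their distance to the Fermi level; altogether
  this gives \<open>|A x|\<^sup>2 \<le> (g\<^sub>n\<^sup>-\<^sup>1 - c) \<langle>x, (T - E) x\<rangle>\<close> once \<open>E\<^sub>0 - E\<close> is \<open>N(\<mu>) / \<beta>\<close> to leading order, \<open>\<beta>\<close> being the
  logarithmically divergent sum of \<open>1 / (m k\<^sup>2 - E\<^sub>B)\<close> over the low modes. The polaron energy has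
  the same leading order, with relative error \<open>1 / \<beta>\<close>.

  The slack \<open>c > 0\<close> in the form bound also shows that the resolvents of the \<open>H\<^sub>n\<close> converge, so that the
  limiting Hamiltonian exists.
\<close>

section \<open>Square-summable functions as a Hilbert space\<close>

text \<open>As the cut-off grows, the reciprocal coupling and the diagonal sum produced by normal
  ordering both diverge logarithmically, so a multiplicative loss in front of the high-mode sum
  would ruin the lower bound. Every high-mode estimate therefore keeps the constant one and allows
  only an additive error of order \<open>1 / (kap L)^2\<close>. This is affordable because
  \<open>(kap L)^2\<close> times the low-mode sum is at least of order log(\<mu>/|E_B|), and its
  inverse is the relative error of the theorem. The assumption L^2 |E_B| >= 1 keeps |E_B| above
  \<open>(kap L)^2 / 64\<close>, so that lattice sums behave like integrals. The Pauli principle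
  enters quantitatively: a sum of N annihilators has norm at most sqrt N, not N. The bound on M
  keeps the nodes of the Cauchy kernel positive: beyond 10 \<mu> at least 9/10 of k^2 is left after
  subtracting \<mu>, and recoil can take away k^2 / M. \<open>Hlim\<close> is a bare choice, about
  which nothing is known before some limit operator has been built; the construction is modelled on
  Krein's resolvent formula.\<close>

lemma summable_on_cmod2_add:
  fixes f g :: "'a \<Rightarrow> complex"
  assumes "(\<lambda>x. (cmod (f x))\<^sup>2) summable_on A" "(\<lambda>x. (cmod (g x))\<^sup>2) summable_on A"
  shows "(\<lambda>x. (cmod (f x + g x))\<^sup>2) summable_on A"
proof -
  have *: "(\<lambda>x. 2 * (cmod (f x))\<^sup>2 + 2 * (cmod (g x))\<^sup>2) summable_on A"
    by (intro summable_on_add summable_on_cmult_right assms)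
  show ?thesis
  proof (rule summable_on_comparison_test[OF *])
    fix x
    have "(cmod (f x + g x))\<^sup>2 \<le> (cmod (f x) + cmod (g x))\<^sup>2"
      by (intro power_mono norm_triangle_ineq) auto
    also have "\<dots> \<le> 2 * (cmod (f x))\<^sup>2 + 2 * (cmod (g x))\<^sup>2"
      using sum_squares_bound[of "cmod (f x)" "cmod (g x)"] by (simp add: power2_sum)
    finally show "(cmod (f x + g x))\<^sup>2 \<le> 2 * (cmod (f x))\<^sup>2 + 2 * (cmod (g x))\<^sup>2" .
  qed auto
qed

lemma summable_on_cmod2_mult:
  fixes f g :: "'a \<Rightarrow> complex"
  assumes "(\<lambda>x. (cmod (f x))\<^sup>2) summable_on A" "(\<lambda>x. (cmod (g x))\<^sup>2) summable_on A"
  shows "(\<lambda>x. norm (cnj (f x) * g x)) summable_on A"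
proof (rule summable_on_comparison_test)
  show "(\<lambda>x. (cmod (f x))\<^sup>2 + (cmod (g x))\<^sup>2) summable_on A"
    by (intro summable_on_add assms)
  fix x show "norm (cnj (f x) * g x) \<le> (cmod (f x))\<^sup>2 + (cmod (g x))\<^sup>2"
  proof -
    have "2 * cmod (f x) * cmod (g x) \<le> (cmod (f x))\<^sup>2 + (cmod (g x))\<^sup>2"
      by (rule sum_squares_bound)
    moreover have "0 \<le> cmod (f x) * cmod (g x)" by simp
    ultimately have "cmod (f x) * cmod (g x) \<le> (cmod (f x))\<^sup>2 + (cmod (g x))\<^sup>2" by linarith
    thus ?thesis by (simp add: norm_mult)
  qed
qed auto

text \<open>A type of its own makes the real inner product classes and completeness available; the
  complex structure is carried separately by \<open>cs\<close> and \<open>cinner\<close>.\<close>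

typedef 'a ell2 = "{f :: 'a \<Rightarrow> complex. (\<lambda>x. (cmod (f x))\<^sup>2) summable_on UNIV}"
  morphisms ev Abs_ell2
  by (rule exI[of _ "\<lambda>_. 0"]) simp

setup_lifting type_definition_ell2

lemma ev_summable: "(\<lambda>c. (cmod (ev x c))\<^sup>2) summable_on UNIV"
  using ev[of x] by simp

lemma ev_Abs: "(\<lambda>c. (cmod (f c))\<^sup>2) summable_on UNIV \<Longrightarrow> ev (Abs_ell2 f) = f"
  by (simp add: Abs_ell2_inverse)

lemma ell2_eqI: "(\<And>c. ev x c = ev y c) \<Longrightarrow> x = y"
  by (metis ev_inject ext)

instantiation ell2 :: (type) real_vector
begin
lift_definition zero_ell2 :: "'a ell2" is "\<lambda>_. 0" by simp
lift_definition uminus_ell2 :: "'a ell2 \<Rightarrow> 'a ell2" is "\<lambda>f x. - f x" by simp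
lift_definition plus_ell2 :: "'a ell2 \<Rightarrow> 'a ell2 \<Rightarrow> 'a ell2" is "\<lambda>f g x. f x + g x"
  by (rule summable_on_cmod2_add)
lift_definition minus_ell2 :: "'a ell2 \<Rightarrow> 'a ell2 \<Rightarrow> 'a ell2" is "\<lambda>f g x. f x - g x"
  using summable_on_cmod2_add[of _ UNIV "\<lambda>x. - g x" for g] by simp
lift_definition scaleR_ell2 :: "real \<Rightarrow> 'a ell2 \<Rightarrow> 'a ell2" is "\<lambda>r f x. complex_of_real r * f x"
  by (simp add: norm_mult power_mult_distrib summable_on_cmult_right)
instance
  by standard (transfer; simp add: algebra_simps scaleR_conv_of_real)+
end

lift_definition cs :: "complex \<Rightarrow> 'a ell2 \<Rightarrow> 'a ell2" is "\<lambda>a f x. a * f x"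
  by (simp add: norm_mult power_mult_distrib summable_on_cmult_right)

lemma ev_simps [simp]:
  "ev 0 c = 0" "ev (- x) c = - ev x c" "ev (x + y) c = ev x c + ev y c"
  "ev (x - y) c = ev x c - ev y c" "ev (r *\<^sub>R x) c = complex_of_real r * ev x c"
  "ev (cs a x) c = a * ev x c"
  by (transfer, simp)+

definition cinner :: "'a ell2 \<Rightarrow> 'a ell2 \<Rightarrow> complex" where
  "cinner x y = infsum (\<lambda>c. cnj (ev x c) * ev y c) UNIV"

lemma cinner_summable: "(\<lambda>c. cnj (ev x c) * ev y c) summable_on UNIV"
  by (rule Infinite_Sum.abs_summable_summable[OF summable_on_cmod2_mult[OF ev_summable ev_summable]])

lemma cinner_add_left: "cinner (x + y) z = cinner x z + cinner y z"
proof -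
  have "cinner x z + cinner y z = infsum (\<lambda>c. cnj (ev x c) * ev z c + cnj (ev y c) * ev z c) UNIV"
    unfolding cinner_def by (rule infsum_add[symmetric]) (rule cinner_summable)+
  thus ?thesis by (simp add: cinner_def distrib_right)
qed

lemma cinner_cs_left: "cinner (cs a x) z = cnj a * cinner x z"
  unfolding cinner_def by (subst infsum_cmult_right'[symmetric]) (simp add: mult.assoc)

lemma cinner_cs_right: "cinner x (cs a z) = a * cinner x z"
  unfolding cinner_def by (subst infsum_cmult_right'[symmetric]) (simp add: mult.left_commute)

lemma cinner_commute: "cinner x y = cnj (cinner y x)"
  unfolding cinner_def by (subst infsum_cnj[symmetric]) (simp add: mult.commute)

lemma cinner_has_sum: "((\<lambda>c. cnj (ev x c) * ev y c) has_sum cinner x y) UNIV"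
  unfolding cinner_def using cinner_summable by (rule has_sum_infsum)

lemma has_sum_Re:
  assumes "(f has_sum a) A" shows "((\<lambda>x. Re (f x)) has_sum Re a) A"
  using has_sum_bounded_linear[OF bounded_linear_Re assms] by (simp add: o_def)

lemma cinner_self_has_sum: "((\<lambda>c. (cmod (ev x c))\<^sup>2) has_sum Re (cinner x x)) UNIV"
proof -
  have "Re (cnj z * z) = (cmod z)\<^sup>2" for z :: complex
    by (metis Re_complex_of_real complex_norm_square mult.commute)
  thus ?thesis using has_sum_Re[OF cinner_has_sum[of x x]] by simp
qed

instantiation ell2 :: (type) real_inner
begin
definition inner_ell2 :: "'a ell2 \<Rightarrow> 'a ell2 \<Rightarrow> real" where "inner_ell2 x y = Re (cinner x y)"
definition norm_ell2 :: "'a ell2 \<Rightarrow> real" where "norm_ell2 x = sqrt (inner x x)"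
definition dist_ell2 :: "'a ell2 \<Rightarrow> 'a ell2 \<Rightarrow> real" where "dist_ell2 x y = norm (x - y)"
definition sgn_ell2 :: "'a ell2 \<Rightarrow> 'a ell2" where "sgn_ell2 x = x /\<^sub>R norm x"
definition uniformity_ell2 :: "('a ell2 \<times> 'a ell2) filter"
  where "uniformity_ell2 = (INF e\<in>{0 <..}. principal {(x, y). dist x y < e})"
definition open_ell2 :: "'a ell2 set \<Rightarrow> bool"
  where "open_ell2 U = (\<forall>x\<in>U. \<forall>\<^sub>F (x', y) in uniformity. x' = x \<longrightarrow> y \<in> U)"
instance
proof
  fix x y z :: "'a ell2" and r :: real
  show "inner x y = inner y x"
    unfolding inner_ell2_def by (subst cinner_commute) simp
  show "inner (x + y) z = inner x z + inner y z"
    by (simp add: inner_ell2_def cinner_add_left)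
  have "r *\<^sub>R x = cs (complex_of_real r) x" by (rule ell2_eqI) simp
  thus "inner (r *\<^sub>R x) y = r * inner x y"
    by (simp add: inner_ell2_def cinner_cs_left)
  show "0 \<le> inner x x"
    unfolding inner_ell2_def using cinner_self_has_sum[of x] by (rule has_sum_nonneg) simp
  show "(inner x x = 0) = (x = 0)"
  proof
    assume "inner x x = 0"
    hence h: "((\<lambda>c. (cmod (ev x c))\<^sup>2) has_sum 0) UNIV"
      using cinner_self_has_sum[of x] by (simp add: inner_ell2_def)
    have "(cmod (ev x c))\<^sup>2 = 0" for c
      by (rule nonneg_has_sum_le_0D[OF h]) auto
    thus "x = 0" by (intro ell2_eqI) simp
  qed (simp add: inner_ell2_def cinner_def)
qed (simp_all add: norm_ell2_def dist_ell2_def sgn_ell2_def uniformity_ell2_def open_ell2_def)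
end

lemma norm2_has_sum: "((\<lambda>c. (cmod (ev x c))\<^sup>2) has_sum (norm x)\<^sup>2) UNIV"
  using cinner_self_has_sum[of x] by (simp add: power2_norm_eq_inner inner_ell2_def)

lemma inner_has_sum: "((\<lambda>c. Re (cnj (ev x c) * ev y c)) has_sum inner x y) UNIV"
  unfolding inner_ell2_def using has_sum_Re[OF cinner_has_sum] .

lemma finite_sum_le_norm2: "finite F \<Longrightarrow> (\<Sum>c\<in>F. (cmod (ev x c))\<^sup>2) \<le> (norm x)\<^sup>2"
  using norm2_has_sum[of x] by (intro finite_sum_le_has_sum) auto

lemma ev_le_norm: "cmod (ev x c) \<le> norm x"
  using finite_sum_le_norm2[of "{c}" x] by (simp add: power2_le_iff_abs_le)

lemma summable_on_cmod2_finite_bound: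
  assumes "\<And>F. finite F \<Longrightarrow> (\<Sum>c\<in>F. (cmod (f c))\<^sup>2) \<le> B"
  shows "(\<lambda>c. (cmod (f c))\<^sup>2) summable_on UNIV"
  by (rule nonneg_bounded_partial_sums_imp_summable_on[where C = B]) (use assms in \<open>auto intro: eventually_finite_subsets_at_top_weakI\<close>)

lemma norm2_le_finite:
  assumes "\<And>F. finite F \<Longrightarrow> (\<Sum>c\<in>F. (cmod (ev x c))\<^sup>2) \<le> B"
  shows "(norm x)\<^sup>2 \<le> B"
  by (rule has_sum_le_finite_sums[OF norm2_has_sum]) (use assms in auto)

text \<open>Coordinates are bounded by the norm, so a Cauchy sequence has a pointwise limit. Bounds
  on finite partial sums survive that limit and give both its membership and convergence in
  norm.\<close>

instance ell2 :: (type) complete_space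
proof
  fix X :: "nat \<Rightarrow> 'a ell2" assume X: "Cauchy X"
  have ptC: "Cauchy (\<lambda>n. ev (X n) c)" for c
  proof (rule metric_CauchyI)
    fix e :: real assume "e > 0"
    then obtain N where N: "\<And>m n. m \<ge> N \<Longrightarrow> n \<ge> N \<Longrightarrow> dist (X m) (X n) < e"
      using metric_CauchyD[OF X] by blast
    show "\<exists>M. \<forall>m\<ge>M. \<forall>n\<ge>M. dist (ev (X m) c) (ev (X n) c) < e"
    proof (intro exI allI impI)
      fix m n assume "N \<le> m" "N \<le> n"
      have "dist (ev (X m) c) (ev (X n) c) = cmod (ev (X m - X n) c)" by (simp add: dist_norm)
      also have "\<dots> \<le> norm (X m - X n)" by (rule ev_le_norm)
      also have "\<dots> < e" using N[OF \<open>N \<le> m\<close> \<open>N \<le> n\<close>] by (simp add: dist_norm)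
      finally show "dist (ev (X m) c) (ev (X n) c) < e" .
    qed
  qed
  define f where "f c = lim (\<lambda>n. ev (X n) c)" for c
  have flim: "(\<lambda>n. ev (X n) c) \<longlonglongrightarrow> f c" for c
    unfolding f_def using ptC[of c] Cauchy_convergent_iff convergent_LIMSEQ_iff by blast
  obtain B where B: "\<And>n. norm (X n) \<le> B"
    using Cauchy_Bseq[OF X] unfolding Bseq_def by blast
  have B0: "B \<ge> 0" using B[of 0] norm_ge_zero order_trans by blast
  have fsum: "(\<lambda>c. (cmod (f c))\<^sup>2) summable_on UNIV"
  proof (rule summable_on_cmod2_finite_bound)
    fix F :: "'a set" assume F: "finite F"
    have "(\<lambda>n. \<Sum>c\<in>F. (cmod (ev (X n) c))\<^sup>2) \<longlonglongrightarrow> (\<Sum>c\<in>F. (cmod (f c))\<^sup>2)"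
      by (intro tendsto_intros flim)
    moreover have "(\<Sum>c\<in>F. (cmod (ev (X n) c))\<^sup>2) \<le> B\<^sup>2" for n
      using finite_sum_le_norm2[OF F, of "X n"] power_mono[OF B norm_ge_zero, of n 2] by linarith
    ultimately show "(\<Sum>c\<in>F. (cmod (f c))\<^sup>2) \<le> B\<^sup>2"
      by (intro LIMSEQ_le_const2) auto
  qed
  define x where "x = Abs_ell2 f"
  have evx: "ev x = f" unfolding x_def by (rule ev_Abs[OF fsum])
  have "X \<longlonglongrightarrow> x"
  proof (rule metric_LIMSEQ_I)
    fix e :: real assume "e > 0"
    hence "e/2 > 0" by simp
    then obtain N where N: "\<And>m n. m \<ge> N \<Longrightarrow> n \<ge> N \<Longrightarrow> dist (X m) (X n) < e/2"
      using metric_CauchyD[OF X] by blast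
    show "\<exists>no. \<forall>n\<ge>no. dist (X n) x < e"
    proof (intro exI allI impI)
      fix n assume n: "N \<le> n"
      have "(norm (X n - x))\<^sup>2 \<le> (e/2)\<^sup>2"
      proof (rule norm2_le_finite)
        fix F :: "'a set" assume F: "finite F"
        have "(\<lambda>m. \<Sum>c\<in>F. (cmod (ev (X n) c - ev (X m) c))\<^sup>2) \<longlonglongrightarrow> (\<Sum>c\<in>F. (cmod (ev (X n) c - f c))\<^sup>2)"
          by (intro tendsto_intros flim)
        moreover have "\<exists>M. \<forall>m\<ge>M. (\<Sum>c\<in>F. (cmod (ev (X n) c - ev (X m) c))\<^sup>2) \<le> (e/2)\<^sup>2"
        proof (intro exI allI impI)
          fix m assume "N \<le> m"
          hence "norm (X n - X m) \<le> e/2" using N[of n m] n by (simp add: dist_norm)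
          hence "(norm (X n - X m))\<^sup>2 \<le> (e/2)\<^sup>2" by (intro power_mono) auto
          thus "(\<Sum>c\<in>F. (cmod (ev (X n) c - ev (X m) c))\<^sup>2) \<le> (e/2)\<^sup>2"
            using finite_sum_le_norm2[OF F, of "X n - X m"] by simp
        qed
        ultimately show "(\<Sum>c\<in>F. (cmod (ev (X n - x) c))\<^sup>2) \<le> (e/2)\<^sup>2"
          by (simp add: evx LIMSEQ_le_const2)
      qed
      hence "norm (X n - x) \<le> e/2" using \<open>e > 0\<close> by (simp add: power2_le_iff_abs_le)
      thus "dist (X n) x < e" using \<open>e > 0\<close> by (simp add: dist_norm)
    qed
  qed
  thus "convergent X" by (rule convergentI)
qed

text \<open>A minimising sequence for the distance is Cauchy by the parallelogram law; completeness
  and closedness supply the minimiser, whose residual is orthogonal to the subspace by the first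
  variation.\<close>

lemma closed_subspace_projection:
  fixes S :: "'a::{real_inner,complete_space} set"
  assumes S: "subspace S" and cl: "closed S"
  obtains y where "y \<in> S" "\<And>s. s \<in> S \<Longrightarrow> inner (x - y) s = 0"
proof -
  define d where "d = infdist x S"
  have ne: "S \<noteq> {}" using S subspace_0 by blast
  have d0: "d \<ge> 0" unfolding d_def by (rule infdist_nonneg)
  have dle: "d \<le> norm (x - s)" if "s \<in> S" for s
    unfolding d_def using infdist_le[OF that, of x] by (simp add: dist_norm)
  have "\<exists>s\<in>S. norm (x - s) < d + 1 / Suc n" for n
  proof (rule ccontr)
    assume "\<not> ?thesis"
    hence "d + 1 / Suc n \<le> dist x s" if "s \<in> S" for s using that by (force simp: dist_norm)
    hence "d + 1 / Suc n \<le> infdist x S" using ne by (simp add: infdist_def cINF_greatest)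
    thus False by (simp add: d_def)
  qed
  then obtain s where s: "\<And>n. s n \<in> S" "\<And>n. norm (x - s n) < d + 1 / Suc n" by metis
  have par: "(norm (s m - s n))\<^sup>2 \<le> 2 * ((norm (x - s m))\<^sup>2 - d\<^sup>2) + 2 * ((norm (x - s n))\<^sup>2 - d\<^sup>2)" for m n
  proof -
    have "(norm ((x - s m) - (x - s n)))\<^sup>2 + (norm ((x - s m) + (x - s n)))\<^sup>2 = 2 * (norm (x - s m))\<^sup>2 + 2 * (norm (x - s n))\<^sup>2"
      by (simp add: power2_norm_eq_inner algebra_simps inner_commute)
    moreover have "norm ((x - s m) + (x - s n)) = 2 * norm (x - (1/2) *\<^sub>R (s m + s n))"
    proof -
      have "(x - s m) + (x - s n) = 2 *\<^sub>R (x - (1/2) *\<^sub>R (s m + s n))"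
        by (simp add: algebra_simps scaleR_2)
      thus ?thesis by (metis abs_numeral norm_scaleR)
    qed
    moreover have "d \<le> norm (x - (1/2) *\<^sub>R (s m + s n))"
      using S s by (intro dle) (auto intro: subspace_scale subspace_add)
    ultimately show ?thesis
      using power_mono[OF _ d0, of "norm (x - (1/2) *\<^sub>R (s m + s n))" 2]
      by (simp add: power_mult_distrib norm_minus_commute)
  qed
  have nlim: "(\<lambda>n. norm (x - s n)) \<longlonglongrightarrow> d"
  proof (rule tendsto_sandwich[of "\<lambda>_. d" _ _ "\<lambda>n. d + 1 / Suc n"])
    show "(\<lambda>n. d + 1 / real (Suc n)) \<longlonglongrightarrow> d"
      using LIMSEQ_inverse_real_of_nat_add[of d] by (simp add: inverse_eq_divide)
  qed (use dle s in \<open>auto simp: less_imp_le intro!: always_eventually\<close>)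
  have "(\<lambda>n. (norm (x - s n))\<^sup>2 - d\<^sup>2) \<longlonglongrightarrow> d\<^sup>2 - d\<^sup>2" by (intro tendsto_intros nlim)
  hence nlim0: "(\<lambda>n. (norm (x - s n))\<^sup>2 - d\<^sup>2) \<longlonglongrightarrow> 0" by simp
  have "Cauchy s"
  proof (rule metric_CauchyI)
    fix e :: real assume e: "e > 0"
    hence "e\<^sup>2/4 > 0" by simp
    then obtain M where M: "\<And>n. n \<ge> M \<Longrightarrow> norm ((norm (x - s n))\<^sup>2 - d\<^sup>2 - 0) < e\<^sup>2/4"
      using LIMSEQ_D[OF nlim0] by blast
    show "\<exists>M. \<forall>m\<ge>M. \<forall>n\<ge>M. dist (s m) (s n) < e"
    proof (intro exI allI impI)
      fix m n assume mn: "M \<le> m" "M \<le> n"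
      have lin: "a < E" if "a \<le> 2 * (p - r) + 2 * (q - r)" "p - r - 0 < E / 4" "q - r - 0 < E / 4"
        for a p q r E :: real using that by argo
      have "(norm (s m - s n))\<^sup>2 < e\<^sup>2"
        by (rule lin[OF par M[OF mn(1), unfolded real_norm_def abs_less_iff, THEN conjunct1]
          M[OF mn(2), unfolded real_norm_def abs_less_iff, THEN conjunct1]])
      thus "dist (s m) (s n) < e" using e by (simp add: dist_norm power_less_imp_less_base)
    qed
  qed
  then obtain y where y: "s \<longlonglongrightarrow> y" using Cauchy_convergent_iff convergent_def by blast
  have yS: "y \<in> S" using closed_sequentially[OF cl _ y] s by blast
  have "(\<lambda>n. norm (x - s n)) \<longlonglongrightarrow> norm (x - y)" by (intro tendsto_intros y)
  hence yd: "norm (x - y) = d" using nlim LIMSEQ_unique by blast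
  have "inner (x - y) t = 0" if t: "t \<in> S" for t
  proof (cases "t = 0")
    case False
    \<comment> \<open>Moving from \<open>y\<close> along \<open>t\<close> by this \<open>r\<close>
      minimises the squared distance, which would drop by
      \<open>(inner (x - y) t)^2 / inner t t\<close>.\<close>
    define r where "r = inner (x - y) t / inner t t"
    have tt: "inner t t > 0" using False by simp
    have "y + r *\<^sub>R t \<in> S" using S yS t by (auto intro: subspace_scale subspace_add)
    hence "d \<le> norm (x - (y + r *\<^sub>R t))" by (rule dle)
    hence "d\<^sup>2 \<le> (norm (x - (y + r *\<^sub>R t)))\<^sup>2" using d0 by (intro power_mono) auto
    also have "\<dots> = (norm (x - y))\<^sup>2 - 2 * r * inner (x - y) t + r\<^sup>2 * inner t t"
      unfolding power2_norm_eq_inner by (simp add: algebra_simps inner_commute power2_eq_square)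
    also have "\<dots> = d\<^sup>2 - (inner (x - y) t)\<^sup>2 / inner t t"
      using tt by (simp add: yd r_def field_simps power2_eq_square)
    finally have "(inner (x - y) t)\<^sup>2 / inner t t \<le> 0" by simp
    hence "(inner (x - y) t)\<^sup>2 \<le> 0" using tt by (meson divide_pos_pos not_le)
    thus ?thesis by simp
  qed simp
  thus thesis using yS that by blast
qed

section \<open>Self-adjoint operators\<close>

lemma cs_simps [simp]: "cs 0 x = 0" "cs 1 x = x" "cs a 0 = 0" "cs a (cs b x) = cs (a * b) x"
  "cs (- a) x = - cs a x" "cs a (- x) = - cs a x" "cs (complex_of_real r) x = r *\<^sub>R x"
  by (auto intro!: ell2_eqI)

lemma cs_add: "cs a (x + y) = cs a x + cs a y" "cs (a + b) x = cs a x + cs b x"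
  "cs a (x - y) = cs a x - cs a y" "cs (a - b) x = cs a x - cs b x"
  by (auto intro!: ell2_eqI simp: algebra_simps)

text \<open>The complex inner product is determined by real ones, so symmetry and limits need
  checking only for \<open>inner\<close>, on spaces stable under multiplication by the imaginary
  unit.\<close>

lemma cinner_inner: "cinner x y = Complex (inner x y) (- inner x (cs \<i> y))"
  by (simp add: inner_ell2_def cinner_cs_right complex_eq_iff)

lemma cinner_eqI:
  assumes "inner x y = inner x' y'" "inner x (cs \<i> y) = inner x' (cs \<i> y')"
  shows "cinner x y = cinner x' y'"
  by (simp add: cinner_inner assms)

lemma Re_cinner [simp]: "Re (cinner x y) = inner x y" by (simp add: inner_ell2_def)

lemma norm_cs [simp]: "norm (cs a x) = cmod a * norm x"
proof -
  have "cinner (cs a x) (cs a x) = (cnj a * a) * cinner x x"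
    by (simp add: cinner_cs_left cinner_cs_right)
  also have "cnj a * a = complex_of_real ((cmod a)\<^sup>2)"
    by (metis complex_norm_square mult.commute)
  finally have "inner (cs a x) (cs a x) = Re (complex_of_real ((cmod a)\<^sup>2) * cinner x x)"
    by (metis Re_cinner)
  hence "inner (cs a x) (cs a x) = (cmod a)\<^sup>2 * inner x x" by simp
  thus ?thesis by (simp add: norm_ell2_def real_sqrt_mult)
qed

lemma cinner_self: "cinner x x = complex_of_real ((norm x)\<^sup>2)"
proof -
  have "Im (cinner x x) = 0" using cinner_commute[of x x] by (metis Reals_cnj_iff complex_is_Real_iff)
  thus ?thesis by (simp add: complex_eq_iff power2_norm_eq_inner)
qed

definition csub :: "'a ell2 set \<Rightarrow> bool" where
  "csub K \<longleftrightarrow> 0 \<in> K \<and> (\<forall>x\<in>K. \<forall>y\<in>K. x + y \<in> K) \<and> (\<forall>a. \<forall>x\<in>K. cs a x \<in> K)"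

lemma csubD:
  assumes "csub K"
  shows "0 \<in> K" "x \<in> K \<Longrightarrow> y \<in> K \<Longrightarrow> x + y \<in> K" "x \<in> K \<Longrightarrow> cs a x \<in> K"
    "x \<in> K \<Longrightarrow> r *\<^sub>R x \<in> K" "x \<in> K \<Longrightarrow> - x \<in> K" "x \<in> K \<Longrightarrow> y \<in> K \<Longrightarrow> x - y \<in> K" "subspace K"
proof -
  show *: "0 \<in> K" "\<And>x y. x \<in> K \<Longrightarrow> y \<in> K \<Longrightarrow> x + y \<in> K" "\<And>a x. x \<in> K \<Longrightarrow> cs a x \<in> K"
    using assms unfolding csub_def by auto
  show r: "\<And>x. x \<in> K \<Longrightarrow> r *\<^sub>R x \<in> K" for r using *(3)[of _ "complex_of_real r"] by simp
  show m: "\<And>x. x \<in> K \<Longrightarrow> - x \<in> K" using r[of _ "-1"] by simp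
  show "x \<in> K \<Longrightarrow> y \<in> K \<Longrightarrow> x - y \<in> K" using *(2)[of x "-y"] m by simp
  show "subspace K" unfolding subspace_def using * r by auto
qed

lemma subspace_closure:
  fixes S :: "'a::real_normed_vector set"
  assumes "subspace S" shows "subspace (closure S)"
  unfolding subspace_def
proof (intro conjI ballI allI)
  show "0 \<in> closure S" using assms subspace_0 closure_subset by blast
  fix x assume "x \<in> closure S"
  then obtain s where s: "\<And>n. s n \<in> S" "s \<longlonglongrightarrow> x" unfolding closure_sequential by blast
  show "x + y \<in> closure S" if yc: "y \<in> closure S" for y
  proof -
    obtain t where t: "\<And>n. t n \<in> S" "t \<longlonglongrightarrow> y" using yc unfolding closure_sequential by blast
    have "(\<lambda>n. s n + t n) \<longlonglongrightarrow> x + y" by (intro tendsto_intros s t)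
    moreover have "s n + t n \<in> S" for n using s t assms by (simp add: subspace_add)
    ultimately show ?thesis unfolding closure_sequential by (intro exI[of _ "\<lambda>n. s n + t n"]) simp
  qed
  show "c *\<^sub>R x \<in> closure S" for c
  proof -
    have "(\<lambda>n. c *\<^sub>R s n) \<longlonglongrightarrow> c *\<^sub>R x" by (intro tendsto_intros s)
    moreover have "c *\<^sub>R s n \<in> S" for n using s assms by (simp add: subspace_scale)
    ultimately show ?thesis unfolding closure_sequential by (intro exI[of _ "\<lambda>n. c *\<^sub>R s n"]) simp
  qed
qed

text \<open>The residual of the real projection onto the closure is also complex-orthogonal to
  \<open>S\<close>, since \<open>S\<close> is stable under multiplication by the imaginary unit; the
  hypothesis then kills it.\<close>

lemma csub_dense:
  assumes K: "csub K" "closed K" and S: "csub S" "S \<subseteq> K"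
    and orth: "\<And>x. x \<in> K \<Longrightarrow> (\<And>s. s \<in> S \<Longrightarrow> cinner x s = 0) \<Longrightarrow> x = 0"
  shows "K \<subseteq> closure S"
proof
  fix x assume x: "x \<in> K"
  have "subspace (closure S)" using csubD(7)[OF S(1)] by (rule subspace_closure)
  then obtain y where y: "y \<in> closure S" "\<And>s. s \<in> closure S \<Longrightarrow> inner (x - y) s = 0"
    using closed_subspace_projection[of "closure S" x] by blast
  have yK: "y \<in> K" using y(1) closure_minimal[OF S(2) K(2)] by blast
  have "cinner (x - y) s = 0" if "s \<in> S" for s
  proof -
    have "cs \<i> s \<in> S" using csubD(3)[OF S(1) that] .
    hence "inner (x - y) s = 0" "inner (x - y) (cs \<i> s) = 0"
      using y(2) that closure_subset by blast+
    thus ?thesis by (simp add: cinner_inner complex_eq_iff)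
  qed
  hence "x - y = 0" using orth[of "x - y"] csubD(6)[OF K(1) x yK] by blast
  thus "x \<in> closure S" using y(1) by simp
qed

text \<open>Self-adjointness inside a closed subspace \<open>K\<close>, so that all particle-number
  sectors can live in one type. The last clause says that the adjoint has no larger domain.\<close>

definition sa :: "'a ell2 set \<Rightarrow> 'a ell2 set \<Rightarrow> ('a ell2 \<Rightarrow> 'a ell2) \<Rightarrow> bool" where
  "sa K D A \<longleftrightarrow> D \<subseteq> K \<and> csub D
    \<and> (\<forall>x\<in>D. \<forall>y\<in>D. A (x + y) = A x + A y) \<and> (\<forall>a. \<forall>x\<in>D. A (cs a x) = cs a (A x))
    \<and> K \<subseteq> closure D \<and> A ` D \<subseteq> K
    \<and> (\<forall>x\<in>D. \<forall>y\<in>D. cinner x (A y) = cinner (A x) y)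
    \<and> (\<forall>x\<in>K. \<forall>h\<in>K. (\<forall>y\<in>D. cinner x (A y) = cinner h y) \<longrightarrow> x \<in> D)"

lemma saD:
  assumes "sa K D A"
  shows "D \<subseteq> K" "csub D" "x \<in> D \<Longrightarrow> y \<in> D \<Longrightarrow> A (x + y) = A x + A y" "x \<in> D \<Longrightarrow> A (cs a x) = cs a (A x)"
    "K \<subseteq> closure D" "x \<in> D \<Longrightarrow> A x \<in> K" "x \<in> D \<Longrightarrow> y \<in> D \<Longrightarrow> cinner x (A y) = cinner (A x) y"
    "x \<in> K \<Longrightarrow> h \<in> K \<Longrightarrow> (\<And>y. y \<in> D \<Longrightarrow> cinner x (A y) = cinner h y) \<Longrightarrow> x \<in> D"
  using assms unfolding sa_def by blast+

lemma sa_diff: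
  assumes "sa K D A" "x \<in> D" "y \<in> D" shows "A (x - y) = A x - A y"
proof -
  have "- y \<in> D" "A (- y) = - A y"
    using csubD(5)[OF saD(2)[OF assms(1)] assms(3)] saD(4)[OF assms(1,3), of "-1"] by auto
  thus ?thesis using saD(3)[OF assms(1,2), of "- y"] by simp
qed

lemma sa_scaleR: "sa K D A \<Longrightarrow> x \<in> D \<Longrightarrow> A (r *\<^sub>R x) = r *\<^sub>R A x"
  using saD(4)[of K D A x "complex_of_real r"] by simp

lemma sa_sym: "sa K D A \<Longrightarrow> x \<in> D \<Longrightarrow> y \<in> D \<Longrightarrow> inner x (A y) = inner (A x) y"
  using saD(7)[of K D A x y] by (metis Re_cinner)

lemma cinner_diff_right: "cinner x (y - z) = cinner x y - cinner x z"
  by (simp add: cinner_inner complex_eq_iff inner_diff_right cs_add)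

lemma cinner_diff_left: "cinner (y - z) x = cinner y x - cinner z x"
  by (metis (no_types, lifting) cinner_commute cinner_diff_right complex_cnj_diff)

lemma cinner_all_zero:
  assumes "x \<in> closure D" "\<And>y. y \<in> D \<Longrightarrow> cinner x y = 0"
  shows "x = 0"
proof -
  obtain s where s: "\<And>n. s n \<in> D" "s \<longlonglongrightarrow> x" using assms(1) unfolding closure_sequential by blast
  have "(\<lambda>n. inner x (s n)) \<longlonglongrightarrow> inner x x" by (intro tendsto_intros s)
  moreover have "inner x (s n) = 0" for n using assms(2)[OF s(1)] by (metis Re_cinner zero_complex.simps(1))
  ultimately have "inner x x = 0" by (simp add: LIMSEQ_const_iff)
  thus ?thesis by simp
qed

text \<open>The bound at the conjugate point makes the range dense, because a vector orthogonal to
  it would solve \<open>A x = cs (cnj z) x\<close>. The bound at \<open>z\<close> makes the range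
  closed: preimages of a convergent sequence are Cauchy, and a self-adjoint operator is
  closed.\<close>

lemma sa_surj:
  assumes K: "csub K" "closed K" and A: "sa K D A" and d: "\<delta> > 0"
    and b: "\<And>x. x \<in> D \<Longrightarrow> \<delta> * norm x \<le> norm (A x - cs z x)"
    and b': "\<And>x. x \<in> D \<Longrightarrow> \<delta> * norm x \<le> norm (A x - cs (cnj z) x)"
    and y: "y \<in> K"
  shows "\<exists>x\<in>D. A x - cs z x = y"
proof -
  note D = saD[OF A]
  define S where "S = (\<lambda>x. A x - cs z x) ` D"
  have S: "csub S"
    unfolding csub_def S_def
  proof (intro conjI ballI allI)
    show "0 \<in> (\<lambda>x. A x - cs z x) ` D"
      using csubD(1)[OF D(2)] D(4)[of 0 0] by (force intro!: rev_image_eqI[of 0])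
  next
    fix u v assume "u \<in> (\<lambda>x. A x - cs z x) ` D" "v \<in> (\<lambda>x. A x - cs z x) ` D"
    then obtain x y where "x \<in> D" "y \<in> D" "u = A x - cs z x" "v = A y - cs z y" by blast
    thus "u + v \<in> (\<lambda>x. A x - cs z x) ` D"
      using csubD(2)[OF D(2), of x y] D(3)[of x y] by (intro rev_image_eqI[of "x + y"]) (auto simp: cs_add)
  next
    fix a u assume "u \<in> (\<lambda>x. A x - cs z x) ` D"
    then obtain x where "x \<in> D" "u = A x - cs z x" by blast
    thus "cs a u \<in> (\<lambda>x. A x - cs z x) ` D"
      using csubD(3)[OF D(2), of x a] D(4)[of x a]
      by (intro rev_image_eqI[of "cs a x"]) (auto simp: cs_add mult.commute)
  qed
  have SK: "S \<subseteq> K" unfolding S_def using D(1,6) csubD(3,6)[OF K(1)] by blast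
  have "K \<subseteq> closure S"
  proof (rule csub_dense[OF K S SK])
    fix x assume x: "x \<in> K" and o: "\<And>s. s \<in> S \<Longrightarrow> cinner x s = 0"
    have e: "cinner x (A y) = cinner (cs (cnj z) x) y" if "y \<in> D" for y
      using o[of "A y - cs z y"] that unfolding S_def
      by (auto simp: cinner_diff_right cinner_cs_right cinner_cs_left)
    have xD: "x \<in> D" by (rule D(8)[OF x csubD(3)[OF K(1) x] e])
    have "A x - cs (cnj z) x = 0"
    proof (rule cinner_all_zero[of _ D])
      show "A x - cs (cnj z) x \<in> closure D" using D(5) D(6)[OF xD] csubD(3,6)[OF K(1)] x by blast
      show "cinner (A x - cs (cnj z) x) y = 0" if "y \<in> D" for y
        using e[OF that] D(7)[OF xD that] by (simp add: cinner_diff_left)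
    qed
    with b'[OF xD] d show "x = 0" by (simp add: mult_le_0_iff)
  qed
  hence "y \<in> closure S" using y by blast
  then obtain s where s: "\<And>n. s n \<in> S" "s \<longlonglongrightarrow> y" unfolding closure_sequential by blast
  then obtain x where x: "\<And>n. x n \<in> D" "\<And>n. s n = A (x n) - cs z (x n)"
    unfolding S_def image_iff by metis
  have bb: "norm (x m - x n) \<le> norm (s m - s n) / \<delta>" for m n
  proof -
    have "x m - x n \<in> D" using x csubD(6)[OF D(2)] by blast
    moreover have "A (x m - x n) - cs z (x m - x n) = s m - s n"
      using sa_diff[OF A x(1) x(1)] x(2) by (simp add: cs_add)
    ultimately have "\<delta> * norm (x m - x n) \<le> norm (s m - s n)" using b[of "x m - x n"] by simp
    thus ?thesis using d by (simp add: pos_le_divide_eq mult.commute)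
  qed
  have "Cauchy x"
  proof (rule metric_CauchyI)
    fix e :: real assume "e > 0"
    hence "\<delta> * e > 0" using d by simp
    then obtain N where N: "\<And>m n. m \<ge> N \<Longrightarrow> n \<ge> N \<Longrightarrow> dist (s m) (s n) < \<delta> * e"
      using metric_CauchyD[OF LIMSEQ_imp_Cauchy[OF s(2)]] by blast
    show "\<exists>M. \<forall>m\<ge>M. \<forall>n\<ge>M. dist (x m) (x n) < e"
    proof (intro exI allI impI)
      fix m n assume mn: "N \<le> m" "N \<le> n"
      have "norm (s m - s n) / \<delta> < e" using N[OF mn] d by (simp add: dist_norm field_simps)
      thus "dist (x m) (x n) < e" using bb[of m n] by (simp add: dist_norm)
    qed
  qed
  then obtain x0 where x0: "x \<longlonglongrightarrow> x0" using Cauchy_convergent_iff convergent_def by blast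
  have x0K: "x0 \<in> K" using closed_sequentially[OF K(2) _ x0] x(1) D(1) by blast
  have clim: "(\<lambda>n. cinner (u n) v) \<longlonglongrightarrow> cinner u0 v" if "u \<longlonglongrightarrow> u0" for u u0 and v :: "'a ell2"
    unfolding cinner_inner by (intro tendsto_Complex tendsto_intros that)
  have lin: "bounded_linear (cs z :: 'a ell2 \<Rightarrow> 'a ell2)"
    by (rule bounded_linear_intro[where K = "cmod z"]) (auto simp: cs_add intro!: ell2_eqI)
  have csx: "(\<lambda>n. cs z (x n)) \<longlonglongrightarrow> cs z x0" by (rule bounded_linear.tendsto[OF lin x0])
  have Alim: "(\<lambda>n. A (x n)) \<longlonglongrightarrow> y + cs z x0"
    using tendsto_add[OF s(2) csx] x(2) by simp
  have e0: "cinner x0 (A v) = cinner (y + cs z x0) v" if v: "v \<in> D" for v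
  proof -
    have "(\<lambda>n. cinner (A (x n)) v) \<longlonglongrightarrow> cinner x0 (A v)"
      using clim[OF x0, of "A v"] by (simp only: D(7)[OF x(1) v])
    thus ?thesis using clim[OF Alim, of v] by (rule LIMSEQ_unique)
  qed
  have yz: "y + cs z x0 \<in> K" using csubD(2,3)[OF K(1)] y x0K by blast
  have x0D: "x0 \<in> D" by (rule D(8)[OF x0K yz e0])
  have "A x0 - (y + cs z x0) = 0"
  proof (rule cinner_all_zero[of _ D])
    show "A x0 - (y + cs z x0) \<in> closure D" using D(5) D(6)[OF x0D] csubD(6)[OF K(1)] yz by blast
    show "cinner (A x0 - (y + cs z x0)) v = 0" if "v \<in> D" for v
      using e0[OF that] D(7)[OF x0D that] by (simp add: cinner_diff_left)
  qed
  hence "A x0 - cs z x0 = y" by (simp add: algebra_simps)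
  thus ?thesis using x0D by blast
qed

lemma sa_bound_nonreal:
  assumes A: "sa K D A" and x: "x \<in> D"
  shows "\<bar>Im z\<bar> * norm x \<le> norm (A x - cs z x)"
proof (cases "x = 0")
  case False
  have "cinner x (A x) = cnj (cinner x (A x))"
    using saD(7)[OF A x x] cinner_commute[of "A x" x] by simp
  hence "Im (cinner x (A x)) = 0" by (metis Reals_cnj_iff complex_is_Real_iff)
  hence "Im (cinner x (A x - cs z x)) = - (Im z * (norm x)\<^sup>2)"
    by (simp add: cinner_diff_right cinner_cs_right cinner_self)
  hence "\<bar>Im z\<bar> * (norm x)\<^sup>2 = \<bar>Im (cinner x (A x - cs z x))\<bar>" by (simp add: abs_mult)
  also have "\<dots> = \<bar>inner x (cs \<i> (A x - cs z x))\<bar>" by (simp add: cinner_inner)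
  also have "\<dots> \<le> norm x * norm (A x - cs z x)"
    using Cauchy_Schwarz_ineq2[of x "cs \<i> (A x - cs z x)"] by simp
  finally show ?thesis using False by (simp add: power2_eq_square)
qed simp

lemma sa_bound_below:
  assumes A: "sa K D A" and x: "x \<in> D" and c: "c * (norm x)\<^sup>2 \<le> inner x (A x)"
  shows "(c - r) * norm x \<le> norm (A x - r *\<^sub>R x)"
proof (cases "x = 0")
  case False
  have "(c - r) * (norm x)\<^sup>2 \<le> inner x (A x - r *\<^sub>R x)"
    using c by (simp add: inner_diff_right algebra_simps power2_norm_eq_inner)
  also have "\<dots> \<le> norm x * norm (A x - r *\<^sub>R x)" by (rule norm_cauchy_schwarz)
  finally show ?thesis using False by (simp add: power2_eq_square mult.commute mult.left_commute)
qed simp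

lemma sa_surj_nonreal:
  assumes K: "csub K" "closed K" and A: "sa K D A" and z: "Im z \<noteq> 0" and y: "y \<in> K"
  shows "\<exists>x\<in>D. A x - cs z x = y"
  by (rule sa_surj[OF K A, of "\<bar>Im z\<bar>"])
     (use z y sa_bound_nonreal[OF A, of _ z] sa_bound_nonreal[OF A, of _ "cnj z"] in auto)

lemma sa_surj_below:
  assumes K: "csub K" "closed K" and A: "sa K D A"
    and c: "\<And>x. x \<in> D \<Longrightarrow> c * (norm x)\<^sup>2 \<le> inner x (A x)" and r: "r < c" and y: "y \<in> K"
  shows "\<exists>x\<in>D. A x - r *\<^sub>R x = y"
  using sa_surj[OF K A, of "c - r" "complex_of_real r" y] sa_bound_below[OF A _ c, of _ r] r y by simp

text \<open>First resolvent identity: \<open>v n - u n\<close> is the resolvent at \<open>w\<close>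
  applied to \<open>cs (z - w) (x - u n)\<close>. Convergence at one point \<open>z\<close> thus
  passes to any \<open>w\<close> where the resolvents are bounded by \<open>1 / \<delta>\<close>
  uniformly in \<open>n\<close>.\<close>

lemma sa_resolvent_transfer:
  assumes K: "csub K" "closed K"
    and An: "\<And>n. sa K (Dn n) (An n)" and A: "sa K D A" and d: "\<delta> > 0"
    and surj: "\<And>n y. y \<in> K \<Longrightarrow> \<exists>x\<in>Dn n. An n x - cs z x = y"
    and conv: "\<And>u x. (\<And>n. u n \<in> Dn n) \<Longrightarrow> x \<in> D \<Longrightarrow> (\<And>n. An n (u n) - cs z (u n) = A x - cs z x) \<Longrightarrow> u \<longlonglongrightarrow> x"
    and b: "\<And>n x. x \<in> Dn n \<Longrightarrow> \<delta> * norm x \<le> norm (An n x - cs w x)"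
    and v: "\<And>n. v n \<in> Dn n" "x \<in> D" "\<And>n. An n (v n) - cs w (v n) = A x - cs w x"
  shows "v \<longlonglongrightarrow> x"
proof -
  have "A x - cs z x \<in> K" using saD(1,6)[OF A] v(2) csubD(3,6)[OF K(1)] by blast
  then obtain u where u: "\<And>n. u n \<in> Dn n" "\<And>n. An n (u n) - cs z (u n) = A x - cs z x"
    using surj by metis
  have lim: "u \<longlonglongrightarrow> x" by (rule conv[OF u(1) v(2) u(2)])
  have "norm (v n - u n) \<le> cmod (z - w) / \<delta> * norm (x - u n)" for n
  proof -
    have "v n - u n \<in> Dn n" using v u csubD(6)[OF saD(2)[OF An]] by blast
    hence "\<delta> * norm (v n - u n) \<le> norm (An n (v n - u n) - cs w (v n - u n))" by (rule b)
    also have "An n (v n - u n) - cs w (v n - u n) = (A x - cs w x) - (An n (u n) - cs z (u n)) - cs z (u n) + cs w (u n)"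
      using sa_diff[OF An v(1) u(1)] v(3)[symmetric] by (simp add: cs_add)
    also have "\<dots> = cs (z - w) (x - u n)" unfolding u(2) by (simp add: cs_add algebra_simps)
    finally show ?thesis using d by (simp add: field_simps)
  qed
  moreover have "(\<lambda>n. cmod (z - w) / \<delta> * norm (x - u n)) \<longlonglongrightarrow> cmod (z - w) / \<delta> * norm (x - x)"
    by (intro tendsto_intros lim)
  ultimately have "(\<lambda>n. v n - u n) \<longlonglongrightarrow> 0"
    by (intro Lim_null_comparison[of "\<lambda>n. v n - u n"]) (auto intro: always_eventually)
  from tendsto_add[OF this lim] show ?thesis by simp
qed

text \<open>If a form bound \<open>c\<close> were in the resolvent set, it could be raised by
  \<open>1 / C\<close>; hence the largest form bound belongs to the spectrum. The nonnegative form
  \<open>q\<close> is tested on a combination of \<open>x\<close> and its preimage \<open>y\<close>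
  under \<open>A - c\<close>.\<close>

lemma sa_not_bounded_inverse_at_inf:
  assumes A: "sa K D A" and c: "\<And>x. x \<in> D \<Longrightarrow> c * (norm x)\<^sup>2 \<le> inner x (A x)"
    and surj: "\<And>y. y \<in> K \<Longrightarrow> \<exists>x\<in>D. A x - c *\<^sub>R x = y"
    and b: "\<And>x. x \<in> D \<Longrightarrow> norm x \<le> C * norm (A x - c *\<^sub>R x)" and C: "C > 0"
    and x: "x \<in> D"
  shows "(c + 1 / C) * (norm x)\<^sup>2 \<le> inner x (A x)"
proof -
  note D = saD[OF A]
  obtain y where y: "y \<in> D" "A y - c *\<^sub>R y = x" using surj x D(1) by blast
  define q where "q u v = inner u (A v - c *\<^sub>R v)" for u v
  have qadd: "q (u + r *\<^sub>R v) (u + r *\<^sub>R v) = q u u + 2 * r * q u v + r\<^sup>2 * q v v" if "u \<in> D" "v \<in> D" for u v r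
  proof -
    have rv: "r *\<^sub>R v \<in> D" using csubD(4)[OF D(2) that(2)] .
    have "inner v (A u) = inner u (A v)" using sa_sym[OF A that] by (simp add: inner_commute)
    thus ?thesis unfolding q_def D(3)[OF that(1) rv] sa_scaleR[OF A that(2)]
      by (simp add: algebra_simps power2_eq_square inner_commute[of v u])
  qed
  have q0: "0 \<le> q u u" if "u \<in> D" for u
    using c[OF that] by (simp add: q_def inner_diff_right power2_norm_eq_inner)
  have qxy: "q x y = (norm x)\<^sup>2" using y by (simp add: q_def power2_norm_eq_inner)
  have "q y y = inner y x" using y by (simp add: q_def)
  also have "\<dots> \<le> norm y * norm x" by (rule norm_cauchy_schwarz)
  also have "\<dots> \<le> C * norm x * norm x" using b[OF y(1)] y(2) by (intro mult_right_mono) auto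
  finally have qyy: "q y y \<le> C * (norm x)\<^sup>2" by (simp add: power2_eq_square mult.assoc)
  \<comment> \<open>With \<open>q x y\<close> equal to the squared norm of \<open>x\<close> and
    \<open>q y y\<close> at most \<open>C\<close> times it, the coefficient \<open>- 1 / C\<close>
    is optimal.\<close>
  have "0 \<le> q (x + (- 1 / C) *\<^sub>R y) (x + (- 1 / C) *\<^sub>R y)"
    using csubD[OF D(2)] x y(1) by (intro q0) auto
  also have "\<dots> = q x x - 2 * (norm x)\<^sup>2 / C + q y y / C\<^sup>2"
    by (subst qadd[OF x y(1)]) (simp add: qxy power2_eq_square)
  also have "q y y / C\<^sup>2 \<le> (norm x)\<^sup>2 / C" using qyy C by (simp add: field_simps power2_eq_square)
  finally have "(norm x)\<^sup>2 / C \<le> q x x" by simp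
  thus ?thesis by (simp add: q_def inner_diff_right power2_norm_eq_inner algebra_simps)
qed

section \<open>Multiplication operators\<close>

definition supp_in :: "'a set \<Rightarrow> 'a ell2 set" where
  "supp_in S = {x. \<forall>c. c \<notin> S \<longrightarrow> ev x c = 0}"

lemma supp_inI: "(\<And>c. c \<notin> S \<Longrightarrow> ev x c = 0) \<Longrightarrow> x \<in> supp_in S"
  and supp_inD: "x \<in> supp_in S \<Longrightarrow> c \<notin> S \<Longrightarrow> ev x c = 0"
  by (auto simp: supp_in_def)

lemma csub_supp_in: "csub (supp_in S)"
  by (auto simp: csub_def supp_in_def)

lemma tendsto_ev: "X \<longlonglongrightarrow> x \<Longrightarrow> (\<lambda>n. ev (X n) c) \<longlonglongrightarrow> ev x c"
proof -
  assume "X \<longlonglongrightarrow> x"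
  hence "(\<lambda>n. norm (X n - x)) \<longlonglongrightarrow> 0" by (simp add: LIM_zero tendsto_norm_zero)
  hence "(\<lambda>n. ev (X n - x) c) \<longlonglongrightarrow> 0"
    by (rule Lim_null_comparison[OF always_eventually[OF allI[OF ev_le_norm]]])
  thus ?thesis using Lim_null by (simp add: LIM_zero_cancel)
qed

lemma closed_supp_in: "closed (supp_in S)"
  unfolding closed_sequential_limits
proof (intro allI impI)
  fix X x assume a: "(\<forall>n. X n \<in> supp_in S) \<and> X \<longlonglongrightarrow> x"
  show "x \<in> supp_in S"
    unfolding supp_in_def
  proof (intro CollectI allI impI)
    fix c assume "c \<notin> S"
    hence "ev (X n) c = 0" for n using a by (auto simp: supp_in_def)
    thus "ev x c = 0" using tendsto_ev[of X x c] a by (simp add: LIMSEQ_const_iff)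
  qed
qed

lemma ev_sum [simp]: "ev (\<Sum>i\<in>I. f i) c = (\<Sum>i\<in>I. ev (f i) c)"
  by (induction I rule: infinite_finite_induct) auto

lemma cs_sum: "cs a (\<Sum>i\<in>I. f i) = (\<Sum>i\<in>I. cs a (f i))"
  by (rule ell2_eqI) (simp add: sum_distrib_left)

lemma csub_sum: "csub K \<Longrightarrow> (\<And>i. i \<in> I \<Longrightarrow> f i \<in> K) \<Longrightarrow> (\<Sum>i\<in>I. f i) \<in> K"
  by (induction I rule: infinite_finite_induct) (auto intro: csubD)

text \<open>Meaningful on \<open>domf f\<close>; elsewhere the product is not square summable and
  the value is unspecified.\<close>

definition mulf :: "('a \<Rightarrow> real) \<Rightarrow> 'a ell2 \<Rightarrow> 'a ell2" where
  "mulf f x = Abs_ell2 (\<lambda>c. complex_of_real (f c) * ev x c)"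

definition domf :: "('a \<Rightarrow> real) \<Rightarrow> 'a ell2 set" where
  "domf f = {x. (\<lambda>c. (cmod (complex_of_real (f c) * ev x c))\<^sup>2) summable_on UNIV}"

lemma ev_mulf: "x \<in> domf f \<Longrightarrow> ev (mulf f x) c = complex_of_real (f c) * ev x c"
  unfolding mulf_def domf_def by (simp add: ev_Abs)

lemma domf_dominated:
  assumes "x \<in> domf g" "\<And>c. ev x c \<noteq> 0 \<Longrightarrow> \<bar>f c\<bar> \<le> \<bar>g c\<bar>"
  shows "x \<in> domf f"
  unfolding domf_def
proof (intro CollectI, rule summable_on_comparison_test)
  show "(\<lambda>c. (cmod (complex_of_real (g c) * ev x c))\<^sup>2) summable_on UNIV"
    using assms(1) by (simp add: domf_def)
  fix c show "(cmod (complex_of_real (f c) * ev x c))\<^sup>2 \<le> (cmod (complex_of_real (g c) * ev x c))\<^sup>2"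
    using assms(2)[of c] by (cases "ev x c = 0") (auto simp: norm_mult power_mult_distrib intro!: power_mono mult_right_mono simp flip: abs_le_square_iff)
qed auto

lemma domf_const: "x \<in> domf (\<lambda>_. B)"
  using ev_summable[of x] by (simp add: domf_def norm_mult power_mult_distrib summable_on_cmult_right)

lemma domf_bounded: "(\<And>c. ev x c \<noteq> 0 \<Longrightarrow> \<bar>f c\<bar> \<le> B) \<Longrightarrow> x \<in> domf f"
  using domf_dominated[OF domf_const, of x f B] by force

lemma norm_mulf_le:
  assumes "\<And>c. ev x c \<noteq> 0 \<Longrightarrow> \<bar>f c\<bar> \<le> B" "B \<ge> 0"
  shows "norm (mulf f x) \<le> B * norm x"
proof -
  have "(norm (mulf f x))\<^sup>2 \<le> (B * norm x)\<^sup>2"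
  proof (rule norm2_le_finite)
    fix F :: "'a set" assume F: "finite F"
    have "(\<Sum>c\<in>F. (cmod (ev (mulf f x) c))\<^sup>2) \<le> (\<Sum>c\<in>F. B\<^sup>2 * (cmod (ev x c))\<^sup>2)"
    proof (rule sum_mono)
      fix c show "(cmod (ev (mulf f x) c))\<^sup>2 \<le> B\<^sup>2 * (cmod (ev x c))\<^sup>2"
        using assms(1)[of c] assms(2)
        by (cases "ev x c = 0") (auto simp: ev_mulf[OF domf_bounded[OF assms(1)]] norm_mult power_mult_distrib intro!: mult_right_mono simp flip: abs_le_square_iff)
    qed
    also have "\<dots> \<le> (B * norm x)\<^sup>2"
      using finite_sum_le_norm2[OF F, of x] by (simp add: power_mult_distrib mult_left_mono flip: sum_distrib_left)
    finally show "(\<Sum>c\<in>F. (cmod (ev (mulf f x) c))\<^sup>2) \<le> (B * norm x)\<^sup>2" .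
  qed
  thus ?thesis using assms(2) by (simp add: power2_le_iff_abs_le)
qed

lemma unit_summable: "(\<lambda>d. (cmod (if d = c then 1 else 0))\<^sup>2) summable_on UNIV"
  by (rule finite_nonzero_values_imp_summable_on, rule finite_subset[of _ "{c}"]) auto

definition unit :: "'a \<Rightarrow> 'a ell2" where "unit c = Abs_ell2 (\<lambda>d. if d = c then 1 else 0)"

lemma ev_unit [simp]: "ev (unit c) d = (if d = c then 1 else 0)"
  unfolding unit_def by (simp add: ev_Abs[OF unit_summable])

lemma cinner_unit: "cinner x (unit c) = cnj (ev x c)"
proof -
  have "cinner x (unit c) = infsum (\<lambda>d. cnj (ev x d) * ev (unit c) d) {c}"
    unfolding cinner_def by (rule infsum_cong_neutral) auto
  thus ?thesis by simp
qed

definition trunc :: "'a set \<Rightarrow> 'a ell2 \<Rightarrow> 'a ell2" where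
  "trunc F x = mulf (indicator F) x"

lemma ev_trunc [simp]: "ev (trunc F x) c = (if c \<in> F then ev x c else 0)"
  unfolding trunc_def by (subst ev_mulf[OF domf_bounded[of _ _ 1]]) (auto simp: indicator_def)

lemma trunc_approx:
  assumes "e > 0"
  obtains F where "finite F" "norm (x - trunc F x) < e"
proof -
  have "((\<lambda>F. \<Sum>c\<in>F. (cmod (ev x c))\<^sup>2) \<longlongrightarrow> (norm x)\<^sup>2) (finite_subsets_at_top UNIV)"
    using norm2_has_sum[of x] by (simp add: has_sum_def)
  hence "eventually (\<lambda>F. dist (\<Sum>c\<in>F. (cmod (ev x c))\<^sup>2) ((norm x)\<^sup>2) < e\<^sup>2 / 4) (finite_subsets_at_top UNIV)"
    using assms by (intro tendstoD) auto
  then obtain F where F: "finite F" "dist (\<Sum>c\<in>F. (cmod (ev x c))\<^sup>2) ((norm x)\<^sup>2) < e\<^sup>2 / 4"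
    unfolding eventually_finite_subsets_at_top by auto
  have "(norm (x - trunc F x))\<^sup>2 \<le> e\<^sup>2 / 4"
  proof (rule norm2_le_finite)
    fix G :: "'a set" assume G: "finite G"
    have "(\<Sum>c\<in>G. (cmod (ev (x - trunc F x) c))\<^sup>2) = (\<Sum>c\<in>G - F. (cmod (ev x c))\<^sup>2)"
      by (rule sum.mono_neutral_cong_right) (use G in auto)
    also have "\<dots> = (\<Sum>c\<in>(G - F) \<union> F. (cmod (ev x c))\<^sup>2) - (\<Sum>c\<in>F. (cmod (ev x c))\<^sup>2)"
      by (subst sum.union_disjoint) (use G F in auto)
    also have "\<dots> \<le> (norm x)\<^sup>2 - (\<Sum>c\<in>F. (cmod (ev x c))\<^sup>2)"
      using finite_sum_le_norm2[of "(G - F) \<union> F" x] G F by auto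
    also have "\<dots> \<le> e\<^sup>2 / 4" 
      using F(2) abs_ge_minus_self[of "(\<Sum>c\<in>F. (cmod (ev x c))\<^sup>2) - (norm x)\<^sup>2"]
      unfolding dist_real_def by linarith
    finally show "(\<Sum>c\<in>G. (cmod (ev (x - trunc F x) c))\<^sup>2) \<le> e\<^sup>2 / 4" .
  qed
  also have "\<dots> < e\<^sup>2" using assms by simp
  finally have "norm (x - trunc F x) < e" using assms by (simp add: power_less_imp_less_base)
  thus thesis using F(1) that by blast
qed

lemma cs_bounded_linear: "bounded_linear (cs z)"
  by (rule bounded_linear_intro[where K = "cmod z"]) (auto simp: cs_add intro!: ell2_eqI)

text \<open>Tested on coordinate vectors, the adjoint relation says that \<open>f c * ev x c\<close>
  equals \<open>ev (h - B x) c\<close>, which is square summable; so \<open>x\<close> lies in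
  \<open>domf f\<close>. Finite truncations give density.\<close>

lemma sa_diag_plus_bounded:
  fixes f :: "'a \<Rightarrow> real" and B :: "'a ell2 \<Rightarrow> 'a ell2"
  assumes lin: "\<And>x y. B (x + y) = B x + B y" "\<And>a x. B (cs a x) = cs a (B x)"
    and BK: "\<And>x. x \<in> supp_in S \<Longrightarrow> B x \<in> supp_in S"
    and sym: "\<And>x y. x \<in> supp_in S \<Longrightarrow> y \<in> supp_in S \<Longrightarrow> inner x (B y) = inner (B x) y"
  shows "sa (supp_in S) (supp_in S \<inter> domf f) (\<lambda>x. mulf f x + B x)"
proof -
  let ?K = "supp_in S" and ?D = "supp_in S \<inter> domf f"
  have csub_domf: "csub (domf f)"
    unfolding csub_def
  proof (intro conjI ballI allI)
    show "0 \<in> domf f" by (rule domf_bounded) auto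
    fix x assume x: "x \<in> domf f"
    show "cs a x \<in> domf f" for a
      using x summable_on_cmult_right[of "\<lambda>c. (cmod (complex_of_real (f c) * ev x c))\<^sup>2" UNIV "(cmod a)\<^sup>2"]
      by (simp add: domf_def norm_mult power_mult_distrib mult.left_commute)
    show "x + y \<in> domf f" if "y \<in> domf f" for y
      using x that summable_on_cmod2_add[of "\<lambda>c. complex_of_real (f c) * ev x c" UNIV "\<lambda>c. complex_of_real (f c) * ev y c"]
      by (simp add: domf_def distrib_left)
  qed
  have csD: "csub ?D" using csub_domf csub_supp_in[of S] by (auto simp: csub_def)
  have mulK: "mulf f x \<in> ?K" if "x \<in> ?D" for x using that by (auto simp: supp_in_def ev_mulf)
  have madd: "mulf f (x + y) = mulf f x + mulf f y" if "x \<in> domf f" "y \<in> domf f" for x y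
    using that csubD(2)[OF csub_domf that] by (intro ell2_eqI) (simp add: ev_mulf distrib_left)
  have mcs: "mulf f (cs a x) = cs a (mulf f x)" if "x \<in> domf f" for a x
    using that csubD(3)[OF csub_domf that] by (intro ell2_eqI) (simp add: ev_mulf mult.left_commute)
  have Bcsym: "cinner x (B y) = cinner (B x) y" if "x \<in> ?K" "y \<in> ?K" for x y
    by (rule cinner_eqI) (use that sym[OF that] sym[OF that(1) csubD(3)[OF csub_supp_in that(2), of \<i>]] lin(2) in auto)
  have cadd: "cinner x (u + v) = cinner x u + cinner x v" for x u v :: "'a ell2"
    by (simp add: cinner_inner complex_eq_iff inner_add_right cs_add)
  have fin: "trunc F x \<in> ?D" if "x \<in> ?K" "finite F" for x F
  proof -
    have "\<bar>f c\<bar> \<le> (\<Sum>c\<in>F. \<bar>f c\<bar>)" if "ev (trunc F x) c \<noteq> 0" for c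
      using that \<open>finite F\<close> by (intro member_le_sum) (auto split: if_splits)
    hence "trunc F x \<in> domf f" by (rule domf_bounded)
    thus ?thesis using \<open>x \<in> ?K\<close> by (auto simp: supp_in_def)
  qed
  show ?thesis
    unfolding sa_def
  proof (intro conjI ballI allI impI)
    show "?D \<subseteq> ?K" by blast
    show "csub ?D" by (rule csD)
    show "mulf f (x + y) + B (x + y) = mulf f x + B x + (mulf f y + B y)" if "x \<in> ?D" "y \<in> ?D" for x y
      using that madd[of x y] lin(1)[of x y] by simp
    show "mulf f (cs a x) + B (cs a x) = cs a (mulf f x + B x)" if "x \<in> ?D" for a x
      using that mcs lin(2) by (simp add: cs_add)
    show "?K \<subseteq> closure ?D"
    proof
      fix x assume x: "x \<in> ?K"
      show "x \<in> closure ?D" unfolding closure_approachable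
      proof (intro allI impI)
        fix e :: real assume "e > 0"
        then obtain F where "finite F" "norm (x - trunc F x) < e" using trunc_approx by blast
        thus "\<exists>y\<in>?D. dist y x < e" using fin[OF x] by (metis dist_commute dist_norm)
      qed
    qed
    show "(\<lambda>x. mulf f x + B x) ` ?D \<subseteq> ?K" using mulK BK csubD(2)[OF csub_supp_in] by blast
    show "cinner x (mulf f y + B y) = cinner (mulf f x + B x) y" if "x \<in> ?D" "y \<in> ?D" for x y
    proof -
      have "cinner x (mulf f y) = cinner (mulf f x) y"
        unfolding cinner_def using that by (intro infsum_cong) (simp add: ev_mulf)
      thus ?thesis using Bcsym[of x y] that by (simp add: cadd cinner_add_left)
    qed
    fix x h assume x: "x \<in> ?K" and h: "h \<in> ?K" and e: "\<forall>y\<in>?D. cinner x (mulf f y + B y) = cinner h y"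
    have "complex_of_real (f c) * ev x c = ev (h - B x) c" for c
    proof (cases "c \<in> S")
      case True
      have u: "unit c \<in> ?D" using True domf_bounded[of "unit c" f "\<bar>f c\<bar>"] by (auto simp: supp_in_def split: if_splits)
      have mu: "mulf f (unit c) = f c *\<^sub>R unit c" using u by (intro ell2_eqI) (auto simp: ev_mulf)
      have "cinner x (mulf f (unit c) + B (unit c)) = cinner h (unit c)" using e u by blast
      hence "complex_of_real (f c) * cinner x (unit c) + cinner (B x) (unit c) = cinner h (unit c)"
        using Bcsym[OF x, of "unit c"] u cinner_cs_right[of x "complex_of_real (f c)"] by (simp add: cadd mu)
      hence "cnj (complex_of_real (f c) * ev x c) = cnj (ev (h - B x) c)"
        by (simp add: cinner_unit algebra_simps)
      thus ?thesis by (simp only: complex_cnj_cancel_iff)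
    next
      case False thus ?thesis using x h BK[OF x] by (auto simp: supp_in_def)
    qed
    hence "x \<in> domf f" using ev_summable[of "h - B x"] by (simp add: domf_def)
    thus "x \<in> ?D" using x by blast
  qed
qed

section \<open>Fermionic operators\<close>

text \<open>Removing a fermion of momentum \<open>k\<close> hands \<open>k\<close> to the impurity,
  so total momentum is conserved. The amplitude of the vector with that fermion removed is at
  \<open>c\<close>, up to sign, the old amplitude at \<open>sh k c\<close>.\<close>

definition sh :: "lat \<Rightarrow> cfg \<Rightarrow> cfg" where "sh k c = (fst c - k, insert k (snd c))"
definition un :: "lat \<Rightarrow> cfg \<Rightarrow> cfg" where "un k c = (fst c + k, snd c - {k})"

lemma sh_un: "k \<in> snd c \<Longrightarrow> sh k (un k c) = c" and un_sh: "k \<notin> snd c \<Longrightarrow> un k (sh k c) = c"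
  by (auto simp: sh_def un_def prod_eq_iff)

lemma bij_sh: "bij_betw (sh k) {c. k \<notin> snd c} {c. k \<in> snd c}"
  by (rule bij_betw_byWitness[of _ "un k"]) (auto simp: sh_un un_sh, auto simp: sh_def un_def)

lemma cmod_sgn_lat [simp]: "cmod (sgn_lat S k) = 1" by (simp add: sgn_lat_def norm_power)
lemma cnj_sgn_lat [simp]: "cnj (sgn_lat S k) = sgn_lat S k" by (simp add: sgn_lat_def)
lemma sgn_lat_sq [simp]: "sgn_lat S k * sgn_lat S k = 1" by (simp add: sgn_lat_def flip: power_add)

lemma sgn_lat_insert:
  assumes "finite S" "l \<notin> S"
  shows "sgn_lat (insert l S) k = (if lat_less l k then - sgn_lat S k else sgn_lat S k)"
proof (cases "lat_less l k")
  case True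
  have "{i \<in> insert l S. lat_less i k} = insert l {i \<in> S. lat_less i k}" using True by auto
  thus ?thesis using assms True by (simp add: sgn_lat_def)
next
  case False
  have "{i \<in> insert l S. lat_less i k} = {i \<in> S. lat_less i k}" using False by auto
  thus ?thesis using False by (simp add: sgn_lat_def)
qed

lemma lat_less_irrefl [simp]: "\<not> lat_less k k" by (simp add: lat_less_def)
lemma lat_less_flip: "k \<noteq> l \<Longrightarrow> lat_less k l \<longleftrightarrow> \<not> lat_less l k"
  by (auto simp: lat_less_def prod_eq_iff)

definition annf :: "lat \<Rightarrow> vec \<Rightarrow> vec" where
  "annf k \<psi> c = (if k \<notin> snd c then sgn_lat (snd c) k * \<psi> (sh k c) else 0)"
definition cref :: "lat \<Rightarrow> vec \<Rightarrow> vec" where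
  "cref k \<psi> c = (if k \<in> snd c then sgn_lat (snd c - {k}) k * \<psi> (un k c) else 0)"

lemma annf_has_sum: "((\<lambda>c. (cmod (annf k (ev x) c))\<^sup>2) has_sum infsum (\<lambda>c. (cmod (ev x c))\<^sup>2) {c. k \<in> snd c}) UNIV"
proof -
  have "(\<lambda>c. (cmod (ev x c))\<^sup>2) summable_on {c. k \<in> snd c}"
    by (rule summable_on_subset_banach[OF ev_summable]) auto
  hence "((\<lambda>c. (cmod (ev x c))\<^sup>2) has_sum infsum (\<lambda>c. (cmod (ev x c))\<^sup>2) {c. k \<in> snd c}) {c. k \<in> snd c}"
    by (rule has_sum_infsum)
  hence "((\<lambda>c. (cmod (ev x (sh k c)))\<^sup>2) has_sum infsum (\<lambda>c. (cmod (ev x c))\<^sup>2) {c. k \<in> snd c}) {c. k \<notin> snd c}"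
    using has_sum_reindex_bij_betw[OF bij_sh[of k]] by fastforce
  thus ?thesis
    by (rule has_sum_cong_neutral[THEN iffD1, rotated -1]) (auto simp: annf_def norm_mult)
qed

lemma cref_has_sum: "((\<lambda>c. (cmod (cref k (ev x) c))\<^sup>2) has_sum infsum (\<lambda>c. (cmod (ev x c))\<^sup>2) {c. k \<notin> snd c}) UNIV"
proof -
  have "(\<lambda>c. (cmod (ev x c))\<^sup>2) summable_on {c. k \<notin> snd c}"
    by (rule summable_on_subset_banach[OF ev_summable]) auto
  hence "((\<lambda>c. (cmod (ev x c))\<^sup>2) has_sum infsum (\<lambda>c. (cmod (ev x c))\<^sup>2) {c. k \<notin> snd c}) {c. k \<notin> snd c}"
    by (rule has_sum_infsum)
  hence "((\<lambda>c. (cmod (ev x (un k (sh k c))))\<^sup>2) has_sum infsum (\<lambda>c. (cmod (ev x c))\<^sup>2) {c. k \<notin> snd c}) {c. k \<notin> snd c}"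
    by (rule has_sum_cong[THEN iffD1, rotated]) (simp add: un_sh)
  hence "((\<lambda>c. (cmod (ev x (un k c)))\<^sup>2) has_sum infsum (\<lambda>c. (cmod (ev x c))\<^sup>2) {c. k \<notin> snd c}) {c. k \<in> snd c}"
    using has_sum_reindex_bij_betw[OF bij_sh[of k], of "\<lambda>c. (cmod (ev x (un k c)))\<^sup>2"] by blast
  thus ?thesis
    by (rule has_sum_cong_neutral[THEN iffD1, rotated -1]) (auto simp: cref_def norm_mult)
qed

definition ann :: "lat \<Rightarrow> cfg ell2 \<Rightarrow> cfg ell2" where "ann k x = Abs_ell2 (annf k (ev x))"
definition cre :: "lat \<Rightarrow> cfg ell2 \<Rightarrow> cfg ell2" where "cre k x = Abs_ell2 (cref k (ev x))"

lemma ev_ann: "ev (ann k x) = annf k (ev x)"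
  unfolding ann_def using annf_has_sum[of k x] by (intro ev_Abs) (auto simp: summable_on_def)
lemma ev_cre: "ev (cre k x) = cref k (ev x)"
  unfolding cre_def using cref_has_sum[of k x] by (intro ev_Abs) (auto simp: summable_on_def)

lemma norm2_ann: "(norm (ann k x))\<^sup>2 = infsum (\<lambda>c. (cmod (ev x c))\<^sup>2) {c. k \<in> snd c}"
  using norm2_has_sum[of "ann k x"] annf_has_sum[of k x] has_sum_unique by (metis (no_types, lifting) ev_ann has_sum_cong)
lemma norm2_cre: "(norm (cre k x))\<^sup>2 = infsum (\<lambda>c. (cmod (ev x c))\<^sup>2) {c. k \<notin> snd c}"
  using norm2_has_sum[of "cre k x"] cref_has_sum[of k x] has_sum_unique by (metis (no_types, lifting) ev_cre has_sum_cong)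

lemma ann_lin: "ann k (x + y) = ann k x + ann k y" "ann k (cs a x) = cs a (ann k x)"
  "ann k (x - y) = ann k x - ann k y" "ann k 0 = 0" "ann k (r *\<^sub>R x) = r *\<^sub>R ann k x"
  by (auto intro!: ell2_eqI simp: ev_ann annf_def algebra_simps)
lemma cre_lin: "cre k (x + y) = cre k x + cre k y" "cre k (cs a x) = cs a (cre k x)"
  "cre k (x - y) = cre k x - cre k y" "cre k 0 = 0" "cre k (r *\<^sub>R x) = r *\<^sub>R cre k x"
  by (auto intro!: ell2_eqI simp: ev_cre cref_def algebra_simps)

lemma ann_sum: "ann k (\<Sum>i\<in>I. f i) = (\<Sum>i\<in>I. ann k (f i))"
  by (induction I rule: infinite_finite_induct) (auto simp: ann_lin)
lemma cre_sum: "cre k (\<Sum>i\<in>I. f i) = (\<Sum>i\<in>I. cre k (f i))"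
  by (induction I rule: infinite_finite_induct) (auto simp: cre_lin)

lemma cinner_ann: "cinner (ann k x) y = cinner x (cre k y)"
proof -
  have "cinner (ann k x) y = infsum (\<lambda>c. cnj (sgn_lat (snd c) k * ev x (sh k c)) * ev y c) {c. k \<notin> snd c}"
    unfolding cinner_def ev_ann by (rule infsum_cong_neutral) (auto simp: annf_def)
  also have "\<dots> = infsum (\<lambda>c. cnj (ev x (sh k c)) * cref k (ev y) (sh k c)) {c. k \<notin> snd c}"
    by (rule infsum_cong) (auto simp: cref_def un_sh, auto simp: sh_def)
  also have "\<dots> = infsum (\<lambda>c. cnj (ev x c) * cref k (ev y) c) {c. k \<in> snd c}"
    by (rule infsum_reindex_bij_betw[OF bij_sh])
  also have "\<dots> = cinner x (cre k y)"
    unfolding cinner_def ev_cre by (rule infsum_cong_neutral) (auto simp: cref_def)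
  finally show ?thesis .
qed

lemma inner_ann: "inner (ann k x) y = inner x (cre k y)"
  using cinner_ann by (metis Re_cinner)
lemma inner_cre: "inner (cre k x) y = inner x (ann k y)"
  using inner_ann by (metis inner_commute)

text \<open>The index type contains infinite occupied sets, where a sign defined through
  \<open>card\<close> loses its meaning. The anticommutation relations are therefore stated on this
  subspace, which contains every sector.\<close>

definition Fin :: "cfg ell2 set" where "Fin = supp_in {c. finite (snd c)}"
abbreviation sec :: "nat \<Rightarrow> cfg ell2 set" where "sec N \<equiv> supp_in (Cfg N)"

lemma sec_Fin: "sec N \<subseteq> Fin" by (auto simp: Fin_def supp_in_def Cfg_def)

text \<open>For distinct modes exactly one precedes the other, so exactly one of the two orders of
  operation picks up an extra sign. For equal modes the two terms live on the configurations without
  and with the mode.\<close>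

lemma CAR:
  assumes x: "x \<in> Fin"
  shows "ann k (cre l x) = (if k = l then x else 0) - cre l (ann k x)"
proof (rule ell2_eqI)
  fix c :: cfg
  obtain p S where c: "c = (p, S)" by (cases c)
  show "ev (ann k (cre l x)) c = ev ((if k = l then x else 0) - cre l (ann k x)) c"
  proof (cases "finite S")
    case False
    have "ev x (q, T) = 0" if "infinite T" for q T using supp_inD[OF x[unfolded Fin_def], of "(q, T)"] that by simp
    thus ?thesis using False by (auto simp: c ev_ann ev_cre annf_def cref_def sh_def un_def)
  next
    case fin: True
    show ?thesis
    proof (cases "k = l")
      case True
      thus ?thesis
        by (cases "k \<in> S") (auto simp: c ev_ann ev_cre annf_def cref_def sh_def un_def insert_absorb mult.assoc[symmetric])
    next
      case kl: False
      show ?thesis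
      proof (cases "l \<in> S \<and> k \<notin> S")
        case True
        define S0 where "S0 = S - {l}"
        have S: "S = insert l S0" "l \<notin> S0" "k \<notin> S0" "finite S0" using True fin by (auto simp: S0_def)
        have e: "insert k (insert l S0) - {l} = insert k S0" "insert l S0 - {l} = S0" using S kl by auto
        have pe: "p - k + l = p + l - k" by (simp add: algebra_simps)
        have "ev (ann k (cre l x)) c = sgn_lat (insert l S0) k * (sgn_lat (insert k S0) l * ev x (p + l - k, insert k S0))"
          using S kl by (simp add: c ev_ann ev_cre annf_def cref_def sh_def un_def e pe)
        moreover have "ev (cre l (ann k x)) c = sgn_lat S0 l * (sgn_lat S0 k * ev x (p + l - k, insert k S0))"
          using S kl by (simp add: c ev_ann ev_cre annf_def cref_def sh_def un_def e)
        ultimately show ?thesis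
          using sgn_lat_insert[OF S(4,2), of k] sgn_lat_insert[OF S(4,3), of l] lat_less_flip[OF kl] kl
          by (cases "lat_less l k") simp_all
      next
        case False
        thus ?thesis using kl by (auto simp: c ev_ann ev_cre annf_def cref_def sh_def un_def)
      qed
    qed
  qed
qed

lemma ann_sec: assumes x: "x \<in> sec (Suc N)" shows "ann k x \<in> sec N"
proof (rule supp_inI)
  fix c :: cfg assume c: "c \<notin> Cfg N"
  have "sh k c \<notin> Cfg (Suc N)" if "k \<notin> snd c"
    using c that by (cases c) (auto simp: Cfg_def sh_def card_insert_if)
  thus "ev (ann k x) c = 0" using supp_inD[OF x, of "sh k c"] by (auto simp: ev_ann annf_def)
qed

lemma cre_sec: assumes x: "x \<in> sec N" shows "cre k x \<in> sec (Suc N)"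
proof (rule supp_inI)
  fix c :: cfg assume c: "c \<notin> Cfg (Suc N)"
  have "un k c \<notin> Cfg N" if "k \<in> snd c"
  proof
    assume "un k c \<in> Cfg N"
    hence f: "finite (snd c)" "card (snd c - {k}) = N" by (auto simp: Cfg_def un_def)
    hence "card (snd c) = Suc N" using card_Suc_Diff1[OF f(1) that] by simp
    hence "c \<in> Cfg (Suc N)" using f(1) by (cases c) (auto simp: Cfg_def)
    thus False using c by blast
  qed
  thus "ev (cre k x) c = 0" using supp_inD[OF x, of "un k c"] by (auto simp: ev_cre cref_def)
qed

definition AA :: "lat set \<Rightarrow> cfg ell2 \<Rightarrow> cfg ell2" where "AA I x = (\<Sum>k\<in>I. ann k x)"
definition CC :: "lat set \<Rightarrow> cfg ell2 \<Rightarrow> cfg ell2" where "CC I x = (\<Sum>k\<in>I. cre k x)"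

lemma inner_AA: "inner (AA I x) y = inner x (CC I y)"
  by (simp add: AA_def CC_def inner_sum_left inner_sum_right inner_ann)
lemma inner_CC: "inner (CC I x) y = inner x (AA I y)"
  using inner_AA by (metis inner_commute)

lemma AA_lin: "AA I (x + y) = AA I x + AA I y" "AA I (cs a x) = cs a (AA I x)"
  "AA I (x - y) = AA I x - AA I y" "AA I 0 = 0" "AA I (r *\<^sub>R x) = r *\<^sub>R AA I x"
  by (simp_all add: AA_def ann_lin sum.distrib cs_sum sum_subtractf scaleR_sum_right)
lemma CC_lin: "CC I (x + y) = CC I x + CC I y" "CC I (cs a x) = cs a (CC I x)"
  "CC I (x - y) = CC I x - CC I y" "CC I 0 = 0" "CC I (r *\<^sub>R x) = r *\<^sub>R CC I x"
  by (simp_all add: CC_def cre_lin sum.distrib cs_sum sum_subtractf scaleR_sum_right)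

lemma AA_sec: "x \<in> sec (Suc N) \<Longrightarrow> AA I x \<in> sec N"
  unfolding AA_def by (intro csub_sum csub_supp_in ann_sec)
lemma CC_sec: "x \<in> sec N \<Longrightarrow> CC I x \<in> sec (Suc N)"
  unfolding CC_def by (intro csub_sum csub_supp_in cre_sec)

text \<open>Summed over all pairs of modes, the anticommutation relation leaves only the diagonal.
  Hence a sum of annihilators has norm at most the square root of the number of modes, where the
  triangle inequality would give the number itself.\<close>

lemma AA_CC_norm:
  assumes "finite I" "x \<in> Fin"
  shows "(norm (AA I x))\<^sup>2 + (norm (CC I x))\<^sup>2 = card I * (norm x)\<^sup>2"
proof -
  have "(norm (AA I x))\<^sup>2 = (\<Sum>l\<in>I. \<Sum>k\<in>I. inner x (cre l (ann k x)))"
    unfolding power2_norm_eq_inner inner_AA by (simp add: AA_def CC_def cre_sum inner_sum_right)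
  hence "(norm (AA I x))\<^sup>2 = (\<Sum>k\<in>I. \<Sum>l\<in>I. inner x (cre l (ann k x)))"
    by (subst sum.swap) simp
  moreover have "(norm (CC I x))\<^sup>2 = (\<Sum>k\<in>I. \<Sum>l\<in>I. inner x (ann k (cre l x)))"
    unfolding power2_norm_eq_inner inner_CC by (simp add: AA_def CC_def ann_sum inner_sum_right)
  ultimately have "(norm (AA I x))\<^sup>2 + (norm (CC I x))\<^sup>2 = (\<Sum>k\<in>I. \<Sum>l\<in>I. if k = l then inner x x else 0)"
    by (simp only: sum.distrib[symmetric], intro sum.cong refl) (auto simp: CAR[OF assms(2)] inner_diff_right)
  thus ?thesis using assms(1) by (simp add: power2_norm_eq_inner)
qed

lemma norm_AA_le: "finite I \<Longrightarrow> x \<in> Fin \<Longrightarrow> (norm (AA I x))\<^sup>2 \<le> card I * (norm x)\<^sup>2"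
  and norm_CC_le: "finite I \<Longrightarrow> x \<in> Fin \<Longrightarrow> (norm (CC I x))\<^sup>2 \<le> card I * (norm x)\<^sup>2"
  using AA_CC_norm[of I x] zero_le_power2[of "norm (AA I x)"] zero_le_power2[of "norm (CC I x)"] by linarith+

text \<open>Identifies the interaction in \<open>Hn\<close> with \<open>CC\<close> after
  \<open>AA\<close>: impurity momenta and signs relative to the intermediate set match term by
  term.\<close>

lemma ev_CC_AA:
  "ev (CC (ball_lat L (real n)) (AA (ball_lat L (real n)) x)) c = Vint L n (ev x) c"
proof -
  let ?B = "ball_lat L (real n)"
  obtain p S where c: "c = (p, S)" by (cases c)
  have *: "sgn_lat (insert k T) k = sgn_lat T k" for k T
  proof -
    have "{i \<in> insert k T. lat_less i k} = {i \<in> T. lat_less i k}" by auto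
    thus ?thesis by (simp add: sgn_lat_def)
  qed
  have "ev (CC ?B (AA ?B x)) c = (\<Sum>l\<in>?B. \<Sum>k\<in>?B. ev (cre l (ann k x)) c)"
    by (simp add: CC_def AA_def cre_sum)
  also have "\<dots> = (\<Sum>k\<in>?B. \<Sum>l\<in>?B. ev (cre l (ann k x)) c)" by (rule sum.swap)
  also have "\<dots> = Vint L n (ev x) c"
    unfolding Vint_def Let_def
  proof (intro sum.cong refl)
    fix k l
    have "insert k (S - {l}) - {k} = S - {l}" if "k \<notin> S - {l}" using that by auto
    moreover have "p + l - k = p - k + l" by simp
    ultimately show "ev (cre l (ann k x)) c = (if l \<in> snd c \<and> (k = l \<or> k \<notin> snd c) then
          sgn_lat (insert k (snd c - {l})) k * sgn_lat (insert k (snd c - {l}) - {k}) l *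
          ev x (fst c - k + l, insert k (snd c - {l})) else 0)"
      by (auto simp: c ev_ann ev_cre annf_def cref_def sh_def un_def * diff_add_eq)
  qed
  finally show ?thesis .
qed

section \<open>Lattice sums\<close>

definition nu :: "lat \<Rightarrow> real" where
  "nu j = (real_of_int (fst j))\<^sup>2 + (real_of_int (snd j))\<^sup>2"

lemma nu_ge0 [simp]: "0 \<le> nu j" by (simp add: nu_def)
lemma nu_minus [simp]: "nu (- j) = nu j" by (simp add: nu_def)
lemma nu_0 [simp]: "nu 0 = 0" by (simp add: nu_def)

lemma nu_ge1: "j \<noteq> 0 \<Longrightarrow> 1 \<le> nu j"
proof -
  assume "j \<noteq> 0"
  hence "fst j \<noteq> 0 \<or> snd j \<noteq> 0" by (auto simp: prod_eq_iff)
  hence "1 \<le> (fst j)\<^sup>2 + (snd j)\<^sup>2"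
    by (smt (verit) zero_less_power2 zero_le_power2)
  hence "1 \<le> real_of_int ((fst j)\<^sup>2 + (snd j)\<^sup>2)" by linarith
  thus ?thesis by (simp add: nu_def)
qed

lemma finite_lat_subset_box:
  fixes F :: "lat set" assumes "finite F"
  obtains n :: nat where "F \<subseteq> {- int n..int n} \<times> {- int n..int n}"
proof
  define n where "n = nat (\<Sum>j\<in>F. \<bar>fst j\<bar> + \<bar>snd j\<bar>)"
  show "F \<subseteq> {- int n..int n} \<times> {- int n..int n}"
  proof
    fix j assume "j \<in> F"
    hence "\<bar>fst j\<bar> + \<bar>snd j\<bar> \<le> (\<Sum>j\<in>F. \<bar>fst j\<bar> + \<bar>snd j\<bar>)"
      using assms by (intro member_le_sum) auto
    hence "\<bar>fst j\<bar> \<le> int n" "\<bar>snd j\<bar> \<le> int n" by (auto simp: n_def)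
    thus "j \<in> {- int n..int n} \<times> {- int n..int n}" by (cases j) auto
  qed
qed

lemma sum_even_int:
  fixes f :: "int \<Rightarrow> real"
  assumes "\<And>a. f (- a) = f a"
  shows "(\<Sum>a\<in>{- int n..int n}. f a) = f 0 + 2 * (\<Sum>a=1..n. f (int a))"
proof (induction n)
  case (Suc n)
  have "{- int (Suc n)..int (Suc n)} = insert (int (Suc n)) (insert (- int (Suc n)) {- int n..int n})"
    by auto
  thus ?case using Suc assms[of "int (Suc n)"] by simp
qed simp

text \<open>Reduces a two-dimensional sum to one dimension: a finite set is enlarged to a box, where
  the dominating product factorises.\<close>

lemma lat_sum_product_le:
  fixes f :: "lat \<Rightarrow> real" and g :: "int \<Rightarrow> real"
  assumes F: "finite F" and fg: "\<And>j. f j \<le> g (fst j) * g (snd j)" and g0: "\<And>a. 0 \<le> g a" and ev: "\<And>a. g (- a) = g a"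
    and b: "\<And>n. g 0 + 2 * (\<Sum>a=1..n. g (int a)) \<le> C"
  shows "(\<Sum>j\<in>F. f j) \<le> C\<^sup>2"
proof -
  obtain n where n: "F \<subseteq> {- int n..int n} \<times> {- int n..int n}" using finite_lat_subset_box[OF F] .
  have "(\<Sum>j\<in>F. f j) \<le> (\<Sum>j\<in>F. g (fst j) * g (snd j))" by (intro sum_mono fg)
  also have "\<dots> \<le> (\<Sum>j\<in>{- int n..int n} \<times> {- int n..int n}. g (fst j) * g (snd j))"
    using n g0 by (intro sum_mono2) auto
  also have "\<dots> = (\<Sum>a\<in>{- int n..int n}. g a)\<^sup>2"
    by (simp add: power2_eq_square sum_product sum.cartesian_product case_prod_unfold)
  also have "\<dots> \<le> C\<^sup>2"
    using b[of n] g0 sum_even_int[of g n, OF ev] by (intro power_mono sum_nonneg) auto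
  finally show ?thesis .
qed

lemma sum_inverse_square_shift:
  assumes "b \<ge> (1::real)"
  shows "(\<Sum>a=1..n. 1 / (b + real a)\<^sup>2) \<le> 1 / b - 1 / (b + real n)"
proof (induction n)
  case (Suc n)
  let ?x = "b + real n"
  have x: "?x > 0" using assms by (simp add: add_pos_nonneg)
  have "1 / (?x + 1)\<^sup>2 \<le> 1 / (?x * (?x + 1))"
    using x by (intro divide_left_mono) (auto simp: power2_eq_square)
  also have "\<dots> = 1 / ?x - 1 / (?x + 1)" using x by (simp add: field_simps)
  finally show ?case using Suc by (simp add: algebra_simps)
qed simp

text \<open>Lattice form of the integral of 1/(B + |x|^2)^2, which is \<pi>/B. The decay in
  \<open>B\<close> is what makes recoil errors independent of the momenta involved. The constant is
  5^2, with \<open>1 / b\<close> from the origin and \<open>4 / b\<close> from the two half-lines in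
  each coordinate.\<close>

lemma lat_sum_inv_sq:
  assumes F: "finite F" and B: "B \<ge> 1"
  shows "(\<Sum>j\<in>F. 1 / (B + nu j)\<^sup>2) \<le> 25 / B"
proof -
  define b where "b = sqrt B"
  have b: "b \<ge> 1" "b\<^sup>2 = B" using B by (auto simp: b_def)
  have "(\<Sum>j\<in>F. 1 / (B + nu j)\<^sup>2) \<le> (5 / b)\<^sup>2"
  proof (rule lat_sum_product_le[OF F, where g = "\<lambda>a. 1 / (B + (real_of_int a)\<^sup>2)"])
    fix j :: lat
    let ?x = "(real_of_int (fst j))\<^sup>2" and ?y = "(real_of_int (snd j))\<^sup>2"
    have "(B + ?x) * (B + ?y) \<le> (B + nu j)\<^sup>2"
      using B by (simp add: nu_def power2_eq_square[of "B + _"] algebra_simps)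
    moreover have "0 < (B + ?x) * (B + ?y)" using B by (intro mult_pos_pos add_pos_nonneg) auto
    ultimately show "1 / (B + nu j)\<^sup>2 \<le> 1 / (B + ?x) * (1 / (B + ?y))"
      by (simp add: frac_le)
  next
    fix n :: nat
    have "1 / (B + (real a)\<^sup>2) \<le> 2 * (1 / (b + real a)\<^sup>2)" for a
    proof -
      have "(b + real a)\<^sup>2 \<le> 2 * (B + (real a)\<^sup>2)"
        using sum_squares_bound[of b "real a"] by (simp add: power2_sum b)
      thus ?thesis using b(1) B by (simp add: field_simps add_pos_nonneg)
    qed
    hence "(\<Sum>a=1..n. 1 / (B + (real a)\<^sup>2)) \<le> 2 * (\<Sum>a=1..n. 1 / (b + real a)\<^sup>2)"
      by (simp add: sum_distrib_left sum_mono)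
    also have "\<dots> \<le> 2 * (1 / b)" using sum_inverse_square_shift[OF b(1), of n] b(1)
      by (smt (verit) divide_nonneg_nonneg of_nat_0_le_iff)
    finally have "1 / B + 2 * (\<Sum>a=1..n. 1 / (B + (real a)\<^sup>2)) \<le> 1 / B + 4 / b" by simp
    also have "1 / B \<le> 1 / b" using b by (simp add: frac_le power2_eq_square flip: b(2))
    finally show "1 / (B + (real_of_int 0)\<^sup>2) + 2 * (\<Sum>a=1..n. 1 / (B + (real_of_int (int a))\<^sup>2)) \<le> 5 / b"
      by simp
  qed (use B in \<open>auto intro!: divide_nonneg_nonneg add_nonneg_nonneg\<close>)
  also have "(5 / b)\<^sup>2 = 25 / B" by (simp add: power_divide b)
  finally show ?thesis .
qed

text \<open>The summand is, up to a constant, the increment of \<open>u / (u + w)\<close> along \<open>u = sqrt a\<close>.\<close>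
lemma sum_inv_sqrt_shift:
  assumes "b > (0::real)"
  shows "(\<Sum>a=1..n. 1 / ((b + real a) * sqrt (real a))) \<le> 4 / sqrt b * (sqrt (real n) / (sqrt (real n) + sqrt b))"
proof (induction n)
  case (Suc n)
  define u v w where "u = sqrt (real (Suc n))" and "v = sqrt (real n)" and "w = sqrt b"
  have w: "w > 0" "w\<^sup>2 = b" and u: "u > 0" "u\<^sup>2 = real n + 1" and v: "v \<ge> 0" "v\<^sup>2 = real n"
    using assms by (auto simp: u_def v_def w_def)
  have uv: "v \<le> u" by (simp add: u_def v_def)
  have d: "(u - v) * (u + v) = 1" using u v by (simp add: algebra_simps power2_eq_square)
  have "1 \<le> 2 * u * (u - v)" using d uv mult_left_mono[of "u + v" "2 * u" "u - v"] by (simp add: mult.commute)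
  hence duv: "1 / (2 * u) \<le> u - v" using u by (simp add: field_simps)
  have "1 / ((b + real (Suc n)) * u) = 1 / ((w\<^sup>2 + u\<^sup>2) * u)" using w u by (simp add: algebra_simps)
  also have "\<dots> \<le> 2 / ((u + w)\<^sup>2 * u)"
  proof -
    have "(u + w)\<^sup>2 \<le> 2 * (w\<^sup>2 + u\<^sup>2)" using sum_squares_bound[of u w] by (simp add: power2_sum)
    hence "2 / (2 * (w\<^sup>2 + u\<^sup>2) * u) \<le> 2 / ((u + w)\<^sup>2 * u)"
      using u(1) w(1) by (intro divide_left_mono mult_right_mono mult_pos_pos zero_less_power) (auto intro: add_pos_pos)
    moreover have "2 / (2 * (w\<^sup>2 + u\<^sup>2) * u) = 1 / ((w\<^sup>2 + u\<^sup>2) * u)"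
      unfolding mult.assoc by (subst divide_divide_eq_left[symmetric]) simp
    ultimately show ?thesis by metis
  qed
  also have "\<dots> = 4 / w * (w * (1 / (2 * u)) / ((u + w) * (u + w)))" using u(1) w(1) by (simp add: power2_eq_square divide_simps)
  also have "\<dots> \<le> 4 / w * (w * (u - v) / ((u + w) * (v + w)))"
    using u w v uv duv by (intro mult_left_mono frac_le mult_nonneg_nonneg mult_pos_pos) auto
  also have "w * (u - v) / ((u + w) * (v + w)) = u / (u + w) - v / (v + w)"
    using u w v by (simp add: field_simps add_pos_nonneg add_nonneg_pos)
  finally show ?case using Suc by (simp add: u_def v_def w_def algebra_simps)
qed simp

text \<open>Row sums for a Schur test of the kernel 1/(1 + nu k + nu l): with
  \<open>B = 1 + nu k\<close> the weight \<open>1 / sqrt (1 + nu l)\<close> reproduces itself up to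
  a constant. With \<open>B = 1\<close> it gives summability of terms of order |k|^-3.\<close>

lemma lat_sum_three_halves:
  assumes F: "finite F" and B: "B \<ge> 1"
  shows "(\<Sum>j\<in>F. 1 / ((B + nu j) * sqrt (1 + nu j))) \<le> 169 / sqrt B"
proof -
  define b where "b = sqrt B"
  have b: "b \<ge> 1" "b\<^sup>2 = B" using B by (auto simp: b_def)
  \<comment> \<open>Each factor \<open>C + nu j\<close> of the denominator is at least sqrt (C +
    x^2) sqrt (C + y^2), which separates the two coordinates.\<close>
  define g where "g a = 1 / (sqrt (B + (real_of_int a)\<^sup>2) * sqrt (sqrt (1 + (real_of_int a)\<^sup>2)))" for a
  have "(\<Sum>j\<in>F. 1 / ((B + nu j) * sqrt (1 + nu j))) \<le> (13 / sqrt b)\<^sup>2"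
  proof (rule lat_sum_product_le[OF F, where g = g])
    fix j :: lat
    let ?x = "(real_of_int (fst j))\<^sup>2" and ?y = "(real_of_int (snd j))\<^sup>2"
    have pr: "sqrt (C + ?x) * sqrt (C + ?y) \<le> C + nu j" if "C \<ge> 1" for C
    proof -
      have "(C + ?x) * (C + ?y) \<le> (C + nu j)\<^sup>2"
        using that by (simp add: nu_def power2_eq_square[of "C + _"] algebra_simps)
      thus ?thesis using that by (simp add: real_le_lsqrt real_sqrt_mult[symmetric])
    qed
    have "g (fst j) * g (snd j) = 1 / ((sqrt (B + ?x) * sqrt (B + ?y)) * sqrt (sqrt (1 + ?x) * sqrt (1 + ?y)))"
      by (simp add: g_def real_sqrt_mult)
    moreover have "(sqrt (B + ?x) * sqrt (B + ?y)) * sqrt (sqrt (1 + ?x) * sqrt (1 + ?y)) \<le> (B + nu j) * sqrt (1 + nu j)"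
      using B by (intro mult_mono pr real_sqrt_le_mono) (auto intro: add_nonneg_nonneg)
    moreover have "0 < (sqrt (B + ?x) * sqrt (B + ?y)) * sqrt (sqrt (1 + ?x) * sqrt (1 + ?y))"
      using B by (intro mult_pos_pos) (auto simp: add_pos_nonneg)
    ultimately show "1 / ((B + nu j) * sqrt (1 + nu j)) \<le> g (fst j) * g (snd j)"
      by (simp add: frac_le)
  next
    fix n :: nat
    have t: "g (int a) \<le> (3/2) * (1 / ((b + real a) * sqrt (real a)))" if "a \<in> {1..n}" for a
    proof -
      have a: "real a \<ge> 1" using that by simp
      have "(b + real a)\<^sup>2 \<le> 2 * (B + (real a)\<^sup>2)"
        using sum_squares_bound[of b "real a"] by (simp add: power2_sum b)
      also have "\<dots> \<le> ((3/2) * sqrt (B + (real a)\<^sup>2))\<^sup>2" 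
      proof -
        define X where "X = B + (real a)\<^sup>2"
        have "X \<ge> 0" using B by (simp add: X_def)
        hence "(3 / 2 * sqrt X)\<^sup>2 = (9/4) * X" by (simp add: power_divide power_mult_distrib)
        moreover have "2 * X \<le> (9/4) * X" using \<open>X \<ge> 0\<close> by simp
        ultimately show ?thesis unfolding X_def by linarith
      qed
      finally have 1: "b + real a \<le> (3/2) * sqrt (B + (real a)\<^sup>2)" using B b by (simp add: power2_le_iff_abs_le abs_le_iff)
      have 2: "sqrt (real a) \<le> sqrt (sqrt (1 + (real a)\<^sup>2))" by (simp add: real_le_rsqrt)
      have "(b + real a) * sqrt (real a) \<le> (3/2) * (sqrt (B + (real a)\<^sup>2) * sqrt (sqrt (1 + (real a)\<^sup>2)))"
        using mult_mono[OF 1 2] b B by (simp add: mult.assoc add_nonneg_nonneg)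
      moreover have "0 < (b + real a) * sqrt (real a)" using a b by simp
      moreover have "0 < sqrt (B + (real a)\<^sup>2) * sqrt (sqrt (1 + (real a)\<^sup>2))"
        using B by (intro mult_pos_pos) (auto simp: add_pos_nonneg)
      ultimately show ?thesis unfolding g_def by (simp add: divide_simps)
    qed
    have "(\<Sum>a=1..n. g (int a)) \<le> (\<Sum>a=1..n. (3/2) * (1 / ((b + real a) * sqrt (real a))))"
      by (intro sum_mono t)
    also have "\<dots> = (3/2) * (\<Sum>a=1..n. 1 / ((b + real a) * sqrt (real a)))" by (simp add: sum_distrib_left)
    also have "\<dots> \<le> (3/2) * (4 / sqrt b * (sqrt (real n) / (sqrt (real n) + sqrt b)))"
      using sum_inv_sqrt_shift[of b n] b by (intro mult_left_mono) auto
    also have "\<dots> \<le> (3/2) * (4 / sqrt b * 1)" using b by (intro mult_left_mono) (auto simp: divide_le_eq add_nonneg_pos)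
    finally have "2 * (\<Sum>a=1..n. g (int a)) \<le> 12 / sqrt b" by simp
    moreover have "g 0 \<le> 1 / sqrt b"
    proof -
      have "sqrt b \<le> b" using b(1) by (simp add: real_le_lsqrt power2_eq_square)
      thus ?thesis using b(1) by (simp add: g_def frac_le flip: b_def)
    qed
    ultimately have "g 0 + 2 * (\<Sum>a=1..n. g (int a)) \<le> 1 / sqrt b + 12 / sqrt b" by linarith
    thus "g 0 + 2 * (\<Sum>a=1..n. g (int a)) \<le> 13 / sqrt b" by (simp add: add_divide_distrib[symmetric])
  qed (use B in \<open>auto simp: g_def intro!: divide_nonneg_nonneg mult_nonneg_nonneg\<close>)
  also have "(13 / sqrt b)\<^sup>2 = 169 / b" using b by (simp add: power_divide)
  finally show ?thesis by (simp add: b_def)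
qed

section \<open>Counting lattice points in balls and annuli, and the logarithmic lattice sum\<close>

lemma card_int_interval_le:
  fixes T :: "int set"
  assumes "\<And>a b. a \<in> T \<Longrightarrow> b \<in> T \<Longrightarrow> real_of_int (b - a) \<le> d" "d \<ge> 0"
  shows "finite T" "real (card T) \<le> d + 1"
proof -
  have "finite T \<and> real (card T) \<le> d + 1"
  proof (cases "T = {}")
    case False
    then obtain t where t: "t \<in> T" by blast
    have bnd: "T \<subseteq> {t - \<lceil>d\<rceil>..t + \<lceil>d\<rceil>}"
    proof
      fix s assume s: "s \<in> T"
      have "real_of_int (s - t) \<le> d" "real_of_int (t - s) \<le> d" using assms(1) s t by auto
      thus "s \<in> {t - \<lceil>d\<rceil>..t + \<lceil>d\<rceil>}" by simp linarith
    qed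
    hence fin: "finite T" using finite_subset by blast
    define a where "a = Min T"
    have a: "a \<in> T" "\<And>s. s \<in> T \<Longrightarrow> a \<le> s" using False fin by (auto simp: a_def)
    have "T \<subseteq> {a..a + \<lfloor>d\<rfloor>}"
    proof
      fix s assume s: "s \<in> T"
      have "real_of_int (s - a) \<le> d" using assms(1) a s by blast
      hence "s - a \<le> \<lfloor>d\<rfloor>" by (simp add: le_floor_iff)
      thus "s \<in> {a..a + \<lfloor>d\<rfloor>}" using a(2)[OF s] by simp
    qed
    hence "card T \<le> card {a..a + \<lfloor>d\<rfloor>}" by (intro card_mono) auto
    hence "real (card T) \<le> real (nat (\<lfloor>d\<rfloor> + 1))" by simp
    also have "\<dots> \<le> d + 1" using assms(2) by simp
    finally show ?thesis using fin by blast
  qed (use assms in auto)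
  thus "finite T" "real (card T) \<le> d + 1" by auto
qed

lemma nu_ball_box:
  assumes "nu j \<le> R" shows "\<bar>real_of_int (fst j)\<bar> \<le> sqrt R" "\<bar>real_of_int (snd j)\<bar> \<le> sqrt R"
proof -
  have "(real_of_int (fst j))\<^sup>2 \<le> R" "(real_of_int (snd j))\<^sup>2 \<le> R"
    using assms unfolding nu_def by (smt (verit) zero_le_power2)+
  thus "\<bar>real_of_int (fst j)\<bar> \<le> sqrt R" "\<bar>real_of_int (snd j)\<bar> \<le> sqrt R"
    by (metis real_sqrt_abs real_sqrt_le_iff)+
qed

lemma nu_ball_sub: "{j. nu j \<le> R} \<subseteq> {-\<lfloor>sqrt R\<rfloor>..\<lfloor>sqrt R\<rfloor>} \<times> {-\<lfloor>sqrt R\<rfloor>..\<lfloor>sqrt R\<rfloor>}"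
proof
  fix j assume "j \<in> {j. nu j \<le> R}"
  hence "\<bar>real_of_int (fst j)\<bar> \<le> sqrt R" "\<bar>real_of_int (snd j)\<bar> \<le> sqrt R" using nu_ball_box by blast+
  hence "\<bar>fst j\<bar> \<le> \<lfloor>sqrt R\<rfloor>" "\<bar>snd j\<bar> \<le> \<lfloor>sqrt R\<rfloor>" by (simp_all add: le_floor_iff)
  thus "j \<in> {-\<lfloor>sqrt R\<rfloor>..\<lfloor>sqrt R\<rfloor>} \<times> {-\<lfloor>sqrt R\<rfloor>..\<lfloor>sqrt R\<rfloor>}" by (cases j) auto
qed

lemma finite_nu_ball [simp]: "finite {j. nu j \<le> R}"
  by (rule finite_subset[OF nu_ball_sub]) simp

lemma card_nu_ball_le:
  assumes "R \<ge> 0" shows "real (card {j. nu j \<le> R}) \<le> (2 * sqrt R + 1)\<^sup>2"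
proof -
  have f: "\<lfloor>sqrt R\<rfloor> \<ge> 0" using assms by simp
  have "card {j. nu j \<le> R} \<le> card ({-\<lfloor>sqrt R\<rfloor>..\<lfloor>sqrt R\<rfloor>} \<times> {-\<lfloor>sqrt R\<rfloor>..\<lfloor>sqrt R\<rfloor>})"
    by (rule card_mono[OF _ nu_ball_sub]) simp
  hence "real (card {j. nu j \<le> R}) \<le> (real (nat (2 * \<lfloor>sqrt R\<rfloor> + 1)))\<^sup>2"
    by (simp add: card_cartesian_product power2_eq_square algebra_simps flip: of_nat_mult)
  also have "real (nat (2 * \<lfloor>sqrt R\<rfloor> + 1)) = 2 * real_of_int \<lfloor>sqrt R\<rfloor> + 1" using f by simp
  also have "(2 * real_of_int \<lfloor>sqrt R\<rfloor> + 1)\<^sup>2 \<le> (2 * sqrt R + 1)\<^sup>2"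
    using f by (intro power_mono) auto
  finally show ?thesis .
qed

lemma card_nu_ball_ge:
  assumes "R \<ge> 0" shows "R / 2 \<le> real (card {j. nu j \<le> R})"
proof -
  define x where "x = sqrt (R / 2)"
  have x: "x \<ge> 0" "x\<^sup>2 = R / 2" using assms by (auto simp: x_def)
  have f: "\<lfloor>x\<rfloor> \<ge> 0" using x by simp
  have "{-\<lfloor>x\<rfloor>..\<lfloor>x\<rfloor>} \<times> {-\<lfloor>x\<rfloor>..\<lfloor>x\<rfloor>} \<subseteq> {j. nu j \<le> R}"
  proof
    fix j assume "j \<in> {-\<lfloor>x\<rfloor>..\<lfloor>x\<rfloor>} \<times> {-\<lfloor>x\<rfloor>..\<lfloor>x\<rfloor>}"
    hence "\<bar>fst j\<bar> \<le> \<lfloor>x\<rfloor>" "\<bar>snd j\<bar> \<le> \<lfloor>x\<rfloor>" by auto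
    hence "\<bar>real_of_int (fst j)\<bar> \<le> \<bar>x\<bar>" "\<bar>real_of_int (snd j)\<bar> \<le> \<bar>x\<bar>" using x by (simp_all add: le_floor_iff)
    hence "(real_of_int (fst j))\<^sup>2 \<le> x\<^sup>2" "(real_of_int (snd j))\<^sup>2 \<le> x\<^sup>2" by (simp_all add: abs_le_square_iff)
    thus "j \<in> {j. nu j \<le> R}" using x by (simp add: nu_def)
  qed
  hence "card ({-\<lfloor>x\<rfloor>..\<lfloor>x\<rfloor>} \<times> {-\<lfloor>x\<rfloor>..\<lfloor>x\<rfloor>}) \<le> card {j. nu j \<le> R}" by (intro card_mono) auto
  hence "(real (nat (2 * \<lfloor>x\<rfloor> + 1)))\<^sup>2 \<le> real (card {j. nu j \<le> R})"
    by (simp add: card_cartesian_product power2_eq_square algebra_simps flip: of_nat_mult)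
  moreover have "x\<^sup>2 \<le> (real (nat (2 * \<lfloor>x\<rfloor> + 1)))\<^sup>2" using x f by (intro power_mono) linarith+
  ultimately show ?thesis using x by linarith
qed

text \<open>In this sector the second coordinate is at least \<open>sqrt \<rho> / 2\<close>, so
  within a column the range \<open>2 * s\<close> of \<open>nu\<close> allows it a range of at most
  \<open>2 * s / sqrt \<rho>\<close>. The number of columns is of order \<open>sqrt \<rho>\<close>;
  one extra point per column is the perimeter term.\<close>

lemma card_annulus_sector:
  assumes s: "0 \<le> s" "s < \<rho> / 2"
  defines "S \<equiv> {j :: lat. \<rho> - s \<le> nu j \<and> nu j \<le> \<rho> + s \<and> \<bar>fst j\<bar> \<le> snd j}"
  shows "real (card S) \<le> 6 * s + 4 * sqrt \<rho> + 1"
proof -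
  have r: "\<rho> > 0" using s by linarith
  define m where "m = \<lfloor>sqrt (2 * \<rho>)\<rfloor>"
  have m: "m \<ge> 0" using r by (simp add: m_def)
  define T where "T a = {b. (a, b) \<in> S}" for a
  have T: "finite (T a)" "real (card (T a)) \<le> 2 * s / sqrt \<rho> + 1" for a
  proof -
    have "real_of_int (b' - b) \<le> 2 * s / sqrt \<rho>" if b: "b \<in> T a" "b' \<in> T a" for b b'
    proof (cases "b \<le> b'")
      case True
      have half: "sqrt \<rho> \<le> 2 * real_of_int c" if "c \<in> T a" for c
      proof -
        have ac: "\<rho> - s \<le> (real_of_int a)\<^sup>2 + (real_of_int c)\<^sup>2" "\<bar>a\<bar> \<le> c"
          using that by (auto simp: T_def S_def nu_def)
        have "\<bar>real_of_int a\<bar> \<le> \<bar>real_of_int c\<bar>" using ac(2) by linarith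
        hence "(real_of_int a)\<^sup>2 \<le> (real_of_int c)\<^sup>2" by (simp add: abs_le_square_iff)
        hence "\<rho> \<le> (2 * real_of_int c)\<^sup>2" using ac(1) s by (simp add: power_mult_distrib)
        moreover have "c \<ge> 0" using ac(2) by linarith
        ultimately show ?thesis by (simp add: real_le_lsqrt)
      qed
      have "(real_of_int b')\<^sup>2 - (real_of_int b)\<^sup>2 \<le> 2 * s" using b by (auto simp: T_def S_def nu_def)
      hence "real_of_int (b' - b) * (real_of_int b' + real_of_int b) \<le> 2 * s"
        by (simp add: power2_eq_square algebra_simps)
      moreover have "real_of_int (b' - b) * sqrt \<rho> \<le> real_of_int (b' - b) * (real_of_int b' + real_of_int b)"
        using half[OF b(1)] half[OF b(2)] True by (intro mult_left_mono) auto
      ultimately have "real_of_int (b' - b) * sqrt \<rho> \<le> 2 * s" by linarith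
      thus ?thesis using r by (simp add: pos_le_divide_eq)
    next
      case False
      hence "real_of_int (b' - b) \<le> 0" by simp
      also have "0 \<le> 2 * s / sqrt \<rho>" using s r by simp
      finally show ?thesis .
    qed
    thus "finite (T a)" "real (card (T a)) \<le> 2 * s / sqrt \<rho> + 1"
      using card_int_interval_le[of "T a" "2 * s / sqrt \<rho>"] s r by auto
  qed
  have "S \<subseteq> (SIGMA a:{-m..m}. T a)"
  proof
    fix j assume j: "j \<in> S"
    have "nu j \<le> 2 * \<rho>" using j s by (simp add: S_def)
    hence "\<bar>real_of_int (fst j)\<bar> \<le> sqrt (2 * \<rho>)" by (rule nu_ball_box)
    hence "\<bar>fst j\<bar> \<le> m" by (simp add: m_def le_floor_iff)
    thus "j \<in> (SIGMA a:{-m..m}. T a)" using j by (cases j) (auto simp: T_def)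
  qed
  hence "card S \<le> card (SIGMA a:{-m..m}. T a)" using T by (intro card_mono finite_SigmaI) auto
  also have "\<dots> = (\<Sum>a\<in>{-m..m}. card (T a))" using T by simp
  finally have "real (card S) \<le> (\<Sum>a\<in>{-m..m}. real (card (T a)))" by (metis of_nat_le_iff of_nat_sum)
  also have "\<dots> \<le> (\<Sum>a\<in>{-m..m}. 2 * s / sqrt \<rho> + 1)" by (intro sum_mono T)
  also have "\<dots> = (2 * real_of_int m + 1) * (2 * s / sqrt \<rho> + 1)" using m by simp
  also have "\<dots> \<le> (2 * sqrt (2 * \<rho>) + 1) * (2 * s / sqrt \<rho> + 1)"
    using s r by (intro mult_right_mono) (auto simp: m_def)
  also have "\<dots> \<le> (3 * sqrt \<rho> + 1) * (2 * s / sqrt \<rho> + 1)"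
  proof (intro mult_right_mono)
    have "2 * sqrt (2 * \<rho>) = (2 * sqrt 2) * sqrt \<rho>" by (simp add: real_sqrt_mult)
    also have "2 * sqrt 2 \<le> (3 :: real)"
    proof -
      have "sqrt 2 \<le> sqrt ((3/2)\<^sup>2)" by (intro real_sqrt_le_mono) (simp add: power2_eq_square)
      thus ?thesis by simp
    qed
    finally show "2 * sqrt (2 * \<rho>) + 1 \<le> 3 * sqrt \<rho> + 1" using r by (simp add: mult_right_mono)
  qed (use s r in auto)
  also have "\<dots> = 6 * s + 3 * sqrt \<rho> + 2 * s / sqrt \<rho> + 1" using r by (simp add: field_simps)
  also have "2 * s / sqrt \<rho> \<le> sqrt \<rho>"
    using s r by (simp add: divide_le_eq)
  finally show ?thesis by simp
qed

text \<open>Area plus perimeter. Reflection and rotations cover a thin annulus by four copies of the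
  sector; a thick annulus is bounded by a ball.\<close>

lemma card_annulus:
  assumes s: "0 \<le> s" and r: "\<rho> \<ge> 0"
  shows "real (card {j. \<rho> - s \<le> nu j \<and> nu j \<le> \<rho> + s}) \<le> 24 * (s + sqrt \<rho> + 1)"
proof (cases "s < \<rho> / 2")
  case True
  define A where "A = {j. \<rho> - s \<le> nu j \<and> nu j \<le> \<rho> + s}"
  define S where "S = {j :: lat. \<rho> - s \<le> nu j \<and> nu j \<le> \<rho> + s \<and> \<bar>fst j\<bar> \<le> snd j}"
  have fin: "finite S" by (rule finite_subset[of _ "{j. nu j \<le> \<rho> + s}"]) (auto simp: S_def)
  let ?f = "\<lambda>(a, b). (a, - b) :: lat" and ?g = "\<lambda>(a, b). (b, a) :: lat" and ?h = "\<lambda>(a, b). (- b, a) :: lat"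
  have "A \<subseteq> S \<union> ?f ` S \<union> ?g ` S \<union> ?h ` S"
  proof
    fix j assume j: "j \<in> A"
    obtain x y where xy: "j = (x, y)" by (cases j)
    consider "\<bar>x\<bar> \<le> y" | "\<bar>x\<bar> \<le> - y" | "\<bar>y\<bar> \<le> x" | "\<bar>y\<bar> \<le> - x" by linarith
    thus "j \<in> S \<union> ?f ` S \<union> ?g ` S \<union> ?h ` S"
    proof cases
      case 1 thus ?thesis using j xy by (simp add: A_def S_def)
    next
      case 2
      hence "(x, - y) \<in> S" using j xy by (simp add: A_def S_def nu_def)
      thus ?thesis using xy by (force intro: rev_image_eqI)
    next
      case 3
      hence "(y, x) \<in> S" using j xy by (simp add: A_def S_def nu_def add.commute)
      thus ?thesis using xy by (force intro: rev_image_eqI)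
    next
      case 4
      hence "(y, - x) \<in> S" using j xy by (simp add: A_def S_def nu_def add.commute)
      thus ?thesis using xy by (force intro: rev_image_eqI)
    qed
  qed
  hence "card A \<le> card (S \<union> ?f ` S \<union> ?g ` S \<union> ?h ` S)" using fin by (intro card_mono) auto
  also have "\<dots> \<le> card S + card (?f ` S) + card (?g ` S) + card (?h ` S)"
    by (meson add_mono card_Un_le le_refl order_trans)
  also have "\<dots> \<le> 4 * card S"
    using card_image_le[OF fin, of ?f] card_image_le[OF fin, of ?g] card_image_le[OF fin, of ?h] by linarith
  finally have "real (card A) \<le> 4 * real (card S)" by linarith
  also have "\<dots> \<le> 4 * (6 * s + 4 * sqrt \<rho> + 1)" using card_annulus_sector[OF s True] by (simp add: S_def)
  also have "\<dots> \<le> 24 * (s + sqrt \<rho> + 1)" using r by simp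
  finally show ?thesis by (simp add: A_def)
next
  case False
  have "card {j. \<rho> - s \<le> nu j \<and> nu j \<le> \<rho> + s} \<le> card {j. nu j \<le> 3 * s}"
    using False by (intro card_mono) auto
  hence "real (card {j. \<rho> - s \<le> nu j \<and> nu j \<le> \<rho> + s}) \<le> real (card {j. nu j \<le> 3 * s})" by linarith
  also have "\<dots> \<le> (2 * sqrt (3 * s) + 1)\<^sup>2" using s by (intro card_nu_ball_le) simp
  also have "\<dots> \<le> 2 * (2 * sqrt (3 * s))\<^sup>2 + 2 * 1\<^sup>2"
    using sum_squares_bound[of "2 * sqrt (3 * s)" 1] by (simp add: power2_sum)
  also have "\<dots> = 24 * s + 2" using s by (simp add: power_mult_distrib)
  also have "\<dots> \<le> 24 * (s + sqrt \<rho> + 1)" using r by simp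
  finally show ?thesis .
qed

text \<open>Cauchy-Schwarz against \<open>lat_sum_inv_sq\<close>. The true growth is logarithmic,
  but a square root suffices for the purpose, which is to keep the annuli at the Fermi level thick
  enough for counting by area.\<close>

lemma lat_sum_crude:
  assumes "R \<ge> 0"
  shows "(\<Sum>j | nu j \<le> R. 1 / (1 + nu j)) \<le> 5 * (2 * sqrt R + 1)"
proof -
  let ?F = "{j. nu j \<le> R}"
  have "((\<Sum>j\<in>?F. 1 * (1 / (1 + nu j))))\<^sup>2 \<le> (\<Sum>j\<in>?F. 1\<^sup>2) * (\<Sum>j\<in>?F. (1 / (1 + nu j))\<^sup>2)"
    by (rule Cauchy_Schwarz_ineq_sum)
  also have "\<dots> = real (card ?F) * (\<Sum>j\<in>?F. 1 / (1 + nu j)\<^sup>2)" by (simp add: power_divide)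
  also have "\<dots> \<le> (2 * sqrt R + 1)\<^sup>2 * (25 / 1)"
    using lat_sum_inv_sq[of ?F 1] card_nu_ball_le[OF assms] by (intro mult_mono sum_nonneg) auto
  also have "\<dots> = (5 * (2 * sqrt R + 1))\<^sup>2" by (simp only: power_mult_distrib) simp
  finally show ?thesis using assms by (simp add: power2_le_iff_abs_le abs_le_iff)
qed

lemma sum_harmonic_ge_ln:
  assumes "1 \<le> a" "a \<le> n + 1"
  shows "ln ((real n + 1) / real a) \<le> (\<Sum>c=a..n. 1 / real c)"
  using assms(2)
proof (induction n)
  case 0 thus ?case using assms(1) by simp
next
  case (Suc k)
  show ?case
  proof (cases "a \<le> k + 1")
    case True
    have "ln ((real (Suc k) + 1) / real a) = ln ((real k + 1) / real a) + ln (1 + 1 / (real k + 1))"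
    proof -
      have "(real (Suc k) + 1) / real a = ((real k + 1) / real a) * (1 + 1 / (real k + 1))"
      proof -
        have "1 + 1 / (real k + 1) = (real (Suc k) + 1) / (real k + 1)" by (simp add: field_simps)
        moreover have "real k + 1 \<noteq> 0" by linarith
        ultimately show ?thesis by simp
      qed
      moreover have "0 < (real k + 1) / real a" "0 < 1 + 1 / (real k + 1)"
        using assms(1) by (auto simp: add_pos_pos)
      ultimately show ?thesis by (metis ln_mult_pos)
    qed
    also have "ln (1 + 1 / (real k + 1)) \<le> 1 / (real k + 1)" by (rule ln_add_one_self_le_self) simp
    finally have "ln ((real (Suc k) + 1) / real a) \<le> (\<Sum>c=a..k. 1 / real c) + 1 / real (Suc k)"
      using Suc.IH[OF True] by (simp add: add.commute)
    also have "\<dots> = (\<Sum>c=a..Suc k. 1 / real c)" using True by (subst sum.nat_ivl_Suc') auto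
    finally show ?thesis .
  next
    case False
    hence "a = Suc k + 1" using Suc.prems by simp
    thus ?thesis by simp
  qed
qed

text \<open>Points \<open>(i, c)\<close> with \<open>i < c\<close> in one octant are enough. For
  \<open>c\<close> at least \<open>sqrt b\<close> the denominator is at most
  \<open>3 * m * c^2\<close>, so column \<open>c\<close> contributes at least
  \<open>1 / (3 * m * c)\<close>, and the harmonic sum gives the logarithm.\<close>

lemma lat_sum_log_ge:
  assumes m: "m \<ge> 1" and b: "b \<ge> 1 / 49" and Rb: "R / b \<ge> 16384"
  shows "ln (R / b) / (12 * m) \<le> (\<Sum>j | nu j \<le> R. 1 / (m * nu j + b))"
proof -
  have b0: "b > 0" using b by simp
  have R: "R > 0" using Rb b0 by (metis divide_le_0_iff less_le_not_le linorder_not_le not_numeral_le_zero order_trans)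
  define n where "n = nat \<lfloor>sqrt (R / 2)\<rfloor>"
  define a where "a = nat \<lceil>sqrt b\<rceil>"
  have ra: "real a = real_of_int \<lceil>sqrt b\<rceil>" using b0 by (simp add: a_def)
  have a2: "sqrt b \<le> real a" "real a \<le> sqrt b + 1"
    unfolding ra by (rule le_of_int_ceiling, rule of_int_ceiling_le_add_one)
  have "0 < real a" using a2(1) b0 by (smt (verit) real_sqrt_gt_zero)
  hence a: "1 \<le> a" "sqrt b \<le> real a" "real a \<le> sqrt b + 1" using a2 by auto
  have rn: "real n = real_of_int \<lfloor>sqrt (R / 2)\<rfloor>" using R by (simp add: n_def)
  have n: "real n \<le> sqrt (R / 2)" "sqrt (R / 2) \<le> real n + 1"
    unfolding rn by (rule of_int_floor_le, rule real_of_int_floor_add_one_ge)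
  have "sqrt (1/49) \<le> sqrt b" using b by (rule real_sqrt_le_mono)
  \<comment> \<open>The bound 1/49 turns the rounding up of \<open>sqrt b\<close> into a factor
    8.\<close>
  hence b7: "1 \<le> 7 * sqrt b" by (simp add: real_sqrt_divide)
  have a8: "real a \<le> 8 * sqrt b" using a(3) b7 by linarith
  have "8 * sqrt b \<le> sqrt (R / 2)"
  proof -
    have "(8 * sqrt b)\<^sup>2 \<le> R / 2" using Rb b0 by (simp add: power_mult_distrib field_simps)
    thus ?thesis using real_le_rsqrt by blast
  qed
  hence an: "a \<le> n + 1" using a8 n by linarith
  let ?P = "SIGMA c:{a..n}. {0..<c}"
  let ?f = "\<lambda>(c, i). (int i, int c) :: lat"
  have inj: "inj_on ?f ?P" by (auto simp: inj_on_def)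
  have sub: "?f ` ?P \<subseteq> {j. nu j \<le> R}"
  proof
    fix j assume "j \<in> ?f ` ?P"
    then obtain c i where ci: "c \<le> n" "i < c" "j = (int i, int c)" by auto
    have "(real i)\<^sup>2 \<le> (real c)\<^sup>2" "(real c)\<^sup>2 \<le> (sqrt (R / 2))\<^sup>2" using ci n(1) by (auto intro!: power_mono)
    moreover have "(sqrt (R / 2))\<^sup>2 = R / 2" using R by simp
    ultimately have "(real i)\<^sup>2 + (real c)\<^sup>2 \<le> R" by linarith
    thus "j \<in> {j. nu j \<le> R}" using ci by (simp add: nu_def)
  qed
  have "ln (R / b) / (12 * m) \<le> ln ((real n + 1) / real a) / (3 * m)"
  proof -
    \<comment> \<open>Rounding and the restriction to \<open>R / 2\<close> cost a factor 128 in
      \<open>R / b\<close>; since \<open>R / b\<close> is at least 128^2, squaring absorbs it. The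
      fourth power together with \<open>3 * m\<close> makes \<open>12 * m\<close>.\<close>
    have "R / b \<le> ((real n + 1) / real a) ^ 4"
    proof -
      have "(sqrt (R / 2) / (8 * sqrt b))\<^sup>2 = R / b / 128" using R b0 by (simp add: power_divide power_mult_distrib)
      moreover have "(sqrt (R / 2) / (8 * sqrt b)) \<le> (real n + 1) / real a"
        using n(2) a8 a(1) R b0 by (intro frac_le) auto
      hence "(sqrt (R / 2) / (8 * sqrt b))\<^sup>2 \<le> ((real n + 1) / real a)\<^sup>2" using R b0 by (intro power_mono) auto
      ultimately have h: "R / b / 128 \<le> ((real n + 1) / real a)\<^sup>2" by linarith
      have "q \<le> (q / 128)\<^sup>2" if "16384 \<le> q" for q :: real
        using mult_right_mono[OF that, of q] that by (simp add: power_divide power2_eq_square)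
      hence "R / b \<le> (R / b / 128)\<^sup>2" using Rb by blast
      also have "\<dots> \<le> (((real n + 1) / real a)\<^sup>2)\<^sup>2" using h R b0 by (intro power_mono) auto
      finally show ?thesis by (simp flip: power_mult)
    qed
    hence "ln (R / b) \<le> ln (((real n + 1) / real a) ^ 4)" using R b0 a(1) by (subst ln_le_cancel_iff) auto
    also have "\<dots> = 4 * ln ((real n + 1) / real a)" using a(1) by (subst ln_realpow) auto
    finally show ?thesis using m by (simp add: field_simps)
  qed
  also have "\<dots> \<le> (\<Sum>c=a..n. 1 / real c) / (3 * m)"
    using sum_harmonic_ge_ln[OF a(1) an] m by (intro divide_right_mono) auto
  also have "\<dots> = (\<Sum>c=a..n. \<Sum>i\<in>{0..<c}. 1 / (3 * m * (real c)\<^sup>2))"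
    using m a(1) by (simp add: sum_divide_distrib power2_eq_square) (intro sum.cong refl, auto simp: field_simps)
  also have "\<dots> = (\<Sum>p\<in>?P. 1 / (3 * m * (real (fst p))\<^sup>2))" by (subst sum.Sigma) (auto simp: case_prod_unfold)
  also have "\<dots> \<le> (\<Sum>p\<in>?P. 1 / (m * nu (?f p) + b))"
  proof (rule sum_mono)
    fix p assume "p \<in> ?P"
    then obtain c i where ci: "p = (c, i)" "a \<le> c" "i < c" by auto
    have "b = (sqrt b)\<^sup>2" using b0 by simp
    also have "\<dots> \<le> (real c)\<^sup>2" using ci a(2) b0 by (intro power_mono) auto
    also have "\<dots> \<le> m * (real c)\<^sup>2" using m by (simp add: mult_le_cancel_right1)
    finally have "b \<le> m * (real c)\<^sup>2" .
    moreover have "(real i)\<^sup>2 \<le> (real c)\<^sup>2" using ci by (intro power_mono) auto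
    hence "m * (real i)\<^sup>2 \<le> m * (real c)\<^sup>2" using m by (intro mult_left_mono) auto
    ultimately have "m * nu (?f p) + b \<le> 3 * m * (real c)\<^sup>2" using ci by (simp add: nu_def distrib_left)
    moreover have "0 < m * nu (?f p) + b" using m b0 by (intro add_nonneg_pos) auto
    ultimately show "1 / (3 * m * (real (fst p))\<^sup>2) \<le> 1 / (m * nu (?f p) + b)" using ci by (simp add: frac_le)
  qed
  also have "\<dots> = (\<Sum>j\<in>?f ` ?P. 1 / (m * nu j + b))" by (rule sum.reindex_cong[OF inj, symmetric]) auto
  also have "\<dots> \<le> (\<Sum>j | nu j \<le> R. 1 / (m * nu j + b))"
    using sub m b0 by (intro sum_mono2) (auto intro!: divide_nonneg_nonneg add_nonneg_nonneg)
  finally show ?thesis .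
qed

section \<open>Form bounds for quadratic expressions in the fermions\<close>

lemma AA_union: "finite I \<Longrightarrow> finite J \<Longrightarrow> I \<inter> J = {} \<Longrightarrow> AA (I \<union> J) x = AA I x + AA J x"
  by (simp add: AA_def sum.union_disjoint)

lemma inner_anti: "x \<in> Fin \<Longrightarrow> k \<noteq> l \<Longrightarrow> inner (ann l x) (ann k x) = - inner (cre k x) (cre l x)"
  using CAR[of x k l] by (simp add: inner_ann inner_cre)

text \<open>Cauchy-Schwarz with the weight \<open>s k\<close>: the square root of \<open>s k\<close>
  lost in bounding \<open>X k\<close> is exactly what the energy \<open>Q\<close> pays for
  \<open>Y k\<close>, so that only the number of terms remains.\<close>

lemma sum_inner_bound:
  fixes X Y :: "'i \<Rightarrow> 'a::real_inner"
  assumes M: "finite M" and s: "\<And>k. k \<in> M \<Longrightarrow> 0 \<le> s k" and a: "a \<ge> 0"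
    and X: "\<And>k. k \<in> M \<Longrightarrow> (norm (X k))\<^sup>2 \<le> a * s k * b\<^sup>2" and b: "b \<ge> 0"
    and Q: "(\<Sum>k\<in>M. s k * (norm (Y k))\<^sup>2) \<le> Q" and n: "real (card M) \<le> n"
  shows "\<bar>\<Sum>k\<in>M. inner (X k) (Y k)\<bar> \<le> sqrt (a * n) * b * sqrt Q"
proof -
  have "\<bar>\<Sum>k\<in>M. inner (X k) (Y k)\<bar> \<le> (\<Sum>k\<in>M. \<bar>inner (X k) (Y k)\<bar>)" by (rule sum_abs)
  also have "\<dots> \<le> (\<Sum>k\<in>M. sqrt a * b * (1 * (sqrt (s k) * norm (Y k))))"
  proof (rule sum_mono)
    fix k assume k: "k \<in> M"
    have "norm (X k) \<le> sqrt (a * s k * b\<^sup>2)" using X[OF k] by (simp add: real_le_rsqrt)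
    also have "\<dots> = sqrt a * sqrt (s k) * b" using b by (simp add: real_sqrt_mult)
    finally have "norm (X k) * norm (Y k) \<le> sqrt a * sqrt (s k) * b * norm (Y k)" by (intro mult_right_mono) auto
    thus "\<bar>inner (X k) (Y k)\<bar> \<le> sqrt a * b * (1 * (sqrt (s k) * norm (Y k)))"
      using Cauchy_Schwarz_ineq2[of "X k" "Y k"] by (simp add: mult_ac)
  qed
  also have "\<dots> = sqrt a * b * (\<Sum>k\<in>M. 1 * (sqrt (s k) * norm (Y k)))" by (simp add: sum_distrib_left)
  also have "\<dots> \<le> sqrt a * b * (sqrt n * sqrt Q)"
  proof (rule mult_left_mono)
    have "(\<Sum>k\<in>M. 1 * (sqrt (s k) * norm (Y k)))\<^sup>2 \<le> (\<Sum>k\<in>M. 1\<^sup>2) * (\<Sum>k\<in>M. (sqrt (s k) * norm (Y k))\<^sup>2)"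
      by (rule Cauchy_Schwarz_ineq_sum)
    also have "(\<Sum>k\<in>M. (sqrt (s k) * norm (Y k))\<^sup>2) = (\<Sum>k\<in>M. s k * (norm (Y k))\<^sup>2)"
      using s by (intro sum.cong) (auto simp: power_mult_distrib)
    also have "(\<Sum>k\<in>M. 1\<^sup>2) * \<dots> \<le> n * Q" using n Q s by (intro mult_mono sum_nonneg) auto
    finally show "(\<Sum>k\<in>M. 1 * (sqrt (s k) * norm (Y k))) \<le> sqrt n * sqrt Q"
      by (simp add: real_le_rsqrt flip: real_sqrt_mult)
  qed (use a b in auto)
  finally show ?thesis by (simp add: real_sqrt_mult mult_ac)
qed

lemma sum_inner_swap:
  fixes X :: "'i \<Rightarrow> 'a::real_inner"
  assumes "finite M" "finite J"
  shows "(\<Sum>k\<in>M. \<Sum>l\<in>J. if P k l then inner (X l) (Y k) else 0)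
    = (\<Sum>k\<in>M. inner (\<Sum>l\<in>{l\<in>J. P k l}. X l) (Y k))"
  using assms by (simp add: inner_sum_left sum.If_cases Int_def)

text \<open>Pairs of modes are ordered by their distance to the Fermi level \<open>\<mu>\<close>: the closer mode is summed
  first and controlled by the anticommutation relations, the other one pays kinetic energy.\<close>
lemma low_modes_form_bound:
  fixes eps :: "lat \<Rightarrow> real"
  assumes fin: "finite {k. eps k \<le> t}" and d: "\<delta> > 0" "\<mu> + \<delta> \<le> t" and a: "a \<ge> 0"
    and cnt: "\<And>s. \<delta> \<le> s \<Longrightarrow> finite {k. \<mu> - s \<le> eps k \<and> eps k \<le> \<mu> + s} \<and> real (card {k. \<mu> - s \<le> eps k \<and> eps k \<le> \<mu> + s}) \<le> a * s"
    and x: "x \<in> Fin" and n: "real (card {k. eps k \<le> t}) \<le> n"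
    and Q: "Q = (\<Sum>k | \<mu> < eps k \<and> eps k \<le> t. (eps k - \<mu>) * (norm (ann k x))\<^sup>2)
              + (\<Sum>k | eps k \<le> \<mu>. (\<mu> - eps k) * (norm (cre k x))\<^sup>2)"
  shows "(norm (AA {k. eps k \<le> t} x))\<^sup>2 \<le> card {k. eps k \<le> \<mu> + \<delta>} * (norm x)\<^sup>2 + 6 * (sqrt (a * n) * norm x * sqrt Q)"
proof -
  \<comment> \<open>The square of the inner part \<open>J\<close> is left to the anticommutation
    relations alone; modes in \<open>M\<close> lie far enough above \<mu> for the count
    \<open>cnt\<close> to apply.\<close>
  define J where "J = {k. eps k \<le> \<mu> + \<delta>}"
  define M where "M = {k. \<mu> + \<delta> < eps k \<and> eps k \<le> t}"
  have fJ: "finite J" unfolding J_def by (rule finite_subset[OF _ fin]) (use d in auto)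
  have fM: "finite M" unfolding M_def by (rule finite_subset[OF _ fin]) auto
  have I: "{k. eps k \<le> t} = J \<union> M" "J \<inter> M = {}" using d by (auto simp: J_def M_def)
  have fmu: "finite {k. eps k \<le> \<mu>}" and fmt: "finite {k. \<mu> < eps k \<and> eps k \<le> t}"
    by (rule finite_subset[OF _ fin]; use d in auto)+
  let ?W = "sqrt (a * n) * norm x * sqrt Q"
  have cM: "real (card M) \<le> n" 
  proof -
    have "card M \<le> card {k. eps k \<le> t}" by (intro card_mono[OF fin]) (auto simp: M_def)
    thus ?thesis using n by linarith
  qed
  have QM: "(\<Sum>k\<in>M. (eps k - \<mu>) * (norm (ann k x))\<^sup>2) \<le> Q"
  proof -
    have "(\<Sum>k\<in>M. (eps k - \<mu>) * (norm (ann k x))\<^sup>2) \<le> (\<Sum>k | \<mu> < eps k \<and> eps k \<le> t. (eps k - \<mu>) * (norm (ann k x))\<^sup>2)"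
      using d by (intro sum_mono2[OF fmt]) (auto simp: M_def)
    moreover have "0 \<le> (\<Sum>k | eps k \<le> \<mu>. (\<mu> - eps k) * (norm (cre k x))\<^sup>2)" by (intro sum_nonneg) auto
    ultimately show ?thesis unfolding Q by linarith
  qed
  have grp: "\<bar>\<Sum>k\<in>M. inner (AA (D k) x) (ann k x)\<bar> \<le> ?W"
    if D: "\<And>k. k \<in> M \<Longrightarrow> D k \<subseteq> {l. \<mu> - (eps k - \<mu>) \<le> eps l \<and> eps l \<le> \<mu> + (eps k - \<mu>)}" for D
  proof (rule sum_inner_bound[OF fM _ a _ _ QM cM])
    fix k assume k: "k \<in> M"
    hence sk: "\<delta> \<le> eps k - \<mu>" by (simp add: M_def)
    show "0 \<le> eps k - \<mu>" using sk d by simp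
    have fD: "finite (D k)" and "real (card (D k)) \<le> a * (eps k - \<mu>)"
      using cnt[OF sk] D[OF k] card_mono finite_subset by (blast, smt (verit) card_mono of_nat_le_iff)
    hence "real (card (D k)) * (norm x)\<^sup>2 \<le> a * (eps k - \<mu>) * (norm x)\<^sup>2" by (intro mult_right_mono) auto
    thus "(norm (AA (D k) x))\<^sup>2 \<le> a * (eps k - \<mu>) * (norm x)\<^sup>2"
      using norm_AA_le[OF fD x] by linarith
  qed simp
  define J' where "J' = {l. eps l < \<mu> - \<delta>}"
  have fJ': "finite J'" unfolding J'_def by (rule finite_subset[OF _ fin]) (use d in auto)
  have cJ': "real (card J') \<le> n" 
  proof -
    have "card J' \<le> card {k. eps k \<le> t}" using d by (intro card_mono[OF fin]) (auto simp: J'_def)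
    thus ?thesis using n by linarith
  qed
  have QJ': "(\<Sum>k\<in>J'. (\<mu> - eps k) * (norm (cre k x))\<^sup>2) \<le> Q"
  proof -
    have "(\<Sum>k\<in>J'. (\<mu> - eps k) * (norm (cre k x))\<^sup>2) \<le> (\<Sum>k | eps k \<le> \<mu>. (\<mu> - eps k) * (norm (cre k x))\<^sup>2)"
      using d by (intro sum_mono2[OF fmu]) (auto simp: J'_def)
    moreover have "0 \<le> (\<Sum>k | \<mu> < eps k \<and> eps k \<le> t. (eps k - \<mu>) * (norm (ann k x))\<^sup>2)" by (intro sum_nonneg) auto
    ultimately show ?thesis unfolding Q by linarith
  qed
  have grp': "\<bar>\<Sum>l\<in>J'. inner (CC (D l) x) (cre l x)\<bar> \<le> ?W"
    if D: "\<And>l. l \<in> J' \<Longrightarrow> D l \<subseteq> {k. \<mu> - (\<mu> - eps l) \<le> eps k \<and> eps k \<le> \<mu> + (\<mu> - eps l)}" for D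
  proof (rule sum_inner_bound[OF fJ' _ a _ _ QJ' cJ'])
    fix k assume k: "k \<in> J'"
    hence sk: "\<delta> \<le> \<mu> - eps k" by (simp add: J'_def)
    show "0 \<le> \<mu> - eps k" using sk d by simp
    have fD: "finite (D k)" and "real (card (D k)) \<le> a * (\<mu> - eps k)"
      using cnt[OF sk] D[OF k] card_mono finite_subset by (blast, smt (verit) card_mono of_nat_le_iff)
    hence "real (card (D k)) * (norm x)\<^sup>2 \<le> a * (\<mu> - eps k) * (norm x)\<^sup>2" by (intro mult_right_mono) auto
    thus "(norm (CC (D k) x))\<^sup>2 \<le> a * (\<mu> - eps k) * (norm x)\<^sup>2"
      using norm_CC_le[OF fD x] by linarith
  qed simp
  have MM: "(norm (AA M x))\<^sup>2 \<le> 2 * ?W"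
  proof -
    let ?g = "\<lambda>k l. inner (ann l x) (ann k x)"
    have "(norm (AA M x))\<^sup>2 = (\<Sum>k\<in>M. \<Sum>l\<in>M. ?g k l)"
      unfolding power2_norm_eq_inner AA_def inner_sum_right inner_sum_left ..
    also have "\<dots> = (\<Sum>k\<in>M. \<Sum>l\<in>M. if eps l \<le> eps k then ?g k l else 0) + (\<Sum>k\<in>M. \<Sum>l\<in>M. if eps k < eps l then ?g k l else 0)"
      unfolding sum.distrib[symmetric] by (intro sum.cong refl) auto
    also have "(\<Sum>k\<in>M. \<Sum>l\<in>M. if eps k < eps l then ?g k l else 0) = (\<Sum>k\<in>M. \<Sum>l\<in>M. if eps l < eps k then ?g k l else 0)"
      by (subst sum.swap, intro sum.cong refl) (auto simp: inner_commute)
    also have "(\<Sum>k\<in>M. \<Sum>l\<in>M. if eps l \<le> eps k then ?g k l else 0) = (\<Sum>k\<in>M. inner (AA {l\<in>M. eps l \<le> eps k} x) (ann k x))"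
      unfolding AA_def by (rule sum_inner_swap[OF fM fM])
    also have "(\<Sum>k\<in>M. \<Sum>l\<in>M. if eps l < eps k then ?g k l else 0) = (\<Sum>k\<in>M. inner (AA {l\<in>M. eps l < eps k} x) (ann k x))"
      unfolding AA_def by (rule sum_inner_swap[OF fM fM])
    finally have e: "(norm (AA M x))\<^sup>2 = (\<Sum>k\<in>M. inner (AA {l\<in>M. eps l \<le> eps k} x) (ann k x))
        + (\<Sum>k\<in>M. inner (AA {l\<in>M. eps l < eps k} x) (ann k x))" .
    have "\<bar>\<Sum>k\<in>M. inner (AA {l\<in>M. eps l \<le> eps k} x) (ann k x)\<bar> \<le> ?W"
      using d by (intro grp) (auto simp: M_def)
    moreover have "\<bar>\<Sum>k\<in>M. inner (AA {l\<in>M. eps l < eps k} x) (ann k x)\<bar> \<le> ?W"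
      using d by (intro grp) (auto simp: M_def)
    ultimately show ?thesis unfolding e by linarith
  qed
  have JM: "inner (AA J x) (AA M x) \<le> 2 * ?W"
  proof -
    let ?g = "\<lambda>k l. inner (ann l x) (ann k x)"
    have "inner (AA J x) (AA M x) = (\<Sum>k\<in>M. \<Sum>l\<in>J. ?g k l)"
      unfolding AA_def inner_sum_right inner_sum_left ..
    also have "\<dots> = (\<Sum>k\<in>M. \<Sum>l\<in>J. if \<mu> - eps l \<le> eps k - \<mu> then ?g k l else 0) + (\<Sum>k\<in>M. \<Sum>l\<in>J. if eps k - \<mu> < \<mu> - eps l then ?g k l else 0)"
      unfolding sum.distrib[symmetric] by (intro sum.cong refl) auto
    \<comment> \<open>In these pairs \<open>l\<close> lies further below \<mu> than \<open>k\<close>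
      lies above it. Anticommuting turns both annihilators into creators, and the hole energy
      \<open>\<mu> - eps l\<close> contained in \<open>Q\<close> pays for \<open>l\<close>.\<close>
    also have "(\<Sum>k\<in>M. \<Sum>l\<in>J. if eps k - \<mu> < \<mu> - eps l then ?g k l else 0) = (\<Sum>l\<in>J. \<Sum>k\<in>M. if eps k - \<mu> < \<mu> - eps l then - inner (cre k x) (cre l x) else 0)"
      using I(2) by (subst sum.swap, intro sum.cong refl if_cong inner_anti[OF x]) auto
    also have "\<dots> = (\<Sum>l\<in>J'. \<Sum>k\<in>M. if eps k - \<mu> < \<mu> - eps l then - inner (cre k x) (cre l x) else 0)"
      using d by (intro sum.mono_neutral_right[OF fJ]) (auto simp: J'_def J_def M_def intro!: sum.neutral)
    also have "\<dots> = - (\<Sum>l\<in>J'. \<Sum>k\<in>M. if eps k - \<mu> < \<mu> - eps l then inner (cre k x) (cre l x) else 0)"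
      by (simp add: sum_negf[symmetric] if_distrib cong: if_cong)
    also have "(\<Sum>l\<in>J'. \<Sum>k\<in>M. if eps k - \<mu> < \<mu> - eps l then inner (cre k x) (cre l x) else 0)
        = (\<Sum>l\<in>J'. inner (CC {k\<in>M. eps k - \<mu> < \<mu> - eps l} x) (cre l x))"
      unfolding CC_def by (rule sum_inner_swap[OF fJ' fM])
    also have "(\<Sum>k\<in>M. \<Sum>l\<in>J. if \<mu> - eps l \<le> eps k - \<mu> then ?g k l else 0) = (\<Sum>k\<in>M. inner (AA {l\<in>J. \<mu> - eps l \<le> eps k - \<mu>} x) (ann k x))"
      unfolding AA_def by (rule sum_inner_swap[OF fM fJ])
    finally have e: "inner (AA J x) (AA M x) = (\<Sum>k\<in>M. inner (AA {l\<in>J. \<mu> - eps l \<le> eps k - \<mu>} x) (ann k x))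
        + - (\<Sum>l\<in>J'. inner (CC {k\<in>M. eps k - \<mu> < \<mu> - eps l} x) (cre l x))" .
    have "\<bar>\<Sum>k\<in>M. inner (AA {l\<in>J. \<mu> - eps l \<le> eps k - \<mu>} x) (ann k x)\<bar> \<le> ?W"
      using d by (intro grp) (auto simp: M_def J_def)
    moreover have "\<bar>\<Sum>l\<in>J'. inner (CC {k\<in>M. eps k - \<mu> < \<mu> - eps l} x) (cre l x)\<bar> \<le> ?W"
      using d by (intro grp') (auto simp: M_def J'_def)
    ultimately show ?thesis unfolding e by linarith
  qed
  have "(norm (AA J x + AA M x))\<^sup>2 = (norm (AA J x))\<^sup>2 + 2 * inner (AA J x) (AA M x) + (norm (AA M x))\<^sup>2"
    by (simp add: power2_norm_eq_inner inner_add_left inner_add_right inner_commute)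
  \<comment> \<open>The factor 6 is 2 from the square of the outer part and twice 2 from the cross
    term.\<close>
  also have "\<dots> \<le> card J * (norm x)\<^sup>2 + 6 * ?W"
    using norm_AA_le[OF fJ x] MM JM by linarith
  finally show ?thesis unfolding I(1) AA_union[OF fJ fM I(2)] by (simp add: J_def)
qed

section \<open>Number operators, normal ordering and the Cauchy kernel\<close>

lemma has_sum_finite_sum:
  fixes f :: "'i \<Rightarrow> 'a \<Rightarrow> real"
  assumes "finite M" "\<And>k. k \<in> M \<Longrightarrow> (f k has_sum a k) A"
  shows "((\<lambda>x. \<Sum>k\<in>M. f k x) has_sum (\<Sum>k\<in>M. a k)) A"
  using assms by (induction M rule: finite_induct) (auto intro: has_sum_add)

lemma ann_number_has_sum:
  assumes "finite M"
  shows "((\<lambda>c. (\<Sum>k\<in>M. if k \<in> snd c then s k else 0) * (cmod (ev x c))\<^sup>2) has_sum (\<Sum>k\<in>M. s k * (norm (ann k x))\<^sup>2)) UNIV"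
proof -
  have "((\<lambda>c. (if k \<in> snd c then s k else 0) * (cmod (ev x c))\<^sup>2) has_sum (s k * (norm (ann k x))\<^sup>2)) UNIV" for k
  proof -
    have "((\<lambda>c. s k * (cmod (ev x c))\<^sup>2) has_sum (s k * (norm (ann k x))\<^sup>2)) {c. k \<in> snd c}"
      unfolding norm2_ann
      by (intro has_sum_cmult_right has_sum_infsum summable_on_subset_banach[OF ev_summable]) auto
    thus ?thesis by (rule has_sum_cong_neutral[THEN iffD1, rotated -1]) auto
  qed
  from has_sum_finite_sum[OF assms this] show ?thesis by (simp add: sum_distrib_right)
qed

lemma cre_number_has_sum:
  assumes "finite M"
  shows "((\<lambda>c. (\<Sum>k\<in>M. if k \<notin> snd c then s k else 0) * (cmod (ev x c))\<^sup>2) has_sum (\<Sum>k\<in>M. s k * (norm (cre k x))\<^sup>2)) UNIV"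
proof -
  have "((\<lambda>c. (if k \<notin> snd c then s k else 0) * (cmod (ev x c))\<^sup>2) has_sum (s k * (norm (cre k x))\<^sup>2)) UNIV" for k
  proof -
    have "((\<lambda>c. s k * (cmod (ev x c))\<^sup>2) has_sum (s k * (norm (cre k x))\<^sup>2)) {c. k \<notin> snd c}"
      unfolding norm2_cre
      by (intro has_sum_cmult_right has_sum_infsum summable_on_subset_banach[OF ev_summable]) auto
    thus ?thesis by (rule has_sum_cong_neutral[THEN iffD1, rotated -1]) auto
  qed
  from has_sum_finite_sum[OF assms this] show ?thesis by (simp add: sum_distrib_right)
qed

lemma inner_mulf_has_sum:
  assumes "y \<in> domf f"
  shows "((\<lambda>c. f c * Re (cnj (ev x c) * ev y c)) has_sum inner x (mulf f y)) UNIV"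
proof -
  have e: "Re (cnj (ev x c) * ev (mulf f y) c) = f c * Re (cnj (ev x c) * ev y c)" for c
  proof -
    have "cnj (ev x c) * ev (mulf f y) c = complex_of_real (f c) * (cnj (ev x c) * ev y c)"
      by (simp add: ev_mulf[OF assms] mult.left_commute)
    moreover have "Re (complex_of_real r * z) = r * Re z" for r z by simp
    ultimately show ?thesis by (simp only:)
  qed
  show ?thesis using inner_has_sum[of x "mulf f y"] by (simp only: e)
qed

text \<open>Pull-through: a diagonal operator passes a creation operator if its argument is shifted
  by the created mode. \<open>R1\<close> is \<open>R\<close> with \<open>l\<close> added,
  \<open>K\<close> is \<open>R1\<close> with \<open>k\<close> added; the exclusion principle removes
  configurations that already contain the mode.\<close>

lemma normal_order:
  assumes v: "v \<in> Fin" and bd: "\<And>c. \<bar>R c\<bar> \<le> B" "\<And>c. \<bar>R1 c\<bar> \<le> B" "\<And>c. \<bar>K c\<bar> \<le> B"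
    and R1: "\<And>c. l \<notin> snd c \<Longrightarrow> finite (snd c) \<Longrightarrow> R1 c = R (sh l c)"
    and K: "\<And>c. k \<notin> snd c \<Longrightarrow> finite (snd c) \<Longrightarrow> K c = R1 (sh k c)"
  shows "ann k (mulf R (cre l v)) = (if k = l then mulf R1 v else 0) - cre l (mulf K (ann k v))"
proof -
  have dom: "y \<in> domf R" "y \<in> domf R1" "y \<in> domf K" for y by (rule domf_bounded, rule bd)+
  have F: "mulf R1 v \<in> Fin" using v dom by (auto simp: Fin_def supp_in_def ev_mulf)
  have v0: "ev v c = 0" if "infinite (snd c)" for c using supp_inD[OF v[unfolded Fin_def]] that by blast
  have "mulf R (cre l v) = cre l (mulf R1 v)"
  proof (rule ell2_eqI)
    fix c show "ev (mulf R (cre l v)) c = ev (cre l (mulf R1 v)) c"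
    proof (cases "l \<in> snd c \<and> finite (snd c)")
      case True
      have "R1 (un l c) = R c" using R1[of "un l c"] sh_un[of l c] True by (simp add: un_def)
      thus ?thesis using True dom by (simp add: ev_mulf ev_cre cref_def)
    next
      case False
      hence "l \<in> snd c \<Longrightarrow> ev v (un l c) = 0" using v0[of "un l c"] by (simp add: un_def)
      thus ?thesis using False dom by (auto simp: ev_mulf ev_cre cref_def)
    qed
  qed
  moreover have "ann k (mulf R1 v) = mulf K (ann k v)"
  proof (rule ell2_eqI)
    fix c show "ev (ann k (mulf R1 v)) c = ev (mulf K (ann k v)) c"
    proof (cases "k \<notin> snd c \<and> finite (snd c)")
      case True thus ?thesis using dom K[of c] by (simp add: ev_mulf ev_ann annf_def)
    next
      case False
      hence "k \<notin> snd c \<Longrightarrow> ev v (sh k c) = 0" using v0[of "sh k c"] by (simp add: sh_def)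
      thus ?thesis using False dom by (auto simp: ev_mulf ev_ann annf_def)
    qed
  qed
  ultimately show ?thesis using CAR[OF F, of k l] by simp
qed

text \<open>The Schur complement with respect to one node is again of this form.\<close>
lemma cauchy_matrix_nonneg:
  fixes \<alpha> :: "'i \<Rightarrow> real" and z :: "'i \<Rightarrow> real"
  assumes "finite I" "\<And>k. k \<in> I \<Longrightarrow> \<alpha> k > 0"
  shows "0 \<le> (\<Sum>k\<in>I. \<Sum>l\<in>I. z k * z l / (\<alpha> k + \<alpha> l))"
  using assms
proof (induction I arbitrary: z rule: finite_induct)
  case (insert i I)
  let ?a = "\<alpha> i"
  have a: "?a > 0" and p: "\<And>k. k \<in> I \<Longrightarrow> \<alpha> k > 0" using insert.prems by auto
  define w where "w k = z k * (\<alpha> k - ?a) / (\<alpha> k + ?a)" for k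
  define S where "S = (\<Sum>k\<in>I. z k / (\<alpha> k + ?a))"
  have split: "z k * z l / (\<alpha> k + \<alpha> l) = w k * w l / (\<alpha> k + \<alpha> l) + 2 * ?a * (z k / (\<alpha> k + ?a)) * (z l / (\<alpha> l + ?a))"
    if "k \<in> I" "l \<in> I" for k l
  proof -
    define A B C where "A = \<alpha> k + ?a" and "B = \<alpha> l + ?a" and "C = \<alpha> k + \<alpha> l"
    have nz: "A \<noteq> 0" "B \<noteq> 0" "C \<noteq> 0" using p[OF that(1)] p[OF that(2)] a by (auto simp: A_def B_def C_def)
    have key: "(\<alpha> k - ?a) * (\<alpha> l - ?a) + 2 * ?a * C = A * B" by (simp add: algebra_simps A_def B_def C_def)
    have "w k * w l / C = z k * z l * ((\<alpha> k - ?a) * (\<alpha> l - ?a)) / (A * B * C)"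
      by (simp add: w_def mult_ac A_def B_def)
    moreover have "2 * ?a * (z k / A) * (z l / B) = z k * z l * (2 * ?a * C) / (A * B * C)"
      using nz by (simp add: field_simps)
    ultimately have "w k * w l / C + 2 * ?a * (z k / A) * (z l / B) = z k * z l * (A * B) / (A * B * C)"
      by (simp only: add_divide_distrib[symmetric] distrib_left[symmetric] key)
    also have "\<dots> = z k * z l / C" using nz by simp
    finally show ?thesis by (simp add: A_def B_def C_def)
  qed
  have "(\<Sum>k\<in>I. \<Sum>l\<in>I. z k * z l / (\<alpha> k + \<alpha> l)) = (\<Sum>k\<in>I. \<Sum>l\<in>I. w k * w l / (\<alpha> k + \<alpha> l)) + 2 * ?a * S\<^sup>2"
  proof -
    have "(\<Sum>k\<in>I. \<Sum>l\<in>I. z k * z l / (\<alpha> k + \<alpha> l)) = (\<Sum>k\<in>I. \<Sum>l\<in>I. w k * w l / (\<alpha> k + \<alpha> l) + 2 * ?a * (z k / (\<alpha> k + ?a)) * (z l / (\<alpha> l + ?a)))"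
      by (intro sum.cong refl split)
    also have "\<dots> = (\<Sum>k\<in>I. \<Sum>l\<in>I. w k * w l / (\<alpha> k + \<alpha> l)) + 2 * ?a * (S * S)"
      unfolding sum.distrib S_def sum_product by (simp add: sum_distrib_left mult.assoc)
    finally show ?thesis by (simp add: power2_eq_square)
  qed
  moreover have "(\<Sum>k\<in>insert i I. \<Sum>l\<in>insert i I. z k * z l / (\<alpha> k + \<alpha> l))
     = (z i)\<^sup>2 / (2 * ?a) + 2 * z i * S + (\<Sum>k\<in>I. \<Sum>l\<in>I. z k * z l / (\<alpha> k + \<alpha> l))"
  proof -
    have c: "(\<Sum>l\<in>I. z i * z l / (?a + \<alpha> l)) = z i * S" "(\<Sum>k\<in>I. z k * z i / (\<alpha> k + ?a)) = z i * S"
      unfolding S_def sum_distrib_left by (intro sum.cong refl, simp add: add.commute)+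
    show ?thesis using insert.hyps by (simp add: sum.distrib c power2_eq_square)
  qed
  moreover have "0 \<le> (\<Sum>k\<in>I. \<Sum>l\<in>I. w k * w l / (\<alpha> k + \<alpha> l))" by (rule insert.IH) (use p in auto)
  moreover have "(z i)\<^sup>2 / (2 * ?a) + 2 * z i * S + 2 * ?a * S\<^sup>2 = (z i + 2 * ?a * S)\<^sup>2 / (2 * ?a)"
    using a by (simp add: field_simps power2_eq_square)
  moreover have "0 \<le> (z i + 2 * ?a * S)\<^sup>2 / (2 * ?a)" using a by simp
  ultimately show ?case by linarith
qed simp

section \<open>Recoil estimates\<close>

definition dotl :: "real \<Rightarrow> lat \<Rightarrow> lat \<Rightarrow> real" where
  "dotl L p k = (kap L)\<^sup>2 * (real_of_int (fst p) * real_of_int (fst k) + real_of_int (snd p) * real_of_int (snd k))"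

lemma msq_nu: "msq L j = (kap L)\<^sup>2 * nu j" by (simp add: msq_def nu_def)
lemma msq_ge0 [simp]: "0 \<le> msq L j" by (simp add: msq_nu)
lemma msq_minus [simp]: "msq L (- j) = msq L j" by (simp add: msq_nu)
lemma msq_0 [simp]: "msq L 0 = 0" by (simp add: msq_nu)

lemma msq_diff: "msq L (p - k) = msq L p + msq L k - 2 * dotl L p k"
  by (simp add: msq_def dotl_def algebra_simps power2_eq_square)
lemma dotl_diff: "dotl L (p - k) l = dotl L p l - dotl L k l"
  by (simp add: dotl_def algebra_simps)
lemma dotl_minus [simp]: "dotl L p (- k) = - dotl L p k"
  by (simp add: dotl_def algebra_simps)

lemma dotl_sq_le: "(dotl L p k)\<^sup>2 \<le> msq L p * msq L k"
proof -
  have "(a * c + b * d)\<^sup>2 \<le> (a\<^sup>2 + b\<^sup>2) * (c\<^sup>2 + d\<^sup>2)" for a b c d :: real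
    using zero_le_power2[of "a * d - b * c"] by (simp add: power2_eq_square algebra_simps)
  moreover have "(K * u)\<^sup>2 \<le> (K * v) * (K * w)" if "u\<^sup>2 \<le> v * w" for K u v w :: real
    using mult_left_mono[OF that, of "K\<^sup>2"] by (simp add: power_mult_distrib power2_eq_square mult_ac)
  ultimately show ?thesis unfolding dotl_def msq_def by blast
qed

lemma dotl_abs_le: "\<bar>dotl L p k\<bar> \<le> sqrt (msq L p) * sqrt (msq L k)"
  using real_le_rsqrt[OF dotl_sq_le[of L p k]] real_sqrt_le_mono[OF dotl_sq_le[of L p k]]
  by (simp add: real_sqrt_mult)

lemma kap_pos: "L > 0 \<Longrightarrow> kap L > 0" by (simp add: kap_def)

lemma msq_ge_kap: "k \<noteq> 0 \<Longrightarrow> (kap L)\<^sup>2 \<le> msq L k"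
  using mult_left_mono[OF nu_ge1[of k], of "(kap L)\<^sup>2"] by (simp add: msq_nu)

lemma msq_ball: assumes "L > 0" shows "{j. msq L j \<le> r} = {j. nu j \<le> r / (kap L)\<^sup>2}"
  using kap_pos[OF assms] by (auto simp: msq_nu field_simps)

lemma finite_msq_ball [simp]: "L > 0 \<Longrightarrow> finite {j. msq L j \<le> r}"
  by (simp add: msq_ball)

lemma finite_ball_lat [simp]: "L > 0 \<Longrightarrow> finite (ball_lat L r)"
  by (simp add: ball_lat_def)

lemma msq_sum_inv_sq:
  assumes L: "L > 0" and F: "finite F" and B: "B \<ge> (kap L)\<^sup>2"
  shows "(\<Sum>j\<in>F. 1 / (B + msq L j)\<^sup>2) \<le> 25 / ((kap L)\<^sup>2 * B)"
proof -
  let ?k = "(kap L)\<^sup>2"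
  have k: "?k > 0" using kap_pos[OF L] by simp
  have "1 / (B + msq L j)\<^sup>2 = 1 / ?k\<^sup>2 * (1 / (B / ?k + nu j)\<^sup>2)" for j
  proof -
    have "B + msq L j = ?k * (B / ?k + nu j)" using kap_pos[OF L] by (simp add: msq_nu distrib_left)
    thus ?thesis by (simp add: power_mult_distrib)
  qed
  hence "(\<Sum>j\<in>F. 1 / (B + msq L j)\<^sup>2) = 1 / ?k\<^sup>2 * (\<Sum>j\<in>F. 1 / (B / ?k + nu j)\<^sup>2)"
    by (simp add: sum_distrib_left)
  also have "\<dots> \<le> 1 / ?k\<^sup>2 * (25 / (B / ?k))"
    using k B by (intro mult_left_mono lat_sum_inv_sq[OF F]) auto
  also have "\<dots> = 25 / (?k * B)" using k B by (simp add: power2_eq_square)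
  finally show ?thesis .
qed

text \<open>Recoil estimate for the pair of momenta \<open>k\<close>, \<open>-k\<close>: the error term is summable over the lattice.\<close>
lemma recoil_pair_bound:
  fixes M X \<tau> P b \<theta> :: real
  assumes M: "M \<ge> 1" and X: "X \<ge> 0" "\<theta> * X \<le> X + \<tau>" "X + \<tau> > 0" and th: "0 < \<theta>" and P: "P \<ge> 0"
    and b: "b\<^sup>2 \<le> P * X"
  shows "1 / ((P + X - 2 * b) / M + X + \<tau>) + 1 / ((P + X + 2 * b) / M + X + \<tau>)
     \<le> 2 / ((1 + 1 / M) * X + \<tau>) + 200 / \<theta>^3 * (P / (P + X)\<^sup>2)"
proof -
  \<comment> \<open>\<open>\<alpha>\<close> is the denominator without total momentum,
    \<open>p\<close> the quadratic shift and \<open>c\<close> the linear one, whose sign differs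
    between the two momenta; so the pair sums to 2 a / (a^2 - c^2).\<close>
  define \<alpha> p c where "\<alpha> = (1 + 1 / M) * X + \<tau>" and "p = P / M" and "c = 2 * b / M"
  define a where "a = \<alpha> + p"
  have M0: "M > 0" using M by simp
  have p0: "p \<ge> 0" using P M0 by (simp add: p_def)
  have XM: "X / M \<ge> 0" using X M0 by simp
  have al: "\<alpha> \<ge> X + \<tau>" "\<alpha> > 0" using X XM by (auto simp: \<alpha>_def distrib_right)
  have sq: "P + X - 2 * b \<ge> 0" "P + X + 2 * b \<ge> 0"
  proof -
    have "\<bar>2 * b\<bar> \<le> P + X"
    proof -
      have "(2 * b)\<^sup>2 \<le> 4 * (P * X)" using b by (simp add: power_mult_distrib)
      also have "\<dots> \<le> (P + X)\<^sup>2" using zero_le_power2[of "P - X"] by (simp add: power2_eq_square algebra_simps)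
      finally have "\<bar>2 * b\<bar> \<le> \<bar>P + X\<bar>" using abs_le_square_iff by blast
      thus ?thesis using P X by simp
    qed
    thus "P + X - 2 * b \<ge> 0" "P + X + 2 * b \<ge> 0" by linarith+
  qed
  have e1: "(P + X - 2 * b) / M + X + \<tau> = a - c" and e2: "(P + X + 2 * b) / M + X + \<tau> = a + c"
    using M0 by (simp_all add: a_def \<alpha>_def p_def c_def field_simps)
  have g1: "a - c \<ge> X + \<tau>" "a + c \<ge> X + \<tau>" using sq M0 e1 e2 by (smt (verit) divide_nonneg_pos)+
  have pos: "a - c > 0" "a + c > 0" using g1 X by auto
  have c2: "c\<^sup>2 \<le> 4 * p * X / M"
  proof -
    have "c\<^sup>2 = 4 * b\<^sup>2 / M\<^sup>2" by (simp add: c_def power_divide power_mult_distrib)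
    also have "\<dots> \<le> 4 * (P * X) / M\<^sup>2" using b by (intro divide_right_mono) auto
    finally show ?thesis using M0 by (simp add: p_def power2_eq_square)
  qed
  have S: "1 / (a - c) + 1 / (a + c) = 2 * a / ((a - c) * (a + c))" using pos by (simp add: field_simps)
  show ?thesis
  \<comment> \<open>For large \<open>P\<close> the quadratic shift beats the linear one and there is
    no error at all. Otherwise \<open>P + X\<close> is comparable to \<open>X\<close>, and the bound
    \<open>\<theta> * X\<close> on the denominators gives an error of order
    \<open>P / X^2\<close>.\<close>
  proof (cases "P \<ge> 4 * X")
    case True
    have "4 * X / M \<le> p" using True M0 by (simp add: p_def divide_right_mono)
    hence "p * (4 * X / M) \<le> p * p" using p0 by (rule mult_left_mono)
    hence "c\<^sup>2 \<le> p * a" using c2 p0 al by (simp add: a_def algebra_simps) (smt (verit) mult_nonneg_nonneg)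
    hence "\<alpha> * a \<le> (a - c) * (a + c)" by (simp add: a_def algebra_simps power2_eq_square)
    hence "2 * a / ((a - c) * (a + c)) \<le> 2 * a / (\<alpha> * a)"
      using al p0 pos by (intro divide_left_mono mult_pos_pos) (auto simp: a_def add_pos_nonneg)
    also have "\<dots> = 2 / \<alpha>" using pos by simp
    finally have "2 * a / ((a - c) * (a + c)) \<le> 2 / \<alpha>" .
    moreover have "0 \<le> 200 / \<theta>^3 * (P / (P + X)\<^sup>2)" using th P by simp
    ultimately show ?thesis unfolding e1 e2 S by (simp add: \<alpha>_def)
  next
    case False
    hence PX: "P < 4 * X" and X0: "X > 0" using P by auto
    have "2 * a / ((a - c) * (a + c)) - 2 / \<alpha> = 2 * (c\<^sup>2 - p * a) / (\<alpha> * ((a - c) * (a + c)))"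
      using pos al by (simp add: divide_simps) (simp add: a_def algebra_simps power2_eq_square)
    also have "\<dots> \<le> 2 * (4 * p * X / M) / (\<alpha> * ((a - c) * (a + c)))"
    proof (rule divide_right_mono)
      have diff_le_mono_nonneg: "u - v \<le> w" if "0 \<le> v" "u \<le> w" for u v w :: real using that by simp
      have "0 \<le> p * a" using p0 al by (simp add: a_def)
      hence "c\<^sup>2 - p * a \<le> 4 * p * X / M" using c2 by (rule diff_le_mono_nonneg)
      thus "2 * (c\<^sup>2 - p * a) \<le> 2 * (4 * p * X / M)" by (intro mult_left_mono) auto
      show "0 \<le> \<alpha> * ((a - c) * (a + c))" using al pos by simp
    qed
    also have "\<dots> \<le> 2 * (4 * p * X / M) / ((\<theta> * X) * ((\<theta> * X) * (\<theta> * X)))"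
      using g1 al X0 th X p0 M0 pos by (intro divide_left_mono mult_mono mult_pos_pos mult_nonneg_nonneg) (auto intro: order_trans)
    also have "\<dots> = 8 / \<theta>^3 * (P / M\<^sup>2 / X\<^sup>2)"
      using X0 th M0 by (simp add: p_def power3_eq_cube power2_eq_square)
    also have "\<dots> \<le> 8 / \<theta>^3 * (25 * (P / (P + X)\<^sup>2))"
    proof (intro mult_left_mono)
      have "(P + X)\<^sup>2 \<le> (5 * X)\<^sup>2" using PX P X0 by (intro power_mono) auto
      hence "P / (25 * X\<^sup>2) \<le> P / (P + X)\<^sup>2"
        using P X0 by (intro divide_left_mono mult_pos_pos zero_less_power) (auto simp: power_mult_distrib)
      moreover have "P / M\<^sup>2 / X\<^sup>2 \<le> P / X\<^sup>2"
        using P M M0 X0 by (intro divide_right_mono) (auto simp: divide_le_eq mult_le_cancel_left1)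
      ultimately show "P / M\<^sup>2 / X\<^sup>2 \<le> 25 * (P / (P + X)\<^sup>2)" by simp
    qed (use th in auto)
    finally show ?thesis unfolding e1 e2 S by (simp add: \<alpha>_def)
  qed
qed

text \<open>Averaging over \<open>k\<close> and \<open>- k\<close> removes the linear recoil term.
  The remaining error carries a factor \<open>msq L p\<close>, which the decay in
  \<open>msq_sum_inv_sq\<close> cancels, so the bound is uniform in \<open>p\<close>; half of 200
  times 25 is 2500.\<close>

lemma recoil_sum_bound:
  assumes L: "L > 0" and M: "M \<ge> 1" and F: "finite F" and sym: "\<And>k. k \<in> F \<Longrightarrow> - k \<in> F"
    and th: "0 < \<theta>" and t: "\<And>k. k \<in> F \<Longrightarrow> \<theta> * msq L k \<le> msq L k + \<tau> \<and> msq L k + \<tau> > 0"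
  shows "(\<Sum>k\<in>F. 1 / (msq L (p - k) / M + msq L k + \<tau>))
    \<le> (\<Sum>k\<in>F. 1 / (mred M * msq L k + \<tau>)) + 2500 / (\<theta>^3 * (kap L)\<^sup>2)"
proof -
  let ?f = "\<lambda>k. 1 / (msq L (p - k) / M + msq L k + \<tau>)"
  have k: "(kap L)\<^sup>2 > 0" using kap_pos[OF L] by simp
  have "bij_betw uminus F F" by (rule bij_betw_byWitness[of _ uminus]) (use sym in auto)
  hence "(\<Sum>k\<in>F. ?f (- k)) = (\<Sum>k\<in>F. ?f k)" by (rule sum.reindex_bij_betw)
  hence "2 * (\<Sum>k\<in>F. ?f k) = (\<Sum>k\<in>F. ?f k + ?f (- k))" by (simp add: sum.distrib)
  also have "\<dots> \<le> (\<Sum>k\<in>F. 2 / (mred M * msq L k + \<tau>) + 200 / \<theta>^3 * (msq L p / (msq L p + msq L k)\<^sup>2))"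
  proof (rule sum_mono)
    fix k assume "k \<in> F"
    from recoil_pair_bound[OF M msq_ge0 _ _ th msq_ge0 dotl_sq_le[of L p k], of \<tau>] t[OF this]
    show "?f k + ?f (- k) \<le> 2 / (mred M * msq L k + \<tau>) + 200 / \<theta>^3 * (msq L p / (msq L p + msq L k)\<^sup>2)"
      using msq_diff[of L p "- k"] by (simp add: msq_diff mred_def)
  qed
  also have "\<dots> = 2 * (\<Sum>k\<in>F. 1 / (mred M * msq L k + \<tau>)) + 200 / \<theta>^3 * (msq L p * (\<Sum>k\<in>F. 1 / (msq L p + msq L k)\<^sup>2))"
    by (simp add: sum.distrib sum_distrib_left)
  also have "msq L p * (\<Sum>k\<in>F. 1 / (msq L p + msq L k)\<^sup>2) \<le> 25 / (kap L)\<^sup>2"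
  proof (cases "p = 0")
    case False
    have kp: "(kap L)\<^sup>2 \<le> msq L p" by (rule msq_ge_kap[OF False])
    hence "msq L p * (\<Sum>k\<in>F. 1 / (msq L p + msq L k)\<^sup>2) \<le> msq L p * (25 / ((kap L)\<^sup>2 * msq L p))"
      by (intro mult_left_mono msq_sum_inv_sq[OF L F]) auto
    thus ?thesis using kp k by simp
  qed simp
  hence "200 / \<theta>^3 * (msq L p * (\<Sum>k\<in>F. 1 / (msq L p + msq L k)\<^sup>2)) \<le> 200 / \<theta>^3 * (25 / (kap L)\<^sup>2)"
    using th by (intro mult_left_mono) auto
  finally show ?thesis by simp
qed

text \<open>Without the mixed term \<open>2 * dotl L k l / M\<close> the denominator is
  \<open>al k + al l\<close>, a nonnegative Cauchy kernel once the nodes are positive. The mixed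
  term is bounded through \<open>msq L k\<close> and \<open>msq L l\<close>, and the lattice sum
  makes its cost of order \<open>1 / (kap L)^2\<close>.\<close>

lemma recoil_kernel_lower:
  fixes z :: "lat \<Rightarrow> real"
  assumes L: "L > 0" and M: "M > 1.225" and H: "finite H" and h: "h \<ge> 0"
    and Hm: "\<And>k. k \<in> H \<Longrightarrow> 10 * \<mu> < msq L k" and mu: "\<mu> > 0"
  shows "- (700 / (kap L)\<^sup>2) * (\<Sum>k\<in>H. msq L k / (h + msq L k) * (z k)\<^sup>2)
    \<le> (\<Sum>k\<in>H. \<Sum>l\<in>H. 1 / (h + (msq L k - \<mu>) + (msq L l - \<mu>) + msq L (P - k - l) / M) * (z k * z l))"
proof -
  have M0: "M > 0" "M \<ge> 1" using M by auto
  define al where "al k = h / 2 + (msq L k - \<mu>) + (msq L P / 2 - 2 * dotl L P k + msq L k) / M" for k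
  define dn where "dn k l = h + (msq L k - \<mu>) + (msq L l - \<mu>) + msq L (P - k - l) / M" for k l
  have dn: "dn k l = al k + al l + 2 * dotl L k l / M" for k l
  proof -
    have "msq L (P - k - l) = msq L P + msq L k + msq L l - 2 * dotl L P k - 2 * dotl L P l + 2 * dotl L k l"
      by (simp add: msq_diff dotl_diff)
    thus ?thesis unfolding dn_def al_def by (simp add: add_divide_distrib diff_divide_distrib)
  qed
  \<comment> \<open>This is where 1.225 enters: \<open>msq L k - \<mu>\<close> is at least 9/10 of
    \<open>msq L k\<close>, recoil takes away at most \<open>msq L k / M\<close>, and 9/10 -
    2041/2500 exceeds 2/25.\<close>
  have Mi: "1 / M \<le> (2041/2500)" using M by (simp add: divide_le_eq)
  have al0: "h / 2 + (2/25) * msq L k \<le> al k" if "k \<in> H" for k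
  proof -
    have d: "2 * dotl L P k \<le> msq L P / 2 + 2 * msq L k"
    proof -
      have "\<bar>2 * dotl L P k\<bar> \<le> 2 * (sqrt (msq L P) * sqrt (msq L k))" using dotl_abs_le[of L P k] by simp
      also have "\<dots> \<le> msq L P / 2 + 2 * msq L k"
        using sum_squares_bound[of "sqrt (msq L P) / 2" "sqrt (msq L k)"] by (simp add: power_divide)
      finally show ?thesis by linarith
    qed
    hence "- msq L k / M \<le> (msq L P / 2 - 2 * dotl L P k + msq L k) / M" using M0 by (intro divide_right_mono) auto
    hence "- (msq L k / M) \<le> (msq L P / 2 - 2 * dotl L P k + msq L k) / M" by simp
    moreover have "msq L k / M \<le> (2041/2500) * msq L k" using mult_right_mono[OF Mi msq_ge0[of L k]] by simp
    moreover have lin: "h / 2 + (2/25) * X \<le> h / 2 + (X - \<mu>) + G" if "- u \<le> G" "u \<le> (2041/2500) * X" "10 * \<mu> < X" "0 \<le> X" for X u G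
      using that by simp
    ultimately show ?thesis unfolding al_def by (intro lin[of "msq L k / M"] Hm[OF that] msq_ge0)
  qed
  have alp: "al k > 0" if "k \<in> H" for k using al0[OF that] Hm[OF that] mu h by linarith
  have dnl: "(9/10) * (h + msq L k + msq L l) \<le> dn k l" if "k \<in> H" "l \<in> H" for k l
  proof -
    have "0 \<le> msq L (P - k - l) / M" using M0 by simp
    moreover have lin: "(9/10) * (h + X + Y) \<le> h + (X - \<mu>) + (Y - \<mu>) + u" if "0 \<le> u" "10 * \<mu> < X" "10 * \<mu> < Y" for X Y u
      using that h by argo
    ultimately show ?thesis unfolding dn_def by (intro lin Hm that)
  qed
  have all: "(2/25) * (h + msq L k + msq L l) \<le> al k + al l" if "k \<in> H" "l \<in> H" for k l
  proof -
    have lin: "(2/25) * (h + X + Y) \<le> a + b" if "h / 2 + (2/25) * X \<le> a" "h / 2 + (2/25) * Y \<le> b" for X Y a b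
      using that h by argo
    show ?thesis by (rule lin[OF al0[OF that(1)] al0[OF that(2)]])
  qed
  have Y: "0 < h + msq L k + msq L l" if "k \<in> H" "l \<in> H" for k l
    using Hm[OF that(1)] Hm[OF that(2)] mu h by linarith
  have tm: "z k * z l / (al k + al l) - 14 * ((msq L k * (z k)\<^sup>2 + msq L l * (z l)\<^sup>2) / (h + msq L k + msq L l)\<^sup>2)
      \<le> 1 / dn k l * (z k * z l)" if kl: "k \<in> H" "l \<in> H" for k l
  proof -
    let ?Y = "h + msq L k + msq L l"
    have p1: "al k + al l > 0" using alp kl by (simp add: add_pos_pos)
    have p2: "dn k l > 0" by (rule less_le_trans[OF _ dnl[OF kl]]) (use Y[OF kl] in simp)
    have "z k * z l / (al k + al l) - 1 / dn k l * (z k * z l) = (2 * dotl L k l / M) * (z k * z l) / ((al k + al l) * dn k l)"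
    proof -
      have "dn k l - (al k + al l) = 2 * dotl L k l / M" by (simp add: dn)
      moreover have "z k * z l / (al k + al l) - 1 / dn k l * (z k * z l) = (dn k l - (al k + al l)) * (z k * z l) / ((al k + al l) * dn k l)"
        using p1 p2 by (simp add: field_simps)
      ultimately show ?thesis by simp
    qed
    also have "\<dots> \<le> \<bar>(2 * dotl L k l / M) * (z k * z l)\<bar> / ((al k + al l) * dn k l)"
      by (rule divide_right_mono[OF abs_ge_self]) (use p1 p2 in auto)
    also have "\<dots> \<le> (msq L k * (z k)\<^sup>2 + msq L l * (z l)\<^sup>2) / ((al k + al l) * dn k l)"
    proof (intro divide_right_mono)
      have "\<bar>(2 * dotl L k l / M) * (z k * z l)\<bar> = 2 * \<bar>dotl L k l\<bar> * (\<bar>z k\<bar> * \<bar>z l\<bar>) / M"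
        using M0 by (simp add: abs_mult)
      also have "\<dots> \<le> 2 * \<bar>dotl L k l\<bar> * (\<bar>z k\<bar> * \<bar>z l\<bar>) / 1"
        using M0 by (intro divide_left_mono) auto
      also have "\<dots> \<le> 2 * (sqrt (msq L k) * sqrt (msq L l)) * (\<bar>z k\<bar> * \<bar>z l\<bar>)"
        using dotl_abs_le[of L k l] by (simp add: mult_right_mono)
      also have "\<dots> = 2 * (sqrt (msq L k) * \<bar>z k\<bar>) * (sqrt (msq L l) * \<bar>z l\<bar>)" by simp
      also have "\<dots> \<le> (sqrt (msq L k) * \<bar>z k\<bar>)\<^sup>2 + (sqrt (msq L l) * \<bar>z l\<bar>)\<^sup>2" by (rule sum_squares_bound)
      finally show "\<bar>(2 * dotl L k l / M) * (z k * z l)\<bar> \<le> msq L k * (z k)\<^sup>2 + msq L l * (z l)\<^sup>2"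
        by (simp add: power_mult_distrib)
    qed (use p1 p2 in auto)
    also have "\<dots> \<le> (msq L k * (z k)\<^sup>2 + msq L l * (z l)\<^sup>2) / (((2/25) * ?Y) * ((9/10) * ?Y))"
      using all[OF kl] dnl[OF kl] Y[OF kl] p1 p2 h alp[OF kl(1)] alp[OF kl(2)] by (intro divide_left_mono mult_mono add_nonneg_nonneg mult_nonneg_nonneg mult_pos_pos) auto
    also have "\<dots> = (msq L k * (z k)\<^sup>2 + msq L l * (z l)\<^sup>2) / ?Y\<^sup>2 / (9/125)"
    proof -
      have "A / (((2/25) * Y) * ((9/10) * Y)) = A / Y\<^sup>2 / (9/125)" for A Y :: real by (simp add: power2_eq_square)
      thus ?thesis .
    qed
    \<comment> \<open>The product of the two denominator constants is 9/125, whose inverse is just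
      below 14; with the 50 of \<open>sums\<close> this makes 700.\<close>
    also have "\<dots> \<le> 14 * ((msq L k * (z k)\<^sup>2 + msq L l * (z l)\<^sup>2) / ?Y\<^sup>2)"
    proof -
      have q: "A / (9/125) \<le> 14 * A" if "0 \<le> A" for A :: real using that by simp
      show ?thesis by (rule q) simp
    qed
    finally show ?thesis by linarith
  qed
  have sums: "(\<Sum>k\<in>H. \<Sum>l\<in>H. (msq L k * (z k)\<^sup>2 + msq L l * (z l)\<^sup>2) / (h + msq L k + msq L l)\<^sup>2)
      \<le> 50 / (kap L)\<^sup>2 * (\<Sum>k\<in>H. msq L k / (h + msq L k) * (z k)\<^sup>2)"
  proof -
    let ?g = "\<lambda>k l. msq L k * (z k)\<^sup>2 / (h + msq L k + msq L l)\<^sup>2"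
    have "(\<Sum>k\<in>H. \<Sum>l\<in>H. (msq L k * (z k)\<^sup>2 + msq L l * (z l)\<^sup>2) / (h + msq L k + msq L l)\<^sup>2)
      = (\<Sum>k\<in>H. \<Sum>l\<in>H. ?g k l) + (\<Sum>k\<in>H. \<Sum>l\<in>H. ?g l k)"
      unfolding sum.distrib[symmetric] add_divide_distrib by (intro sum.cong refl) (simp add: add_ac)
    also have "(\<Sum>k\<in>H. \<Sum>l\<in>H. ?g l k) = (\<Sum>k\<in>H. \<Sum>l\<in>H. ?g k l)" by (rule sum.swap)
    also have "(\<Sum>k\<in>H. \<Sum>l\<in>H. ?g k l) + (\<Sum>k\<in>H. \<Sum>l\<in>H. ?g k l) = 2 * (\<Sum>k\<in>H. msq L k * (z k)\<^sup>2 * (\<Sum>l\<in>H. 1 / (h + msq L k + msq L l)\<^sup>2))"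
      by (simp add: sum_distrib_left)
    also have "\<dots> \<le> 2 * (\<Sum>k\<in>H. msq L k * (z k)\<^sup>2 * (25 / ((kap L)\<^sup>2 * (h + msq L k))))"
    proof (intro mult_left_mono sum_mono)
      fix k assume k: "k \<in> H"
      have "k \<noteq> 0" using Hm[OF k] mu by auto
      hence "(kap L)\<^sup>2 \<le> h + msq L k" using msq_ge_kap[of k L] h by linarith
      thus "(\<Sum>l\<in>H. 1 / (h + msq L k + msq L l)\<^sup>2) \<le> 25 / ((kap L)\<^sup>2 * (h + msq L k))"
        by (rule msq_sum_inv_sq[OF L H])
    qed auto
    finally show ?thesis by (simp add: sum_distrib_left mult_ac)
  qed
  have "(\<Sum>k\<in>H. \<Sum>l\<in>H. z k * z l / (al k + al l)) - 14 * (\<Sum>k\<in>H. \<Sum>l\<in>H. (msq L k * (z k)\<^sup>2 + msq L l * (z l)\<^sup>2) / (h + msq L k + msq L l)\<^sup>2)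
    \<le> (\<Sum>k\<in>H. \<Sum>l\<in>H. 1 / dn k l * (z k * z l))"
    unfolding sum_distrib_left sum_subtractf[symmetric] by (intro sum_mono tm)
  moreover have "0 \<le> (\<Sum>k\<in>H. \<Sum>l\<in>H. z k * z l / (al k + al l))"
    by (rule cauchy_matrix_nonneg[OF H alp])
  ultimately show ?thesis using sums unfolding dn_def by simp
qed

lemma mred_msq_pos: "M > 0 \<Longrightarrow> EB < 0 \<Longrightarrow> 0 < mred M * msq L k - EB"
proof -
  assume "M > 0" "EB < 0"
  hence "0 \<le> mred M * msq L k" by (simp add: mred_def)
  thus ?thesis using \<open>EB < 0\<close> by linarith
qed

lemma domf_csub: "csub (domf f)"
  unfolding csub_def
proof (intro conjI ballI allI)
  show "0 \<in> domf f" by (rule domf_bounded) auto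
  fix x assume x: "x \<in> domf f"
  show "cs a x \<in> domf f" for a
    using x summable_on_cmult_right[of "\<lambda>c. (cmod (complex_of_real (f c) * ev x c))\<^sup>2" UNIV "(cmod a)\<^sup>2"]
    by (simp add: domf_def norm_mult power_mult_distrib mult.left_commute)
  show "x + y \<in> domf f" if "y \<in> domf f" for y
    using x that summable_on_cmod2_add[of "\<lambda>c. complex_of_real (f c) * ev x c" UNIV "\<lambda>c. complex_of_real (f c) * ev y c"]
    by (simp add: domf_def distrib_left)
qed

lemma mulf_add: "x \<in> domf f \<Longrightarrow> y \<in> domf f \<Longrightarrow> mulf f (x + y) = mulf f x + mulf f y"
  using csubD(2)[OF domf_csub, of x f y] by (intro ell2_eqI) (simp add: ev_mulf distrib_left)

lemma mulf_0: "mulf f 0 = 0"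
  by (rule ell2_eqI) (subst ev_mulf, rule domf_bounded, auto)

lemma mulf_sum: "(\<And>i. i \<in> I \<Longrightarrow> x i \<in> domf f) \<Longrightarrow> mulf f (\<Sum>i\<in>I. x i) = (\<Sum>i\<in>I. mulf f (x i))"
proof (induction I rule: infinite_finite_induct)
  case (insert i I)
  have "(\<Sum>i\<in>I. x i) \<in> domf f" using insert.prems by (intro csub_sum domf_csub) auto
  thus ?case using insert by (simp add: mulf_add)
qed (auto simp: mulf_0)

text \<open>The diagonal of the anticommutator yields a multiplication operator, the part that will
  diverge with the cut-off. What is left annihilates first and is governed by the kernel
  \<open>K\<close>.\<close>

lemma inner_CC_mulf_CC:
  assumes v: "v \<in> Fin" and H: "finite H" and bd: "\<And>c. \<bar>R c\<bar> \<le> B" "\<And>k c. k \<in> H \<Longrightarrow> \<bar>R1 k c\<bar> \<le> B"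
      "\<And>k l c. k \<in> H \<Longrightarrow> l \<in> H \<Longrightarrow> \<bar>K k l c\<bar> \<le> B"
    and R1: "\<And>l c. l \<in> H \<Longrightarrow> l \<notin> snd c \<Longrightarrow> finite (snd c) \<Longrightarrow> R1 l c = R (sh l c)"
    and K: "\<And>k l c. k \<in> H \<Longrightarrow> l \<in> H \<Longrightarrow> k \<notin> snd c \<Longrightarrow> finite (snd c) \<Longrightarrow> K k l c = R1 l (sh k c)"
  shows "inner (CC H v) (mulf R (CC H v)) = (\<Sum>k\<in>H. inner v (mulf (R1 k) v)) - (\<Sum>k\<in>H. \<Sum>l\<in>H. inner (ann l v) (mulf (K k l) (ann k v)))"
    and "AA H (mulf R (CC H v)) = (\<Sum>k\<in>H. mulf (R1 k) v) - (\<Sum>k\<in>H. \<Sum>l\<in>H. cre l (mulf (K k l) (ann k v)))"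
proof -
  have dom: "y \<in> domf R" for y by (rule domf_bounded, rule bd)
  have no: "ann k (mulf R (cre l v)) = (if k = l then mulf (R1 l) v else 0) - cre l (mulf (K k l) (ann k v))"
    if "k \<in> H" "l \<in> H" for k l
    by (rule normal_order[where R = R and ?R1.0 = "R1 l" and K = "K k l" and B = B], rule v, rule bd(1),
      rule bd(2)[OF that(2)], rule bd(3)[OF that], erule (1) R1[OF that(2)], erule (1) K[OF that])
  have "AA H (mulf R (CC H v)) = (\<Sum>k\<in>H. \<Sum>l\<in>H. ann k (mulf R (cre l v)))"
    unfolding AA_def CC_def by (simp add: mulf_sum dom ann_sum)
  also have "\<dots> = (\<Sum>k\<in>H. \<Sum>l\<in>H. (if k = l then mulf (R1 l) v else 0) - cre l (mulf (K k l) (ann k v)))"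
    by (intro sum.cong refl no)
  also have "\<dots> = (\<Sum>k\<in>H. mulf (R1 k) v) - (\<Sum>k\<in>H. \<Sum>l\<in>H. cre l (mulf (K k l) (ann k v)))"
    using H by (simp add: sum_subtractf)
  finally show A: "AA H (mulf R (CC H v)) = (\<Sum>k\<in>H. mulf (R1 k) v) - (\<Sum>k\<in>H. \<Sum>l\<in>H. cre l (mulf (K k l) (ann k v)))" .
  show "inner (CC H v) (mulf R (CC H v)) = (\<Sum>k\<in>H. inner v (mulf (R1 k) v)) - (\<Sum>k\<in>H. \<Sum>l\<in>H. inner (ann l v) (mulf (K k l) (ann k v)))"
    unfolding inner_CC A by (simp add: inner_diff_right inner_sum_right inner_ann)
qed

section \<open>High modes: the dual bound and the form bound\<close>

definition thi :: "real \<Rightarrow> real \<Rightarrow> cfg \<Rightarrow> real" where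
  "thi L \<mu> c = (\<Sum>k | k \<in> snd c \<and> 10 * \<mu> < msq L k. msq L k - \<mu>)"

lemma thi_ge0: "\<mu> > 0 \<Longrightarrow> 0 \<le> thi L \<mu> c"
  unfolding thi_def by (rule sum_nonneg) auto

lemma thi_sh:
  assumes "finite (snd c)" "k \<notin> snd c" "10 * \<mu> < msq L k"
  shows "thi L \<mu> (sh k c) = thi L \<mu> c + (msq L k - \<mu>)"
proof -
  have "{j. j \<in> snd (sh k c) \<and> 10 * \<mu> < msq L j} = insert k {j. j \<in> snd c \<and> 10 * \<mu> < msq L j}"
    using assms by (auto simp: sh_def)
  thus ?thesis unfolding thi_def using assms by simp
qed

lemma thi_ge_member: "\<mu> > 0 \<Longrightarrow> finite (snd c) \<Longrightarrow> k \<in> snd c \<Longrightarrow> 10 * \<mu> < msq L k \<Longrightarrow> msq L k - \<mu> \<le> thi L \<mu> c"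
  unfolding thi_def by (rule member_le_sum) auto

text \<open>Birman-Schwinger side of the high-mode estimate. The divergent sum keeps the constant
  one, because the reciprocal coupling contains the same sum. The errors come from the recoil in the
  diagonal part and from the deficit of the Cauchy kernel in the remainder; 4000 and 7000/9 add up
  to less than 5000.\<close>

lemma hi_modes_dual_bound:
  assumes L: "L > 0" and M: "M > 1.225" and mu: "\<mu> > 0" and km: "(kap L)\<^sup>2 \<le> 10 * \<mu>"
    and EB: "EB < 0" "\<bar>EB\<bar> \<le> \<mu>"
    and Hf: "finite H" and H: "\<And>k. k \<in> H \<Longrightarrow> 10 * \<mu> < msq L k" and sym: "\<And>k. k \<in> H \<Longrightarrow> - k \<in> H"
    and v: "v \<in> Fin"
    and R: "R = (\<lambda>c. if finite (snd c) \<and> (\<exists>k\<in>snd c. 10 * \<mu> < msq L k) then 1 / (thi L \<mu> c + msq L (fst c) / M) else 0)"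
  shows "inner (CC H v) (mulf R (CC H v)) \<le> ((\<Sum>k\<in>H. 1 / (mred M * msq L k - EB)) + 5000 / (kap L)\<^sup>2) * (norm v)\<^sup>2"
proof -
  have M0: "M \<ge> 1" "M > 0" using M by auto
  let ?k = "(kap L)\<^sup>2"
  have k0: "?k > 0" using kap_pos[OF L] by simp
  define R1 where "R1 k c = 1 / (thi L \<mu> c + (msq L k - \<mu>) + msq L (fst c - k) / M)" for k c
  define K where "K k l c = 1 / (thi L \<mu> c + (msq L k - \<mu>) + (msq L l - \<mu>) + msq L (fst c - k - l) / M)" for k l c
  have t0: "0 \<le> thi L \<mu> c" for c by (rule thi_ge0[OF mu])
  have P0: "0 \<le> msq L p / M" for p using M0 by simp
  have Rb: "\<bar>R c\<bar> \<le> 1 / (9 * \<mu>)" for c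
  proof (cases "finite (snd c) \<and> (\<exists>k\<in>snd c. 10 * \<mu> < msq L k)")
    case True
    then obtain k where k: "k \<in> snd c" "10 * \<mu> < msq L k" by blast
    have "9 * \<mu> \<le> thi L \<mu> c + msq L (fst c) / M"
      using thi_ge_member[OF mu _ k] True k P0[of "fst c"] by linarith
    thus ?thesis using mu True by (simp add: R frac_le)
  qed (use mu in \<open>auto simp: R\<close>)
  have R1b: "\<bar>R1 k c\<bar> \<le> 1 / (9 * \<mu>)" if "k \<in> H" for k c
  proof -
    have "9 * \<mu> \<le> thi L \<mu> c + (msq L k - \<mu>) + msq L (fst c - k) / M" using H[OF that] t0[of c] P0[of "fst c - k"] by linarith
    thus ?thesis using mu by (simp add: R1_def frac_le)
  qed
  have Kb: "\<bar>K k l c\<bar> \<le> 1 / (9 * \<mu>)" if "k \<in> H" "l \<in> H" for k l c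
  proof -
    have "9 * \<mu> \<le> thi L \<mu> c + (msq L k - \<mu>) + (msq L l - \<mu>) + msq L (fst c - k - l) / M"
      using H[OF that(1)] H[OF that(2)] mu t0[of c] P0[of "fst c - k - l"] by linarith
    thus ?thesis using mu by (simp add: K_def frac_le)
  qed
  have e: "inner (CC H v) (mulf R (CC H v)) = (\<Sum>k\<in>H. inner v (mulf (R1 k) v)) - (\<Sum>k\<in>H. \<Sum>l\<in>H. inner (ann l v) (mulf (K k l) (ann k v)))"
  proof (rule inner_CC_mulf_CC(1)[OF v Hf Rb R1b Kb])
    show "R1 l c = R (sh l c)" if "l \<in> H" "l \<notin> snd c" "finite (snd c)" for l c
      using that H[OF that(1)] by (auto simp: R1_def R thi_sh) (auto simp: sh_def)
    show "K k l c = R1 l (sh k c)" if "k \<in> H" "l \<in> H" "k \<notin> snd c" "finite (snd c)" for k l c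
      using that H[OF that(1)] by (simp add: R1_def K_def thi_sh) (simp add: sh_def)
  qed
  have dom: "y \<in> domf (R1 k)" if "k \<in> H" for y k by (rule domf_bounded, rule R1b[OF that])
  have domK: "y \<in> domf (K k l)" if "k \<in> H" "l \<in> H" for y k l by (rule domf_bounded, rule Kb[OF that])
  have R1sum: "(\<Sum>k\<in>H. R1 k c) \<le> (\<Sum>k\<in>H. 1 / (mred M * msq L k - EB)) + 4000 / ?k" for c
  proof -
    have "(\<Sum>k\<in>H. R1 k c) \<le> (\<Sum>k\<in>H. 1 / (msq L (fst c - k) / M + msq L k + (- \<mu>)))"
      unfolding R1_def
    proof (intro sum_mono frac_le)
      fix k assume k: "k \<in> H"
      show "0 < msq L (fst c - k) / M + msq L k + - \<mu>" using H[OF k] P0[of "fst c - k"] mu by linarith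
      show "msq L (fst c - k) / M + msq L k + - \<mu> \<le> thi L \<mu> c + (msq L k - \<mu>) + msq L (fst c - k) / M" using t0[of c] by simp
    qed auto
    \<comment> \<open>High modes satisfy \<mu> < \<open>msq L k\<close> / 10, whence the parameter
      9/10. The error is 2500 / 0.729, and replacing -\<mu> by -E_B adds 25; both fit into
      4000.\<close>
    also have "\<dots> \<le> (\<Sum>k\<in>H. 1 / (mred M * msq L k + (- \<mu>))) + 2500 / ((9/10)^3 * ?k)"
    proof (rule recoil_sum_bound[OF L M0(1) Hf sym])
      fix k assume "k \<in> H"
      thus "9 / 10 * msq L k \<le> msq L k + - \<mu> \<and> msq L k + - \<mu> > 0" using H[of k] mu by auto
    qed auto
    also have "(\<Sum>k\<in>H. 1 / (mred M * msq L k + (- \<mu>))) \<le> (\<Sum>k\<in>H. 1 / (mred M * msq L k - EB) + 10 * \<mu> * (1 / (10 * \<mu> + msq L k)\<^sup>2))"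
    proof (rule sum_mono)
      fix k assume k: "k \<in> H"
      let ?X = "msq L k"
      have X: "10 * \<mu> < ?X" by (rule H[OF k])
      define Y where "Y = mred M * ?X"
      have YX: "Y \<ge> ?X" using M0 by (simp add: Y_def mred_def distrib_right)
      have p: "Y - \<mu> > 0" "Y - EB > 0" using YX X mu EB by auto
      have "1 / (Y - \<mu>) - 1 / (Y - EB) = (\<mu> - EB) / ((Y - \<mu>) * (Y - EB))" using p by (simp add: field_simps)
      also have "\<dots> \<le> (2 * \<mu>) / ((9/10 * ?X) * ?X)"
        using EB X YX mu p by (intro frac_le mult_mono mult_pos_pos) auto
      also have "\<dots> \<le> 10 * \<mu> * (1 / (10 * \<mu> + ?X)\<^sup>2)"
      proof -
        have "(10 * \<mu> + ?X)\<^sup>2 \<le> (2 * ?X)\<^sup>2" using X mu by (intro power_mono) auto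
        moreover have "(2 * X)\<^sup>2 \<le> 5 * ((9/10 * X) * X)" for X :: real by (simp add: power2_eq_square)
        ultimately have "(10 * \<mu> + ?X)\<^sup>2 \<le> 5 * ((9/10 * ?X) * ?X)" by (rule order_trans)
        hence "10 * \<mu> / (5 * ((9/10 * ?X) * ?X)) \<le> 10 * \<mu> / (10 * \<mu> + ?X)\<^sup>2"
          using X mu by (intro divide_left_mono mult_pos_pos zero_less_power) auto
        thus ?thesis by simp
      qed
      finally show "1 / (mred M * ?X + - \<mu>) \<le> 1 / (mred M * ?X - EB) + 10 * \<mu> * (1 / (10 * \<mu> + ?X)\<^sup>2)" by (simp add: Y_def)
    qed
    also have "\<dots> = (\<Sum>k\<in>H. 1 / (mred M * msq L k - EB)) + 10 * \<mu> * (\<Sum>k\<in>H. 1 / (10 * \<mu> + msq L k)\<^sup>2)"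
      by (simp add: sum.distrib sum_distrib_left)
    also have "10 * \<mu> * (\<Sum>k\<in>H. 1 / (10 * \<mu> + msq L k)\<^sup>2) \<le> 10 * \<mu> * (25 / (?k * (10 * \<mu>)))"
      using mu km by (intro mult_left_mono msq_sum_inv_sq[OF L Hf]) auto
    also have "\<dots> = 25 / ?k" using mu by simp
    finally have "(\<Sum>k\<in>H. R1 k c) \<le> (\<Sum>k\<in>H. 1 / (mred M * msq L k - EB)) + 25 / ?k + 2500 / ((9/10)^3 * ?k)" by simp
    moreover have "25 / ?k + 2500 / ((9/10)^3 * ?k) \<le> 4000 / ?k" using k0 by (simp add: field_simps)
    ultimately show ?thesis by linarith
  qed
  have first: "(\<Sum>k\<in>H. inner v (mulf (R1 k) v)) \<le> ((\<Sum>k\<in>H. 1 / (mred M * msq L k - EB)) + 4000 / ?k) * (norm v)\<^sup>2"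
  proof -
    have cm: "Re (cnj z * z) = (cmod z)\<^sup>2" for z :: complex
      by (metis Re_complex_of_real complex_norm_square mult.commute)
    have "((\<lambda>c. \<Sum>k\<in>H. R1 k c * Re (cnj (ev v c) * ev v c)) has_sum (\<Sum>k\<in>H. inner v (mulf (R1 k) v))) UNIV"
      by (intro has_sum_finite_sum Hf inner_mulf_has_sum dom)
    hence h1: "((\<lambda>c. (\<Sum>k\<in>H. R1 k c) * (cmod (ev v c))\<^sup>2) has_sum (\<Sum>k\<in>H. inner v (mulf (R1 k) v))) UNIV"
      by (simp only: cm sum_distrib_right)
    have h2: "((\<lambda>c. ((\<Sum>k\<in>H. 1 / (mred M * msq L k - EB)) + 4000 / ?k) * (cmod (ev v c))\<^sup>2) has_sum
       (((\<Sum>k\<in>H. 1 / (mred M * msq L k - EB)) + 4000 / ?k) * (norm v)\<^sup>2)) UNIV"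
      by (intro has_sum_cmult_right norm2_has_sum)
    show ?thesis by (rule has_sum_mono[OF h1 h2]) (intro mult_right_mono R1sum, simp)
  qed
  \<comment> \<open>Dividing by the square root of the high energy gives a vector \<open>u\<close>
    whose high-mode energy is at most the squared norm of \<open>v\<close>. The weights
    \<open>msq L k / (h + msq L k)\<close> of the kernel estimate become this energy up to the
    factor 10/9.\<close>
  define g where "g c = (if finite (snd c) \<and> (\<exists>k\<in>snd c. 10 * \<mu> < msq L k) then 1 / sqrt (thi L \<mu> c) else 0)" for c
  have gb: "\<bar>g c\<bar> \<le> 1 / sqrt (9 * \<mu>)" for c
  proof (cases "finite (snd c) \<and> (\<exists>k\<in>snd c. 10 * \<mu> < msq L k)")
    case True
    then obtain k where k: "k \<in> snd c" "10 * \<mu> < msq L k" by blast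
    have "9 * \<mu> \<le> thi L \<mu> c" using thi_ge_member[OF mu _ k] True k by linarith
    hence "sqrt (9 * \<mu>) \<le> sqrt (thi L \<mu> c)" by (rule real_sqrt_le_mono)
    moreover have "0 < sqrt (9 * \<mu>)" using mu by simp
    ultimately show ?thesis using True by (simp add: g_def frac_le)
  qed (use mu in \<open>auto simp: g_def\<close>)
  define u where "u = mulf g v"
  have evu: "ev u c = complex_of_real (g c) * ev v c" for c unfolding u_def by (rule ev_mulf, rule domf_bounded, rule gb)
  have v0: "ev v c = 0" if "infinite (snd c)" for c using supp_inD[OF v[unfolded Fin_def]] that by blast
  have su: "(\<Sum>k\<in>H. (msq L k - \<mu>) * (norm (ann k u))\<^sup>2) \<le> (norm v)\<^sup>2"
  proof (rule has_sum_mono[OF ann_number_has_sum[OF Hf] norm2_has_sum])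
    fix c
    show "(\<Sum>k\<in>H. if k \<in> snd c then msq L k - \<mu> else 0) * (cmod (ev u c))\<^sup>2 \<le> (cmod (ev v c))\<^sup>2"
    proof (cases "finite (snd c) \<and> (\<exists>k\<in>snd c. 10 * \<mu> < msq L k)")
      case True
      then obtain k where k: "k \<in> snd c" "10 * \<mu> < msq L k" by blast
      have tp: "0 < thi L \<mu> c" using thi_ge_member[OF mu _ k] True k mu by linarith
      have "(\<Sum>k\<in>H. if k \<in> snd c then msq L k - \<mu> else 0) = (\<Sum>k\<in>H \<inter> snd c. msq L k - \<mu>)"
        using Hf by (simp add: sum.If_cases Int_def)
      also have "\<dots> \<le> thi L \<mu> c" unfolding thi_def using True H mu by (intro sum_mono2) auto
      finally have "(\<Sum>k\<in>H. if k \<in> snd c then msq L k - \<mu> else 0) * (1 / thi L \<mu> c) \<le> 1" using tp by (simp add: divide_le_eq)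
      from mult_right_mono[OF this, of "(cmod (ev v c))\<^sup>2"] show ?thesis
        using True tp by (simp add: evu g_def norm_mult norm_divide power_mult_distrib power_divide)
    next
      case False thus ?thesis by (auto simp: evu g_def)
    qed
  qed
  have second: "- (7000 / 9 / ?k) * (norm v)\<^sup>2 \<le> (\<Sum>k\<in>H. \<Sum>l\<in>H. inner (ann l v) (mulf (K k l) (ann k v)))"
  proof -
    let ?z = "\<lambda>k c. ev (ann k v) c"
    have h1: "((\<lambda>c. \<Sum>k\<in>H. \<Sum>l\<in>H. K k l c * Re (cnj (?z l c) * ?z k c)) has_sum (\<Sum>k\<in>H. \<Sum>l\<in>H. inner (ann l v) (mulf (K k l) (ann k v)))) UNIV"
      by (intro has_sum_finite_sum Hf inner_mulf_has_sum domK)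
    have h2: "((\<lambda>c. - (7000 / 9 / ?k) * (\<Sum>k\<in>H. (msq L k - \<mu>) * (cmod (ev (ann k u) c))\<^sup>2)) has_sum
        (- (7000 / 9 / ?k) * (\<Sum>k\<in>H. (msq L k - \<mu>) * (norm (ann k u))\<^sup>2))) UNIV"
      by (intro has_sum_finite_sum Hf has_sum_cmult_right norm2_has_sum)
    have "- (7000 / 9 / ?k) * (\<Sum>k\<in>H. (msq L k - \<mu>) * (norm (ann k u))\<^sup>2) \<le> (\<Sum>k\<in>H. \<Sum>l\<in>H. inner (ann l v) (mulf (K k l) (ann k v)))"
    proof (rule has_sum_mono[OF h2 h1])
      fix c
      define h where "h = thi L \<mu> c"
      have h0: "h \<ge> 0" by (simp add: h_def t0)
      let ?kern = "\<lambda>k l. 1 / (h + (msq L k - \<mu>) + (msq L l - \<mu>) + msq L (fst c - k - l) / M)"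
      \<comment> \<open>The kernel estimate is for real amplitudes, so real and imaginary parts are
        treated separately.\<close>
      have "(\<Sum>k\<in>H. \<Sum>l\<in>H. K k l c * Re (cnj (?z l c) * ?z k c)) =
         (\<Sum>k\<in>H. \<Sum>l\<in>H. ?kern k l * (Re (?z k c) * Re (?z l c))) + (\<Sum>k\<in>H. \<Sum>l\<in>H. ?kern k l * (Im (?z k c) * Im (?z l c)))"
        unfolding sum.distrib[symmetric] K_def h_def by (intro sum.cong refl) (simp add: distrib_left mult_ac add_divide_distrib)
      also have "\<dots> \<ge> - (700 / ?k) * (\<Sum>k\<in>H. msq L k / (h + msq L k) * (Re (?z k c))\<^sup>2) + - (700 / ?k) * (\<Sum>k\<in>H. msq L k / (h + msq L k) * (Im (?z k c))\<^sup>2)"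
        by (intro add_mono recoil_kernel_lower[OF L M Hf h0 H mu])
      also have "- (700 / ?k) * (\<Sum>k\<in>H. msq L k / (h + msq L k) * (Re (?z k c))\<^sup>2) + - (700 / ?k) * (\<Sum>k\<in>H. msq L k / (h + msq L k) * (Im (?z k c))\<^sup>2)
         = - (700 / ?k) * (\<Sum>k\<in>H. msq L k / (h + msq L k) * (cmod (?z k c))\<^sup>2)"
        unfolding distrib_left[symmetric] sum.distrib[symmetric] by (simp add: cmod_power2 distrib_left)
      also have "\<dots> \<ge> - (700 / ?k) * (\<Sum>k\<in>H. 10 / 9 * ((msq L k - \<mu>) * (cmod (ev (ann k u) c))\<^sup>2))"
      proof (intro mult_left_mono_neg sum_mono)
        fix k assume k: "k \<in> H"
        have X: "10 * \<mu> < msq L k" by (rule H[OF k])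
        show "msq L k / (h + msq L k) * (cmod (?z k c))\<^sup>2 \<le> 10 / 9 * ((msq L k - \<mu>) * (cmod (ev (ann k u) c))\<^sup>2)"
        proof (cases "k \<notin> snd c \<and> finite (snd c)")
          case True
          have tt: "thi L \<mu> (sh k c) = h + (msq L k - \<mu>)" using True X by (simp add: thi_sh h_def)
          have "g (sh k c) = 1 / sqrt (h + (msq L k - \<mu>))" using True X tt by (auto simp: g_def sh_def)
          hence eu: "(cmod (ev (ann k u) c))\<^sup>2 = 1 / (h + (msq L k - \<mu>)) * (cmod (?z k c))\<^sup>2"
            using True h0 X mu by (simp add: ev_ann annf_def evu norm_mult norm_divide power_mult_distrib power_divide)
          have "msq L k / (h + msq L k) \<le> (10 / 9 * (msq L k - \<mu>)) / (h + (msq L k - \<mu>))"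
            using h0 X mu by (intro frac_le) auto
          hence "msq L k / (h + msq L k) * (cmod (?z k c))\<^sup>2 \<le> (10 / 9 * (msq L k - \<mu>)) / (h + (msq L k - \<mu>)) * (cmod (?z k c))\<^sup>2"
            by (intro mult_right_mono) auto
          moreover have "10 / 9 * s / d * w = 10 / 9 * (s * (1 / d * w))" for s d w :: real by simp
          ultimately show ?thesis unfolding eu by (simp only:)
        next
          case False
          hence "?z k c = 0" using v0[of "sh k c"] by (auto simp: ev_ann annf_def) (auto simp: sh_def)
          thus ?thesis using X mu by simp
        qed
      qed (use k0 in auto)
      also have "- (700 / ?k) * (\<Sum>k\<in>H. 10 / 9 * ((msq L k - \<mu>) * (cmod (ev (ann k u) c))\<^sup>2))
          = - (7000 / 9 / ?k) * (\<Sum>k\<in>H. (msq L k - \<mu>) * (cmod (ev (ann k u) c))\<^sup>2)"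
        unfolding sum_distrib_left[symmetric] by simp
      finally show "- (7000 / 9 / ?k) * (\<Sum>k\<in>H. (msq L k - \<mu>) * (cmod (ev (ann k u) c))\<^sup>2) \<le> (\<Sum>k\<in>H. \<Sum>l\<in>H. K k l c * Re (cnj (?z l c) * ?z k c))" .
    qed
    moreover have "- (7000 / 9 / ?k) * (norm v)\<^sup>2 \<le> - (7000 / 9 / ?k) * (\<Sum>k\<in>H. (msq L k - \<mu>) * (norm (ann k u))\<^sup>2)"
      using su k0 by (intro mult_left_mono_neg) auto
    ultimately show ?thesis by linarith
  qed
  have "inner (CC H v) (mulf R (CC H v)) \<le> ((\<Sum>k\<in>H. 1 / (mred M * msq L k - EB)) + 4000 / ?k) * (norm v)\<^sup>2 + (7000 / 9 / ?k) * (norm v)\<^sup>2"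
    unfolding e using first second by linarith
  also have "\<dots> = ((\<Sum>k\<in>H. 1 / (mred M * msq L k - EB)) + (4000 / ?k + 7000 / 9 / ?k)) * (norm v)\<^sup>2" by (simp add: distrib_right)
  also have "\<dots> \<le> ((\<Sum>k\<in>H. 1 / (mred M * msq L k - EB)) + 5000 / ?k) * (norm v)\<^sup>2"
    using k0 by (intro mult_right_mono add_left_mono) (auto simp: field_simps)
  finally show ?thesis .
qed

text \<open>With \<open>v = AA H x\<close> and \<open>y = CC H v\<close>, the squared norm of
  \<open>v\<close> is \<open>inner y x\<close>. Young's inequality in each coordinate bounds this by
  the dual form of \<open>y\<close> and by \<open>W\<close>, and the dual bound closes the
  estimate.\<close>

lemma hi_modes_form_bound:
  assumes L: "L > 0" and M: "M > 1.225" and mu: "\<mu> > 0" and km: "(kap L)\<^sup>2 \<le> 10 * \<mu>"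
    and EB: "EB < 0" "\<bar>EB\<bar> \<le> \<mu>"
    and Hf: "finite H" and H: "\<And>k. k \<in> H \<Longrightarrow> 10 * \<mu> < msq L k" and sym: "\<And>k. k \<in> H \<Longrightarrow> - k \<in> H"
    and x: "x \<in> sec (Suc N)" and W: "((\<lambda>c. (thi L \<mu> c + msq L (fst c) / M) * (cmod (ev x c))\<^sup>2) has_sum W) UNIV"
  shows "(norm (AA H x))\<^sup>2 \<le> ((\<Sum>k\<in>H. 1 / (mred M * msq L k - EB)) + 5000 / (kap L)\<^sup>2) * W"
proof -
  define \<beta> where "\<beta> = (\<Sum>k\<in>H. 1 / (mred M * msq L k - EB)) + 5000 / (kap L)\<^sup>2"
  have M0: "M > 0" using M by simp
  have b0: "\<beta> > 0" unfolding \<beta>_def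
  proof (intro add_nonneg_pos sum_nonneg)
    show "0 \<le> 1 / (mred M * msq L k - EB)" for k using mred_msq_pos[OF M0 EB(1), of L k] by simp
  qed (use kap_pos[OF L] in auto)
  define v where "v = AA H x"
  have vs: "v \<in> sec N" unfolding v_def by (rule AA_sec[OF x])
  have vF: "v \<in> Fin" using vs sec_Fin by blast
  define R where "R = (\<lambda>c. if finite (snd c) \<and> (\<exists>k\<in>snd c. 10 * \<mu> < msq L k) then 1 / (thi L \<mu> c + msq L (fst c) / M) else 0)"
  define y where "y = CC H v"
  have yF: "y \<in> sec (Suc N)" unfolding y_def by (rule CC_sec[OF vs])
  have Rb: "\<bar>R c\<bar> \<le> 1 / (9 * \<mu>)" for c
  proof (cases "finite (snd c) \<and> (\<exists>k\<in>snd c. 10 * \<mu> < msq L k)")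
    case True
    then obtain k where k: "k \<in> snd c" "10 * \<mu> < msq L k" by blast
    have "0 \<le> msq L (fst c) / M" using M0 by simp
    hence "9 * \<mu> \<le> thi L \<mu> c + msq L (fst c) / M"
      using thi_ge_member[OF mu _ k] True k by linarith
    thus ?thesis using mu True by (simp add: R_def frac_le)
  qed (use mu in \<open>auto simp: R_def\<close>)
  have dual: "inner y (mulf R y) \<le> \<beta> * (norm v)\<^sup>2"
    unfolding y_def \<beta>_def by (rule hi_modes_dual_bound[OF L M mu km EB Hf H sym vF R_def])
  have cm: "Re (cnj z * z) = (cmod z)\<^sup>2" for z :: complex
    by (metis Re_complex_of_real complex_norm_square mult.commute)
  have h1: "((\<lambda>c. R c * (cmod (ev y c))\<^sup>2) has_sum inner y (mulf R y)) UNIV"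
    using inner_mulf_has_sum[of y R y] domf_bounded[of y R, OF Rb] by (simp only: cm)
  have "2 * inner y x \<le> 1 / \<beta> * inner y (mulf R y) + \<beta> * W"
  proof (rule has_sum_mono)
    show "((\<lambda>c. 2 * Re (cnj (ev y c) * ev x c)) has_sum (2 * inner y x)) UNIV"
      by (intro has_sum_cmult_right inner_has_sum)
    show "((\<lambda>c. 1 / \<beta> * (R c * (cmod (ev y c))\<^sup>2) + \<beta> * ((thi L \<mu> c + msq L (fst c) / M) * (cmod (ev x c))\<^sup>2)) has_sum (1 / \<beta> * inner y (mulf R y) + \<beta> * W)) UNIV"
      by (intro has_sum_add has_sum_cmult_right h1 W)
    fix c
    let ?w = "thi L \<mu> c + msq L (fst c) / M"
    have w0: "?w \<ge> 0" using thi_ge0[OF mu, of L c] M0 by simp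
    show "2 * Re (cnj (ev y c) * ev x c) \<le> 1 / \<beta> * (R c * (cmod (ev y c))\<^sup>2) + \<beta> * (?w * (cmod (ev x c))\<^sup>2)"
    proof (cases "ev y c = 0")
      case True thus ?thesis using b0 w0 by simp
    next
      case False
      have fin: "finite (snd c)" using False yF supp_inD[OF yF, of c] by (cases c) (auto simp: Cfg_def)
      \<comment> \<open>A configuration charged by \<open>y\<close> was reached by creating a mode
        of \<open>H\<close>. It therefore contains a high mode, and \<open>R\<close> is the inverse
        energy there and not its default 0.\<close>
      obtain k where k: "k \<in> H" "k \<in> snd c"
      proof -
        have "\<exists>k\<in>H. ev (cre k v) c \<noteq> 0" using False unfolding y_def CC_def by (auto dest: sum.not_neutral_contains_not_neutral)
        thus thesis using that by (auto simp: ev_cre cref_def split: if_splits)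
      qed
      have "9 * \<mu> \<le> ?w" using thi_ge_member[OF mu fin k(2) H[OF k(1)]] H[OF k(1)] M0 by (smt (verit) divide_nonneg_pos msq_ge0)
      hence wp: "?w > 0" using mu by linarith
      have Rw: "R c = 1 / ?w" using fin k H[OF k(1)] by (auto simp: R_def)
      have "2 * Re (cnj (ev y c) * ev x c) \<le> 2 * (cmod (ev y c) * cmod (ev x c))"
        using complex_Re_le_cmod[of "cnj (ev y c) * ev x c"] by (simp add: norm_mult)
      also have "\<dots> = 2 * (cmod (ev y c) / sqrt (\<beta> * ?w)) * (sqrt (\<beta> * ?w) * cmod (ev x c))" using b0 wp by simp
      also have "\<dots> \<le> (cmod (ev y c) / sqrt (\<beta> * ?w))\<^sup>2 + (sqrt (\<beta> * ?w) * cmod (ev x c))\<^sup>2" by (rule sum_squares_bound)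
      also have "\<dots> = 1 / \<beta> * (R c * (cmod (ev y c))\<^sup>2) + \<beta> * (?w * (cmod (ev x c))\<^sup>2)"
        using b0 wp by (simp add: power_divide power_mult_distrib Rw)
      finally show ?thesis .
    qed
  qed
  moreover have "inner y x = (norm v)\<^sup>2" by (simp add: y_def inner_CC power2_norm_eq_inner v_def)
  moreover have "1 / \<beta> * inner y (mulf R y) \<le> (norm v)\<^sup>2" using dual b0 by (simp add: divide_le_eq mult.commute)
  ultimately have "(norm v)\<^sup>2 \<le> \<beta> * W" by linarith
  thus ?thesis by (simp add: v_def \<beta>_def)
qed

section \<open>The lower bound for the cut-off Hamiltonians\<close>

lemma has_sum_diff_real:
  fixes f g :: "'a \<Rightarrow> real"
  assumes "(f has_sum a) A" "(g has_sum b) A"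
  shows "((\<lambda>x. f x - g x) has_sum (a - b)) A"
  using has_sum_add[OF assms(1) has_sum_cmult_right[OF assms(2), of "-1"]] by simp

text \<open>From the width \<open>\<delta>\<close> on, the perimeter term and the additive constant
  of \<open>card_annulus\<close> are absorbed into the area term at the price of
  \<open>b\<close>.\<close>

lemma card_msq_annulus:
  assumes L: "L > 0" and mu: "\<mu> > 0" and s: "s \<ge> \<delta>" and d: "\<delta> > 0" "sqrt (\<mu> / (kap L)\<^sup>2) \<le> b * (\<delta> / (kap L)\<^sup>2)" "1 \<le> b * (\<delta> / (kap L)\<^sup>2)"
  shows "finite {k. \<mu> - s \<le> msq L k \<and> msq L k \<le> \<mu> + s}"
    "real (card {k. \<mu> - s \<le> msq L k \<and> msq L k \<le> \<mu> + s}) \<le> (24 * (1 + 2 * b) / (kap L)\<^sup>2) * s"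
proof -
  let ?k = "(kap L)\<^sup>2"
  have k: "?k > 0" using kap_pos[OF L] by simp
  have e: "{k. \<mu> - s \<le> msq L k \<and> msq L k \<le> \<mu> + s} = {j. \<mu> / ?k - s / ?k \<le> nu j \<and> nu j \<le> \<mu> / ?k + s / ?k}"
    using k by (auto simp: msq_nu field_simps)
  show "finite {k. \<mu> - s \<le> msq L k \<and> msq L k \<le> \<mu> + s}"
    by (rule finite_subset[OF _ finite_msq_ball[OF L, of "\<mu> + s"]]) auto
  have b0: "b \<ge> 0" using d k by (smt (verit) divide_pos_pos mult_nonpos_nonneg)
  have ds: "\<delta> / ?k \<le> s / ?k" using s k by (simp add: divide_right_mono)
  have "real (card {k. \<mu> - s \<le> msq L k \<and> msq L k \<le> \<mu> + s}) \<le> 24 * (s / ?k + sqrt (\<mu> / ?k) + 1)"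
    unfolding e by (rule card_annulus) (use s d mu k in auto)
  also have "\<dots> \<le> 24 * (s / ?k + b * (s / ?k) + b * (s / ?k))"
    using d mult_left_mono[OF ds b0] by (intro mult_left_mono add_mono) auto
  also have "\<dots> = (24 * (1 + 2 * b) / ?k) * s" by (simp add: algebra_simps add_divide_distrib)
  finally show "real (card {k. \<mu> - s \<le> msq L k \<and> msq L k \<le> \<mu> + s}) \<le> (24 * (1 + 2 * b) / ?k) * s" .
qed

lemma kin_nonneg: "M > 0 \<Longrightarrow> 0 \<le> kin M L c"
  unfolding kin_def by (intro add_nonneg_nonneg sum_nonneg) auto

text \<open>There are as many fermions as lattice points in the Fermi ball, so energies may be
  counted from \<mu>. What remains is a sum of nonnegative terms: the impurity, particles in the two
  ranges above \<mu>, and holes below.\<close>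

lemma kin_decompose:
  assumes L: "L > 0" and mu: "\<mu> > 0" and c: "c \<in> Cfg (Nmu L \<mu>)"
  shows "kin M L c - E0 L \<mu> = msq L (fst c) / M + thi L \<mu> c
    + (\<Sum>k | \<mu> < msq L k \<and> msq L k \<le> 10 * \<mu>. if k \<in> snd c then msq L k - \<mu> else 0)
    + (\<Sum>k | msq L k \<le> \<mu>. if k \<notin> snd c then \<mu> - msq L k else 0)"
proof -
  define S where "S = snd c"
  define B where "B = ball_lat L \<mu>"
  have S: "finite S" "card S = card B" using c by (auto simp: S_def Cfg_def B_def Nmu_def)
  have fB: "finite B" unfolding B_def using L by simp
  have Bset: "B = {k. msq L k \<le> \<mu>}" by (simp add: B_def ball_lat_def)
  let ?f = "\<lambda>k. msq L k - \<mu>"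
  have "(\<Sum>k\<in>S. ?f k) = (\<Sum>k\<in>S \<inter> B. ?f k) + (\<Sum>k\<in>S - B. ?f k)"
    using S(1) by (metis Int_Diff_Un Int_Diff_disjoint finite_Diff finite_Int sum.union_disjoint)
  moreover have "(\<Sum>k\<in>B. ?f k) = (\<Sum>k\<in>S \<inter> B. ?f k) + (\<Sum>k\<in>B - S. ?f k)"
    using fB by (metis Int_Diff_Un Int_Diff_disjoint Int_commute finite_Diff finite_Int sum.union_disjoint)
  moreover have "(\<Sum>k\<in>S - B. ?f k) = (\<Sum>k | k \<in> S \<and> 10 * \<mu> < msq L k. ?f k) + (\<Sum>k | k \<in> S \<and> \<mu> < msq L k \<and> msq L k \<le> 10 * \<mu>. ?f k)"
  proof -
    have "S - B = {k. k \<in> S \<and> 10 * \<mu> < msq L k} \<union> {k. k \<in> S \<and> \<mu> < msq L k \<and> msq L k \<le> 10 * \<mu>}"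
      using mu by (auto simp: Bset)
    thus ?thesis using S(1) by (simp only:) (rule sum.union_disjoint, auto)
  qed
  moreover have "(\<Sum>k | \<mu> < msq L k \<and> msq L k \<le> 10 * \<mu>. if k \<in> S then ?f k else 0) = (\<Sum>k | k \<in> S \<and> \<mu> < msq L k \<and> msq L k \<le> 10 * \<mu>. ?f k)"
  proof -
    have "finite {k. \<mu> < msq L k \<and> msq L k \<le> 10 * \<mu>}"
      by (rule finite_subset[OF _ finite_msq_ball[OF L, of "10 * \<mu>"]]) auto
    thus ?thesis by (simp add: sum.If_cases Int_def conj_commute)
  qed
  moreover have "(\<Sum>k | msq L k \<le> \<mu>. if k \<notin> S then \<mu> - msq L k else 0) = - (\<Sum>k\<in>B - S. ?f k)"
    using fB unfolding Bset[symmetric] by (simp add: sum.If_cases sum_negf[symmetric] Diff_eq Int_def Compl_eq)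
  moreover have "(\<Sum>k\<in>S. ?f k) = (\<Sum>k\<in>S. msq L k) - real (card B) * \<mu>" "(\<Sum>k\<in>B. ?f k) = E0 L \<mu> - real (card B) * \<mu>"
    using S by (simp_all add: sum_subtractf E0_def B_def)
  ultimately show ?thesis unfolding kin_def thi_def S_def[symmetric] by linarith
qed

lemma kin_ge_E0:
  assumes "L > 0" "\<mu> > 0" "M > 0" "c \<in> Cfg (Nmu L \<mu>)"
  shows "E0 L \<mu> \<le> kin M L c"
proof -
  have "0 \<le> msq L (fst c) / M" using assms by simp
  moreover have "0 \<le> (\<Sum>k | \<mu> < msq L k \<and> msq L k \<le> 10 * \<mu>. if k \<in> snd c then msq L k - \<mu> else 0)"
    by (rule sum_nonneg) auto
  moreover have "0 \<le> (\<Sum>k | msq L k \<le> \<mu>. if k \<notin> snd c then \<mu> - msq L k else 0)"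
    by (rule sum_nonneg) auto
  ultimately show ?thesis using kin_decompose[OF assms(1,2,4), of M] thi_ge0[OF assms(2), of L c] by linarith
qed

lemma Nmu_pos: "L > 0 \<Longrightarrow> \<mu> > 0 \<Longrightarrow> Nmu L \<mu> > 0"
proof -
  assume "L > 0" "\<mu> > 0"
  hence "(0::lat) \<in> ball_lat L \<mu>" "finite (ball_lat L \<mu>)" by (auto simp: ball_lat_def)
  thus ?thesis unfolding Nmu_def by (metis card_gt_0_iff empty_iff)
qed

definition low_sum :: "real \<Rightarrow> real \<Rightarrow> real \<Rightarrow> real \<Rightarrow> real" where
  "low_sum M L \<mu> EB = (\<Sum>k | msq L k \<le> 10 * \<mu>. 1 / (mred M * msq L k - EB))"

text \<open>The cut-off Hamiltonians will be bounded below by \<open>E0 - elow\<close>, uniformly in the cut-off.\<close>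
definition elow :: "real \<Rightarrow> real \<Rightarrow> real \<Rightarrow> real \<Rightarrow> real \<Rightarrow> real" where
  "elow M L \<mu> EB b = (let \<beta> = low_sum M L \<mu> EB - 5001 / (kap L)\<^sup>2; a = 24 * (1 + 2 * b) / (kap L)\<^sup>2;
      \<delta> = \<mu> / ((kap L)\<^sup>2 * \<beta>) in
    (real (card {k. msq L k \<le> \<mu> + \<delta>}) + 9 * a * real (card {k. msq L k \<le> 10 * \<mu>}) / \<beta>) / \<beta>)"

text \<open>The weights add up without loss; they will be the shares of low and high modes in the
  reciprocal coupling, where no factor can be given away.\<close>

lemma convex_split:
  fixes u v :: "'a::real_inner"
  assumes "b1 > 0" "b2 > 0"
  shows "(norm (u + v))\<^sup>2 \<le> (b1 + b2) * ((norm u)\<^sup>2 / b1 + (norm v)\<^sup>2 / b2)"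
proof -
  have "(norm (u + v))\<^sup>2 \<le> (norm u + norm v)\<^sup>2" by (intro power_mono norm_triangle_ineq) auto
  also have "\<dots> \<le> (b1 + b2) * ((norm u)\<^sup>2 / b1 + (norm v)\<^sup>2 / b2)"
  proof -
    have "(b1 + b2) * ((norm u)\<^sup>2 / b1 + (norm v)\<^sup>2 / b2) - (norm u + norm v)\<^sup>2 = (b2 * norm u - b1 * norm v)\<^sup>2 / (b1 * b2)"
      using assms by (simp add: field_simps power2_eq_square)
    moreover have "0 \<le> (b2 * norm u - b1 * norm v)\<^sup>2 / (b1 * b2)" using assms by simp
    ultimately show ?thesis by linarith
  qed
  finally show ?thesis .
qed

text \<open>The low modes get the share \<open>\<beta>\<close>, the high modes their sum plus
  \<open>5000 / (kap L)^2\<close>. The 5001 subtracted in \<open>\<beta>\<close> pays for that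
  excess and leaves \<open>1 / (kap L)^2\<close> as slack uniform in the cut-off.\<close>

lemma cutoff_form_bound:
  assumes L: "L > 0" and M: "M > 1.225" and mu: "\<mu> > 0" and km: "(kap L)\<^sup>2 \<le> \<mu>"
    and EB: "EB < 0" "\<bar>EB\<bar> \<le> \<mu>"
    and \<beta>: "\<beta> = low_sum M L \<mu> EB - 5001 / (kap L)\<^sup>2" "1 \<le> (kap L)\<^sup>2 * \<beta>" "(kap L)\<^sup>2 * \<beta> \<le> b * sqrt (\<mu> / (kap L)\<^sup>2)"
    and n: "10 * \<mu> \<le> real n"
    and x: "x \<in> sec (Nmu L \<mu>)" and W: "((\<lambda>c. kin M L c * (cmod (ev x c))\<^sup>2) has_sum W) UNIV"
  shows "(norm (AA (ball_lat L (real n)) x))\<^sup>2 \<le> (1 / gcoup M L EB n - 1 / (kap L)\<^sup>2) * (W - (E0 L \<mu> - elow M L \<mu> EB b) * (norm x)\<^sup>2)"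
proof -
  let ?k = "(kap L)\<^sup>2"
  have k: "?k > 0" using kap_pos[OF L] by simp
  have M0: "M > 0" using M by simp
  have b0: "\<beta> > 0" using \<beta>(2) k by (smt (verit) mult_nonneg_nonpos)
  \<comment> \<open>With this width the annulus just outside the Fermi ball holds a fraction of
    order \<open>1 / ((kap L)^2 * \<beta>)\<close> of N(\<mu>), the relative size of the other
    low-mode error.\<close>
  define \<delta> where "\<delta> = \<mu> / (?k * \<beta>)"
  have d0: "\<delta> > 0" using mu k b0 by (simp add: \<delta>_def)
  have rho: "1 \<le> \<mu> / ?k" using km k by simp
  have dk: "sqrt (\<mu> / ?k) \<le> b * (\<delta> / ?k)"
  proof -
    have "sqrt (\<mu> / ?k) * (?k * \<beta>) \<le> sqrt (\<mu> / ?k) * (b * sqrt (\<mu> / ?k))" using \<beta>(3) mu k by (intro mult_left_mono) auto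
    also have "\<dots> = b * (\<mu> / ?k)" using rho by (simp add: mult.left_commute flip: power2_eq_square)
    finally show ?thesis using k b0 by (simp add: \<delta>_def field_simps)
  qed
  have dk1: "1 \<le> b * (\<delta> / ?k)" using dk rho by (metis order_trans real_sqrt_ge_one)
  have dmu: "\<mu> + \<delta> \<le> 10 * \<mu>"
  proof -
    have "\<delta> \<le> \<mu> / 1" unfolding \<delta>_def using \<beta>(2) mu by (intro divide_left_mono) auto
    thus ?thesis using mu by simp
  qed
  define a where "a = 24 * (1 + 2 * b) / ?k"
  have bb: "b \<ge> 0" using dk1 d0 k by (smt (verit) divide_pos_pos mult_nonpos_nonneg)
  have a0: "a \<ge> 0" using bb k by (simp add: a_def)
  define e where "e = elow M L \<mu> EB b"
  have e: "e = (real (card {k. msq L k \<le> \<mu> + \<delta>}) + 9 * a * real (card {k. msq L k \<le> 10 * \<mu>}) / \<beta>) / \<beta>"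
    unfolding e_def elow_def Let_def a_def \<delta>_def \<beta>(1) ..
  define I where "I = {k. msq L k \<le> 10 * \<mu>}"
  define H where "H = {k. 10 * \<mu> < msq L k \<and> msq L k \<le> real n}"
  have fI: "finite I" unfolding I_def using L by simp
  have fH: "finite H" unfolding H_def by (rule finite_subset[OF _ finite_msq_ball[OF L, of "real n"]]) auto
  have Bn: "ball_lat L (real n) = I \<union> H" "I \<inter> H = {}" using n by (auto simp: ball_lat_def I_def H_def)
  obtain N where N: "Nmu L \<mu> = Suc N" using Nmu_pos[OF L mu] gr0_implies_Suc by blast
  have xF: "x \<in> Fin" using x sec_Fin by blast
  define Q where "Q = (\<Sum>k | \<mu> < msq L k \<and> msq L k \<le> 10 * \<mu>. (msq L k - \<mu>) * (norm (ann k x))\<^sup>2)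
              + (\<Sum>k | msq L k \<le> \<mu>. (\<mu> - msq L k) * (norm (cre k x))\<^sup>2)"
  have fm: "finite {k. \<mu> < msq L k \<and> msq L k \<le> 10 * \<mu>}"
    by (rule finite_subset[OF _ finite_msq_ball[OF L, of "10 * \<mu>"]]) auto
  have Q0: "Q \<ge> 0" unfolding Q_def by (intro add_nonneg_nonneg sum_nonneg) auto
  have hQ: "((\<lambda>c. (\<Sum>k | \<mu> < msq L k \<and> msq L k \<le> 10 * \<mu>. if k \<in> snd c then msq L k - \<mu> else 0) * (cmod (ev x c))\<^sup>2
     + (\<Sum>k | msq L k \<le> \<mu>. if k \<notin> snd c then \<mu> - msq L k else 0) * (cmod (ev x c))\<^sup>2) has_sum Q) UNIV"
    unfolding Q_def by (intro has_sum_add ann_number_has_sum cre_number_has_sum fm finite_msq_ball[OF L])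
  have "((\<lambda>c. kin M L c * (cmod (ev x c))\<^sup>2 - E0 L \<mu> * (cmod (ev x c))\<^sup>2
     - ((\<Sum>k | \<mu> < msq L k \<and> msq L k \<le> 10 * \<mu>. if k \<in> snd c then msq L k - \<mu> else 0) * (cmod (ev x c))\<^sup>2
     + (\<Sum>k | msq L k \<le> \<mu>. if k \<notin> snd c then \<mu> - msq L k else 0) * (cmod (ev x c))\<^sup>2)) has_sum (W - E0 L \<mu> * (norm x)\<^sup>2 - Q)) UNIV"
    by (intro has_sum_diff_real W has_sum_cmult_right norm2_has_sum hQ)
  hence hW: "((\<lambda>c. (thi L \<mu> c + msq L (fst c) / M) * (cmod (ev x c))\<^sup>2) has_sum (W - E0 L \<mu> * (norm x)\<^sup>2 - Q)) UNIV"
  proof (rule has_sum_cong[THEN iffD1, rotated])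
    fix c :: cfg
    show "kin M L c * (cmod (ev x c))\<^sup>2 - E0 L \<mu> * (cmod (ev x c))\<^sup>2
     - ((\<Sum>k | \<mu> < msq L k \<and> msq L k \<le> 10 * \<mu>. if k \<in> snd c then msq L k - \<mu> else 0) * (cmod (ev x c))\<^sup>2
     + (\<Sum>k | msq L k \<le> \<mu>. if k \<notin> snd c then \<mu> - msq L k else 0) * (cmod (ev x c))\<^sup>2) = (thi L \<mu> c + msq L (fst c) / M) * (cmod (ev x c))\<^sup>2"
    proof (cases "c \<in> Cfg (Nmu L \<mu>)")
      case True
      have gen: "(E + P + t + q1 + q2) * w - E * w - (q1 * w + q2 * w) = (t + P) * w" for E P t q1 q2 w :: real
        by (simp add: algebra_simps)
      have ke: "kin M L c = E0 L \<mu> + msq L (fst c) / M + thi L \<mu> c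
    + (\<Sum>k | \<mu> < msq L k \<and> msq L k \<le> 10 * \<mu>. if k \<in> snd c then msq L k - \<mu> else 0)
    + (\<Sum>k | msq L k \<le> \<mu>. if k \<notin> snd c then \<mu> - msq L k else 0)"
        using kin_decompose[OF L mu True, of M] by linarith
      show ?thesis unfolding ke by (rule gen)
    next
      case False thus ?thesis using supp_inD[OF x] by simp
    qed
  qed
  let ?bh = "(\<Sum>k\<in>H. 1 / (mred M * msq L k - EB)) + 5000 / ?k"
  have bh: "?bh > 0"
  proof (intro add_nonneg_pos sum_nonneg)
    show "0 \<le> 1 / (mred M * msq L q - EB)" for q using mred_msq_pos[OF M0 EB(1), of L q] by simp
  qed (use k in auto)
  have hi: "(norm (AA H x))\<^sup>2 \<le> ?bh * (W - E0 L \<mu> * (norm x)\<^sup>2 - Q)"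
    by (rule hi_modes_form_bound[OF L M mu _ EB fH _ _ x[unfolded N] hW]) (use km mu in \<open>auto simp: H_def\<close>)
  have lo: "(norm (AA I x))\<^sup>2 \<le> \<beta> * (Q + e * (norm x)\<^sup>2)"
  proof -
    let ?n = "real (card I)"
    have "(norm (AA I x))\<^sup>2 \<le> card {k. msq L k \<le> \<mu> + \<delta>} * (norm x)\<^sup>2 + 6 * (sqrt (a * ?n) * norm x * sqrt Q)"
      unfolding I_def
    proof (rule low_modes_form_bound[OF _ d0 dmu a0 _ xF _ Q_def])
      show "finite {k. msq L k \<le> 10 * \<mu>}" using L by simp
      fix s assume "\<delta> \<le> s"
      from card_msq_annulus[OF L mu this d0 dk dk1]
      show "finite {k. \<mu> - s \<le> msq L k \<and> msq L k \<le> \<mu> + s} \<and> real (card {k. \<mu> - s \<le> msq L k \<and> msq L k \<le> \<mu> + s}) \<le> a * s"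
        by (simp add: a_def)
    qed simp
    \<comment> \<open>Young's inequality balanced so that exactly \<open>\<beta>\<close> multiplies
      \<open>Q\<close>; the price goes into the energy shift.\<close>
    also have "6 * (sqrt (a * ?n) * norm x * sqrt Q) \<le> \<beta> * Q + 9 * a * ?n / \<beta> * (norm x)\<^sup>2"
    proof -
      have "2 * (sqrt \<beta> * sqrt Q) * (3 * sqrt (a * ?n) * norm x / sqrt \<beta>) \<le> (sqrt \<beta> * sqrt Q)\<^sup>2 + (3 * sqrt (a * ?n) * norm x / sqrt \<beta>)\<^sup>2"
        by (rule sum_squares_bound)
      moreover have "(sqrt \<beta> * sqrt Q)\<^sup>2 = \<beta> * Q" using b0 Q0 by (simp add: power_mult_distrib)
      moreover have "(3 * sqrt (a * ?n) * norm x / sqrt \<beta>)\<^sup>2 = 9 * a * ?n / \<beta> * (norm x)\<^sup>2"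
        using b0 a0 by (simp add: power_mult_distrib power_divide)
      moreover have "2 * (sqrt \<beta> * sqrt Q) * (3 * sqrt (a * ?n) * norm x / sqrt \<beta>) = 6 * (sqrt (a * ?n) * norm x * sqrt Q)"
        using b0 by simp
      ultimately show ?thesis by linarith
    qed
    finally have "(norm (AA I x))\<^sup>2 \<le> \<beta> * Q + (real (card {k. msq L k \<le> \<mu> + \<delta>}) + 9 * a * ?n / \<beta>) * (norm x)\<^sup>2"
      by (simp add: distrib_right)
    also have "real (card {k. msq L k \<le> \<mu> + \<delta>}) + 9 * a * ?n / \<beta> = \<beta> * e" using b0 by (simp add: e I_def)
    finally show ?thesis by (simp add: distrib_left)
  qed
  have "(norm (AA I x + AA H x))\<^sup>2 \<le> (\<beta> + ?bh) * ((norm (AA I x))\<^sup>2 / \<beta> + (norm (AA H x))\<^sup>2 / ?bh)"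
    by (rule convex_split[OF b0 bh])
  also have "\<dots> \<le> (\<beta> + ?bh) * ((Q + e * (norm x)\<^sup>2) + (W - E0 L \<mu> * (norm x)\<^sup>2 - Q))"
    using lo hi b0 bh by (intro mult_left_mono add_mono) (auto simp: divide_le_eq mult.commute)
  also have "\<dots> = (\<beta> + ?bh) * (W - (E0 L \<mu> - e) * (norm x)\<^sup>2)" by (simp add: algebra_simps)
  also have "\<beta> + ?bh = 1 / gcoup M L EB n - 1 / ?k"
  proof -
    have "1 / gcoup M L EB n = (\<Sum>k\<in>I. 1 / (mred M * msq L k - EB)) + (\<Sum>k\<in>H. 1 / (mred M * msq L k - EB))"
      unfolding gcoup_def Bn(1) using fI fH Bn(2) by (simp add: sum.union_disjoint)
    thus ?thesis unfolding \<beta>(1) low_sum_def I_def[symmetric] by (simp add: diff_divide_distrib[symmetric])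
  qed
  finally show ?thesis unfolding Bn(1) AA_union[OF fI fH Bn(2)] e_def .
qed

section \<open>Strong resolvent limits\<close>

text \<open>Solutions \<open>u n\<close> of the equation at \<open>\<i>\<close> with the right-hand
  side of \<open>x\<close> converge to \<open>x\<close>; by that equation \<open>An n (u n)\<close>
  then converges to \<open>A x\<close>, and the form inequality passes to the limit.\<close>

lemma resolvent_limit_lower_bound:
  assumes K: "csub K" "closed K" and An: "\<And>n. sa K (Dn n) (An n)" and A: "sa K D A"
    and conv: "\<And>z u x. Im z \<noteq> 0 \<Longrightarrow> (\<And>n. u n \<in> Dn n) \<Longrightarrow> x \<in> D \<Longrightarrow> (\<And>n. An n (u n) - cs z (u n) = A x - cs z x) \<Longrightarrow> u \<longlonglongrightarrow> x"
    and low: "\<And>n x. x \<in> Dn n \<Longrightarrow> c * (norm x)\<^sup>2 \<le> inner x (An n x)" and x: "x \<in> D"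
  shows "c * (norm x)\<^sup>2 \<le> inner x (A x)"
proof -
  have y: "A x - cs \<i> x \<in> K" using saD(1,6)[OF A] x csubD(3,6)[OF K(1)] by blast
  have "\<forall>n. \<exists>u\<in>Dn n. An n u - cs \<i> u = A x - cs \<i> x"
    using sa_surj_nonreal[OF K An, of \<i>, OF _ y] by simp
  then obtain u where u: "\<And>n. u n \<in> Dn n" "\<And>n. An n (u n) - cs \<i> (u n) = A x - cs \<i> x" by metis
  have lim: "u \<longlonglongrightarrow> x" by (rule conv[of \<i>, OF _ u(1) x u(2)]) simp
  have "An n (u n) = (A x - cs \<i> x) + cs \<i> (u n)" for n using u(2)[of n] by (simp add: algebra_simps)
  moreover have "(\<lambda>n. (A x - cs \<i> x) + cs \<i> (u n)) \<longlonglongrightarrow> (A x - cs \<i> x) + cs \<i> x"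
    by (intro tendsto_intros bounded_linear.tendsto[OF cs_bounded_linear] lim)
  ultimately have Al: "(\<lambda>n. An n (u n)) \<longlonglongrightarrow> A x" by simp
  have "(\<lambda>n. c * (norm (u n))\<^sup>2) \<longlonglongrightarrow> c * (norm x)\<^sup>2" by (intro tendsto_intros lim)
  moreover have "(\<lambda>n. inner (u n) (An n (u n))) \<longlonglongrightarrow> inner x (A x)" by (intro tendsto_intros lim Al)
  ultimately show ?thesis by (rule LIMSEQ_le) (use low u(1) in auto)
qed

text \<open>The trial vectors cannot be inserted into \<open>A\<close>, because their limit
  \<open>f0\<close> need not lie in \<open>D\<close>. Instead the resolvent form at
  \<open>f0\<close> is compared: positivity of the cut-off forms at
  \<open>v n - a *\<^sub>R f n\<close> bounds it below by \<open>(norm f0)^2 / (s - r)\<close>,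
  while a form bound \<open>s'\<close> for \<open>A\<close> would bound it above by
  \<open>(norm f0)^2 / (s' - r)\<close>.\<close>

lemma resolvent_limit_upper_bound:
  assumes K: "csub K" "closed K" and An: "\<And>n. sa K (Dn n) (An n)" and A: "sa K D A"
    and conv: "\<And>z u x. Im z \<noteq> 0 \<Longrightarrow> (\<And>n. u n \<in> Dn n) \<Longrightarrow> x \<in> D \<Longrightarrow> (\<And>n. An n (u n) - cs z (u n) = A x - cs z x) \<Longrightarrow> u \<longlonglongrightarrow> x"
    and low: "\<And>n x. x \<in> Dn n \<Longrightarrow> c * (norm x)\<^sup>2 \<le> inner x (An n x)"
    and f: "\<And>n. f n \<in> Dn n" "f \<longlonglongrightarrow> f0" "f0 \<noteq> 0" and th: "\<theta> \<longlonglongrightarrow> 0"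
    and up: "\<And>n. inner (f n) (An n (f n)) \<le> s * (norm (f n))\<^sup>2 + \<theta> n" and s': "s' > s"
  shows "\<exists>x\<in>D. inner x (A x) < s' * (norm x)\<^sup>2"
proof (rule ccontr)
  assume "\<not> ?thesis"
  hence H: "s' * (norm x)\<^sup>2 \<le> inner x (A x)" if "x \<in> D" for x using that by force
  define r where "r = min c s - 1"
  have r: "r < c" "r < s" by (auto simp: r_def)
  have f0K: "f0 \<in> K" using closed_sequentially[OF K(2) _ f(2)] f(1) saD(1)[OF An] by blast
  obtain x where x: "x \<in> D" "A x - r *\<^sub>R x = f0"
    using sa_surj_below[OF K A H _ f0K, of r] s' r by auto
  have "\<forall>n. \<exists>v\<in>Dn n. An n v - r *\<^sub>R v = f0" using sa_surj_below[OF K An low r(1) f0K] by blast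
  then obtain v where v: "\<And>n. v n \<in> Dn n" "\<And>n. An n (v n) - r *\<^sub>R v n = f0" by metis
  have vl: "v \<longlonglongrightarrow> x"
  proof (rule sa_resolvent_transfer[OF K An A, where z = \<i> and w = "complex_of_real r" and \<delta> = "c - r"])
    show "c - r > 0" using r by simp
    show "\<exists>x\<in>Dn n. An n x - cs \<i> x = y" if "y \<in> K" for n y
      using sa_surj_nonreal[OF K An _ that, of \<i> n] by simp
    show "u \<longlonglongrightarrow> x" if "\<And>n. u n \<in> Dn n" "x \<in> D" "\<And>n. An n (u n) - cs \<i> (u n) = A x - cs \<i> x" for u x
      by (rule conv[of \<i>, OF _ that]) simp
    show "(c - r) * norm x \<le> norm (An n x - cs (complex_of_real r) x)" if "x \<in> Dn n" for n x
      using sa_bound_below[OF An that low[OF that], of r] by simp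
  qed (use v x in auto)
  \<comment> \<open>Minimises the quadratic polynomial in \<open>a\<close> to which
    \<open>pos\<close> converges.\<close>
  define a where "a = 1 / (s - r)"
  have pos: "0 \<le> inner (v n) f0 - 2 * a * inner (f n) f0 + a\<^sup>2 * ((s - r) * (norm (f n))\<^sup>2 + \<theta> n)" for n
  proof -
    let ?u = "v n - a *\<^sub>R f n"
    have af: "a *\<^sub>R f n \<in> Dn n" using csubD(4)[OF saD(2)[OF An] f(1)] .
    have u: "?u \<in> Dn n" using csubD(6)[OF saD(2)[OF An] v(1) af] .
    have Au: "An n ?u - r *\<^sub>R ?u = f0 - a *\<^sub>R (An n (f n) - r *\<^sub>R f n)"
      using sa_diff[OF An v(1) af] sa_scaleR[OF An f(1)] v(2)[of n] by (simp add: algebra_simps)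
    have "0 \<le> (c - r) * (norm ?u)\<^sup>2" using r by simp
    also have "\<dots> \<le> inner ?u (An n ?u - r *\<^sub>R ?u)"
      using low[OF u] by (simp add: inner_diff_right algebra_simps power2_norm_eq_inner)
    also have "\<dots> = inner (v n) f0 - a * inner (f n) f0 - a * inner (v n) (An n (f n) - r *\<^sub>R f n) + a\<^sup>2 * inner (f n) (An n (f n) - r *\<^sub>R f n)"
      unfolding Au by (simp add: inner_diff_left inner_diff_right algebra_simps power2_eq_square)
    also have "inner (v n) (An n (f n) - r *\<^sub>R f n) = inner (An n (v n) - r *\<^sub>R v n) (f n)"
      using sa_sym[OF An v(1) f(1)] by (simp add: inner_diff_left inner_diff_right)
    also have "\<dots> = inner (f n) f0" using v(2)[of n] by (simp add: inner_commute)
    also have "inner (f n) (An n (f n) - r *\<^sub>R f n) \<le> (s - r) * (norm (f n))\<^sup>2 + \<theta> n"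
      using up[of n] by (simp add: inner_diff_right algebra_simps power2_norm_eq_inner)
    hence "inner (v n) f0 - a * inner (f n) f0 - a * inner (f n) f0 + a\<^sup>2 * inner (f n) (An n (f n) - r *\<^sub>R f n)
      \<le> inner (v n) f0 - 2 * a * inner (f n) f0 + a\<^sup>2 * ((s - r) * (norm (f n))\<^sup>2 + \<theta> n)"
      by (simp add: mult_left_mono)
    finally show ?thesis .
  qed
  have "(\<lambda>n. inner (v n) f0 - 2 * a * inner (f n) f0 + a\<^sup>2 * ((s - r) * (norm (f n))\<^sup>2 + \<theta> n))
    \<longlonglongrightarrow> inner x f0 - 2 * a * inner f0 f0 + a\<^sup>2 * ((s - r) * (norm f0)\<^sup>2 + 0)"
    by (intro tendsto_intros vl f th)
  hence "0 \<le> inner x f0 - 2 * a * inner f0 f0 + a\<^sup>2 * ((s - r) * (norm f0)\<^sup>2 + 0)"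
    by (rule LIMSEQ_le_const) (use pos in auto)
  also have "\<dots> = inner x f0 - (norm f0)\<^sup>2 / (s - r)"
  proof -
    have "i - 2 * (1 / d) * q + (1 / d)\<^sup>2 * (d * q + 0) = i - q / d" if "d \<noteq> 0" for i d q :: real
      using that by (simp add: power2_eq_square)
    thus ?thesis using r unfolding a_def power2_norm_eq_inner by simp
  qed
  finally have lo: "(norm f0)\<^sup>2 / (s - r) \<le> inner x f0" by simp
  have "(s' - r) * (norm x)\<^sup>2 \<le> inner x f0"
  proof -
    have "A x = f0 + r *\<^sub>R x" using x(2) by (simp add: algebra_simps)
    hence "inner x (A x) = inner x f0 + r * (norm x)\<^sup>2" by (simp add: inner_add_right power2_norm_eq_inner)
    thus ?thesis using H[OF x(1)] by (simp add: left_diff_distrib)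
  qed
  also have "\<dots> \<le> norm x * norm f0" by (rule norm_cauchy_schwarz)
  finally have h0: "(s' - r) * (norm x)\<^sup>2 \<le> norm x * norm f0" .
  have h: "(s' - r) * norm x \<le> norm f0"
  proof (cases "x = 0")
    case False
    have "(s' - r) * norm x * norm x \<le> norm f0 * norm x"
      using h0 by (simp only: power2_eq_square mult.assoc mult.commute[of "norm x" "norm f0"])
    thus ?thesis by (rule mult_right_le_imp_le) (use False in simp)
  qed simp
  have "inner x f0 \<le> norm x * norm f0" by (rule norm_cauchy_schwarz)
  also have "\<dots> \<le> norm f0 / (s' - r) * norm f0" using h r s' by (intro mult_right_mono) (auto simp: pos_le_divide_eq mult.commute)
  also have "\<dots> = (norm f0)\<^sup>2 / (s' - r)" by (simp add: power2_eq_square)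
  also have "\<dots> < (norm f0)\<^sup>2 / (s - r)" using f(3) r s' by (intro divide_strict_left_mono) auto
  finally show False using lo by simp
qed

text \<open>The pointwise limit \<open>W\<close> of the resolvents at \<open>r\<close> is linear and
  symmetric, and \<open>A\<close> is its inverse plus \<open>r\<close>. What could fail is
  injectivity: a kernel of \<open>W\<close> would make its range too small to be dense. This is
  excluded by \<open>inj\<close>.\<close>

lemma resolvent_limit_exists:
  assumes K: "csub K" "closed K" and An: "\<And>n. sa K (Dn n) (An n)"
    and low: "\<And>n x. x \<in> Dn n \<Longrightarrow> c * (norm x)\<^sup>2 \<le> inner x (An n x)" and l: "r < c"
    and conv: "\<And>y. y \<in> K \<Longrightarrow> \<exists>w\<in>K. \<forall>v. (\<forall>n. v n \<in> Dn n \<and> An n (v n) - r *\<^sub>R v n = y) \<longrightarrow> v \<longlonglongrightarrow> w"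
    and inj: "\<And>y. y \<in> K \<Longrightarrow> y \<noteq> 0 \<Longrightarrow> \<exists>\<epsilon>>0. \<forall>n. \<forall>v\<in>Dn n. An n v - r *\<^sub>R v = y \<longrightarrow> \<epsilon> \<le> inner y v"
  shows "\<exists>D A. sa K D A \<and> (\<forall>z u x. Im z \<noteq> 0 \<longrightarrow> (\<forall>n. u n \<in> Dn n) \<longrightarrow> x \<in> D \<longrightarrow>
     (\<forall>n. An n (u n) - cs z (u n) = A x - cs z x) \<longrightarrow> u \<longlonglongrightarrow> x)"
proof -
  have surj: "\<exists>v\<in>Dn n. An n v - r *\<^sub>R v = y" if "y \<in> K" for n y
    by (rule sa_surj_below[OF K An low l that])
  define W where "W y = (SOME w. w \<in> K \<and> (\<forall>v. (\<forall>n. v n \<in> Dn n \<and> An n (v n) - r *\<^sub>R v n = y) \<longrightarrow> v \<longlonglongrightarrow> w))" for y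
  have Wex: "W y \<in> K \<and> (\<forall>v. (\<forall>n. v n \<in> Dn n \<and> An n (v n) - r *\<^sub>R v n = y) \<longrightarrow> v \<longlonglongrightarrow> W y)" if "y \<in> K" for y
    unfolding W_def by (rule someI_ex) (use conv[OF that] in blast)
  have W: "\<And>y. y \<in> K \<Longrightarrow> W y \<in> K" "\<And>y v. y \<in> K \<Longrightarrow> (\<And>n. v n \<in> Dn n) \<Longrightarrow> (\<And>n. An n (v n) - r *\<^sub>R v n = y) \<Longrightarrow> v \<longlonglongrightarrow> W y"
    using Wex by blast+
  define R where "R n y = (SOME v. v \<in> Dn n \<and> An n v - r *\<^sub>R v = y)" for n y
  have R: "R n y \<in> Dn n" "An n (R n y) - r *\<^sub>R R n y = y" if "y \<in> K" for n y
    using someI_ex[of "\<lambda>v. v \<in> Dn n \<and> An n v - r *\<^sub>R v = y"] surj[OF that, of n] by (auto simp: R_def)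
  have RW: "(\<lambda>n. R n y) \<longlonglongrightarrow> W y" if "y \<in> K" for y by (rule W(2)[OF that R(1)[OF that] R(2)[OF that]])
  have Wadd: "W (x + y) = W x + W y" if "x \<in> K" "y \<in> K" for x y
  proof -
    have "(\<lambda>n. R n x + R n y) \<longlonglongrightarrow> W (x + y)"
    proof (rule W(2))
      show "x + y \<in> K" using csubD(2)[OF K(1) that] .
      fix n
      show "R n x + R n y \<in> Dn n" using csubD(2)[OF saD(2)[OF An] R(1)[OF that(1)] R(1)[OF that(2)]] .
      show "An n (R n x + R n y) - r *\<^sub>R (R n x + R n y) = x + y"
        using saD(3)[OF An R(1)[OF that(1)] R(1)[OF that(2)], of n] R(2)[OF that(1), of n] R(2)[OF that(2), of n] by (simp add: algebra_simps)
    qed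
    moreover have "(\<lambda>n. R n x + R n y) \<longlonglongrightarrow> W x + W y" by (intro tendsto_intros RW that)
    ultimately show ?thesis by (rule LIMSEQ_unique)
  qed
  have Wcs: "W (cs a x) = cs a (W x)" if "x \<in> K" for a x
  proof -
    have "(\<lambda>n. cs a (R n x)) \<longlonglongrightarrow> W (cs a x)"
    proof (rule W(2))
      show "cs a x \<in> K" using csubD(3)[OF K(1) that] .
      fix n
      show "cs a (R n x) \<in> Dn n" using csubD(3)[OF saD(2)[OF An] R(1)[OF that]] .
      have "cs a (An n (R n x) - r *\<^sub>R R n x) = cs a x" using R(2)[OF that, of n] by simp
      moreover have "cs a (r *\<^sub>R R n x) = r *\<^sub>R cs a (R n x)" by (rule ell2_eqI) simp
      ultimately show "An n (cs a (R n x)) - r *\<^sub>R cs a (R n x) = cs a x"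
        using saD(4)[OF An R(1)[OF that], of n a] by (simp add: cs_add)
    qed
    moreover have "(\<lambda>n. cs a (R n x)) \<longlonglongrightarrow> cs a (W x)" by (intro bounded_linear.tendsto[OF cs_bounded_linear] RW that)
    ultimately show ?thesis by (rule LIMSEQ_unique)
  qed
  have Wsym: "cinner (W x) y = cinner x (W y)" if "x \<in> K" "y \<in> K" for x y
  proof -
    have re: "inner (W x) y = inner x (W y)" if "x \<in> K" "y \<in> K" for x y
    proof -
      have "inner (R n x) y = inner x (R n y)" for n
      proof -
        have "inner (R n x) y = inner (R n x) (An n (R n y) - r *\<^sub>R R n y)" by (simp only: R(2)[OF that(2)])
        also have "\<dots> = inner (An n (R n x) - r *\<^sub>R R n x) (R n y)"
          using sa_sym[OF An R(1)[OF that(1)] R(1)[OF that(2)], of n] by (simp add: inner_diff_left inner_diff_right)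
        also have "\<dots> = inner x (R n y)" by (simp only: R(2)[OF that(1)])
        finally show ?thesis .
      qed
      moreover have "(\<lambda>n. inner (R n x) y) \<longlonglongrightarrow> inner (W x) y" "(\<lambda>n. inner x (R n y)) \<longlonglongrightarrow> inner x (W y)"
        by (intro tendsto_intros RW that)+
      ultimately show ?thesis using LIMSEQ_unique by (simp only:)
    qed
    have "cs \<i> y \<in> K" using csubD(3)[OF K(1) that(2)] .
    thus ?thesis by (intro cinner_eqI) (simp_all add: re that Wcs[symmetric])
  qed
  have W0: "y = 0" if yW: "y \<in> K" "W y = 0" for y
  proof (rule ccontr)
    assume "y \<noteq> 0"
    then obtain \<epsilon> where e0: "\<epsilon> > 0" "\<forall>n. \<forall>v\<in>Dn n. An n v - r *\<^sub>R v = y \<longrightarrow> \<epsilon> \<le> inner y v" using inj[OF yW(1)] by blast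
    hence e: "\<epsilon> > 0" "\<And>n. \<epsilon> \<le> inner y (R n y)" using R[OF yW(1)] by blast+
    have "(\<lambda>n. inner y (R n y)) \<longlonglongrightarrow> inner y (W y)" by (intro tendsto_intros RW yW)
    hence "\<epsilon> \<le> inner y (W y)" by (rule LIMSEQ_le_const) (use e in auto)
    thus False using e yW by simp
  qed
  have Wdiff: "W (x - y) = W x - W y" if "x \<in> K" "y \<in> K" for x y
    using Wadd[OF that(1) csubD(5)[OF K(1) that(2)]] Wcs[OF that(2), of "-1"] by simp
  have Winj: "x = y" if "x \<in> K" "y \<in> K" "W x = W y" for x y
    using W0[OF csubD(6)[OF K(1) that(1,2)]] Wdiff[OF that(1,2)] that(3) by simp
  define D where "D = W ` K"
  define V where "V = inv_into K W"
  have V: "V (W y) = y" if "y \<in> K" for y unfolding V_def using that Winj by (intro inv_into_f_f) (auto simp: inj_on_def)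
  define A where "A x = V x + r *\<^sub>R x" for x
  have AW: "A (W y) = y + r *\<^sub>R W y" if "y \<in> K" for y using V[OF that] by (simp add: A_def)
  have csD: "csub D"
    unfolding csub_def D_def
  proof (intro conjI ballI allI)
    show "0 \<in> W ` K" using csubD(1)[OF K(1)] Wcs[of 0 0] by (intro rev_image_eqI[of 0]) auto
    show "x + y \<in> W ` K" if "x \<in> W ` K" "y \<in> W ` K" for x y
      using that Wadd csubD(2)[OF K(1)] by (auto simp: image_iff) metis
    show "cs a x \<in> W ` K" if "x \<in> W ` K" for a x
      using that Wcs csubD(3)[OF K(1)] by (auto simp: image_iff) metis
  qed
  have saA: "sa K D A"
    unfolding sa_def
  proof (intro conjI ballI allI impI)
    show "D \<subseteq> K" using W(1) by (auto simp: D_def)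
    show "csub D" by (rule csD)
    show "A (x + y) = A x + A y" if xy: "x \<in> D" "y \<in> D" for x y
    proof -
      obtain a b where ab: "a \<in> K" "b \<in> K" "x = W a" "y = W b" using xy by (auto simp: D_def)
      have e: "x + y = W (a + b)" using Wadd[OF ab(1,2)] ab by simp
      have "A (x + y) = (a + b) + r *\<^sub>R (x + y)" using AW[OF csubD(2)[OF K(1) ab(1,2)]] unfolding e .
      moreover have "A x = a + r *\<^sub>R x" "A y = b + r *\<^sub>R y" using AW[OF ab(1)] AW[OF ab(2)] ab by auto
      ultimately show ?thesis by (simp add: scaleR_add_right)
    qed
    show "A (cs a x) = cs a (A x)" if x: "x \<in> D" for a x
    proof -
      obtain b where b: "b \<in> K" "x = W b" using x by (auto simp: D_def)
      have "cs a x = W (cs a b)" using Wcs[OF b(1)] b by simp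
      moreover have "cs a (r *\<^sub>R x) = r *\<^sub>R cs a x" by (rule ell2_eqI) simp
      ultimately show ?thesis using AW[OF csubD(3)[OF K(1) b(1)], of a] AW[OF b(1)] b by (simp add: cs_add)
    qed
    show "K \<subseteq> closure D"
    proof (rule csub_dense[OF K csD])
      show "D \<subseteq> K" using W(1) by (auto simp: D_def)
      fix x assume x: "x \<in> K" and o: "\<And>s. s \<in> D \<Longrightarrow> cinner x s = 0"
      \<comment> \<open>A vector orthogonal to the range of \<open>W\<close> lies in its kernel, by
        symmetry.\<close>
      have "cinner (W x) (W x) = 0" using o[of "W (W x)"] Wsym[OF x W(1)[OF x]] W(1)[OF x] by (auto simp: D_def)
      hence "W x = 0" by (simp add: cinner_self)
      thus "x = 0" by (rule W0[OF x])
    qed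
    show "A ` D \<subseteq> K" using AW csubD(2,4)[OF K(1)] W(1) by (auto simp: D_def)
    show "cinner x (A y) = cinner (A x) y" if xy: "x \<in> D" "y \<in> D" for x y
    proof -
      obtain a b where ab: "a \<in> K" "b \<in> K" "x = W a" "y = W b" using xy by (auto simp: D_def)
      have ca: "cinner u (v + w) = cinner u v + cinner u w" for u v w :: "'a ell2"
        by (simp add: cinner_inner complex_eq_iff inner_add_right cs_add)
      have "cinner (r *\<^sub>R u) v = complex_of_real r * cinner u v" "cinner u (r *\<^sub>R v) = complex_of_real r * cinner u v" for u v :: "'a ell2"
        using cinner_cs_left[of "complex_of_real r" u v] cinner_cs_right[of u "complex_of_real r" v] by auto
      thus ?thesis using AW[OF ab(1)] AW[OF ab(2)] Wsym[OF ab(1,2)] ab by (simp add: ca cinner_add_left)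
    qed
    fix x h assume x: "x \<in> K" and h: "h \<in> K" and e: "\<forall>y\<in>D. cinner x (A y) = cinner h y"
    have hk: "h - r *\<^sub>R x \<in> K" using csubD(4,6)[OF K(1)] x h by blast
    have "x - W (h - r *\<^sub>R x) = 0"
    proof -
      have ca: "cinner u (v + w) = cinner u v + cinner u w" for u v w :: "'a ell2"
        by (simp add: cinner_inner complex_eq_iff inner_add_right cs_add)
      have rr: "cinner (r *\<^sub>R u) v = complex_of_real r * cinner u v" "cinner u (r *\<^sub>R v) = complex_of_real r * cinner u v" for u v :: "'a ell2"
        using cinner_cs_left[of "complex_of_real r" u v] cinner_cs_right[of u "complex_of_real r" v] by auto
      have "cinner (x - W (h - r *\<^sub>R x)) y = 0" if y: "y \<in> K" for y
      proof -
        have "cinner x (A (W y)) = cinner h (W y)" using e y by (auto simp: D_def)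
        hence "cinner x y = cinner (h - r *\<^sub>R x) (W y)" by (simp add: AW[OF y] ca rr cinner_diff_left algebra_simps)
        also have "\<dots> = cinner (W (h - r *\<^sub>R x)) y" using Wsym[OF hk y] by simp
        finally show ?thesis by (simp add: cinner_diff_left)
      qed
      from this[of "x - W (h - r *\<^sub>R x)"] show ?thesis using csubD(6)[OF K(1) x W(1)[OF hk]] by (simp add: cinner_self)
    qed
    thus "x \<in> D" using hk by (auto simp: D_def)
  qed
  have "u \<longlonglongrightarrow> x" if z: "Im z \<noteq> 0" and u: "\<And>n. u n \<in> Dn n" "x \<in> D" "\<And>n. An n (u n) - cs z (u n) = A x - cs z x" for z u x
  proof (rule sa_resolvent_transfer[OF K An saA, where z = "complex_of_real r" and w = z and \<delta> = "\<bar>Im z\<bar>"])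
    show "\<bar>Im z\<bar> > 0" using z by simp
    show "\<exists>x\<in>Dn n. An n x - cs (complex_of_real r) x = y" if "y \<in> K" for n y using surj[OF that] by simp
    show "v \<longlonglongrightarrow> x" if v: "\<And>n. v n \<in> Dn n" "x \<in> D" "\<And>n. An n (v n) - cs (complex_of_real r) (v n) = A x - cs (complex_of_real r) x" for v x
    proof -
      obtain y where y: "y \<in> K" "x = W y" using v(2) by (auto simp: D_def)
      have "A x - r *\<^sub>R x = y" using AW[OF y(1)] y(2) by simp
      hence "v \<longlonglongrightarrow> W y" using v by (intro W(2)[OF y(1)]) auto
      thus ?thesis using y by simp
    qed
    show "\<bar>Im z\<bar> * norm x \<le> norm (An n x - cs z x)" if "x \<in> Dn n" for n x by (rule sa_bound_nonreal[OF An that])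
  qed (use u in auto)
  thus ?thesis using saA by blast
qed

section \<open>Transfer to coordinates\<close>

lemma l2_sec: "ev x \<in> l2 N \<longleftrightarrow> x \<in> sec N"
  using ev_summable[of x] by (auto simp: l2_def supp_in_def)

lemma l2_Abs: "\<psi> \<in> l2 N \<Longrightarrow> ev (Abs_ell2 \<psi>) = \<psi>"
  by (rule ev_Abs) (simp add: l2_def)

lemma l2_image: "l2 N = ev ` sec N"
proof
  show "l2 N \<subseteq> ev ` sec N"
  proof
    fix \<psi> assume "\<psi> \<in> l2 N"
    hence "Abs_ell2 \<psi> \<in> sec N" "\<psi> = ev (Abs_ell2 \<psi>)" using l2_Abs[of \<psi> N] l2_sec[of "Abs_ell2 \<psi>" N] by auto
    thus "\<psi> \<in> ev ` sec N" by blast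
  qed
qed (use l2_sec in auto)

lemma norm_l2_ev: "norm_l2 (ev x) = norm x"
  unfolding norm_l2_def using norm2_has_sum[of x] by (simp add: infsumI)

lemma inner_l2_ev: "inner_l2 (ev x) (ev y) = cinner x y"
  by (simp add: inner_l2_def cinner_def)

text \<open>Links an operator on coordinate functions to one on the type of square-summable vectors.
  The values of \<open>snd H\<close> off the domain stay free, as they do in the choice of
  \<open>Hlim\<close>.\<close>

definition repr_op :: "op \<Rightarrow> cfg ell2 set \<Rightarrow> (cfg ell2 \<Rightarrow> cfg ell2) \<Rightarrow> bool" where
  "repr_op H D A \<longleftrightarrow> fst H = ev ` D \<and> (\<forall>x\<in>D. snd H (ev x) = ev (A x))"

lemma ev_lin: "(\<lambda>c. a * ev x c + b * ev y c) = ev (cs a x + cs b y)"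
  and ev_diff: "(\<lambda>c. ev x c - ev y c) = ev (x - y)"
  and ev_diff_cs: "(\<lambda>c. ev x c - z * ev y c) = ev (x - cs z y)"
  and ev_zero: "(\<lambda>c. 0) = ev (0 :: 'a ell2)"
  by (auto simp: fun_eq_iff)

lemma repr_selfadjoint:
  assumes r: "repr_op H D A" and A: "sa (sec N) D A"
  shows "selfadjoint N H"
proof -
  note D = saD[OF A]
  have f: "fst H = ev ` D" and s: "\<And>x. x \<in> D \<Longrightarrow> snd H (ev x) = ev (A x)" using r by (auto simp: repr_op_def)
  have lin: "cs a x + cs b y \<in> D" "A (cs a x + cs b y) = cs a (A x) + cs b (A y)" if "x \<in> D" "y \<in> D" for a b x y
    using csubD(2,3)[OF D(2)] D(3,4) that by auto
  show ?thesis
    unfolding selfadjoint_def Let_def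
  proof (intro conjI)
    show "fst H \<subseteq> l2 N" unfolding f l2_image using D(1) by blast
    show "(\<lambda>c. 0) \<in> fst H" unfolding ev_zero f using csubD(1)[OF D(2)] by blast
    show "\<forall>\<phi>\<in>fst H. \<forall>\<psi>\<in>fst H. \<forall>a b. (\<lambda>c. a * \<phi> c + b * \<psi> c) \<in> fst H
          \<and> snd H (\<lambda>c. a * \<phi> c + b * \<psi> c) = (\<lambda>c. a * snd H \<phi> c + b * snd H \<psi> c)"
      unfolding f ball_simps
    proof (intro ballI allI)
      fix x y a b assume xy: "x \<in> D" "y \<in> D"
      show "(\<lambda>c. a * ev x c + b * ev y c) \<in> ev ` D \<and> snd H (\<lambda>c. a * ev x c + b * ev y c) = (\<lambda>c. a * snd H (ev x) c + b * snd H (ev y) c)"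
        unfolding ev_lin s[OF xy(1)] s[OF xy(2)] s[OF lin(1)[OF xy]] lin(2)[OF xy] using lin(1)[OF xy] by simp
    qed
    show "\<forall>\<psi>\<in>l2 N. \<forall>\<epsilon>>0. \<exists>\<phi>\<in>fst H. norm_l2 (\<lambda>c. \<psi> c - \<phi> c) < \<epsilon>"
      unfolding l2_image f ball_simps bex_simps
    proof (intro ballI allI impI)
      fix x and \<epsilon> :: real assume "x \<in> sec N" "\<epsilon> > 0"
      then obtain y where "y \<in> D" "dist y x < \<epsilon>" using D(5) closure_approachable[of x D] by blast
      thus "\<exists>y\<in>D. norm_l2 (\<lambda>c. ev x c - ev y c) < \<epsilon>" unfolding ev_diff norm_l2_ev by (metis dist_commute dist_norm)
    qed
    show "snd H ` fst H \<subseteq> l2 N" unfolding f l2_image using s D(6) by auto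
    show "\<forall>\<phi>\<in>fst H. \<forall>\<psi>\<in>fst H. inner_l2 \<phi> (snd H \<psi>) = inner_l2 (snd H \<phi>) \<psi>"
      unfolding f ball_simps using D(7) by (simp add: s inner_l2_ev)
    show "\<forall>\<phi>\<in>l2 N. (\<exists>\<eta>\<in>l2 N. \<forall>\<psi>\<in>fst H. inner_l2 \<phi> (snd H \<psi>) = inner_l2 \<eta> \<psi>) \<longrightarrow> \<phi> \<in> fst H"
      unfolding l2_image f ball_simps bex_simps
    proof (intro ballI impI)
      fix x assume x: "x \<in> sec N" and "\<exists>h\<in>sec N. \<forall>y\<in>D. inner_l2 (ev x) (snd H (ev y)) = inner_l2 (ev h) (ev y)"
      then obtain h where h: "h \<in> sec N" "\<And>y. y \<in> D \<Longrightarrow> cinner x (A y) = cinner h y" by (auto simp: s inner_l2_ev)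
      show "ev x \<in> ev ` D" using D(8)[OF x h] by blast
    qed
  qed
qed

lemma selfadjoint_repr:
  assumes "selfadjoint N H"
  obtains D A where "repr_op H D A" "sa (sec N) D A"
proof -
  define D where "D = {x. ev x \<in> fst H}"
  define A where "A x = Abs_ell2 (snd H (ev x))" for x
  have sub: "fst H \<subseteq> l2 N" and z: "(\<lambda>c. 0) \<in> fst H"
    and lin: "\<And>\<phi> \<psi> a b. \<phi> \<in> fst H \<Longrightarrow> \<psi> \<in> fst H \<Longrightarrow> (\<lambda>c. a * \<phi> c + b * \<psi> c) \<in> fst H
          \<and> snd H (\<lambda>c. a * \<phi> c + b * \<psi> c) = (\<lambda>c. a * snd H \<phi> c + b * snd H \<psi> c)"
    and dense: "\<And>\<psi> \<epsilon>. \<psi> \<in> l2 N \<Longrightarrow> \<epsilon> > 0 \<Longrightarrow> \<exists>\<phi>\<in>fst H. norm_l2 (\<lambda>c. \<psi> c - \<phi> c) < \<epsilon>"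
    and im: "\<And>\<phi>. \<phi> \<in> fst H \<Longrightarrow> snd H \<phi> \<in> l2 N"
    and sym: "\<And>\<phi> \<psi>. \<phi> \<in> fst H \<Longrightarrow> \<psi> \<in> fst H \<Longrightarrow> inner_l2 \<phi> (snd H \<psi>) = inner_l2 (snd H \<phi>) \<psi>"
    and max: "\<And>\<phi> \<eta>. \<phi> \<in> l2 N \<Longrightarrow> \<eta> \<in> l2 N \<Longrightarrow> (\<And>\<psi>. \<psi> \<in> fst H \<Longrightarrow> inner_l2 \<phi> (snd H \<psi>) = inner_l2 \<eta> \<psi>) \<Longrightarrow> \<phi> \<in> fst H"
    using assms unfolding selfadjoint_def Let_def by blast+
  have evA: "ev (A x) = snd H (ev x)" if "x \<in> D" for x
    unfolding A_def using that im by (intro l2_Abs[of _ N]) (auto simp: D_def)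
  have fH: "fst H = ev ` D"
  proof
    show "fst H \<subseteq> ev ` D"
    proof
      fix \<psi> assume p: "\<psi> \<in> fst H"
      hence e: "ev (Abs_ell2 \<psi>) = \<psi>" using sub l2_Abs by blast
      thus "\<psi> \<in> ev ` D" using p by (intro rev_image_eqI[of "Abs_ell2 \<psi>"]) (auto simp: D_def)
    qed
  qed (auto simp: D_def)
  have rep: "repr_op H D A" using fH evA by (simp add: repr_op_def)
  have comb: "cs a x + cs b y \<in> D \<and> A (cs a x + cs b y) = cs a (A x) + cs b (A y)" if "x \<in> D" "y \<in> D" for a b x y
  proof -
    have 1: "ev (cs a x + cs b y) \<in> fst H" and 2: "snd H (ev (cs a x + cs b y)) = (\<lambda>c. a * snd H (ev x) c + b * snd H (ev y) c)"
      using lin[of "ev x" "ev y" a b] that unfolding ev_lin by (auto simp: D_def)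
    have d: "cs a x + cs b y \<in> D" using 1 by (simp add: D_def)
    have "ev (A (cs a x + cs b y)) = ev (cs a (A x) + cs b (A y))"
      unfolding evA[OF d] 2 by (simp add: fun_eq_iff evA[OF that(1)] evA[OF that(2)])
    thus ?thesis using d ev_inject by blast
  qed
  have "sa (sec N) D A"
    unfolding sa_def
  proof (intro conjI ballI allI impI)
    show "D \<subseteq> sec N" using sub l2_sec by (auto simp: D_def)
    have "(0 :: cfg ell2) \<in> D" using z unfolding ev_zero by (simp add: D_def)
    moreover have "x + y \<in> D" if "x \<in> D" "y \<in> D" for x y using comb[OF that, of 1 1] by simp
    moreover have "cs a x \<in> D" if "x \<in> D" for a x using comb[OF that that, of a 0] by simp
    ultimately show "csub D" by (auto simp: csub_def)
    show "A (x + y) = A x + A y" if "x \<in> D" "y \<in> D" for x y using comb[OF that, of 1 1] by simp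
    show "A (cs a x) = cs a (A x)" if "x \<in> D" for a x using comb[OF that that, of a 0] by simp
    show "sec N \<subseteq> closure D"
    proof
      fix x assume x: "x \<in> sec N"
      show "x \<in> closure D" unfolding closure_approachable
      proof (intro allI impI)
        fix e :: real assume "e > 0"
        then obtain \<phi> where p: "\<phi> \<in> fst H" "norm_l2 (\<lambda>c. ev x c - \<phi> c) < e" using dense[of "ev x" e] x l2_sec by blast
        then obtain y where "y \<in> D" "\<phi> = ev y" using fH by blast
        thus "\<exists>y\<in>D. dist y x < e" using p(2) unfolding \<open>\<phi> = ev y\<close> ev_diff norm_l2_ev by (metis dist_commute dist_norm)
      qed
    qed
    show "A ` D \<subseteq> sec N"
    proof
      fix y assume "y \<in> A ` D"
      then obtain x where "x \<in> D" "y = A x" by blast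
      thus "y \<in> sec N" using im[of "ev x"] evA[of x] l2_sec[of y N] by (auto simp: D_def)
    qed
    show "cinner x (A y) = cinner (A x) y" if "x \<in> D" "y \<in> D" for x y
      using sym[of "ev x" "ev y"] that unfolding inner_l2_ev[symmetric] evA[OF that(1)] evA[OF that(2)] by (simp add: D_def)
    fix x h assume x: "x \<in> sec N" and h: "h \<in> sec N" and e: "\<forall>y\<in>D. cinner x (A y) = cinner h y"
    have "ev x \<in> fst H"
    proof (rule max[of "ev x" "ev h"])
      show "ev x \<in> l2 N" "ev h \<in> l2 N" using x h l2_sec by auto
      fix \<psi> assume "\<psi> \<in> fst H"
      then obtain y where y: "y \<in> D" "\<psi> = ev y" using fH by blast
      thus "inner_l2 (ev x) (snd H \<psi>) = inner_l2 (ev h) \<psi>" using e evA[OF y(1)] by (metis inner_l2_ev)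
    qed
    thus "x \<in> D" by (simp add: D_def)
  qed
  thus thesis using rep that by blast
qed

lemma resolv_repr:
  assumes r: "repr_op H D A" and A: "sa (sec N) D A" and z: "Im z \<noteq> 0" and x: "x \<in> D" "A x - cs z x = y"
  shows "resolv H z (ev y) = ev x"
  unfolding resolv_def
proof (rule the_equality)
  have f: "fst H = ev ` D" and s: "\<And>x. x \<in> D \<Longrightarrow> snd H (ev x) = ev (A x)" using r by (auto simp: repr_op_def)
  show "ev x \<in> fst H \<and> (\<lambda>c. snd H (ev x) c - z * ev x c) = ev y"
    using x f by (simp add: s ev_diff_cs)
  fix \<phi> assume p: "\<phi> \<in> fst H \<and> (\<lambda>c. snd H \<phi> c - z * \<phi> c) = ev y"
  then obtain u where u: "u \<in> D" "\<phi> = ev u" using f by blast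
  have "ev (A u - cs z u) = ev y" using p u by (simp add: s ev_diff_cs)
  hence "A u - cs z u = y" by (simp add: ev_inject)
  moreover have "A (u - x) - cs z (u - x) = (A u - cs z u) - (A x - cs z x)"
    unfolding sa_diff[OF A u(1) x(1)] by (simp add: cs_add)
  ultimately have "A (u - x) - cs z (u - x) = 0" using x by simp
  hence "\<bar>Im z\<bar> * norm (u - x) \<le> 0" using sa_bound_nonreal[OF A csubD(6)[OF saD(2)[OF A] u(1) x(1)], of z] by simp
  hence "u = x" using z by (simp add: mult_le_0_iff)
  thus "\<phi> = ev x" using u by simp
qed

text \<open>Resolvents are replaced by solutions of one and the same equation, which for nonreal
  \<open>z\<close> exist and are unique; limits can then be discussed without inverses.\<close>

lemma srs_conv_repr:
  assumes rn: "\<And>n. repr_op (Hs n) (Dn n) (An n)" and An: "\<And>n. sa (sec N) (Dn n) (An n)"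
    and r: "repr_op H D A" and A: "sa (sec N) D A"
  shows "srs_conv N Hs H \<longleftrightarrow> (\<forall>z u x. Im z \<noteq> 0 \<longrightarrow> (\<forall>n. u n \<in> Dn n) \<longrightarrow> x \<in> D \<longrightarrow>
     (\<forall>n. An n (u n) - cs z (u n) = A x - cs z x) \<longrightarrow> u \<longlonglongrightarrow> x)"
proof
  assume s: "srs_conv N Hs H"
  show "\<forall>z u x. Im z \<noteq> 0 \<longrightarrow> (\<forall>n. u n \<in> Dn n) \<longrightarrow> x \<in> D \<longrightarrow>
     (\<forall>n. An n (u n) - cs z (u n) = A x - cs z x) \<longrightarrow> u \<longlonglongrightarrow> x"
  proof (intro allI impI)
    fix z :: complex and u x assume z: "Im z \<noteq> 0" and u: "\<forall>n. u n \<in> Dn n" and x: "x \<in> D" and e: "\<forall>n. An n (u n) - cs z (u n) = A x - cs z x"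
    let ?y = "A x - cs z x"
    have "?y \<in> sec N" using saD(1,6)[OF A] x csubD(3,6)[OF csub_supp_in] by blast
    hence "ev ?y \<in> l2 N" by (simp add: l2_sec)
    hence "(\<lambda>n. norm_l2 (\<lambda>c. resolv (Hs n) z (ev ?y) c - resolv H z (ev ?y) c)) \<longlonglongrightarrow> 0"
      using s z unfolding srs_conv_def by blast
    moreover have "resolv (Hs n) z (ev ?y) = ev (u n)" for n using resolv_repr[OF rn An z, of "u n" n ?y] u e by simp
    moreover have "resolv H z (ev ?y) = ev x" using resolv_repr[OF r A z x] by simp
    ultimately have "(\<lambda>n. norm (u n - x)) \<longlonglongrightarrow> 0" by (simp add: ev_diff norm_l2_ev)
    thus "u \<longlonglongrightarrow> x" by (simp add: LIM_zero_iff tendsto_norm_zero_iff)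
  qed
next
  assume c: "\<forall>z u x. Im z \<noteq> 0 \<longrightarrow> (\<forall>n. u n \<in> Dn n) \<longrightarrow> x \<in> D \<longrightarrow>
     (\<forall>n. An n (u n) - cs z (u n) = A x - cs z x) \<longrightarrow> u \<longlonglongrightarrow> x"
  show "srs_conv N Hs H"
    unfolding srs_conv_def l2_image ball_simps
  proof (intro allI impI ballI)
    fix z :: complex and y assume z: "Im z \<noteq> 0" and y: "y \<in> sec N"
    obtain x where x: "x \<in> D" "A x - cs z x = y" using sa_surj_nonreal[OF csub_supp_in closed_supp_in A z y] by blast
    have "\<forall>n. \<exists>u\<in>Dn n. An n u - cs z u = y" using sa_surj_nonreal[OF csub_supp_in closed_supp_in An z y] by blast
    then obtain u where u: "\<And>n. u n \<in> Dn n" "\<And>n. An n (u n) - cs z (u n) = y" by metis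
    have "u \<longlonglongrightarrow> x" using c z u x by blast
    hence "(\<lambda>n. norm (u n - x)) \<longlonglongrightarrow> 0" by (simp add: LIM_zero_iff tendsto_norm_zero_iff)
    moreover have "resolv (Hs n) z (ev y) = ev (u n)" for n by (rule resolv_repr[OF rn An z u])
    moreover have "resolv H z (ev y) = ev x" by (rule resolv_repr[OF r A z x])
    ultimately show "(\<lambda>n. norm_l2 (\<lambda>c. resolv (Hs n) z (ev y) c - resolv H z (ev y) c)) \<longlonglongrightarrow> 0"
      by (simp add: ev_diff norm_l2_ev)
  qed
qed

lemma spectrum_repr:
  assumes r: "repr_op H D A"
  shows "complex_of_real t \<in> spectrum_op N H \<longleftrightarrow> \<not> ((\<forall>y\<in>sec N. \<exists>x\<in>D. A x - t *\<^sub>R x = y) \<and> (\<exists>C. \<forall>x\<in>D. norm x \<le> C * norm (A x - t *\<^sub>R x)))"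
proof -
  have f: "fst H = ev ` D" and s: "\<And>x. x \<in> D \<Longrightarrow> snd H (ev x) = ev (A x)" using r by (auto simp: repr_op_def)
  have e: "(\<lambda>c. snd H (ev x) c - complex_of_real t * ev x c) = ev (A x - t *\<^sub>R x)" if "x \<in> D" for x
    using s[OF that] by (simp add: fun_eq_iff)
  show ?thesis unfolding spectrum_op_def mem_Collect_eq l2_image f ball_simps bex_simps
    by (simp add: e norm_l2_ev ev_inject cong: ball_cong bex_cong)
qed

text \<open>Every number below a form bound is in the resolvent set, and the largest form bound is a
  spectral point. That point lies between \<open>c\<close> and \<open>s\<close>, hence so does the
  infimum.\<close>

lemma spectrum_inf_bounds:
  assumes r: "repr_op H D A" and A: "sa (sec N) D A"
    and low: "\<And>x. x \<in> D \<Longrightarrow> c * (norm x)\<^sup>2 \<le> inner x (A x)"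
    and up: "\<And>s'. s' > s \<Longrightarrow> \<exists>x\<in>D. inner x (A x) < s' * (norm x)\<^sup>2"
  shows "c \<le> Inf {x. complex_of_real x \<in> spectrum_op N H}" "Inf {x. complex_of_real x \<in> spectrum_op N H} \<le> s"
proof -
  let ?S = "{x. complex_of_real x \<in> spectrum_op N H}"
  have lower: "b \<le> t" if t: "t \<in> ?S" and b: "\<And>x. x \<in> D \<Longrightarrow> b * (norm x)\<^sup>2 \<le> inner x (A x)" for b t
  proof (rule ccontr)
    assume "\<not> b \<le> t"
    hence tb: "t < b" by simp
    have "\<forall>y\<in>sec N. \<exists>x\<in>D. A x - t *\<^sub>R x = y"
      using sa_surj_below[OF csub_supp_in closed_supp_in A b tb] by blast
    moreover have "norm x \<le> 1 / (b - t) * norm (A x - t *\<^sub>R x)" if "x \<in> D" for x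
      using sa_bound_below[OF A that b[OF that], of t] tb by (simp add: pos_le_divide_eq mult.commute)
    ultimately show False using t spectrum_repr[OF r, of t N] by blast
  qed
  define T where "T = {b. \<forall>x\<in>D. b * (norm x)\<^sup>2 \<le> inner x (A x)}"
  have cT: "c \<in> T" using low by (simp add: T_def)
  have bT: "b \<le> s" if "b \<in> T" for b
  proof (rule ccontr)
    assume "\<not> b \<le> s"
    then obtain x where "x \<in> D" "inner x (A x) < b * (norm x)\<^sup>2" using up[of b] by auto
    thus False using that by (force simp: T_def)
  qed
  have bdd: "bdd_above T" using bT by (rule bdd_aboveI)
  define E where "E = Sup T"
  have ET: "E * (norm x)\<^sup>2 \<le> inner x (A x)" if x: "x \<in> D" for x
  proof (cases "x = 0")
    case False
    have "E \<le> inner x (A x) / (norm x)\<^sup>2" unfolding E_def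
      using cT x False by (intro cSup_least) (auto simp: T_def pos_le_divide_eq)
    thus ?thesis using False by (simp add: pos_le_divide_eq)
  qed simp
  have cE: "c \<le> E" unfolding E_def by (rule cSup_upper[OF cT bdd])
  have Es: "E \<le> s" unfolding E_def using cT bT by (intro cSup_least) auto
  have ES: "E \<in> ?S"
  proof (rule ccontr)
    assume "E \<notin> ?S"
    then obtain C where sj: "\<forall>y\<in>sec N. \<exists>x\<in>D. A x - E *\<^sub>R x = y" and C: "\<forall>x\<in>D. norm x \<le> C * norm (A x - E *\<^sub>R x)"
      using spectrum_repr[OF r, of E N] by auto
    \<comment> \<open>Enlarged to be positive, as \<open>sa_not_bounded_inverse_at_inf\<close>
      requires.\<close>
    define C' where "C' = max C 1"
    have C': "norm x \<le> C' * norm (A x - E *\<^sub>R x)" if "x \<in> D" for x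
      using C that mult_right_mono[of C C' "norm (A x - E *\<^sub>R x)"] by (force simp: C'_def)
    have "E + 1 / C' \<in> T" unfolding T_def
      using sa_not_bounded_inverse_at_inf[OF A ET _ C'] sj by (auto simp: C'_def)
    hence "E + 1 / C' \<le> E" unfolding E_def by (intro cSup_upper bdd)
    thus False by (simp add: C'_def)
  qed
  have "bdd_below ?S" using lower[OF _ low] by (intro bdd_belowI[of _ c]) blast
  thus "Inf ?S \<le> s" using cInf_lower[OF ES] Es by linarith
  show "c \<le> Inf ?S" using ES lower[OF _ low] by (intro cInf_greatest) auto
qed

section \<open>The cut-off Hamiltonians as self-adjoint operators on a sector\<close>

definition Dkin :: "real \<Rightarrow> real \<Rightarrow> nat \<Rightarrow> cfg ell2 set" where "Dkin M L N = sec N \<inter> domf (kin M L)"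
definition Acut :: "real \<Rightarrow> real \<Rightarrow> real \<Rightarrow> nat \<Rightarrow> cfg ell2 \<Rightarrow> cfg ell2" where
  "Acut M L EB n x = mulf (kin M L) x + (- gcoup M L EB n) *\<^sub>R CC (ball_lat L (real n)) (AA (ball_lat L (real n)) x)"

lemma sa_Acut: "sa (sec (Suc N)) (Dkin M L (Suc N)) (Acut M L EB n)"
proof -
  let ?B = "ball_lat L (real n)" and ?g = "- gcoup M L EB n"
  have "sa (sec (Suc N)) (sec (Suc N) \<inter> domf (kin M L)) (\<lambda>x. mulf (kin M L) x + ?g *\<^sub>R CC ?B (AA ?B x))"
  proof (rule sa_diag_plus_bounded)
    show "?g *\<^sub>R CC ?B (AA ?B (x + y)) = ?g *\<^sub>R CC ?B (AA ?B x) + ?g *\<^sub>R CC ?B (AA ?B y)" for x y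
      by (simp only: AA_lin CC_lin scaleR_add_right)
    show "?g *\<^sub>R CC ?B (AA ?B (cs a x)) = cs a (?g *\<^sub>R CC ?B (AA ?B x))" for a x
      unfolding AA_lin CC_lin by (rule ell2_eqI) simp
    show "?g *\<^sub>R CC ?B (AA ?B x) \<in> sec (Suc N)" if "x \<in> sec (Suc N)" for x
      using csubD(4)[OF csub_supp_in CC_sec[OF AA_sec[OF that]]] .
    show "inner x (?g *\<^sub>R CC ?B (AA ?B y)) = inner (?g *\<^sub>R CC ?B (AA ?B x)) y" for x y
      by (simp add: inner_CC inner_AA[symmetric])
  qed
  thus ?thesis by (simp only: Dkin_def Acut_def[abs_def])
qed

lemma repr_Hn: "repr_op (Hn M L EB (Suc N) n) (Dkin M L (Suc N)) (Acut M L EB n)"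
  unfolding repr_op_def
proof (intro conjI ballI)
  have "ev x \<in> fst (Hn M L EB (Suc N) n) \<longleftrightarrow> x \<in> Dkin M L (Suc N)" for x
  proof -
    have "(\<lambda>c. complex_of_real (kin M L c) * ev x c) \<in> l2 (Suc N) \<longleftrightarrow> x \<in> domf (kin M L)" if "x \<in> sec (Suc N)"
      using supp_inD[OF that] by (auto simp: l2_def domf_def)
    thus ?thesis by (auto simp: Hn_def Dkin_def l2_sec)
  qed
  moreover have "fst (Hn M L EB (Suc N) n) \<subseteq> l2 (Suc N)" by (auto simp: Hn_def)
  ultimately show "fst (Hn M L EB (Suc N) n) = ev ` Dkin M L (Suc N)"
    unfolding l2_image by blast
  fix x assume x: "x \<in> Dkin M L (Suc N)"
  hence xs: "x \<in> sec (Suc N)" and xd: "x \<in> domf (kin M L)" by (auto simp: Dkin_def)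
  have As: "Acut M L EB n x \<in> sec (Suc N)" using saD(6)[OF sa_Acut x] .
  show "snd (Hn M L EB (Suc N) n) (ev x) = ev (Acut M L EB n x)"
  proof (rule ext)
    fix c show "snd (Hn M L EB (Suc N) n) (ev x) c = ev (Acut M L EB n x) c"
    proof (cases "c \<in> Cfg (Suc N)")
      case True
      thus ?thesis by (simp add: Hn_def Acut_def ev_mulf[OF xd] ev_CC_AA)
    next
      case False
      thus ?thesis using supp_inD[OF As False] by (simp add: Hn_def)
    qed
  qed
qed

section \<open>Convergence over momentum balls\<close>

lemma ball_lat_mono: "r \<le> s \<Longrightarrow> ball_lat L r \<subseteq> ball_lat L s" by (auto simp: ball_lat_def)

lemma finite_subset_ball_lat:
  assumes "finite F" shows "\<exists>n0. \<forall>n\<ge>n0. F \<subseteq> ball_lat L (real n)"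
proof -
  define R where "R = (\<Sum>k\<in>F. msq L k)"
  obtain n0 :: nat where n0: "R \<le> real n0" using real_arch_simple by blast
  have "k \<in> ball_lat L (real n)" if "k \<in> F" "n \<ge> n0" for k n
    using member_le_sum[of k F "msq L"] that assms n0 by (auto simp: ball_lat_def R_def)
  thus ?thesis by blast
qed

lemma sum_ball_lat_tendsto:
  fixes f :: "lat \<Rightarrow> real"
  assumes L: "L > 0" and f: "f summable_on UNIV"
  shows "(\<lambda>n. \<Sum>k\<in>ball_lat L (real n). f k) \<longlonglongrightarrow> infsum f UNIV"
proof -
  have "(sum f \<longlongrightarrow> infsum f UNIV) (finite_subsets_at_top UNIV)"
    using has_sum_infsum[OF f] by (simp add: has_sum_def)
  moreover have "filterlim (\<lambda>n. ball_lat L (real n)) (finite_subsets_at_top UNIV) sequentially"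
    unfolding filterlim_finite_subsets_at_top
  proof (intro allI impI)
    fix X :: "lat set" assume "finite X \<and> X \<subseteq> UNIV"
    then obtain n0 where "\<forall>n\<ge>n0. X \<subseteq> ball_lat L (real n)" using finite_subset_ball_lat by blast
    thus "\<forall>\<^sub>F n in sequentially. finite (ball_lat L (real n)) \<and> X \<subseteq> ball_lat L (real n) \<and> ball_lat L (real n) \<subseteq> UNIV"
      using L by (auto simp: eventually_sequentially)
  qed
  ultimately show ?thesis by (rule filterlim_compose)
qed

lemma one_plus_msq_ge:
  assumes L: "L > 0" shows "\<exists>a>0. \<forall>k. a * (1 + nu k) \<le> 1 + msq L k"
proof (intro exI conjI allI)
  define a where "a = min 1 ((kap L)\<^sup>2)"
  show "a > 0" using kap_pos[OF L] by (simp add: a_def)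
  fix k
  have "a * nu k \<le> (kap L)\<^sup>2 * nu k" by (intro mult_right_mono) (auto simp: a_def)
  thus "a * (1 + nu k) \<le> 1 + msq L k" by (simp add: distrib_left msq_nu a_def add_mono)
qed

lemma summable_inv_sq_msq:
  assumes L: "L > 0" shows "(\<lambda>k. (1 / (1 + msq L k))\<^sup>2) summable_on UNIV"
proof -
  obtain a where a: "a > 0" "\<And>k. a * (1 + nu k) \<le> 1 + msq L k" using one_plus_msq_ge[OF L] by blast
  show ?thesis
  proof (rule nonneg_bounded_partial_sums_imp_summable_on[where C = "25 / a\<^sup>2"])
    show "\<forall>\<^sub>F F in finite_subsets_at_top UNIV. (\<Sum>k\<in>F. (1 / (1 + msq L k))\<^sup>2) \<le> 25 / a\<^sup>2"
    proof (rule eventually_finite_subsets_at_top_weakI)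
      fix F :: "lat set" assume F: "finite F"
      have "(\<Sum>k\<in>F. (1 / (1 + msq L k))\<^sup>2) \<le> (\<Sum>k\<in>F. 1 / a\<^sup>2 * (1 / (1 + nu k)\<^sup>2))"
      proof (rule sum_mono)
        fix k
        have "1 / (1 + msq L k) \<le> 1 / (a * (1 + nu k))" using a(1) a(2)[of k] by (intro divide_left_mono mult_pos_pos add_pos_nonneg) auto
        hence "(1 / (1 + msq L k))\<^sup>2 \<le> (1 / (a * (1 + nu k)))\<^sup>2" by (intro power_mono) auto
        thus "(1 / (1 + msq L k))\<^sup>2 \<le> 1 / a\<^sup>2 * (1 / (1 + nu k)\<^sup>2)" by (simp add: power_divide power_mult_distrib)
      qed
      also have "\<dots> = 1 / a\<^sup>2 * (\<Sum>k\<in>F. 1 / (1 + nu k)\<^sup>2)" by (simp add: sum_distrib_left)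
      also have "\<dots> \<le> 1 / a\<^sup>2 * 25" using lat_sum_inv_sq[OF F, of 1] by (intro mult_left_mono) auto
      finally show "(\<Sum>k\<in>F. (1 / (1 + msq L k))\<^sup>2) \<le> 25 / a\<^sup>2" by simp
    qed
  qed auto
qed

lemma Cauchy_inv_sq_msq:
  assumes L: "L > 0" and e: "e > 0"
  shows "\<exists>n0. \<forall>E. finite E \<longrightarrow> E \<inter> ball_lat L (real n0) = {} \<longrightarrow> (\<Sum>k\<in>E. (1 / (1 + msq L k))\<^sup>2) < e"
proof -
  let ?f = "\<lambda>k. (1 / (1 + msq L k))\<^sup>2"
  have s: "?f summable_on UNIV" by (rule summable_inv_sq_msq[OF L])
  have "(\<lambda>n. \<Sum>k\<in>ball_lat L (real n). ?f k) \<longlonglongrightarrow> infsum ?f UNIV" by (rule sum_ball_lat_tendsto[OF L s])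
  then obtain n0 where n0: "\<bar>(\<Sum>k\<in>ball_lat L (real n0). ?f k) - infsum ?f UNIV\<bar> < e"
    using LIMSEQ_D[OF _ e] by (metis order_refl real_norm_def)
  show ?thesis
  proof (intro exI allI impI)
    fix E :: "lat set" assume E: "finite E" "E \<inter> ball_lat L (real n0) = {}"
    have "(\<Sum>k\<in>E. ?f k) + (\<Sum>k\<in>ball_lat L (real n0). ?f k) = (\<Sum>k\<in>E \<union> ball_lat L (real n0). ?f k)"
      using E L by (simp add: sum.union_disjoint)
    also have "\<dots> \<le> infsum ?f UNIV" using E L by (intro finite_sum_le_infsum[OF s]) auto
    finally show "(\<Sum>k\<in>E. ?f k) < e" using n0 by (simp add: abs_less_iff)
  qed
qed

text \<open>At a configuration with \<open>Suc N\<close> fermions at most \<open>Suc N\<close>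
  summands are nonzero, so Cauchy-Schwarz costs the particle number and not the number of
  modes.\<close>

lemma norm2_sum_cre_le:
  assumes E: "finite E" and y: "\<And>l. l \<in> E \<Longrightarrow> y l \<in> sec N"
  shows "(norm (\<Sum>l\<in>E. cre l (y l)))\<^sup>2 \<le> real (Suc N) * (\<Sum>l\<in>E. (norm (y l))\<^sup>2)"
proof -
  have "((\<lambda>c. real (Suc N) * (\<Sum>l\<in>E. (cmod (ev (cre l (y l)) c))\<^sup>2)) has_sum (real (Suc N) * (\<Sum>l\<in>E. (norm (cre l (y l)))\<^sup>2))) UNIV"
    by (intro has_sum_cmult_right has_sum_finite_sum E norm2_has_sum)
  hence "(norm (\<Sum>l\<in>E. cre l (y l)))\<^sup>2 \<le> real (Suc N) * (\<Sum>l\<in>E. (norm (cre l (y l)))\<^sup>2)"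
  proof (rule has_sum_mono[OF norm2_has_sum])
    fix c
    show "(cmod (ev (\<Sum>l\<in>E. cre l (y l)) c))\<^sup>2 \<le> real (Suc N) * (\<Sum>l\<in>E. (cmod (ev (cre l (y l)) c))\<^sup>2)"
    proof (cases "c \<in> Cfg (Suc N)")
      case True
      hence fc: "finite (snd c)" "card (snd c) = Suc N" by (auto simp: Cfg_def)
      let ?G = "E \<inter> snd c" and ?t = "\<lambda>l. ev (cre l (y l)) c"
      have z: "?t l = 0" if "l \<notin> snd c" for l using that by (simp add: ev_cre cref_def)
      have "cmod (ev (\<Sum>l\<in>E. cre l (y l)) c) = cmod (\<Sum>l\<in>?G. ?t l)"
        unfolding ev_sum using E z by (intro arg_cong[of _ _ cmod] sum.mono_neutral_right) auto
      also have "\<dots> \<le> (\<Sum>l\<in>?G. 1 * cmod (?t l))" using norm_sum[of ?t ?G] by simp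
      finally have "(cmod (ev (\<Sum>l\<in>E. cre l (y l)) c))\<^sup>2 \<le> (\<Sum>l\<in>?G. 1 * cmod (?t l))\<^sup>2" by (intro power_mono) auto
      also have "\<dots> \<le> (\<Sum>l\<in>?G. 1\<^sup>2) * (\<Sum>l\<in>?G. (cmod (?t l))\<^sup>2)" by (rule Cauchy_Schwarz_ineq_sum)
      also have "\<dots> \<le> real (Suc N) * (\<Sum>l\<in>E. (cmod (?t l))\<^sup>2)"
      proof (rule mult_mono)
        have "card ?G \<le> Suc N" using card_mono[OF fc(1), of ?G] fc(2) by simp
        thus "(\<Sum>l\<in>?G. 1\<^sup>2) \<le> real (Suc N)" by simp
        show "(\<Sum>l\<in>?G. (cmod (?t l))\<^sup>2) \<le> (\<Sum>l\<in>E. (cmod (?t l))\<^sup>2)" using E by (intro sum_mono2) auto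
      qed (auto intro: sum_nonneg)
      finally show ?thesis .
    next
      case False
      have "ev (cre l (y l)) c = 0" if "l \<in> E" for l using supp_inD[OF cre_sec[OF y[OF that]] False] .
      thus ?thesis by (simp add: ev_sum)
    qed
  qed
  also have "\<dots> \<le> real (Suc N) * (\<Sum>l\<in>E. (norm (y l))\<^sup>2)"
  proof (intro mult_left_mono sum_mono)
    fix l assume "l \<in> E"
    hence "y l \<in> Fin" using y sec_Fin by blast
    hence "(norm (CC {l} (y l)))\<^sup>2 \<le> card {l} * (norm (y l))\<^sup>2" by (intro norm_CC_le) auto
    thus "(norm (cre l (y l)))\<^sup>2 \<le> (norm (y l))\<^sup>2" by (simp add: CC_def)
  qed auto
  finally show ?thesis .
qed

text \<open>Additivity turns the increment between two balls into a value of \<open>F\<close> on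
  their difference, which is controlled by the tail of a convergent lattice sum.\<close>

lemma Cauchy_by_sets:
  fixes F :: "lat set \<Rightarrow> 'a::real_normed_vector"
  assumes L: "L > 0" and add: "\<And>A B. finite A \<Longrightarrow> finite B \<Longrightarrow> A \<inter> B = {} \<Longrightarrow> F (A \<union> B) = F A + F B"
    and C: "C \<ge> 0" and b: "\<And>E. finite E \<Longrightarrow> (norm (F E))\<^sup>2 \<le> C * (\<Sum>k\<in>E. (1 / (1 + msq L k))\<^sup>2)"
  shows "Cauchy (\<lambda>n. F (ball_lat L (real n)))"
proof (rule metric_CauchyI)
  fix e :: real assume e: "e > 0"
  hence "e\<^sup>2 / (4 * (C + 1)) > 0" using C by simp
  then obtain n0 where n0: "\<And>E. finite E \<Longrightarrow> E \<inter> ball_lat L (real n0) = {} \<Longrightarrow> (\<Sum>k\<in>E. (1 / (1 + msq L k))\<^sup>2) < e\<^sup>2 / (4 * (C + 1))"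
    using Cauchy_inv_sq_msq[OF L] by blast
  have d: "norm (F (ball_lat L (real n)) - F (ball_lat L (real n0))) < e / 2" if "n \<ge> n0" for n
  proof -
    let ?B = "ball_lat L (real n)" and ?A = "ball_lat L (real n0)"
    have "?B = ?A \<union> (?B - ?A)" using ball_lat_mono[of "real n0" "real n" L] that by auto
    hence "F ?B = F ?A + F (?B - ?A)" using add[of ?A "?B - ?A"] L by (metis Diff_disjoint finite_Diff finite_ball_lat)
    moreover have "(norm (F (?B - ?A)))\<^sup>2 \<le> C * (\<Sum>k\<in>?B - ?A. (1 / (1 + msq L k))\<^sup>2)" using L by (intro b) simp
    moreover have "C * (\<Sum>k\<in>?B - ?A. (1 / (1 + msq L k))\<^sup>2) \<le> C * (e\<^sup>2 / (4 * (C + 1)))"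
    proof (rule mult_left_mono[OF _ C])
      have "(?B - ?A) \<inter> ?A = {}" "finite (?B - ?A)" using L by auto
      thus "(\<Sum>k\<in>?B - ?A. (1 / (1 + msq L k))\<^sup>2) \<le> e\<^sup>2 / (4 * (C + 1))" using n0[of "?B - ?A"] by simp
    qed
    moreover have "C * (e\<^sup>2 / (4 * (C + 1))) < (e / 2)\<^sup>2" using C e by (simp add: field_simps power2_eq_square)
    ultimately have "(norm (F ?B - F ?A))\<^sup>2 < (e / 2)\<^sup>2" by simp
    thus ?thesis by (rule power_less_imp_less_base) (use e in simp)
  qed
  show "\<exists>M. \<forall>m\<ge>M. \<forall>n\<ge>M. dist (F (ball_lat L (real m))) (F (ball_lat L (real n))) < e"
  proof (intro exI allI impI)
    fix m n assume "m \<ge> n0" "n \<ge> n0"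
    thus "dist (F (ball_lat L (real m))) (F (ball_lat L (real n))) < e"
      using d[of m] d[of n] dist_triangle_half_l[of "F (ball_lat L (real m))" "F (ball_lat L (real n0))" e "F (ball_lat L (real n))"]
      by (simp add: dist_norm norm_minus_commute)
  qed
qed

lemma convergent_sum_cre:
  assumes L: "L > 0" and y: "\<And>l. y l \<in> sec N" and b: "\<And>l. norm (y l) \<le> b / (1 + msq L l)"
  shows "convergent (\<lambda>n. \<Sum>l\<in>ball_lat L (real n). cre l (y l))"
proof -
  have "Cauchy (\<lambda>n. \<Sum>l\<in>ball_lat L (real n). cre l (y l))"
  proof (rule Cauchy_by_sets[OF L, where C = "real (Suc N) * b\<^sup>2"])
    fix E :: "lat set" assume E: "finite E"
    have "(norm (\<Sum>l\<in>E. cre l (y l)))\<^sup>2 \<le> real (Suc N) * (\<Sum>l\<in>E. (norm (y l))\<^sup>2)"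
      by (rule norm2_sum_cre_le[OF E y])
    also have "\<dots> \<le> real (Suc N) * (\<Sum>l\<in>E. b\<^sup>2 * (1 / (1 + msq L l))\<^sup>2)"
    proof (intro mult_left_mono sum_mono)
      fix l
      have "(norm (y l))\<^sup>2 \<le> (b / (1 + msq L l))\<^sup>2" using b by (intro power_mono) auto
      thus "(norm (y l))\<^sup>2 \<le> b\<^sup>2 * (1 / (1 + msq L l))\<^sup>2" by (simp add: power_divide)
    qed auto
    finally show "(norm (\<Sum>l\<in>E. cre l (y l)))\<^sup>2 \<le> real (Suc N) * b\<^sup>2 * (\<Sum>k\<in>E. (1 / (1 + msq L k))\<^sup>2)"
      by (simp add: sum_distrib_left mult.assoc)
  qed (auto simp: sum.union_disjoint)
  thus ?thesis using Cauchy_convergent_iff by blast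
qed

lemma norm_le_of_dominated:
  assumes "\<And>c. cmod (ev x c) \<le> cmod (ev y c)" shows "norm x \<le> norm y"
proof -
  have "(norm x)\<^sup>2 \<le> (norm y)\<^sup>2"
    by (rule has_sum_mono[OF norm2_has_sum norm2_has_sum]) (use assms in \<open>auto intro: power_mono\<close>)
  thus ?thesis by simp
qed

text \<open>Dominated convergence: outside a finite set of coordinates the difference is dominated
  by the tail of \<open>2 *\<^sub>R mulf g w\<close>, inside it pointwise convergence
  suffices.\<close>

lemma mulf_dominated_tendsto:
  fixes f :: "nat \<Rightarrow> 'a \<Rightarrow> real"
  assumes w: "w \<in> domf g" and d: "\<And>n c. \<bar>f n c\<bar> \<le> g c" and l: "\<And>c. (\<lambda>n. f n c) \<longlonglongrightarrow> f0 c"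
  shows "(\<lambda>n. mulf (f n) w) \<longlonglongrightarrow> mulf f0 w"
proof -
  have g0: "g c \<ge> 0" for c using d[of 0 c] by (meson abs_ge_zero order_trans)
  have d0: "\<bar>f0 c\<bar> \<le> g c" for c
    using LIMSEQ_le_const2[OF tendsto_rabs[OF l[of c]], of "g c"] d by blast
  have dom: "w \<in> domf (f n)" "w \<in> domf f0" for n
    using domf_dominated[OF w] d d0 g0 by (simp_all add: abs_of_nonneg)
  have ev0: "ev (mulf (f n) w - mulf f0 w) c = complex_of_real (f n c - f0 c) * ev w c" for n c
    using dom by (simp add: ev_mulf left_diff_distrib)
  show ?thesis
  proof (rule metric_LIMSEQ_I)
    fix e :: real assume e: "e > 0"
    define y where "y = 2 *\<^sub>R mulf g w"
    have evy: "ev y c = complex_of_real (2 * g c) * ev w c" for c using w by (simp add: y_def ev_mulf)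
    obtain F where F: "finite F" "norm (y - trunc F y) < e / 2" using trunc_approx[of "e/2" y] e by auto
    have "(\<lambda>n. \<Sum>c\<in>F. cmod (complex_of_real (f n c - f0 c) * ev w c)) \<longlonglongrightarrow> (\<Sum>c\<in>F. cmod (complex_of_real (f0 c - f0 c) * ev w c))"
      by (intro tendsto_intros l)
    hence "(\<lambda>n. \<Sum>c\<in>F. cmod (complex_of_real (f n c - f0 c) * ev w c)) \<longlonglongrightarrow> 0" by simp
    then obtain n0 where n0: "\<And>n. n \<ge> n0 \<Longrightarrow> norm ((\<Sum>c\<in>F. cmod (complex_of_real (f n c - f0 c) * ev w c)) - 0) < e / 2"
      using LIMSEQ_D[of "\<lambda>n. \<Sum>c\<in>F. cmod (complex_of_real (f n c - f0 c) * ev w c)" 0 "e/2"] e by auto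
    show "\<exists>no. \<forall>n\<ge>no. dist (mulf (f n) w) (mulf f0 w) < e"
    proof (intro exI allI impI)
      fix n assume n: "n \<ge> n0"
      let ?x = "mulf (f n) w - mulf f0 w"
      have "norm (trunc F ?x) \<le> (\<Sum>c\<in>F. cmod (ev ?x c))"
      proof -
        have "trunc F ?x = (\<Sum>c\<in>F. cs (ev ?x c) (unit c))"
          using F(1) by (intro ell2_eqI) (simp add: ev_sum if_distrib cong: if_cong)
        moreover have "norm (unit c :: 'a ell2) = 1" for c
        proof -
          have "(norm (unit c :: 'a ell2))\<^sup>2 = 1" using cinner_unit[of "unit c" c] by (simp add: cinner_self flip: of_real_power)
          thus ?thesis using norm_ge_zero[of "unit c :: 'a ell2"] power2_eq_1_iff[of "norm (unit c :: 'a ell2)"] by linarith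
        qed
        ultimately show ?thesis using norm_sum[of "\<lambda>c. cs (ev ?x c) (unit c)" F] by simp
      qed
      also have "\<dots> < e / 2" using n0[OF n]
        unfolding ev0 real_norm_def diff_zero by (rule order_le_less_trans[OF abs_ge_self])
      finally have 1: "norm (trunc F ?x) < e / 2" .
      have "norm (?x - trunc F ?x) \<le> norm (y - trunc F y)"
      proof (rule norm_le_of_dominated)
        fix c
        have "\<bar>f n c - f0 c\<bar> \<le> 2 * g c" using d[of n c] d0[of c] by linarith
        hence "cmod (ev ?x c) \<le> cmod (ev y c)"
          unfolding ev0 evy norm_mult norm_of_real using g0[of c] by (intro mult_right_mono) auto
        moreover have evd: "ev (u - trunc F u) c = (if c \<in> F then 0 else ev u c)" for u :: "'a ell2" by simp
        ultimately show "cmod (ev (?x - trunc F ?x) c) \<le> cmod (ev (y - trunc F y) c)"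
          unfolding evd by (cases "c \<in> F") (simp_all only: if_True if_False norm_zero order_refl)
      qed
      hence 2: "norm (?x - trunc F ?x) < e / 2" using F(2) by simp
      have "norm ?x \<le> norm (trunc F ?x) + norm (?x - trunc F ?x)" using norm_triangle_ineq[of "trunc F ?x" "?x - trunc F ?x"] by simp
      thus "dist (mulf (f n) w) (mulf f0 w) < e" using 1 2 by (simp add: dist_norm)
    qed
  qed
qed

text \<open>The two terms separately decay only like |k|^-2. Because \<open>mred M\<close> equals
  \<open>1 + 1 / M\<close>, the quadratic parts of their denominators agree; the numerator of the
  difference grows like |k| against |k|^4, which is summable in two dimensions.\<close>

lemma polaron_term_summable:
  assumes L: "L > 0" and M: "M > 0" and EB: "EB < 0" and th: "\<theta> > 0"
    and t: "\<And>k. P k \<Longrightarrow> \<theta> * (1 + msq L k) \<le> msq L (p - k) / M + msq L k + \<tau>" and fin: "finite {k. \<not> P k}"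
  shows "(\<lambda>k. 1 / (mred M * msq L k - EB) - (if P k then 1 / (msq L (p - k) / M + msq L k + \<tau>) else 0)) summable_on UNIV"
proof -
  let ?f = "\<lambda>k. 1 / (mred M * msq L k - EB) - (if P k then 1 / (msq L (p - k) / M + msq L k + \<tau>) else 0)"
  obtain a where a: "a > 0" "\<And>k. a * (1 + nu k) \<le> 1 + msq L k" using one_plus_msq_ge[OF L] by blast
  define q where "q = min 1 \<bar>EB\<bar>"
  have q: "q > 0" using EB by (simp add: q_def)
  have den1: "q * (1 + msq L k) \<le> mred M * msq L k - EB" for k
  proof -
    have "q * msq L k \<le> 1 * msq L k" by (intro mult_right_mono) (auto simp: q_def)
    also have "\<dots> \<le> mred M * msq L k" using M by (intro mult_right_mono) (auto simp: mred_def)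
    finally show ?thesis using EB by (simp add: distrib_left q_def)
  qed
  define A where "A = msq L p / M + 2 * sqrt (msq L p) * \<bar>kap L\<bar> / M + \<bar>\<tau>\<bar> + \<bar>EB\<bar>"
  have A0: "A \<ge> 0" using M by (simp add: A_def)
  have bound: "\<bar>?f k\<bar> \<le> A / (q * \<theta> * a\<^sup>2) * (1 / ((1 + nu k) * sqrt (1 + nu k)))" if "P k" for k
  proof -
    let ?X = "mred M * msq L k - EB" and ?Y = "msq L (p - k) / M + msq L k + \<tau>"
    have o: "1 + msq L k > 0" by (simp add: add_pos_nonneg)
    have X: "?X > 0" using mred_msq_pos[OF M EB] .
    have Y: "?Y > 0" using t[OF that] th o by (smt (verit) mult_pos_pos)
    have num: "\<bar>?Y - ?X\<bar> \<le> A * sqrt (1 + nu k)"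
    proof -
      have "?Y - ?X = msq L p / M - 2 * dotl L p k / M + \<tau> + EB"
        by (simp add: msq_diff mred_def add_divide_distrib diff_divide_distrib distrib_right)
      hence "\<bar>?Y - ?X\<bar> \<le> msq L p / M + 2 * \<bar>dotl L p k\<bar> / M + \<bar>\<tau>\<bar> + \<bar>EB\<bar>"
      proof -
        have tri: "\<bar>u - v + x + y\<bar> \<le> u + w + \<bar>x\<bar> + \<bar>y\<bar>" if "0 \<le> u" "\<bar>v\<bar> \<le> w" for u v w x y :: real
          using that by linarith
        have "\<bar>2 * dotl L p k / M\<bar> \<le> 2 * \<bar>dotl L p k\<bar> / M" using M by (simp add: abs_mult)
        moreover have "0 \<le> msq L p / M" using M by simp
        ultimately show ?thesis using \<open>?Y - ?X = _\<close> tri by (simp only:)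
      qed
      also have "2 * \<bar>dotl L p k\<bar> / M \<le> 2 * (sqrt (msq L p) * sqrt (msq L k)) / M"
        using dotl_abs_le[of L p k] M by (intro divide_right_mono) auto
      also have "sqrt (msq L k) = \<bar>kap L\<bar> * sqrt (nu k)" by (simp add: msq_nu real_sqrt_mult)
      also have "msq L p / M + 2 * (sqrt (msq L p) * (\<bar>kap L\<bar> * sqrt (nu k))) / M + \<bar>\<tau>\<bar> + \<bar>EB\<bar>
        \<le> msq L p / M * sqrt (1 + nu k) + 2 * sqrt (msq L p) * \<bar>kap L\<bar> / M * sqrt (1 + nu k) + \<bar>\<tau>\<bar> * sqrt (1 + nu k) + \<bar>EB\<bar> * sqrt (1 + nu k)"
      proof (intro add_mono)
        have s1: "1 \<le> sqrt (1 + nu k)" by simp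
        show "msq L p / M \<le> msq L p / M * sqrt (1 + nu k)" using mult_left_mono[OF s1, of "msq L p / M"] M by simp
        show "\<bar>\<tau>\<bar> \<le> \<bar>\<tau>\<bar> * sqrt (1 + nu k)" using mult_left_mono[OF s1, of "\<bar>\<tau>\<bar>"] by simp
        show "\<bar>EB\<bar> \<le> \<bar>EB\<bar> * sqrt (1 + nu k)" using mult_left_mono[OF s1, of "\<bar>EB\<bar>"] by simp
        have "2 * sqrt (msq L p) * \<bar>kap L\<bar> / M * sqrt (nu k) \<le> 2 * sqrt (msq L p) * \<bar>kap L\<bar> / M * sqrt (1 + nu k)"
          using M by (intro mult_left_mono) auto
        thus "2 * (sqrt (msq L p) * (\<bar>kap L\<bar> * sqrt (nu k))) / M \<le> 2 * sqrt (msq L p) * \<bar>kap L\<bar> / M * sqrt (1 + nu k)" by (simp add: mult.assoc)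
      qed
      also have "\<dots> = A * sqrt (1 + nu k)" by (simp add: A_def distrib_right)
      finally show ?thesis by simp
    qed
    have den: "q * \<theta> * a\<^sup>2 * (1 + nu k)\<^sup>2 \<le> ?X * ?Y"
    proof -
      have "(q * (a * (1 + nu k))) * (\<theta> * (a * (1 + nu k))) \<le> (q * (1 + msq L k)) * (\<theta> * (1 + msq L k))"
        using a q th by (intro mult_mono mult_left_mono mult_nonneg_nonneg) (auto simp: add_nonneg_nonneg)
      also have "\<dots> \<le> ?X * ?Y" using den1[of k] t[OF that] q th X by (intro mult_mono) (auto simp: add_nonneg_nonneg)
      finally show ?thesis by (simp add: power2_eq_square mult_ac)
    qed
    have "\<bar>?f k\<bar> = \<bar>?Y - ?X\<bar> / (?X * ?Y)"
    proof -
      have "?f k = (?Y - ?X) / (?X * ?Y)" using that X Y by (simp add: diff_frac_eq)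
      thus ?thesis using X Y by (simp only: abs_divide abs_mult abs_of_pos)
    qed
    also have "\<dots> \<le> (A * sqrt (1 + nu k)) / (q * \<theta> * a\<^sup>2 * (1 + nu k)\<^sup>2)"
      using num den A0 q th a by (intro frac_le mult_pos_pos zero_less_power) (auto simp: add_pos_nonneg)
    also have "\<dots> = A / (q * \<theta> * a\<^sup>2) * (sqrt (1 + nu k) / (1 + nu k)\<^sup>2)" by simp
    also have "sqrt (1 + nu k) / (1 + nu k)\<^sup>2 = 1 / ((1 + nu k) * sqrt (1 + nu k))"
    proof -
      have gen: "s / (s\<^sup>2)\<^sup>2 = 1 / (s\<^sup>2 * s)" if "s > 0" for s :: real using that by (simp add: power2_eq_square)
      have "sqrt (1 + nu k) > 0" "(sqrt (1 + nu k))\<^sup>2 = 1 + nu k" by (auto simp: add_pos_nonneg)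
      thus ?thesis using gen[of "sqrt (1 + nu k)"] by simp
    qed
    finally show ?thesis .
  qed
  have "(\<lambda>k. 1 / ((1 + nu k) * sqrt (1 + nu k))) summable_on UNIV"
    by (rule nonneg_bounded_partial_sums_imp_summable_on[where C = 169])
       (use lat_sum_three_halves[of _ 1] in \<open>auto intro!: eventually_finite_subsets_at_top_weakI\<close>)
  hence "(\<lambda>k. A / (q * \<theta> * a\<^sup>2) * (1 / ((1 + nu k) * sqrt (1 + nu k)))) summable_on {k. P k}"
    using summable_on_subset_banach[OF summable_on_cmult_right] by blast
  hence "(\<lambda>k. norm (?f k)) summable_on {k. P k}"
    by (rule summable_on_comparison_test) (use bound in \<open>simp_all only: mem_Collect_eq real_norm_def abs_ge_zero\<close>)
  hence "?f summable_on {k. P k}" by (rule Infinite_Sum.abs_summable_summable)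
  moreover have "?f summable_on {k. \<not> P k}" using fin by (rule summable_on_finite)
  ultimately have "?f summable_on ({k. P k} \<union> {k. \<not> P k})" by (rule summable_on_Un_disjoint) auto
  moreover have "{k. P k} \<union> {k. \<not> P k} = UNIV" by auto
  ultimately show ?thesis by simp
qed

text \<open>\<open>b1\<close> makes the width used in \<open>cutoff_form_bound\<close> at most
  \<mu>, and \<open>b2\<close> makes it large against the perimeter term of the lattice
  count.\<close>

locale cutoff_model =
  fixes M L \<mu> EB b :: real
  assumes L: "L > 0" and M: "M > 1.225" and mu: "\<mu> > 0" and km: "(kap L)\<^sup>2 \<le> \<mu>"
    and EB: "EB < 0" "\<bar>EB\<bar> \<le> \<mu>"
    and b1: "1 \<le> (kap L)\<^sup>2 * (low_sum M L \<mu> EB - 5001 / (kap L)\<^sup>2)"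
    and b2: "(kap L)\<^sup>2 * (low_sum M L \<mu> EB - 5001 / (kap L)\<^sup>2) \<le> b * sqrt (\<mu> / (kap L)\<^sup>2)"
begin

definition ecut where "ecut = E0 L \<mu> - elow M L \<mu> EB b"
definition NN where "NN = Nmu L \<mu> - 1"
text \<open>Cut-offs are shifted so that every ball contains the modes up to 10 \<mu>; a finite
  shift does not change the limit.\<close>

definition n0 :: nat where "n0 = nat \<lceil>10 * \<mu>\<rceil>"
abbreviation "Dk \<equiv> Dkin M L (Suc NN)"
definition "An n = Acut M L EB (n + n0)"
definition "Bn n = ball_lat L (real (n + n0))"
definition "g n = gcoup M L EB (n + n0)"

lemma M0: "M > 0" "M \<ge> 1" using M by auto
lemma k0: "(kap L)\<^sup>2 > 0" using kap_pos[OF L] by simp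

lemma Suc_NN: "Suc NN = Nmu L \<mu>" using Nmu_pos[OF L mu] by (simp add: NN_def)

lemma n0_ge: "10 * \<mu> \<le> real (n + n0)"
proof -
  have "10 * \<mu> \<le> real n0" using mu by (simp add: n0_def)
  thus ?thesis by simp
qed

lemma finite_Bn [simp]: "finite (Bn n)" using L by (simp add: Bn_def)

lemma Bn_sym: "k \<in> Bn n \<Longrightarrow> - k \<in> Bn n" by (simp add: Bn_def ball_lat_def)

lemma inv_g: "1 / g n = (\<Sum>k\<in>Bn n. 1 / (mred M * msq L k - EB))"
  by (simp add: g_def gcoup_def Bn_def)

lemma inv_g_gt: "1 / (kap L)\<^sup>2 < 1 / g n"
proof -
  have "low_sum M L \<mu> EB \<le> 1 / g n"
    unfolding inv_g low_sum_def
  proof (rule sum_mono2)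
    show "{k. msq L k \<le> 10 * \<mu>} \<subseteq> Bn n" using n0_ge[of n] by (auto simp: Bn_def ball_lat_def)
    show "0 \<le> 1 / (mred M * msq L k - EB)" for k using mred_msq_pos[OF M0(1) EB(1), of L k] by simp
  qed simp
  moreover have "0 < low_sum M L \<mu> EB - 5001 / (kap L)\<^sup>2" using b1 k0 by (smt (verit) mult_nonneg_nonpos)
  moreover have "1 / (kap L)\<^sup>2 < 5001 / (kap L)\<^sup>2" using k0 by (simp add: divide_strict_right_mono)
  ultimately show ?thesis by linarith
qed

lemma g_pos: "g n > 0"
proof -
  have "0 < 1 / (kap L)\<^sup>2" using k0 by simp
  hence "0 < 1 / g n" using inv_g_gt[of n] by linarith
  thus ?thesis by simp
qed

lemma saAn: "sa (sec (Suc NN)) Dk (An n)" unfolding An_def by (rule sa_Acut)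

lemma kin_form_has_sum: "x \<in> Dk \<Longrightarrow> ((\<lambda>c. kin M L c * (cmod (ev x c))\<^sup>2) has_sum inner x (mulf (kin M L) x)) UNIV"
proof -
  assume "x \<in> Dk"
  have cm: "Re (cnj z * z) = (cmod z)\<^sup>2" for z :: complex
    by (metis Re_complex_of_real complex_norm_square mult.commute)
  show ?thesis using inner_mulf_has_sum[of x "kin M L" x] \<open>x \<in> Dk\<close> by (simp only: cm Dkin_def IntD2)
qed

lemma An_form: "inner x (An n x) = inner x (mulf (kin M L) x) - g n * (norm (AA (Bn n) x))\<^sup>2"
  by (simp add: An_def Acut_def Bn_def g_def inner_diff_right power2_norm_eq_inner inner_AA)

lemma form_bound:
  assumes x: "x \<in> Dk"
  shows "(norm (AA (Bn n) x))\<^sup>2 \<le> (1 / g n - 1 / (kap L)\<^sup>2) * (inner x (mulf (kin M L) x) - ecut * (norm x)\<^sup>2)"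
  unfolding Bn_def g_def ecut_def
  by (rule cutoff_form_bound[OF L M mu km EB refl b1 b2 n0_ge])
     (use x kin_form_has_sum[OF x] in \<open>auto simp: Dkin_def Suc_NN\<close>)

text \<open>The slack of \<open>form_bound\<close> leaves a multiple of the squared norm of
  \<open>AA (Bn n) x\<close> in the energy. It will absorb errors of the form
  \<open>CC (Bn n) \<epsilon>\<close>: there is no bound on \<open>CC (Bn n)\<close> uniform in
  \<open>n\<close>, but paired with \<open>x\<close> such an error involves only
  \<open>AA (Bn n) x\<close>.\<close>

lemma low_slack:
  assumes x: "x \<in> Dk"
  shows "ecut * (norm x)\<^sup>2 + (g n)\<^sup>2 / (kap L)\<^sup>2 * (norm (AA (Bn n) x))\<^sup>2 \<le> inner x (An n x)"
proof -
  define Y where "Y = inner x (mulf (kin M L) x) - ecut * (norm x)\<^sup>2"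
  define P where "P = (norm (AA (Bn n) x))\<^sup>2"
  define k where "k = 1 / (kap L)\<^sup>2"
  have gp: "g n > 0" by (rule g_pos)
  have k: "k > 0" using k0 by (simp add: k_def)
  have gk: "0 < 1 - g n * k" using inv_g_gt[of n] gp by (simp add: k_def[symmetric] field_simps)
  have "P \<le> (1 / g n - k) * Y" using form_bound[OF x, of n] by (simp add: P_def Y_def k_def)
  hence "g n * P \<le> g n * ((1 / g n - k) * Y)" using gp by (intro mult_left_mono) auto
  also have "\<dots> = (1 - g n * k) * Y" using gp by (simp add: left_diff_distrib right_diff_distrib mult.assoc[symmetric])
  finally have 1: "g n * P \<le> (1 - g n * k) * Y" .
  have P0: "0 \<le> g n * P" using gp by (simp add: P_def)
  hence "0 \<le> (1 - g n * k) * Y" using 1 by linarith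
  hence Y0: "0 \<le> Y" using gk by (simp add: zero_le_mult_iff)
  have "(1 - g n * k) * Y \<le> 1 * Y" using Y0 gp k by (intro mult_right_mono) auto
  hence gPY: "g n * P \<le> Y" using 1 by simp
  have "g n * P + (g n * k) * (g n * P) \<le> g n * P + (g n * k) * Y" using gPY gp k by (intro add_left_mono mult_left_mono) auto
  also have "\<dots> \<le> (1 - g n * k) * Y + (g n * k) * Y" using 1 by simp
  also have "\<dots> = Y" by (simp add: algebra_simps)
  finally have "(g n)\<^sup>2 * k * P \<le> Y - g n * P" by (simp add: power2_eq_square mult_ac)
  thus ?thesis unfolding An_form Y_def P_def k_def by simp
qed

lemma low_An: "x \<in> Dk \<Longrightarrow> ecut * (norm x)\<^sup>2 \<le> inner x (An n x)"
proof -
  assume "x \<in> Dk"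
  moreover have "0 \<le> (g n)\<^sup>2 / (kap L)\<^sup>2 * (norm (AA (Bn n) x))\<^sup>2" by simp
  ultimately show ?thesis using low_slack[of x n] by linarith
qed

text \<open>A point below all cut-off spectra. Since \<open>- r\<close> is at least 1 and at least
  |E_B|, denominators are bounded below by \<open>1 + msq L k\<close> and compare with those of the
  coupling.\<close>

definition r where "r = min ecut 0 - 1 - \<bar>EB\<bar>"
definition hh where "hh c = (\<Sum>j\<in>snd c. msq L j)" for c :: cfg
definition Rr where "Rr c = 1 / (kin M L c - r)"
definition R1 where "R1 k c = 1 / (msq L (fst c - k) / M + msq L k + (hh c - r))" for k and c :: cfg
definition KK where "KK k l c = 1 / (msq L (fst c - k - l) / M + msq L l + (hh c + msq L k - r))" for k l and c :: cfg

lemma r_le: "r < ecut" "1 \<le> - r" "\<bar>EB\<bar> \<le> - r" by (auto simp: r_def)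
lemma hh0: "0 \<le> hh c" by (simp add: hh_def sum_nonneg)
lemma mM: "0 \<le> msq L p / M" using M0 by simp

lemma Rr_bounds: "0 < Rr c" "Rr c \<le> 1" "1 \<le> kin M L c - r"
proof -
  show k: "1 \<le> kin M L c - r" using kin_nonneg[OF M0(1), of L c] r_le by linarith
  show "0 < Rr c" "Rr c \<le> 1" using k by (auto simp: Rr_def)
qed

lemma R1_bounds: "0 < R1 k c" "R1 k c \<le> 1 / (1 + msq L k)" "R1 k c \<le> 1"
proof -
  have d: "1 + msq L k \<le> msq L (fst c - k) / M + msq L k + (hh c - r)" using mM[of "fst c - k"] hh0[of c] r_le by linarith
  have o: "0 < 1 + msq L k" by (simp add: add_pos_nonneg)
  show "0 < R1 k c" using d o by (simp add: R1_def)
  show 1: "R1 k c \<le> 1 / (1 + msq L k)" using d o by (simp add: R1_def frac_le)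
  have "1 / (1 + msq L k) \<le> 1" using o by (simp add: divide_le_eq)
  thus "R1 k c \<le> 1" using 1 by linarith
qed

lemma KK_bounds: "0 < KK k l c" "KK k l c \<le> 1 / (1 + msq L k + msq L l)" "KK k l c \<le> 1 / (1 + msq L l)" "KK k l c \<le> 1"
proof -
  have d: "1 + msq L k + msq L l \<le> msq L (fst c - k - l) / M + msq L l + (hh c + msq L k - r)"
    using mM[of "fst c - k - l"] hh0[of c] r_le by linarith
  have o: "0 < 1 + msq L l" "0 < 1 + msq L k + msq L l" by (simp_all add: add_pos_nonneg)
  show "0 < KK k l c" using d o by (simp add: KK_def)
  show 1: "KK k l c \<le> 1 / (1 + msq L k + msq L l)" using d o by (simp add: KK_def frac_le)
  have "1 / (1 + msq L k + msq L l) \<le> 1 / (1 + msq L l)" using o by (intro divide_left_mono) auto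
  thus 2: "KK k l c \<le> 1 / (1 + msq L l)" using 1 by linarith
  have "1 / (1 + msq L l) \<le> 1" using o(1) by (simp add: divide_le_eq)
  thus "KK k l c \<le> 1" using 2 by linarith
qed

lemma KK_sym: "KK k l c = KK l k c"
proof -
  have e: "fst c - k - l = fst c - l - k" by (simp add: algebra_simps)
  show ?thesis unfolding KK_def e by (simp add: add_ac)
qed

lemma domR: "x \<in> domf Rr" "x \<in> domf (R1 k)" "x \<in> domf (KK k l)"
proof -
  show "x \<in> domf Rr" by (rule domf_bounded[of _ _ 1]) (use Rr_bounds in \<open>simp add: abs_le_iff less_imp_le order_trans[of _ 0]\<close>)
  show "x \<in> domf (R1 k)" by (rule domf_bounded[of _ _ 1]) (use R1_bounds in \<open>simp add: abs_of_pos\<close>)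
  show "x \<in> domf (KK k l)" by (rule domf_bounded[of _ _ 1]) (use KK_bounds in \<open>simp add: abs_of_pos\<close>)
qed

lemma mulf_sec: "x \<in> domf f \<Longrightarrow> x \<in> sec N \<Longrightarrow> mulf f x \<in> sec N"
  by (rule supp_inI) (simp add: ev_mulf supp_inD)

lemma Rr_Dk: "y \<in> sec (Suc NN) \<Longrightarrow> mulf Rr y \<in> Dk"
proof -
  assume y: "y \<in> sec (Suc NN)"
  have "mulf Rr y \<in> domf (kin M L)"
    unfolding domf_def
  proof (intro CollectI, rule summable_on_comparison_test[OF ev_summable[of y]])
    fix c
    have "\<bar>kin M L c * Rr c\<bar> \<le> 1"
      using Rr_bounds[of c] kin_nonneg[OF M0(1), of L c] r_le by (simp add: Rr_def abs_of_nonneg divide_le_eq)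
    hence "\<bar>kin M L c * Rr c\<bar> * cmod (ev y c) \<le> 1 * cmod (ev y c)" by (intro mult_right_mono) auto
    thus "(cmod (complex_of_real (kin M L c) * ev (mulf Rr y) c))\<^sup>2 \<le> (cmod (ev y c))\<^sup>2"
      by (intro power_mono) (simp_all add: ev_mulf[OF domR(1)] norm_mult abs_mult mult.assoc)
  qed auto
  thus ?thesis using mulf_sec[OF domR(1) y] by (simp add: Dkin_def)
qed

lemma kin_Rr:
  assumes "y \<in> sec (Suc NN)" shows "mulf (kin M L) (mulf Rr y) - r *\<^sub>R mulf Rr y = y"
proof (rule ell2_eqI)
  fix c
  have d: "mulf Rr y \<in> domf (kin M L)" using Rr_Dk[OF assms] by (simp add: Dkin_def)
  have "complex_of_real (kin M L c) * (complex_of_real (Rr c) * ev y c) - complex_of_real r * (complex_of_real (Rr c) * ev y c)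
    = complex_of_real ((kin M L c - r) * Rr c) * ev y c" by (simp add: algebra_simps)
  also have "(kin M L c - r) * Rr c = 1" using Rr_bounds[of c] by (simp add: Rr_def)
  finally show "ev (mulf (kin M L) (mulf Rr y) - r *\<^sub>R mulf Rr y) c = ev y c"
    by (simp add: ev_mulf[OF d] ev_mulf[OF domR(1)])
qed

lemma hh_sh: "finite (snd c) \<Longrightarrow> k \<notin> snd c \<Longrightarrow> hh (sh k c) = hh c + msq L k"
  by (simp add: hh_def sh_def)

lemma R1_eq: "l \<notin> snd c \<Longrightarrow> finite (snd c) \<Longrightarrow> R1 l c = Rr (sh l c)"
  by (simp add: R1_def Rr_def kin_def hh_def sh_def algebra_simps)

lemma KK_eq: "k \<notin> snd c \<Longrightarrow> finite (snd c) \<Longrightarrow> KK k l c = R1 l (sh k c)"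
  by (simp add: KK_def R1_def hh_sh) (simp add: sh_def algebra_simps)

text \<open>\<open>XX\<close> and \<open>Lam\<close> are the off-diagonal and the diagonal part of
  the operator in Krein's resolvent formula, the reciprocal coupling minus \<open>AA\<close> after
  \<open>mulf Rr\<close> after \<open>CC\<close>. The divergence of \<open>1 / g n\<close> cancels
  inside \<open>Lam\<close>.\<close>

definition XX where "XX n w = (\<Sum>k\<in>Bn n. \<Sum>l\<in>Bn n. cre l (mulf (KK k l) (ann k w)))"
definition Lam where "Lam n c = (\<Sum>k\<in>Bn n. 1 / (mred M * msq L k - EB) - R1 k c)"

lemma dom_Lam_n: "w \<in> domf (Lam n)"
proof (rule domf_bounded[of _ _ "(\<Sum>k\<in>Bn n. \<bar>1 / (mred M * msq L k - EB)\<bar> + 1)"])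
  fix c
  have "\<bar>Lam n c\<bar> \<le> (\<Sum>k\<in>Bn n. \<bar>1 / (mred M * msq L k - EB) - R1 k c\<bar>)" unfolding Lam_def by (rule sum_abs)
  also have "\<dots> \<le> (\<Sum>k\<in>Bn n. \<bar>1 / (mred M * msq L k - EB)\<bar> + 1)"
  proof (rule sum_mono)
    fix k show "\<bar>1 / (mred M * msq L k - EB) - R1 k c\<bar> \<le> \<bar>1 / (mred M * msq L k - EB)\<bar> + 1"
      using R1_bounds[of k c] by linarith
  qed
  finally show "\<bar>Lam n c\<bar> \<le> (\<Sum>k\<in>Bn n. \<bar>1 / (mred M * msq L k - EB)\<bar> + 1)" .
qed

lemma Phi_n:
  assumes w: "w \<in> sec NN"
  shows "(1 / g n) *\<^sub>R w - AA (Bn n) (mulf Rr (CC (Bn n) w)) = mulf (Lam n) w + XX n w"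
proof -
  have "AA (Bn n) (mulf Rr (CC (Bn n) w)) = (\<Sum>k\<in>Bn n. mulf (R1 k) w) - XX n w"
    unfolding XX_def
  proof (rule inner_CC_mulf_CC(2)[where B = 1])
    show "w \<in> Fin" using w sec_Fin by blast
    show "\<bar>Rr c\<bar> \<le> 1" for c using Rr_bounds[of c] by simp
    show "\<bar>R1 k c\<bar> \<le> 1" for k c using R1_bounds[of k c] by simp
    show "\<bar>KK k l c\<bar> \<le> 1" for k l c using KK_bounds[of k l c] by simp
  qed (auto simp: R1_eq KK_eq)
  moreover have "(1 / g n) *\<^sub>R w - (\<Sum>k\<in>Bn n. mulf (R1 k) w) = mulf (Lam n) w"
  proof (rule ell2_eqI)
    fix c
    have "Lam n c = 1 / g n - (\<Sum>k\<in>Bn n. R1 k c)" unfolding Lam_def inv_g by (rule sum_subtractf)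
    thus "ev ((1 / g n) *\<^sub>R w - (\<Sum>k\<in>Bn n. mulf (R1 k) w)) c = ev (mulf (Lam n) w) c"
      by (simp add: ev_mulf[OF dom_Lam_n] ev_mulf[OF domR(2)] left_diff_distrib sum_distrib_right)
  qed
  ultimately show ?thesis by (simp add: algebra_simps)
qed

text \<open>Dual to \<open>form_bound\<close>, obtained by inserting
  \<open>mulf Rr (CC (Bn n) w)\<close> there. The slack reappears as a lower bound uniform in the
  cut-off, which will make the limit invertible.\<close>

lemma Phi_lower:
  assumes w: "w \<in> sec NN"
  shows "1 / (kap L)\<^sup>2 * (norm w)\<^sup>2 \<le> inner w (mulf (Lam n) w + XX n w)"
proof -
  define x where "x = mulf Rr (CC (Bn n) w)"
  have xD: "x \<in> Dk" unfolding x_def by (rule Rr_Dk[OF CC_sec[OF w]])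
  define \<xi> where "\<xi> = inner (CC (Bn n) w) x"
  define q where "q = 1 / g n - 1 / (kap L)\<^sup>2"
  have q: "q > 0" using inv_g_gt[of n] by (simp add: q_def)
  have "CC (Bn n) w = mulf (kin M L) x - r *\<^sub>R x" unfolding x_def by (rule kin_Rr[symmetric, OF CC_sec[OF w]])
  hence xi: "\<xi> = inner x (mulf (kin M L) x) - r * (norm x)\<^sup>2"
    unfolding \<xi>_def by (simp add: inner_diff_left inner_diff_right inner_commute power2_norm_eq_inner)
  have "(norm (AA (Bn n) x))\<^sup>2 \<le> q * (inner x (mulf (kin M L) x) - ecut * (norm x)\<^sup>2)"
    using form_bound[OF xD, of n] by (simp add: q_def)
  also have "\<dots> \<le> q * \<xi>"
    unfolding xi using q r_le(1) by (intro mult_left_mono diff_left_mono mult_right_mono) auto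
  finally have 1: "(norm (AA (Bn n) x))\<^sup>2 \<le> q * \<xi>" .
  have 2: "\<xi> = inner w (AA (Bn n) x)" unfolding \<xi>_def by (rule inner_CC)
  hence "\<xi> \<le> norm w * norm (AA (Bn n) x)" by (simp add: norm_cauchy_schwarz)
  hence "2 * \<xi> \<le> 2 * (sqrt q * norm w) * (norm (AA (Bn n) x) / sqrt q)" using q by simp
  also have "\<dots> \<le> (sqrt q * norm w)\<^sup>2 + (norm (AA (Bn n) x) / sqrt q)\<^sup>2" by (rule sum_squares_bound)
  also have "\<dots> = q * (norm w)\<^sup>2 + (norm (AA (Bn n) x))\<^sup>2 / q" using q by (simp add: power_mult_distrib power_divide)
  also have "\<dots> \<le> q * (norm w)\<^sup>2 + \<xi>" using 1 q by (simp add: divide_le_eq mult.commute)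
  finally have "\<xi> \<le> q * (norm w)\<^sup>2" by simp
  moreover have "inner w (mulf (Lam n) w + XX n w) = 1 / g n * (norm w)\<^sup>2 - \<xi>"
    unfolding Phi_n[OF w, symmetric] 2 x_def by (simp add: inner_diff_right power2_norm_eq_inner)
  ultimately show ?thesis by (simp add: q_def left_diff_distrib)
qed

lemma sum_ann_le:
  assumes w: "w \<in> sec NN" and F: "finite F"
  shows "(\<Sum>k\<in>F. (norm (ann k w))\<^sup>2) \<le> real NN * (norm w)\<^sup>2"
proof -
  have h: "((\<lambda>c. (\<Sum>k\<in>F. if k \<in> snd c then 1 else 0) * (cmod (ev w c))\<^sup>2) has_sum (\<Sum>k\<in>F. 1 * (norm (ann k w))\<^sup>2)) UNIV"
    by (rule ann_number_has_sum[OF F])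
  have "(\<Sum>k\<in>F. 1 * (norm (ann k w))\<^sup>2) \<le> real NN * (norm w)\<^sup>2"
  proof (rule has_sum_mono[OF h has_sum_cmult_right[OF norm2_has_sum]])
    fix c
    show "(\<Sum>k\<in>F. if k \<in> snd c then 1 else 0) * (cmod (ev w c))\<^sup>2 \<le> real NN * (cmod (ev w c))\<^sup>2"
    proof (cases "c \<in> Cfg NN")
      case True
      hence fc: "finite (snd c)" "card (snd c) = NN" by (auto simp: Cfg_def)
      have "(\<Sum>k\<in>F. if k \<in> snd c then 1 else 0) = real (card (F \<inter> snd c))" using F by (simp add: sum.If_cases Int_def)
      also have "\<dots> \<le> real NN" using card_mono[OF fc(1), of "F \<inter> snd c"] fc(2) by simp
      finally show ?thesis by (intro mult_right_mono) auto
    next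
      case False thus ?thesis using supp_inD[OF w] by simp
    qed
  qed
  thus ?thesis by simp
qed

definition aa where "aa = min 1 ((kap L)\<^sup>2)"
lemma aa: "aa > 0" "aa * (1 + nu k + nu l) \<le> 1 + msq L k + msq L l"
proof -
  show "aa > 0" using k0 by (simp add: aa_def)
  have "aa * nu k \<le> (kap L)\<^sup>2 * nu k" "aa * nu l \<le> (kap L)\<^sup>2 * nu l" by (auto intro!: mult_right_mono simp: aa_def)
  thus "aa * (1 + nu k + nu l) \<le> 1 + msq L k + msq L l" by (simp add: distrib_left msq_nu aa_def add_mono)
qed

lemma inner_XX: "inner w' (XX n w) = (\<Sum>k\<in>Bn n. \<Sum>l\<in>Bn n. inner (ann l w') (mulf (KK k l) (ann k w)))"
  by (simp add: XX_def inner_sum_right inner_ann)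

text \<open>Schur test. The kernel has the size of 1/(1 + k^2 + l^2), which over pairs of
  two-dimensional momenta is not square summable, so a Hilbert-Schmidt bound would grow with the
  cut-off.\<close>

lemma XX_bilinear:
  assumes w: "w \<in> sec NN" "w' \<in> sec NN"
  shows "\<bar>inner w' (XX n w)\<bar> \<le> 169 / aa * real NN / 2 * ((norm w)\<^sup>2 + (norm w')\<^sup>2)"
proof -
  let ?z = "\<lambda>k c. ev (ann k w) c" and ?z' = "\<lambda>k c. ev (ann k w') c" and ?B = "Bn n"
  have h: "((\<lambda>c. \<Sum>k\<in>?B. \<Sum>l\<in>?B. KK k l c * Re (cnj (?z' l c) * ?z k c)) has_sum inner w' (XX n w)) UNIV"
    unfolding inner_XX by (intro has_sum_finite_sum finite_Bn inner_mulf_has_sum domR)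
  let ?C = "169 / aa / 2"
  have h2: "((\<lambda>c. ?C * ((\<Sum>k\<in>?B. (cmod (?z k c))\<^sup>2) + (\<Sum>l\<in>?B. (cmod (?z' l c))\<^sup>2))) has_sum
     (?C * ((\<Sum>k\<in>?B. (norm (ann k w))\<^sup>2) + (\<Sum>l\<in>?B. (norm (ann l w'))\<^sup>2)))) UNIV"
    by (intro has_sum_cmult_right has_sum_add has_sum_finite_sum finite_Bn norm2_has_sum)
  have pt: "\<bar>\<Sum>k\<in>?B. \<Sum>l\<in>?B. KK k l c * Re (cnj (?z' l c) * ?z k c)\<bar> \<le> ?C * ((\<Sum>k\<in>?B. (cmod (?z k c))\<^sup>2) + (\<Sum>l\<in>?B. (cmod (?z' l c))\<^sup>2))" for c
  proof -
    define \<rho> where "\<rho> k = sqrt (1 + nu k)" for k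
    have \<rho>: "\<rho> k > 0" for k by (simp add: \<rho>_def add_pos_nonneg)
    \<comment> \<open>The Schur weight: \<open>lat_sum_three_halves\<close> with
      \<open>B = 1 + nu k\<close> gives \<open>169 / \<rho> k\<close>, and the factor
      \<open>\<rho> k\<close> makes the row sums bounded.\<close>
    define q where "q k l = 1 / ((1 + nu k + nu l) * \<rho> l) * \<rho> k" for k l
    have qs: "(\<Sum>l\<in>?B. q k l) \<le> 169" for k
    proof -
      have "(\<Sum>l\<in>?B. q k l) = (\<Sum>l\<in>?B. 1 / (((1 + nu k) + nu l) * sqrt (1 + nu l))) * \<rho> k"
        by (simp add: q_def \<rho>_def sum_distrib_right)
      also have "\<dots> \<le> 169 / sqrt (1 + nu k) * \<rho> k"
        using \<rho>[of k] by (intro mult_right_mono lat_sum_three_halves) auto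
      also have "\<dots> = 169" using \<rho>[of k] by (simp add: \<rho>_def)
      finally show ?thesis .
    qed
    have t: "\<bar>KK k l c * Re (cnj (?z' l c) * ?z k c)\<bar> \<le> 1 / aa / 2 * (q k l * (cmod (?z k c))\<^sup>2 + q l k * (cmod (?z' l c))\<^sup>2)" for k l
    proof -
      let ?D = "1 + nu k + nu l"
      have D: "?D > 0" by (simp add: add_pos_nonneg)
      have "KK k l c \<le> 1 / (1 + msq L k + msq L l)" by (rule KK_bounds)
      also have "\<dots> \<le> 1 / (aa * ?D)" using aa(1) aa(2)[of k l] D by (intro divide_left_mono mult_pos_pos add_pos_nonneg) auto
      finally have K: "KK k l c \<le> 1 / aa * (1 / ?D)" by simp
      have "\<bar>Re (cnj (?z' l c) * ?z k c)\<bar> \<le> cmod (?z' l c) * cmod (?z k c)"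
        using abs_Re_le_cmod[of "cnj (?z' l c) * ?z k c"] by (simp add: norm_mult)
      hence "\<bar>KK k l c * Re (cnj (?z' l c) * ?z k c)\<bar> \<le> (1 / aa * (1 / ?D)) * (cmod (?z' l c) * cmod (?z k c))"
        unfolding abs_mult using K KK_bounds(1)[of k l c] aa(1) D by (intro mult_mono) auto
      also have "\<dots> \<le> (1 / aa * (1 / ?D)) * ((\<rho> k / \<rho> l * (cmod (?z k c))\<^sup>2 + \<rho> l / \<rho> k * (cmod (?z' l c))\<^sup>2) / 2)"
      proof (rule mult_left_mono)
        have "2 * (sqrt (\<rho> k / \<rho> l) * cmod (?z k c)) * (sqrt (\<rho> l / \<rho> k) * cmod (?z' l c)) \<le> (sqrt (\<rho> k / \<rho> l) * cmod (?z k c))\<^sup>2 + (sqrt (\<rho> l / \<rho> k) * cmod (?z' l c))\<^sup>2"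
          by (rule sum_squares_bound)
        moreover have "sqrt (\<rho> k / \<rho> l) * sqrt (\<rho> l / \<rho> k) = 1" using \<rho>[of k] \<rho>[of l] by (simp add: real_sqrt_mult[symmetric])
        hence "2 * (sqrt (\<rho> k / \<rho> l) * cmod (?z k c)) * (sqrt (\<rho> l / \<rho> k) * cmod (?z' l c)) = 2 * (cmod (?z' l c) * cmod (?z k c))"
        proof -
          have gen: "2 * (s * u) * (t * v) = 2 * (v * u)" if "s * t = 1" for s t u v :: real
          proof -
            have "2 * (s * u) * (t * v) = (s * t) * (2 * (v * u))" by (simp only: mult_ac)
            thus ?thesis using that by simp
          qed
          show ?thesis by (rule gen) fact
        qed
        moreover have "(sqrt (\<rho> k / \<rho> l) * cmod (?z k c))\<^sup>2 = \<rho> k / \<rho> l * (cmod (?z k c))\<^sup>2" "(sqrt (\<rho> l / \<rho> k) * cmod (?z' l c))\<^sup>2 = \<rho> l / \<rho> k * (cmod (?z' l c))\<^sup>2"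
          using \<rho>[of k] \<rho>[of l] by (simp_all add: power_mult_distrib)
        ultimately show "cmod (?z' l c) * cmod (?z k c) \<le> (\<rho> k / \<rho> l * (cmod (?z k c))\<^sup>2 + \<rho> l / \<rho> k * (cmod (?z' l c))\<^sup>2) / 2" by simp
      qed (use aa(1) D in auto)
      also have "\<dots> = 1 / aa / 2 * (q k l * (cmod (?z k c))\<^sup>2 + q l k * (cmod (?z' l c))\<^sup>2)"
      proof -
        have "1 / ?D * (\<rho> k / \<rho> l) = q k l" "1 / ?D * (\<rho> l / \<rho> k) = q l k" by (simp_all add: q_def add_ac)
        moreover have "(1 / A * B) * ((x * u + y * v) / 2) = 1 / A / 2 * ((B * x) * u + (B * y) * v)" for A B x y u v :: real by (simp add: algebra_simps)
        ultimately show ?thesis by (simp only:)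
      qed
      finally show ?thesis .
    qed
    have "\<bar>\<Sum>k\<in>?B. \<Sum>l\<in>?B. KK k l c * Re (cnj (?z' l c) * ?z k c)\<bar> \<le> (\<Sum>k\<in>?B. \<Sum>l\<in>?B. 1 / aa / 2 * (q k l * (cmod (?z k c))\<^sup>2 + q l k * (cmod (?z' l c))\<^sup>2))"
      by (rule order_trans[OF sum_abs], rule sum_mono, rule order_trans[OF sum_abs], rule sum_mono, rule t)
    also have "\<dots> = 1 / aa / 2 * ((\<Sum>k\<in>?B. \<Sum>l\<in>?B. q k l * (cmod (?z k c))\<^sup>2) + (\<Sum>k\<in>?B. \<Sum>l\<in>?B. q l k * (cmod (?z' l c))\<^sup>2))"
      by (simp only: sum_distrib_left[symmetric] sum.distrib)
    also have "(\<Sum>k\<in>?B. \<Sum>l\<in>?B. q l k * (cmod (?z' l c))\<^sup>2) = (\<Sum>k\<in>?B. \<Sum>l\<in>?B. q k l * (cmod (?z' k c))\<^sup>2)" by (rule sum.swap)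
    also have "1 / aa / 2 * ((\<Sum>k\<in>?B. \<Sum>l\<in>?B. q k l * (cmod (?z k c))\<^sup>2) + (\<Sum>k\<in>?B. \<Sum>l\<in>?B. q k l * (cmod (?z' k c))\<^sup>2))
       \<le> 1 / aa / 2 * ((\<Sum>k\<in>?B. 169 * (cmod (?z k c))\<^sup>2) + (\<Sum>k\<in>?B. 169 * (cmod (?z' k c))\<^sup>2))"
      unfolding sum_distrib_right[symmetric] using aa(1) qs by (intro mult_left_mono add_mono sum_mono mult_right_mono) auto
    also have "\<dots> = ?C * ((\<Sum>k\<in>?B. (cmod (?z k c))\<^sup>2) + (\<Sum>l\<in>?B. (cmod (?z' l c))\<^sup>2))"
      unfolding sum_distrib_left[symmetric] distrib_left[symmetric] by simp
    finally show ?thesis .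
  qed
  let ?Q = "?C * ((\<Sum>k\<in>?B. (norm (ann k w))\<^sup>2) + (\<Sum>l\<in>?B. (norm (ann l w'))\<^sup>2))"
  have "inner w' (XX n w) \<le> ?Q"
    by (rule has_sum_mono[OF h h2]) (rule order_trans[OF abs_ge_self pt])
  moreover have "- inner w' (XX n w) \<le> ?Q"
  proof (rule has_sum_mono[OF _ h2])
    show "((\<lambda>c. - (\<Sum>k\<in>?B. \<Sum>l\<in>?B. KK k l c * Re (cnj (?z' l c) * ?z k c))) has_sum - inner w' (XX n w)) UNIV"
      using has_sum_cmult_right[OF h, of "-1"] by simp
    show "- (\<Sum>k\<in>?B. \<Sum>l\<in>?B. KK k l c * Re (cnj (?z' l c) * ?z k c)) \<le> ?C * ((\<Sum>k\<in>?B. (cmod (?z k c))\<^sup>2) + (\<Sum>l\<in>?B. (cmod (?z' l c))\<^sup>2))" for c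
      by (rule order_trans[OF abs_ge_minus_self pt])
  qed
  ultimately have "\<bar>inner w' (XX n w)\<bar> \<le> ?Q" by (rule abs_leI)
  also have "\<dots> \<le> ?C * (real NN * (norm w)\<^sup>2 + real NN * (norm w')\<^sup>2)"
    using sum_ann_le[OF w(1) finite_Bn, of n] sum_ann_le[OF w(2) finite_Bn, of n] aa(1) by (intro mult_left_mono add_mono) auto
  also have "\<dots> = 169 / aa * real NN / 2 * ((norm w)\<^sup>2 + (norm w')\<^sup>2)" by (simp add: distrib_left[symmetric])
  finally show ?thesis .
qed

end

section \<open>Existence of the limiting Hamiltonian\<close>

lemma mulf_cs: "x \<in> domf f \<Longrightarrow> mulf f (cs a x) = cs a (mulf f x)"
  using csubD(3)[OF domf_csub, of x f a] by (intro ell2_eqI) (simp add: ev_mulf mult.left_commute)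

lemma inner_mulf_sym: "x \<in> domf f \<Longrightarrow> y \<in> domf f \<Longrightarrow> inner x (mulf f y) = inner (mulf f x) y"
proof -
  assume a: "x \<in> domf f" "y \<in> domf f"
  have "cinner x (mulf f y) = cinner (mulf f x) y"
    unfolding cinner_def using a by (intro infsum_cong) (simp add: ev_mulf)
  thus ?thesis by (metis Re_cinner)
qed

lemma trunc_lin: "trunc F (x + y) = trunc F x + trunc F y" "trunc F (cs a x) = cs a (trunc F x)"
  by (auto intro!: ell2_eqI)

lemma trunc_sec: "trunc (Cfg N) x \<in> sec N" by (rule supp_inI) simp
lemma trunc_sec_id: "x \<in> sec N \<Longrightarrow> trunc (Cfg N) x = x"
  by (rule ell2_eqI) (simp add: supp_inD)

lemma convergent_finite_sum:
  fixes f :: "'i \<Rightarrow> nat \<Rightarrow> 'a::real_normed_vector"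
  assumes "finite I" "\<And>i. i \<in> I \<Longrightarrow> convergent (f i)"
  shows "convergent (\<lambda>n. \<Sum>i\<in>I. f i n)"
  using assms by (induction I rule: finite_induct) (auto intro: convergent_add convergent_const)

context cutoff_model
begin

lemma XX_lin: "XX n (x + y) = XX n x + XX n y" "XX n (cs a x) = cs a (XX n x)"
proof -
  have "XX n (x + y) = (\<Sum>k\<in>Bn n. \<Sum>l\<in>Bn n. cre l (mulf (KK k l) (ann k x)) + cre l (mulf (KK k l) (ann k y)))"
    unfolding XX_def ann_lin mulf_add[OF domR(3) domR(3)] cre_lin ..
  thus "XX n (x + y) = XX n x + XX n y" by (simp add: XX_def sum.distrib)
  show "XX n (cs a x) = cs a (XX n x)"
    unfolding XX_def ann_lin mulf_cs[OF domR(3)] cre_lin cs_sum ..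
qed

lemma XX_diff: "XX n (x - y) = XX n x - XX n y"
  using XX_lin(1)[of n "x - y" y] by simp

lemma ann_sec0: "w \<in> sec 0 \<Longrightarrow> ann k w = 0"
proof (rule ell2_eqI)
  fix c assume w: "w \<in> sec 0"
  have "sh k c \<notin> Cfg 0" by (auto simp: Cfg_def sh_def card_gt_0_iff)
  thus "ev (ann k w) c = ev 0 c" using supp_inD[OF w] by (simp add: ev_ann annf_def)
qed

lemma XX_sec: assumes w: "w \<in> sec NN" shows "XX n w \<in> sec NN"
proof (cases NN)
  case 0
  hence "ann k w = 0" for k using w ann_sec0 by simp
  thus ?thesis using csubD(1)[OF csub_supp_in] by (simp add: XX_def mulf_0 cre_lin)
next
  case (Suc N')
  have "cre l (mulf (KK k l) (ann k w)) \<in> sec (Suc N')" for k l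
    using w Suc by (intro cre_sec mulf_sec domR ann_sec) simp
  thus ?thesis unfolding XX_def Suc by (intro csub_sum csub_supp_in)
qed

definition CX where "CX = 169 / aa * real NN"
lemma CX0: "CX \<ge> 0" using aa(1) by (simp add: CX_def)

lemma XX_bound: assumes w: "w \<in> sec NN" shows "norm (XX n w) \<le> CX * norm w"
proof (cases "XX n w = 0 \<or> w = 0")
  case True
  thus ?thesis using CX0 XX_diff[of n 0 0] by auto
next
  case False
  define y where "y = XX n w"
  have y: "norm y > 0" "norm w > 0" using False by (auto simp: y_def)
  let ?w = "(norm w / norm y) *\<^sub>R y"
  have "?w \<in> sec NN" using csubD(4)[OF csub_supp_in XX_sec[OF w]] by (simp add: y_def)
  from XX_bilinear[OF w this, of n]
  have "inner ?w y \<le> CX / 2 * ((norm w)\<^sup>2 + (norm ?w)\<^sup>2)" by (simp add: y_def CX_def)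
  also have "norm ?w = norm w" using y by simp
  also have "inner ?w y = norm w * norm y" using y by (simp add: power2_norm_eq_inner[symmetric] power2_eq_square)
  finally have "norm y * norm w \<le> (CX * norm w) * norm w" by (simp add: power2_eq_square mult_ac)
  from mult_right_le_imp_le[OF this y(2)] show ?thesis by (simp add: y_def)
qed

lemma convergent_Bn: "convergent (\<lambda>n. f (ball_lat L (real n))) \<Longrightarrow> convergent (\<lambda>n. f (Bn n))" for f :: "lat set \<Rightarrow> 'a::topological_space"
  unfolding Bn_def using convergent_ignore_initial_segment[of "\<lambda>n. f (ball_lat L (real n))" n0] by simp

text \<open>A vector with finitely many coordinates occupies finitely many modes, so the sum over
  \<open>k\<close> is finite and each sum over \<open>l\<close> converges by
  \<open>convergent_sum_cre\<close>. The uniform \<open>XX_bound\<close> later extends convergence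
  to the whole sector.\<close>

lemma XX_convergent_finite:
  assumes w: "w \<in> sec NN" and G: "finite G" shows "convergent (\<lambda>n. XX n (trunc G w))"
proof (cases NN)
  case 0
  have "trunc G w \<in> sec 0" using w 0 by (intro supp_inI) (auto dest: supp_inD)
  hence "XX n (trunc G w) = 0" for n using ann_sec0 by (simp add: XX_def mulf_0 cre_lin)
  thus ?thesis by (simp add: convergent_const)
next
  case (Suc N')
  define x where "x = trunc (G \<inter> Cfg NN) w"
  have xt: "trunc G w = x" unfolding x_def using supp_inD[OF w] by (intro ell2_eqI) auto
  have xs: "x \<in> sec (Suc N')" unfolding x_def Suc[symmetric] by (rule supp_inI) simp
  define S where "S = (\<Union>c\<in>G \<inter> Cfg NN. snd c)"
  have fS: "finite S" unfolding S_def using G by (auto simp: Cfg_def)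
  have z: "ann k x = 0" if "k \<notin> S" for k
  proof (rule ell2_eqI)
    fix c
    have "k \<in> snd (sh k c)" by (simp add: sh_def)
    hence "sh k c \<notin> G \<inter> Cfg NN" using that unfolding S_def by blast
    thus "ev (ann k x) c = ev 0 c" by (auto simp: ev_ann annf_def x_def)
  qed
  define T where "T k n = (\<Sum>l\<in>Bn n. cre l (mulf (KK k l) (ann k x)))" for k n
  have Tc: "convergent (T k)" for k
  proof -
    have "convergent (\<lambda>n. \<Sum>l\<in>ball_lat L (real n). cre l (mulf (KK k l) (ann k x)))"
    proof (rule convergent_sum_cre[OF L, where N = N' and b = "norm (ann k x)"])
      fix l
      show "mulf (KK k l) (ann k x) \<in> sec N'" by (intro mulf_sec domR ann_sec xs)
      have "norm (mulf (KK k l) (ann k x)) \<le> 1 / (1 + msq L l) * norm (ann k x)"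
      proof (rule norm_mulf_le)
        fix c show "\<bar>KK k l c\<bar> \<le> 1 / (1 + msq L l)" using KK_bounds[of k l c] by simp
      qed simp
      thus "norm (mulf (KK k l) (ann k x)) \<le> norm (ann k x) / (1 + msq L l)" by simp
    qed
    thus ?thesis unfolding T_def by (rule convergent_Bn)
  qed
  have T0: "T k n = 0" if "k \<notin> S" for k n using z[OF that] by (simp add: T_def mulf_0 cre_lin)
  obtain m where m: "\<And>n. n \<ge> m \<Longrightarrow> S \<subseteq> ball_lat L (real n)" using finite_subset_ball_lat[OF fS] by blast
  have "\<forall>n\<ge>m. (\<Sum>k\<in>S. T k n) = XX n (trunc G w)"
  proof (intro allI impI)
    fix n assume "n \<ge> m"
    hence "S \<subseteq> Bn n" unfolding Bn_def using m[of "n + n0"] by simp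
    hence "(\<Sum>k\<in>Bn n. T k n) = (\<Sum>k\<in>S. T k n)" using T0 by (intro sum.mono_neutral_right) auto
    thus "(\<Sum>k\<in>S. T k n) = XX n (trunc G w)" by (simp add: XX_def T_def xt)
  qed
  hence ev: "eventually (\<lambda>n. (\<Sum>k\<in>S. T k n) = XX n (trunc G w)) sequentially" unfolding eventually_sequentially by blast
  have "convergent (\<lambda>n. \<Sum>k\<in>S. T k n)" by (intro convergent_finite_sum fS Tc)
  then obtain l where "(\<lambda>n. \<Sum>k\<in>S. T k n) \<longlonglongrightarrow> l" by (auto simp: convergent_def)
  hence "(\<lambda>n. XX n (trunc G w)) \<longlonglongrightarrow> l" using ev by (rule Lim_transform_eventually)
  thus ?thesis by (auto simp: convergent_def)
qed

lemma XX_convergent: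
  assumes w: "w \<in> sec NN" shows "convergent (\<lambda>n. XX n w)"
proof -
  have "Cauchy (\<lambda>n. XX n w)"
  proof (rule metric_CauchyI)
    fix e :: real assume e: "e > 0"
    define d where "d = e / (4 * (CX + 1))"
    have d: "d > 0" using e CX0 by (simp add: d_def)
    obtain G where G: "finite G" "norm (w - trunc G w) < d" using trunc_approx[OF d] by blast
    have tw: "trunc G w \<in> sec NN" using w by (intro supp_inI) (auto dest: supp_inD)
    have "Cauchy (\<lambda>n. XX n (trunc G w))" using XX_convergent_finite[OF w G(1)] by (rule convergent_Cauchy)
    then obtain m where m: "\<And>i j. i \<ge> m \<Longrightarrow> j \<ge> m \<Longrightarrow> dist (XX i (trunc G w)) (XX j (trunc G w)) < e / 2"
      using metric_CauchyD[of "\<lambda>n. XX n (trunc G w)" "e / 2"] e by auto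
    have s: "dist (XX i w) (XX i (trunc G w)) \<le> e / 4" for i
    proof -
      have "norm (XX i (w - trunc G w)) \<le> CX * norm (w - trunc G w)" by (rule XX_bound[OF csubD(6)[OF csub_supp_in w tw]])
      also have "\<dots> \<le> (CX + 1) * d" using CX0 G(2) by (intro mult_mono) auto
      also have "\<dots> = e / 4"
      proof -
        have gen: "q * (e / (4 * q)) = e / 4" if "q \<noteq> 0" for q :: real using that by simp
        show ?thesis unfolding d_def by (rule gen) (use CX0 in simp)
      qed
      finally show ?thesis by (simp add: dist_norm XX_diff)
    qed
    show "\<exists>M. \<forall>m\<ge>M. \<forall>n\<ge>M. dist (XX m w) (XX n w) < e"
    proof (intro exI allI impI)
      fix i j assume "i \<ge> m" "j \<ge> m"
      have "dist (XX i w) (XX j w) \<le> dist (XX i w) (XX i (trunc G w)) + dist (XX i (trunc G w)) (XX j (trunc G w)) + dist (XX j w) (XX j (trunc G w))"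
        using dist_triangle[of "XX i w" "XX j w" "XX i (trunc G w)"]
          dist_triangle[of "XX i (trunc G w)" "XX j w" "XX j (trunc G w)"]
          dist_commute[of "XX j (trunc G w)" "XX j w"] by linarith
      thus "dist (XX i w) (XX j w) < e" using s[of i] s[of j] m[OF \<open>i \<ge> m\<close> \<open>j \<ge> m\<close>] by linarith
    qed
  qed
  thus ?thesis using Cauchy_convergent_iff by blast
qed

text \<open>Truncating to the sector first makes the limit exist for every vector, so that
  \<open>XL\<close> is linear on the whole type.\<close>

definition XL where "XL w = lim (\<lambda>n. XX n (trunc (Cfg NN) w))"

lemma XL_lim: "(\<lambda>n. XX n (trunc (Cfg NN) w)) \<longlonglongrightarrow> XL w"
  unfolding XL_def using XX_convergent[OF trunc_sec] by (simp add: convergent_LIMSEQ_iff)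

lemma XL_lim_sec: "w \<in> sec NN \<Longrightarrow> (\<lambda>n. XX n w) \<longlonglongrightarrow> XL w"
  using XL_lim[of w] by (simp add: trunc_sec_id)

lemma XX_sym: "inner x (XX n y) = inner (XX n x) y"
proof -
  have "inner (XX n x) y = (\<Sum>k\<in>Bn n. \<Sum>l\<in>Bn n. inner (ann l y) (mulf (KK k l) (ann k x)))"
    unfolding inner_commute[of "XX n x" y] inner_XX ..
  also have "\<dots> = (\<Sum>k\<in>Bn n. \<Sum>l\<in>Bn n. inner (ann k x) (mulf (KK l k) (ann l y)))"
  proof (intro sum.cong refl)
    fix k l
    have e: "KK l k = KK k l" by (rule ext) (rule KK_sym)
    show "inner (ann l y) (mulf (KK k l) (ann k x)) = inner (ann k x) (mulf (KK l k) (ann l y))"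
      unfolding e inner_mulf_sym[OF domR(3) domR(3), of "ann l y"] by (rule inner_commute)
  qed
  also have "\<dots> = inner x (XX n y)" unfolding inner_XX by (rule sum.swap)
  finally show ?thesis ..
qed

definition LamL where "LamL c = infsum (\<lambda>k. 1 / (mred M * msq L k - EB) - R1 k c) UNIV"

lemma Lam_tendsto: "(\<lambda>n. Lam n c) \<longlonglongrightarrow> LamL c"
proof -
  have "(\<lambda>k. 1 / (mred M * msq L k - EB) - (if True then 1 / (msq L (fst c - k) / M + msq L k + (hh c - r)) else 0)) summable_on UNIV"
  proof (rule polaron_term_summable[OF L M0(1) EB(1), where \<theta> = 1])
    show "1 * (1 + msq L k) \<le> msq L (fst c - k) / M + msq L k + (hh c - r)" for k
      unfolding mult_1_left using mM[of "fst c - k"] hh0[of c] r_le by linarith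
  qed auto
  hence "(\<lambda>k. 1 / (mred M * msq L k - EB) - R1 k c) summable_on UNIV" by (simp add: R1_def)
  from LIMSEQ_ignore_initial_segment[OF sum_ball_lat_tendsto[OF L this], of n0]
  show ?thesis by (simp add: Lam_def LamL_def Bn_def)
qed

definition CL where "CL = 2500 / (kap L)\<^sup>2"

text \<open>\<open>recoil_sum_bound\<close> on a symmetric set, with parameter 1 because
  \<open>hh c - r\<close> is nonnegative; being at least |E_B|, it also makes the recoil-free
  denominators at least those of the coupling.\<close>

lemma sym_sum_lower:
  assumes F: "finite F" "\<And>k. k \<in> F \<Longrightarrow> - k \<in> F"
  shows "- CL \<le> (\<Sum>k\<in>F. 1 / (mred M * msq L k - EB) - R1 k c)"
proof -
  have t: "\<bar>EB\<bar> \<le> hh c - r" "1 \<le> hh c - r" using hh0[of c] r_le by linarith+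
  have "(\<Sum>k\<in>F. R1 k c) \<le> (\<Sum>k\<in>F. 1 / (mred M * msq L k + (hh c - r))) + 2500 / (1^3 * (kap L)\<^sup>2)"
    unfolding R1_def
  proof (rule recoil_sum_bound[OF L M0(2) F])
    fix k show "1 * msq L k \<le> msq L k + (hh c - r) \<and> 0 < msq L k + (hh c - r)" using t msq_ge0[of L k] by linarith
  qed auto
  also have "(\<Sum>k\<in>F. 1 / (mred M * msq L k + (hh c - r))) \<le> (\<Sum>k\<in>F. 1 / (mred M * msq L k - EB))"
  proof (rule sum_mono)
    fix k show "1 / (mred M * msq L k + (hh c - r)) \<le> 1 / (mred M * msq L k - EB)"
      using mred_msq_pos[OF M0(1) EB(1), of L k] t EB(1) by (intro divide_left_mono mult_pos_pos) auto
  qed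
  finally show ?thesis by (simp add: CL_def sum_subtractf)
qed

text \<open>\<open>LamL\<close> need not be bounded, so a dominating function is required. Passing
  to a larger ball adds a sum over a symmetric set, which is at least \<open>- CL\<close>; hence
  \<open>Lam n\<close> exceeds its limit by at most \<open>CL\<close>.\<close>

lemma Lam_dominated: "\<bar>Lam n c\<bar> \<le> \<bar>LamL c\<bar> + CL"
proof -
  have 1: "- CL \<le> Lam n c" unfolding Lam_def by (rule sym_sum_lower) (auto intro: Bn_sym)
  have "- CL \<le> LamL c - Lam n c"
  proof (rule LIMSEQ_le_const)
    show "(\<lambda>m. Lam m c - Lam n c) \<longlonglongrightarrow> LamL c - Lam n c" by (intro tendsto_intros Lam_tendsto)
    show "\<exists>N. \<forall>m\<ge>N. - CL \<le> Lam m c - Lam n c"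
    proof (intro exI allI impI)
      fix m assume "n \<le> m"
      hence sub: "Bn n \<subseteq> Bn m" unfolding Bn_def by (intro ball_lat_mono) simp
      have "- CL \<le> (\<Sum>k\<in>Bn m - Bn n. 1 / (mred M * msq L k - EB) - R1 k c)"
        by (rule sym_sum_lower) (simp, auto simp: Bn_def ball_lat_def)
      also have "\<dots> = Lam m c - Lam n c" unfolding Lam_def using sub by (simp add: sum_diff)
      finally show "- CL \<le> Lam m c - Lam n c" .
    qed
  qed
  thus ?thesis using 1 by linarith
qed

lemma Lam_mulf_tendsto:
  assumes w: "w \<in> domf LamL" shows "(\<lambda>n. mulf (Lam n) w) \<longlonglongrightarrow> mulf LamL w"
proof (rule mulf_dominated_tendsto)
  show "\<bar>Lam n c\<bar> \<le> \<bar>LamL c\<bar> + CL" for n c by (rule Lam_dominated)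
  show "(\<lambda>n. Lam n c) \<longlonglongrightarrow> LamL c" for c by (rule Lam_tendsto)
  have "w \<in> domf (\<lambda>c. \<bar>LamL c\<bar>)" by (rule domf_dominated[OF w]) simp
  hence "(\<lambda>c. (cmod (complex_of_real \<bar>LamL c\<bar> * ev w c + complex_of_real CL * ev w c))\<^sup>2) summable_on UNIV"
    using domf_const[of w CL] unfolding domf_def by (intro summable_on_cmod2_add) auto
  thus "w \<in> domf (\<lambda>c. \<bar>LamL c\<bar> + CL)" by (simp add: domf_def distrib_right)
qed

lemma sa_PhiL: "sa (sec NN) (sec NN \<inter> domf LamL) (\<lambda>w. mulf LamL w + XL w)"
proof (rule sa_diag_plus_bounded)
  show "XL (x + y) = XL x + XL y" for x y
  proof (rule LIMSEQ_unique[OF XL_lim])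
    show "(\<lambda>n. XX n (trunc (Cfg NN) (x + y))) \<longlonglongrightarrow> XL x + XL y"
      unfolding trunc_lin XX_lin by (intro tendsto_intros XL_lim)
  qed
  show "XL (cs a x) = cs a (XL x)" for a x
  proof (rule LIMSEQ_unique[OF XL_lim])
    show "(\<lambda>n. XX n (trunc (Cfg NN) (cs a x))) \<longlonglongrightarrow> cs a (XL x)"
      unfolding trunc_lin XX_lin by (intro bounded_linear.tendsto[OF cs_bounded_linear] XL_lim)
  qed
  show "XL x \<in> sec NN" if "x \<in> sec NN" for x
    by (rule closed_sequentially[OF closed_supp_in _ XL_lim_sec[OF that]]) (rule XX_sec[OF that])
  show "inner x (XL y) = inner (XL x) y" if "x \<in> sec NN" "y \<in> sec NN" for x y
  proof -
    have "(\<lambda>n. inner x (XX n y)) \<longlonglongrightarrow> inner x (XL y)" by (intro tendsto_intros XL_lim_sec that)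
    moreover have "(\<lambda>n. inner (XX n x) y) \<longlonglongrightarrow> inner (XL x) y" by (intro tendsto_intros XL_lim_sec that)
    ultimately show ?thesis unfolding XX_sym by (rule LIMSEQ_unique)
  qed
qed

lemma Phi_tendsto: "w \<in> sec NN \<Longrightarrow> w \<in> domf LamL \<Longrightarrow> (\<lambda>n. mulf (Lam n) w + XX n w) \<longlonglongrightarrow> mulf LamL w + XL w"
  by (intro tendsto_add Lam_mulf_tendsto XL_lim_sec)

lemma PhiL_surj:
  assumes h: "h \<in> sec NN" shows "\<exists>w\<in>sec NN \<inter> domf LamL. mulf LamL w + XL w = h"
proof -
  have "\<exists>w\<in>sec NN \<inter> domf LamL. (mulf LamL w + XL w) - 0 *\<^sub>R w = h"
  proof (rule sa_surj_below[OF csub_supp_in closed_supp_in sa_PhiL _ _ h, where c = "1 / (kap L)\<^sup>2"])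
    fix w assume w: "w \<in> sec NN \<inter> domf LamL"
    have "(\<lambda>n. inner w (mulf (Lam n) w + XX n w)) \<longlonglongrightarrow> inner w (mulf LamL w + XL w)"
      using w by (intro tendsto_inner tendsto_const Phi_tendsto) auto
    thus "1 / (kap L)\<^sup>2 * (norm w)\<^sup>2 \<le> inner w (mulf LamL w + XL w)"
      by (rule LIMSEQ_le_const) (use Phi_lower w in auto)
  qed (use k0 in simp)
  thus ?thesis by simp
qed

lemma Rr_cre:
  assumes v: "v \<in> Fin" shows "mulf Rr (cre l v) = cre l (mulf (R1 l) v)"
proof (rule ell2_eqI)
  fix c show "ev (mulf Rr (cre l v)) c = ev (cre l (mulf (R1 l) v)) c"
  proof (cases "l \<in> snd c \<and> finite (snd c)")
    case True
    have "R1 l (un l c) = Rr c" using R1_eq[of l "un l c"] sh_un[of l c] True by (simp add: un_def)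
    thus ?thesis using True by (simp add: ev_mulf[OF domR(1)] ev_mulf[OF domR(2)] ev_cre cref_def)
  next
    case False
    hence "l \<in> snd c \<Longrightarrow> ev v (un l c) = 0" using supp_inD[OF v[unfolded Fin_def], of "un l c"] by (simp add: un_def)
    thus ?thesis using False by (auto simp: ev_mulf[OF domR(1)] ev_mulf[OF domR(2)] ev_cre cref_def)
  qed
qed

lemma Rr_CC: "v \<in> Fin \<Longrightarrow> finite E \<Longrightarrow> mulf Rr (CC E v) = (\<Sum>l\<in>E. cre l (mulf (R1 l) v))"
  unfolding CC_def by (simp add: mulf_sum domR Rr_cre)

lemma norm_R1: "norm (mulf (R1 l) v) \<le> norm v / (1 + msq L l)"
proof -
  have "norm (mulf (R1 l) v) \<le> 1 / (1 + msq L l) * norm v"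
  proof (rule norm_mulf_le)
    fix c show "\<bar>R1 l c\<bar> \<le> 1 / (1 + msq L l)" using R1_bounds[of l c] by simp
  qed simp
  thus ?thesis by simp
qed

lemma RCC_convergent:
  assumes w: "w \<in> sec NN" shows "convergent (\<lambda>n. mulf Rr (CC (Bn n) w))"
proof -
  have wF: "w \<in> Fin" using w sec_Fin by blast
  have "convergent (\<lambda>n. \<Sum>l\<in>ball_lat L (real n). cre l (mulf (R1 l) w))"
    by (rule convergent_sum_cre[OF L mulf_sec[OF domR(2) w] norm_R1])
  from convergent_Bn[OF this] show ?thesis by (simp add: Rr_CC[OF wF])
qed

text \<open>By duality the squared norm of \<open>v\<close> is a pairing of \<open>y\<close> with
  \<open>mulf Rr (CC E v)\<close>, and the decay of \<open>R1\<close> bounds the latter by the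
  lattice sum over \<open>E\<close>.\<close>

lemma AAR_convergent:
  assumes y: "y \<in> sec (Suc NN)" shows "convergent (\<lambda>n. AA (Bn n) (mulf Rr y))"
proof -
  have zs: "mulf Rr y \<in> sec (Suc NN)" using Rr_Dk[OF y] by (simp add: Dkin_def)
  have "Cauchy (\<lambda>n. AA (ball_lat L (real n)) (mulf Rr y))"
  proof (rule Cauchy_by_sets[OF L AA_union, where C = "(norm y)\<^sup>2 * real (Suc NN)"])
    fix E :: "lat set" assume E: "finite E"
    define v where "v = AA E (mulf Rr y)"
    define S where "S = (\<Sum>k\<in>E. (1 / (1 + msq L k))\<^sup>2)"
    have S0: "S \<ge> 0" unfolding S_def by (rule sum_nonneg) simp
    have vs: "v \<in> sec NN" unfolding v_def by (rule AA_sec[OF zs])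
    have vF: "v \<in> Fin" using vs sec_Fin by blast
    have "(norm v)\<^sup>2 = inner (mulf Rr y) (CC E v)" unfolding power2_norm_eq_inner by (simp add: v_def inner_AA)
    also have "\<dots> = inner y (mulf Rr (CC E v))" by (rule inner_mulf_sym[symmetric, OF domR(1) domR(1)])
    also have "\<dots> \<le> norm y * norm (mulf Rr (CC E v))" by (rule norm_cauchy_schwarz)
    also have "norm (mulf Rr (CC E v)) \<le> sqrt (real (Suc NN) * S) * norm v"
    proof -
      have "(norm (mulf Rr (CC E v)))\<^sup>2 \<le> real (Suc NN) * (\<Sum>l\<in>E. (norm (mulf (R1 l) v))\<^sup>2)"
        unfolding Rr_CC[OF vF E] by (rule norm2_sum_cre_le[OF E mulf_sec[OF domR(2) vs]])
      also have "\<dots> \<le> real (Suc NN) * (\<Sum>l\<in>E. (norm v)\<^sup>2 * (1 / (1 + msq L l))\<^sup>2)"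
      proof (intro mult_left_mono sum_mono)
        fix l
        have "(norm (mulf (R1 l) v))\<^sup>2 \<le> (norm v / (1 + msq L l))\<^sup>2" by (intro power_mono norm_R1) auto
        thus "(norm (mulf (R1 l) v))\<^sup>2 \<le> (norm v)\<^sup>2 * (1 / (1 + msq L l))\<^sup>2" by (simp add: power_divide)
      qed auto
      also have "\<dots> = (sqrt (real (Suc NN) * S) * norm v)\<^sup>2"
        using S0 by (simp add: power_mult_distrib S_def sum_distrib_left[symmetric])
      finally show ?thesis using S0 by (simp add: power2_le_iff_abs_le)
    qed
    finally have h: "(norm v)\<^sup>2 \<le> norm y * (sqrt (real (Suc NN) * S) * norm v)" by (simp add: mult_left_mono)
    have "norm v \<le> norm y * sqrt (real (Suc NN) * S)"
    proof (cases "norm v = 0")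
      case False
      have "norm v * norm v \<le> (norm y * sqrt (real (Suc NN) * S)) * norm v" using h by (simp only: power2_eq_square mult.assoc)
      thus ?thesis by (rule mult_right_le_imp_le) (use False in simp)
    qed (use S0 in simp)
    hence "(norm v)\<^sup>2 \<le> (norm y * sqrt (real (Suc NN) * S))\<^sup>2" by (intro power_mono) auto
    also have "\<dots> = (norm y)\<^sup>2 * real (Suc NN) * S" using S0 by (simp add: power_mult_distrib)
    finally show "(norm (AA E (mulf Rr y)))\<^sup>2 \<le> (norm y)\<^sup>2 * real (Suc NN) * (\<Sum>k\<in>E. (1 / (1 + msq L k))\<^sup>2)"
      by (simp add: v_def S_def)
  qed auto
  thus ?thesis using Cauchy_convergent_iff convergent_Bn[of "\<lambda>B. AA B (mulf Rr y)"] by blast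
qed

lemma An_apply: "An n x = mulf (kin M L) x - g n *\<^sub>R CC (Bn n) (AA (Bn n) x)"
  by (simp add: An_def Acut_def g_def Bn_def)

text \<open>Krein's formula. For given \<open>y\<close>, the limiting equation is solved for
  \<open>w\<close> with the limit of \<open>AA (Bn n) (mulf Rr y)\<close> on the right; then
  \<open>mulf Rr y + mulf Rr (CC (Bn n) w)\<close> solves the resolvent equation up to
  \<open>g n *\<^sub>R CC (Bn n) (\<epsilon> n)\<close> with \<open>\<epsilon>\<close> tending to
  0.\<close>

theorem limit_operator_exists:
  "\<exists>D A. sa (sec (Suc NN)) D A \<and> (\<forall>z u x. Im z \<noteq> 0 \<longrightarrow> (\<forall>n. u n \<in> Dk) \<longrightarrow> x \<in> D \<longrightarrow>
     (\<forall>n. An n (u n) - cs z (u n) = A x - cs z x) \<longrightarrow> u \<longlonglongrightarrow> x)"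
proof (rule resolvent_limit_exists[OF csub_supp_in closed_supp_in saAn low_An r_le(1)])
  fix y assume y: "y \<in> sec (Suc NN)"
  show "\<exists>w\<in>sec (Suc NN). \<forall>v. (\<forall>n. v n \<in> Dk \<and> An n (v n) - r *\<^sub>R v n = y) \<longrightarrow> v \<longlonglongrightarrow> w"
  proof -
    define z where "z = mulf Rr y"
    have zD: "z \<in> Dk" unfolding z_def by (rule Rr_Dk[OF y])
    have zs: "z \<in> sec (Suc NN)" using zD by (simp add: Dkin_def)
    obtain h where h: "(\<lambda>n. AA (Bn n) z) \<longlonglongrightarrow> h" using AAR_convergent[OF y] by (auto simp: convergent_def z_def)
    have hs: "h \<in> sec NN" by (rule closed_sequentially[OF closed_supp_in _ h]) (rule AA_sec[OF zs])
    obtain w where w: "w \<in> sec NN" "w \<in> domf LamL" "mulf LamL w + XL w = h" using PhiL_surj[OF hs] by blast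
    obtain t where t: "(\<lambda>n. mulf Rr (CC (Bn n) w)) \<longlonglongrightarrow> t" using RCC_convergent[OF w(1)] by (auto simp: convergent_def)
    define u where "u n = z + mulf Rr (CC (Bn n) w)" for n
    have uD: "u n \<in> Dk" for n unfolding u_def
      using csubD(2)[OF saD(2)[OF saAn] zD Rr_Dk[OF CC_sec[OF w(1)]]] .
    have ul: "u \<longlonglongrightarrow> z + t" unfolding u_def by (intro tendsto_intros t)
    define \<epsilon> where "\<epsilon> n = (mulf (Lam n) w + XX n w) - AA (Bn n) z" for n
    have "\<epsilon> \<longlonglongrightarrow> (mulf LamL w + XL w) - h" unfolding \<epsilon>_def by (intro tendsto_diff Phi_tendsto w h)
    hence el: "\<epsilon> \<longlonglongrightarrow> 0" using w(3) by simp
    have Au: "An n (u n) - r *\<^sub>R u n = y + g n *\<^sub>R CC (Bn n) (\<epsilon> n)" for n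
    proof -
      let ?C = "CC (Bn n) w"
      have cw: "?C \<in> sec (Suc NN)" by (rule CC_sec[OF w(1)])
      have ku: "mulf (kin M L) (u n) = mulf (kin M L) z + mulf (kin M L) (mulf Rr ?C)"
        unfolding u_def using zD Rr_Dk[OF cw] by (intro mulf_add) (auto simp: Dkin_def)
      have "mulf (kin M L) (u n) - r *\<^sub>R u n = (mulf (kin M L) z - r *\<^sub>R z) + (mulf (kin M L) (mulf Rr ?C) - r *\<^sub>R mulf Rr ?C)"
        unfolding ku by (simp add: u_def scaleR_add_right)
      also have "\<dots> = y + ?C" unfolding z_def kin_Rr[OF y] kin_Rr[OF cw] ..
      finally have 1: "mulf (kin M L) (u n) - r *\<^sub>R u n = y + ?C" .
      have "AA (Bn n) (u n) = AA (Bn n) z + AA (Bn n) (mulf Rr ?C)" unfolding u_def AA_lin ..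
      also have "\<dots> = (1 / g n) *\<^sub>R w - \<epsilon> n" unfolding \<epsilon>_def Phi_n[OF w(1), symmetric] by simp
      finally have "CC (Bn n) (AA (Bn n) (u n)) = (1 / g n) *\<^sub>R ?C - CC (Bn n) (\<epsilon> n)" by (simp only: CC_lin)
      hence "g n *\<^sub>R CC (Bn n) (AA (Bn n) (u n)) = ?C - g n *\<^sub>R CC (Bn n) (\<epsilon> n)"
        using g_pos[of n] by (simp add: scaleR_diff_right)
      thus ?thesis using 1 unfolding An_apply by (simp add: algebra_simps)
    qed
    have "v \<longlonglongrightarrow> z + t" if v: "\<And>n. v n \<in> Dk" "\<And>n. An n (v n) - r *\<^sub>R v n = y" for v
    proof -
      \<comment> \<open>The error is paired with the difference \<open>d\<close>, hence with
        \<open>AA (Bn n) d\<close>; \<open>low_slack\<close> absorbs the resulting quadratic term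
        and only the norm of \<open>\<epsilon> n\<close> remains.\<close>
      have bd: "(ecut - r) * (norm (u n - v n))\<^sup>2 \<le> (kap L)\<^sup>2 / 4 * (norm (\<epsilon> n))\<^sup>2" for n
      proof -
        define d where "d = u n - v n"
        have dD: "d \<in> Dk" unfolding d_def using csubD(6)[OF saD(2)[OF saAn] uD v(1)] .
        have Ad: "An n d - r *\<^sub>R d = g n *\<^sub>R CC (Bn n) (\<epsilon> n)"
        proof -
          have "An n d - r *\<^sub>R d = (An n (u n) - r *\<^sub>R u n) - (An n (v n) - r *\<^sub>R v n)"
            unfolding d_def sa_diff[OF saAn uD v(1)] by (simp add: scaleR_diff_right)
          thus ?thesis unfolding Au v(2) by simp
        qed
        define P where "P = norm (AA (Bn n) d)"
        have "inner d (An n d) - r * (norm d)\<^sup>2 = g n * inner (AA (Bn n) d) (\<epsilon> n)"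
          using arg_cong[OF Ad, of "inner d"] by (simp add: inner_diff_right power2_norm_eq_inner inner_AA)
        also have "\<dots> \<le> g n * (P * norm (\<epsilon> n))" unfolding P_def using g_pos[of n] by (intro mult_left_mono norm_cauchy_schwarz) auto
        also have "\<dots> \<le> (g n)\<^sup>2 / (kap L)\<^sup>2 * P\<^sup>2 + (kap L)\<^sup>2 / 4 * (norm (\<epsilon> n))\<^sup>2"
        proof -
          have "2 * (g n / kap L * P) * (kap L / 2 * norm (\<epsilon> n)) \<le> (g n / kap L * P)\<^sup>2 + (kap L / 2 * norm (\<epsilon> n))\<^sup>2" by (rule sum_squares_bound)
          thus ?thesis using kap_pos[OF L] by (simp add: power_mult_distrib power_divide)
        qed
        finally show ?thesis using low_slack[OF dD, of n] by (simp add: d_def[symmetric] P_def left_diff_distrib)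
      qed
      have "(\<lambda>n. u n - v n) \<longlonglongrightarrow> 0"
      proof (rule tendsto_norm_zero_cancel)
        have "(\<lambda>n. (kap L)\<^sup>2 / 4 / (ecut - r) * (norm (\<epsilon> n))\<^sup>2) \<longlonglongrightarrow> (kap L)\<^sup>2 / 4 / (ecut - r) * (norm (0 :: cfg ell2))\<^sup>2"
          by (intro tendsto_intros el)
        hence "(\<lambda>n. (kap L)\<^sup>2 / 4 / (ecut - r) * (norm (\<epsilon> n))\<^sup>2) \<longlonglongrightarrow> 0" by simp
        hence "(\<lambda>n. (norm (u n - v n))\<^sup>2) \<longlonglongrightarrow> 0"
        proof (rule Lim_null_comparison[rotated])
          show "\<forall>\<^sub>F n in sequentially. norm ((norm (u n - v n))\<^sup>2) \<le> (kap L)\<^sup>2 / 4 / (ecut - r) * (norm (\<epsilon> n))\<^sup>2"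
            using bd r_le(1) by (intro always_eventually) (simp add: field_simps)
        qed
        from tendsto_real_sqrt[OF this] show "(\<lambda>n. norm (u n - v n)) \<longlonglongrightarrow> 0" by simp
      qed
      from tendsto_diff[OF ul this] show ?thesis by simp
    qed
    moreover have "z + t \<in> sec (Suc NN)"
      by (rule closed_sequentially[OF closed_supp_in _ ul]) (use uD in \<open>auto simp: Dkin_def\<close>)
    ultimately show ?thesis by blast
  qed
  \<comment> \<open>The interaction only lowers the form, so the cut-off resolvents dominate the
    free one: \<open>inner y v\<close> is at least \<open>inner y z\<close>, which is positive and
    independent of \<open>n\<close>.\<close>
  assume y0: "y \<noteq> 0"
  define z where "z = mulf Rr y"
  have zD: "z \<in> Dk" unfolding z_def by (rule Rr_Dk[OF y])
  have cm: "Re (cnj q * q) = (cmod q)\<^sup>2" for q :: complex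
    by (metis Re_complex_of_real complex_norm_square mult.commute)
  have hs: "((\<lambda>c. Rr c * (cmod (ev y c))\<^sup>2) has_sum inner y z) UNIV"
    unfolding z_def using inner_mulf_has_sum[OF domR(1), of y y] by (simp only: cm)
  have pos: "0 < inner y z"
  proof -
    have "0 \<le> inner y z" by (rule has_sum_nonneg[OF hs]) (intro mult_nonneg_nonneg less_imp_le[OF Rr_bounds(1)] zero_le_power2)
    moreover have "inner y z \<noteq> 0"
    proof
      assume "inner y z = 0"
      hence "((\<lambda>c. Rr c * (cmod (ev y c))\<^sup>2) has_sum 0) UNIV" using hs by simp
      hence "Rr c * (cmod (ev y c))\<^sup>2 = 0" for c
        by (rule nonneg_has_sum_le_0D) (simp_all only: order_refl UNIV_I mult_nonneg_nonneg less_imp_le[OF Rr_bounds(1)] zero_le_power2)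
      hence "ev y c = 0" for c using Rr_bounds(1)[of c] by (metis less_irrefl mult_eq_0_iff norm_eq_zero power_eq_0_iff)
      thus False using y0 by (auto intro!: ell2_eqI)
    qed
    ultimately show ?thesis by linarith
  qed
  show "\<exists>\<epsilon>>0. \<forall>n. \<forall>v\<in>Dk. An n v - r *\<^sub>R v = y \<longrightarrow> \<epsilon> \<le> inner y v"
  proof (intro exI conjI allI ballI impI)
    show "0 < inner y z" by (rule pos)
    fix n v assume v: "v \<in> Dk" "An n v - r *\<^sub>R v = y"
    let ?d = "v - z"
    have dD: "?d \<in> Dk" using csubD(6)[OF saD(2)[OF saAn] v(1) zD] .
    have "0 \<le> (ecut - r) * (norm ?d)\<^sup>2" using r_le(1) by simp
    also have "\<dots> \<le> inner ?d (An n ?d - r *\<^sub>R ?d)"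
      using low_An[OF dD, of n] by (simp add: inner_diff_right left_diff_distrib power2_norm_eq_inner)
    also have "An n ?d - r *\<^sub>R ?d = y - (An n z - r *\<^sub>R z)"
      unfolding sa_diff[OF saAn v(1) zD] using v(2) by (simp add: algebra_simps)
    also have "An n z - r *\<^sub>R z = y - g n *\<^sub>R CC (Bn n) (AA (Bn n) z)"
      using kin_Rr[OF y] by (simp add: An_apply z_def algebra_simps)
    finally have "0 \<le> g n * inner ?d (CC (Bn n) (AA (Bn n) z))" by simp
    moreover have "inner v (An n z - r *\<^sub>R z) = inner y z"
      using sa_sym[OF saAn v(1) zD, of n] unfolding v(2)[symmetric] by (simp add: inner_diff_right inner_diff_left)
    moreover have "An n z - r *\<^sub>R z = y - g n *\<^sub>R CC (Bn n) (AA (Bn n) z)"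
      using kin_Rr[OF y] by (simp add: An_apply z_def algebra_simps)
    ultimately have "inner v y - g n * inner v (CC (Bn n) (AA (Bn n) z)) = inner y z"
      by (simp add: inner_diff_right)
    moreover have "0 \<le> g n * inner v (CC (Bn n) (AA (Bn n) z))"
    proof -
      have "0 \<le> g n * (norm (AA (Bn n) z))\<^sup>2" using g_pos[of n] by simp
      hence "0 \<le> g n * inner z (CC (Bn n) (AA (Bn n) z))" by (simp add: power2_norm_eq_inner inner_AA)
      thus ?thesis using \<open>0 \<le> g n * inner ?d (CC (Bn n) (AA (Bn n) z))\<close> by (simp add: inner_diff_left right_diff_distrib)
    qed
    ultimately show "inner y z \<le> inner y v" by (simp add: inner_commute)
  qed
qed

end

section \<open>The polaron equation\<close>

text \<open>2500 is the error constant of \<open>recoil_sum_bound\<close>; the assumption makes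
  \<open>cG\<close> at energies far below zero bounded below by a positive number.\<close>

locale polaron_model = cutoff_model +
  assumes bmu: "2500 < (kap L)\<^sup>2 * (\<Sum>k\<in>ball_lat L \<mu>. 1 / (mred M * msq L k - EB))"
begin

text \<open>Energy, relative to \<open>E0 L \<mu> + e\<close>, of the filled Fermi ball with one
  fermion moved from \<open>q\<close> to \<open>k\<close> and the impurity carrying
  \<open>q - k\<close>; it is the denominator in G(q, -q^2 - e).\<close>

definition dG where "dG q k e = msq L (q - k) / M + msq L k + (- msq L q - e)"
definition tG where "tG q e k = 1 / (mred M * msq L k - EB) - (if \<mu> < msq L k then 1 / dG q k e else 0)"
definition cG where "cG q e = infsum (tG q e) UNIV"
definition FB where "FB = ball_lat L \<mu>"
definition bm where "bm = (\<Sum>k\<in>FB. 1 / (mred M * msq L k - EB))"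

lemma finite_FB [simp]: "finite FB" using L by (simp add: FB_def)
lemma FB_iff: "k \<in> FB \<longleftrightarrow> msq L k \<le> \<mu>" by (simp add: FB_def ball_lat_def)
lemma zero_FB: "0 \<in> FB" using mu by (simp add: FB_iff)
lemma term_pos: "0 < 1 / (mred M * msq L k - EB)" using mred_msq_pos[OF M0(1) EB(1), of L k] by simp

lemma cG_Gfun: "cG q e = L\<^sup>2 * Gfun M L \<mu> EB (latvec L q) (- msq L q - e)"
proof -
  have "tG q e = (\<lambda>j. 1 / (mred M * msq L j - EB)
      - (if msq L j > \<mu> then
           1 / (((fst (latvec L q) - kap L * real_of_int (fst j))^2 + (snd (latvec L q) - kap L * real_of_int (snd j))^2) / M
                + msq L j + (- msq L q - e))
         else 0))"
  proof (rule ext)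
    fix j
    have "(fst (latvec L q) - kap L * real_of_int (fst j))^2 + (snd (latvec L q) - kap L * real_of_int (snd j))^2 = msq L (q - j)"
      by (simp add: latvec_def msq_def power2_eq_square algebra_simps)
    thus "tG q e j = 1 / (mred M * msq L j - EB)
      - (if msq L j > \<mu> then
           1 / (((fst (latvec L q) - kap L * real_of_int (fst j))^2 + (snd (latvec L q) - kap L * real_of_int (snd j))^2) / M
                + msq L j + (- msq L q - e))
         else 0)" by (simp add: tG_def dG_def)
  qed
  thus ?thesis unfolding cG_def Gfun_def using L by simp
qed

definition th where "th e = - e / (1 + \<mu> - e)" for e :: real

lemma th_pos: "e < 0 \<Longrightarrow> th e > 0" unfolding th_def using mu by (intro divide_pos_pos) auto

lemma dG_lower:
  assumes q: "q \<in> FB" and e: "e \<le> e2" "e2 < 0" and k: "\<mu> < msq L k"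
  shows "th e2 * (1 + msq L k) \<le> dG q k e" "0 < dG q k e"
proof -
  define a where "a = - e2"
  define X where "X = msq L k"
  have a: "a > 0" using e by (simp add: a_def)
  have D: "1 + \<mu> + a > 0" using mu a by simp
  have "0 \<le> msq L (q - k) / M" by (rule mM)
  hence d: "X - \<mu> + a \<le> dG q k e" using q e by (simp add: dG_def FB_iff X_def a_def)
  have "th e2 * (1 + X) = a * (1 + X) / (1 + \<mu> + a)" by (simp add: th_def a_def)
  also have "\<dots> \<le> X - \<mu> + a"
  proof -
    have "0 \<le> (X - \<mu>) * (1 + \<mu>) + a * a" using k mu a by (intro add_nonneg_nonneg mult_nonneg_nonneg) (auto simp: X_def)
    hence "a * (1 + X) \<le> (X - \<mu> + a) * (1 + \<mu> + a)" by (simp add: algebra_simps)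
    thus ?thesis using D by (simp add: pos_divide_le_eq)
  qed
  finally show t: "th e2 * (1 + msq L k) \<le> dG q k e" using d by (simp add: X_def)
  have "0 < X - \<mu> + a" using k a by (simp add: X_def)
  thus "0 < dG q k e" using d by linarith
qed

lemma tG_summable: "q \<in> FB \<Longrightarrow> e < 0 \<Longrightarrow> tG q e summable_on UNIV"
proof -
  assume q: "q \<in> FB" and e: "e < 0"
  have "(\<lambda>k. 1 / (mred M * msq L k - EB) - (if \<mu> < msq L k then 1 / (msq L (q - k) / M + msq L k + (- msq L q - e)) else 0)) summable_on UNIV"
  proof (rule polaron_term_summable[OF L M0(1) EB(1) th_pos[OF e]])
    show "th e * (1 + msq L k) \<le> msq L (q - k) / M + msq L k + (- msq L q - e)" if "\<mu> < msq L k" for k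
      using dG_lower(1)[OF q order_refl e that] by (simp add: dG_def)
    show "finite {k. \<not> \<mu> < msq L k}" using finite_msq_ball[OF L, of \<mu>] by (simp add: not_less)
  qed
  thus ?thesis unfolding tG_def[abs_def] dG_def .
qed

lemma cG_mono:
  assumes q: "q \<in> FB" and e: "e \<le> e'" "e' < 0" shows "cG q e' \<le> cG q e"
  unfolding cG_def
proof (rule infsum_mono)
  show "tG q e' summable_on UNIV" "tG q e summable_on UNIV" using tG_summable[OF q] e by auto
  fix k
  show "tG q e' k \<le> tG q e k"
  proof (cases "\<mu> < msq L k")
    case True
    have "0 < dG q k e'" using dG_lower(2)[OF q order_refl e(2) True] .
    moreover have "dG q k e' \<le> dG q k e" using e by (simp add: dG_def)
    ultimately show ?thesis using True by (simp add: tG_def frac_le)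
  qed (simp add: tG_def)
qed

text \<open>The difference of two resolvent terms is \<open>e' - e\<close> over a product of two
  denominators, hence summable. The resulting continuity serves the intermediate value argument for
  the polaron equation.\<close>

lemma cG_lipschitz:
  assumes q: "q \<in> FB" and e2: "e2 < 0"
  shows "\<exists>C\<ge>0. \<forall>e\<le>e2. \<forall>e'\<le>e2. \<bar>cG q e - cG q e'\<bar> \<le> C * \<bar>e - e'\<bar>"
proof -
  define S where "S = infsum (\<lambda>k. (1 / (1 + msq L k))\<^sup>2) UNIV"
  have Ss: "(\<lambda>k. (1 / (1 + msq L k))\<^sup>2) summable_on UNIV" by (rule summable_inv_sq_msq[OF L])
  have S0: "S \<ge> 0" unfolding S_def by (rule infsum_nonneg) simp
  have t0: "th e2 > 0" by (rule th_pos[OF e2])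
  have "cG q e - cG q e' \<le> S / (th e2)\<^sup>2 * \<bar>e - e'\<bar>" if e: "e \<le> e2" "e' \<le> e2" for e e'
  proof -
    have s: "tG q e summable_on UNIV" "tG q e' summable_on UNIV" using tG_summable[OF q] e e2 by auto
    have "cG q e \<le> infsum (\<lambda>k. tG q e' k + \<bar>e - e'\<bar> / (th e2)\<^sup>2 * (1 / (1 + msq L k))\<^sup>2) UNIV"
      unfolding cG_def
    proof (rule infsum_mono[OF s(1)])
      show "(\<lambda>k. tG q e' k + \<bar>e - e'\<bar> / (th e2)\<^sup>2 * (1 / (1 + msq L k))\<^sup>2) summable_on UNIV"
        by (intro summable_on_add s summable_on_cmult_right Ss)
      fix k
      show "tG q e k \<le> tG q e' k + \<bar>e - e'\<bar> / (th e2)\<^sup>2 * (1 / (1 + msq L k))\<^sup>2"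
      proof (cases "\<mu> < msq L k")
        case True
        have d: "0 < dG q k e" "0 < dG q k e'" using dG_lower(2)[OF q _ e2 True] e by auto
        have o: "0 < 1 + msq L k" by (simp add: add_pos_nonneg)
        have "1 / dG q k e' - 1 / dG q k e = (dG q k e - dG q k e') / (dG q k e' * dG q k e)" using d by (simp add: diff_frac_eq)
        also have "dG q k e - dG q k e' = e' - e" by (simp add: dG_def)
        also have "(e' - e) / (dG q k e' * dG q k e) \<le> \<bar>e - e'\<bar> / (dG q k e' * dG q k e)"
          using d by (intro divide_right_mono) auto
        also have "\<dots> \<le> \<bar>e - e'\<bar> / ((th e2 * (1 + msq L k)) * (th e2 * (1 + msq L k)))"
          using dG_lower(1)[OF q e(1) e2 True] dG_lower(1)[OF q e(2) e2 True] t0 o d by (intro divide_left_mono mult_mono mult_pos_pos) auto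
        also have "\<dots> = \<bar>e - e'\<bar> / (th e2)\<^sup>2 * (1 / (1 + msq L k))\<^sup>2" by (simp add: power2_eq_square)
        finally show ?thesis using True by (simp add: tG_def)
      qed (simp add: tG_def)
    qed
    also have "\<dots> = cG q e' + \<bar>e - e'\<bar> / (th e2)\<^sup>2 * S"
      unfolding cG_def S_def infsum_add[OF s(2) summable_on_cmult_right[OF Ss]] infsum_cmult_right' ..
    finally show ?thesis by (simp add: mult.commute)
  qed
  from this this[of _ _] have "\<bar>cG q e - cG q e'\<bar> \<le> S / (th e2)\<^sup>2 * \<bar>e - e'\<bar>" if "e \<le> e2" "e' \<le> e2" for e e'
    using that abs_minus_commute[of e e'] by (smt (verit) abs_minus_commute)
  thus ?thesis using S0 by (intro exI[of _ "S / (th e2)\<^sup>2"]) auto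
qed

lemma cG_continuous:
  assumes q: "q \<in> FB" and e2: "e2 < 0" shows "continuous_on {e1..e2} (cG q)"
proof -
  obtain C where C: "C \<ge> 0" "\<And>e e'. e \<le> e2 \<Longrightarrow> e' \<le> e2 \<Longrightarrow> \<bar>cG q e - cG q e'\<bar> \<le> C * \<bar>e - e'\<bar>"
    using cG_lipschitz[OF q e2] by blast
  have "C-lipschitz_on {e1..e2} (cG q)" using C by (intro lipschitz_onI) (auto simp: dist_real_def)
  thus ?thesis by (rule lipschitz_on_continuous_on)
qed

text \<open>Convexity of the reciprocal removes the recoil direction: the pair \<open>k\<close>,
  \<open>- k\<close> is at least \<open>2 / a\<close>. Comparing \<open>a\<close> with the
  denominator of the coupling costs 2 \<mu>, and half of 16 times 25 gives 200.\<close>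

lemma cG_upper:
  assumes q: "q \<in> FB" and e: "e < 0" "- e \<le> \<mu>" shows "cG q e \<le> bm + 200 / (kap L)\<^sup>2"
proof -
  have s: "tG q e summable_on UNIV" by (rule tG_summable[OF q e(1)])
  have bij: "bij_betw uminus (UNIV :: lat set) UNIV" by (rule bij_betw_byWitness[of _ uminus]) auto
  have s': "(\<lambda>k. tG q e (- k)) summable_on UNIV" using summable_on_reindex_bij_betw[OF bij, of "tG q e"] s by simp
  have r: "infsum (\<lambda>k. tG q e (- k)) UNIV = cG q e" unfolding cG_def by (rule infsum_reindex_bij_betw[OF bij])
  have "2 * cG q e = infsum (\<lambda>k. tG q e k + tG q e (- k)) UNIV"
    unfolding infsum_add[OF s s'] r by (simp add: cG_def)
  also have "\<dots> \<le> 2 * bm + 16 * \<mu> * (25 / ((kap L)\<^sup>2 * \<mu>))"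
  proof (rule infsum_le_finite_sums[OF summable_on_add[OF s s']])
    fix F :: "lat set" assume F: "finite F" "F \<subseteq> UNIV"
    have "(\<Sum>k\<in>F. tG q e k + tG q e (- k)) \<le> (\<Sum>k\<in>F. 2 * (if msq L k \<le> \<mu> then 1 / (mred M * msq L k - EB) else 0) + 16 * \<mu> * (1 / (\<mu> + msq L k)\<^sup>2))"
    proof (rule sum_mono)
      fix k
      show "tG q e k + tG q e (- k) \<le> 2 * (if msq L k \<le> \<mu> then 1 / (mred M * msq L k - EB) else 0) + 16 * \<mu> * (1 / (\<mu> + msq L k)\<^sup>2)"
      proof (cases "msq L k \<le> \<mu>")
        case True thus ?thesis using mu by (simp add: tG_def)
      next
        case False
        hence kX: "\<mu> < msq L k" by simp
        let ?X = "msq L k"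
        define a where "a = mred M * ?X + msq L q / M - msq L q - e"
        define c where "c = 2 * dotl L q k / M"
        have d1: "dG q k e = a - c" and d2: "dG q (- k) e = a + c"
          using msq_diff[of L q "- k"] by (simp_all add: dG_def msq_diff a_def c_def mred_def add_divide_distrib diff_divide_distrib distrib_right)
        have p: "a - c > 0" "a + c > 0"
          using dG_lower(2)[OF q order_refl e(1) kX] dG_lower(2)[OF q order_refl e(1), of "- k"] kX by (auto simp: d1 d2)
        have a0: "a > 0" using p by linarith
        have "2 / a \<le> 1 / (a - c) + 1 / (a + c)"
        proof -
          have "1 / (a - c) + 1 / (a + c) = 2 * a / ((a - c) * (a + c))" using p by (simp add: field_simps)
          moreover have "2 * a / (a * a) \<le> 2 * a / ((a - c) * (a + c))"
            using p a0 by (intro divide_left_mono mult_pos_pos) (auto simp: algebra_simps)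
          ultimately show ?thesis using a0 by simp
        qed
        moreover have "a \<le> mred M * ?X + 2 * \<mu>"
        proof -
          have "msq L q / M \<le> msq L q / 1" using M0 by (intro divide_left_mono) auto
          thus ?thesis using e(2) mu by (simp add: a_def)
        qed
        hence "2 / (mred M * ?X + 2 * \<mu>) \<le> 2 / a" using a0 by (intro divide_left_mono mult_pos_pos) auto
        moreover have "2 / (mred M * ?X - EB) - 2 / (mred M * ?X + 2 * \<mu>) \<le> 16 * \<mu> * (1 / (\<mu> + ?X)\<^sup>2)"
        proof -
          define Y where "Y = mred M * ?X"
          have YX: "Y \<ge> ?X" using M0 by (simp add: Y_def mred_def distrib_right)
          have pp: "Y - EB > 0" "Y + 2 * \<mu> > 0" using YX kX mu EB by auto
          have "2 / (Y - EB) - 2 / (Y + 2 * \<mu>) = 2 * (2 * \<mu> + EB) / ((Y - EB) * (Y + 2 * \<mu>))" using pp by (simp add: field_simps)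
          also have "\<dots> \<le> 2 * (2 * \<mu>) / (?X * ?X)"
            using EB mu kX YX pp by (intro frac_le mult_mono mult_pos_pos) auto
          also have "\<dots> \<le> 16 * \<mu> * (1 / (\<mu> + ?X)\<^sup>2)"
          proof -
            have "(\<mu> + ?X)\<^sup>2 \<le> (2 * ?X)\<^sup>2" using kX mu by (intro power_mono) auto
            hence "16 * \<mu> / (2 * ?X)\<^sup>2 \<le> 16 * \<mu> / (\<mu> + ?X)\<^sup>2"
              using mu kX by (intro divide_left_mono mult_pos_pos zero_less_power) auto
            thus ?thesis by (simp add: power2_eq_square)
          qed
          finally show ?thesis by (simp add: Y_def)
        qed
        ultimately have "2 / (mred M * ?X - EB) - (1 / (a - c) + 1 / (a + c)) \<le> 16 * \<mu> * (1 / (\<mu> + ?X)\<^sup>2)" by linarith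
        thus ?thesis using kX by (simp add: tG_def d1 d2)
      qed
    qed
    also have "\<dots> = 2 * (\<Sum>k\<in>F. if msq L k \<le> \<mu> then 1 / (mred M * msq L k - EB) else 0) + 16 * \<mu> * (\<Sum>k\<in>F. 1 / (\<mu> + msq L k)\<^sup>2)"
      by (simp only: sum.distrib sum_distrib_left)
    also have "\<dots> \<le> 2 * bm + 16 * \<mu> * (25 / ((kap L)\<^sup>2 * \<mu>))"
    proof (intro add_mono mult_left_mono)
      have "(\<Sum>k\<in>F. if msq L k \<le> \<mu> then 1 / (mred M * msq L k - EB) else 0) = (\<Sum>k\<in>F \<inter> FB. 1 / (mred M * msq L k - EB))"
        using F by (simp add: sum.If_cases FB_iff Int_def)
      also have "\<dots> \<le> bm" unfolding bm_def using term_pos by (intro sum_mono2) (auto intro: less_imp_le)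
      finally show "(\<Sum>k\<in>F. if msq L k \<le> \<mu> then 1 / (mred M * msq L k - EB) else 0) \<le> bm" .
      show "(\<Sum>k\<in>F. 1 / (\<mu> + msq L k)\<^sup>2) \<le> 25 / ((kap L)\<^sup>2 * \<mu>)" by (rule msq_sum_inv_sq[OF L F(1) km])
    qed (use mu in auto)
    finally show "(\<Sum>k\<in>F. tG q e k + tG q e (- k)) \<le> 2 * bm + 16 * \<mu> * (25 / ((kap L)\<^sup>2 * \<mu>))" .
  qed
  also have "\<dots> = 2 * bm + 400 / (kap L)\<^sup>2" using mu by simp
  finally show ?thesis by simp
qed

text \<open>For such negative \<open>e\<close> the shift \<open>- msq L q - e\<close> is at least
  |E_B|, so \<open>recoil_sum_bound\<close> applies with parameter 1. The bound provides the
  starting point of the intermediate value argument.\<close>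

lemma cG_lower:
  assumes q: "q \<in> FB" and e: "e \<le> EB - \<mu>" shows "bm - 2500 / (kap L)\<^sup>2 \<le> cG q e"
proof -
  have e0: "e < 0" using e EB mu by linarith
  have lim: "(\<lambda>n. \<Sum>k\<in>ball_lat L (real n). tG q e k) \<longlonglongrightarrow> cG q e"
    unfolding cG_def by (rule sum_ball_lat_tendsto[OF L tG_summable[OF q e0]])
  show ?thesis
  proof (rule LIMSEQ_le_const[OF lim], intro exI allI impI)
    fix n assume n: "nat \<lceil>\<mu>\<rceil> \<le> n"
    let ?B = "ball_lat L (real n)"
    define F where "F = {k \<in> ?B. \<mu> < msq L k}"
    have mn: "\<mu> \<le> real n" using n by linarith
    have BF: "?B = FB \<union> F" "FB \<inter> F = {}" using mn by (auto simp: F_def FB_iff ball_lat_def)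
    have fF: "finite F" using L by (simp add: F_def)
    have t: "\<bar>EB\<bar> \<le> - msq L q - e" using q e EB by (simp add: FB_iff)
    have "(\<Sum>k\<in>F. 1 / dG q k e) \<le> (\<Sum>k\<in>F. 1 / (mred M * msq L k + (- msq L q - e))) + 2500 / (1^3 * (kap L)\<^sup>2)"
      unfolding dG_def
    proof (rule recoil_sum_bound[OF L M0(2) fF])
      show "- k \<in> F" if "k \<in> F" for k using that by (simp add: F_def ball_lat_def)
      show "1 * msq L k \<le> msq L k + (- msq L q - e) \<and> 0 < msq L k + (- msq L q - e)" if "k \<in> F" for k
        using t EB(1) msq_ge0[of L k] by linarith
    qed simp
    also have "(\<Sum>k\<in>F. 1 / (mred M * msq L k + (- msq L q - e))) \<le> (\<Sum>k\<in>F. 1 / (mred M * msq L k - EB))"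
    proof (rule sum_mono)
      fix k show "1 / (mred M * msq L k + (- msq L q - e)) \<le> 1 / (mred M * msq L k - EB)"
        using mred_msq_pos[OF M0(1) EB(1), of L k] t EB(1) by (intro divide_left_mono mult_pos_pos) auto
    qed
    finally have 1: "(\<Sum>k\<in>F. 1 / dG q k e) \<le> (\<Sum>k\<in>F. 1 / (mred M * msq L k - EB)) + 2500 / (kap L)\<^sup>2" by simp
    have "(\<Sum>k\<in>?B. tG q e k) = (\<Sum>k\<in>FB. tG q e k) + (\<Sum>k\<in>F. tG q e k)"
      unfolding BF(1) using fF BF(2) by (simp add: sum.union_disjoint)
    also have "(\<Sum>k\<in>FB. tG q e k) = bm" unfolding bm_def by (rule sum.cong) (auto simp: tG_def FB_iff)
    also have "(\<Sum>k\<in>F. tG q e k) = (\<Sum>k\<in>F. 1 / (mred M * msq L k - EB)) - (\<Sum>k\<in>F. 1 / dG q k e)"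
      unfolding sum_subtractf[symmetric] by (rule sum.cong) (auto simp: tG_def F_def)
    finally show "bm - 2500 / (kap L)\<^sup>2 \<le> (\<Sum>k\<in>?B. tG q e k)" using 1 by linarith
  qed
qed

lemma polaron_eq_cG: "polaron_eq M L \<mu> EB e \<longleftrightarrow> e = - (\<Sum>q\<in>FB. 1 / cG q e)"
proof -
  have "(1 / L\<^sup>2) * (\<Sum>j\<in>FB. 1 / Gfun M L \<mu> EB (latvec L j) (- msq L j - e)) = (\<Sum>q\<in>FB. 1 / cG q e)"
    unfolding cG_Gfun sum_distrib_left by simp
  thus ?thesis unfolding polaron_eq_def FB_def by simp
qed

text \<open>The terms \<open>1 / cG\<close> may be singular, and the least solution has to be one
  where all \<open>cG\<close> are positive. Since \<open>cG\<close> is nonincreasing in the energy,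
  a solution at which all are positive is automatically the least. It is found for the sum with
  \<open>cG\<close> replaced by \<open>max (cG q e) \<eta>\<close>, and \<open>\<eta>\<close> turns
  out to be inactive there.\<close>

lemma eP_properties:
  "eP M L \<mu> EB < 0" "q \<in> FB \<Longrightarrow> 0 < cG q (eP M L \<mu> EB)" "eP M L \<mu> EB = - (\<Sum>q\<in>FB. 1 / cG q (eP M L \<mu> EB))"
proof -
  define \<gamma> where "\<gamma> = bm - 2500 / (kap L)\<^sup>2"
  have g0: "\<gamma> > 0"
  proof -
    have "2500 / (kap L)\<^sup>2 < bm" using bmu k0 by (simp add: pos_divide_less_eq bm_def FB_def mult.commute)
    thus ?thesis by (simp add: \<gamma>_def)
  qed
  \<comment> \<open>At \<open>e1\<close> every \<open>cG\<close> is at least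
    \<open>\<gamma>\<close>, so the sum is at most \<open>card FB / \<gamma>\<close>, which is below
    \<open>- e1\<close>.\<close>
  define e1 where "e1 = EB - \<mu> - real (card FB) / \<gamma>"
  have e1: "e1 \<le> EB - \<mu>" "e1 < 0" using g0 EB mu by (auto simp: e1_def add_pos_nonneg) (smt (verit) divide_nonneg_pos of_nat_0_le_iff)
  have G1: "\<gamma> \<le> cG q e1" if "q \<in> FB" for q using cG_lower[OF that e1(1)] by (simp add: \<gamma>_def)
  have F1: "(\<Sum>q\<in>FB. 1 / cG q e1) \<le> - e1"
  proof -
    have "(\<Sum>q\<in>FB. 1 / cG q e1) \<le> (\<Sum>q\<in>FB. 1 / \<gamma>)" using G1 g0 by (intro sum_mono frac_le) auto
    also have "\<dots> = real (card FB) / \<gamma>" by simp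
    also have "\<dots> \<le> - e1" using EB mu by (simp add: e1_def)
    finally show ?thesis .
  qed
  \<comment> \<open>A positive number whose reciprocal is at most \<open>- e1\<close> is at least
    twice \<open>\<eta>\<close>. So wherever the regularised sum is at most \<open>- e1\<close>, the
    maximum is not attained by \<open>\<eta>\<close>.\<close>
  define \<eta> where "\<eta> = 1 / (2 * - e1)"
  have eta: "\<eta> > 0" "\<eta> < 1 / - e1" using e1(2) unfolding \<eta>_def by (simp, intro frac_less2) auto
  have ge: "1 / - e1 \<le> c" if "1 / c \<le> - e1" "c > 0" for c using that e1(2) by (simp add: field_simps)
  have single: "1 / cG q e1 \<le> - e1" if "q \<in> FB" for q
  proof -
    have "1 / cG q e1 \<le> (\<Sum>q\<in>FB. 1 / cG q e1)" using that G1 g0 by (intro member_le_sum) (auto intro: order_trans less_imp_le)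
    thus ?thesis using F1 by linarith
  qed
  define \<psi> where "\<psi> e = e + (\<Sum>q\<in>FB. 1 / max (cG q e) \<eta>)" for e
  have psi1: "\<psi> e1 \<le> 0"
  proof -
    have "max (cG q e1) \<eta> = cG q e1" if "q \<in> FB" for q
      using ge[OF single[OF that]] G1[OF that] g0 eta by (smt (verit))
    hence "\<psi> e1 = e1 + (\<Sum>q\<in>FB. 1 / cG q e1)" unfolding \<psi>_def by simp
    thus ?thesis using F1 by linarith
  qed
  \<comment> \<open>The mode 0 alone makes the sum at \<open>- \<omega> / 2\<close> at least
    \<open>\<omega>\<close>, because its \<open>cG\<close> does not increase on the way up from
    \<open>e1\<close>.\<close>
  define \<omega> where "\<omega> = 1 / cG 0 e1"
  have om: "\<omega> > 0" "\<omega> \<le> - e1" using G1[OF zero_FB] g0 single[OF zero_FB] by (auto simp: \<omega>_def)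
  define e2 where "e2 = - \<omega> / 2"
  have e2: "e2 < 0" "e1 \<le> e2" using om by (auto simp: e2_def)
  have psi2: "0 \<le> \<psi> e2"
  proof -
    have "cG 0 e2 \<le> cG 0 e1" by (rule cG_mono[OF zero_FB e2(2,1)])
    moreover have "\<eta> \<le> cG 0 e1" using ge[OF single[OF zero_FB]] G1[OF zero_FB] g0 eta by linarith
    ultimately have "max (cG 0 e2) \<eta> \<le> cG 0 e1" by simp
    hence "\<omega> \<le> 1 / max (cG 0 e2) \<eta>" unfolding \<omega>_def using eta by (intro divide_left_mono mult_pos_pos) (auto simp: less_max_iff_disj intro: less_le_trans)
    also have "\<dots> \<le> (\<Sum>q\<in>FB. 1 / max (cG q e2) \<eta>)"
      using zero_FB eta by (intro member_le_sum) (auto simp: less_max_iff_disj intro!: less_imp_le divide_pos_pos)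
    finally show ?thesis unfolding \<psi>_def e2_def using om by linarith
  qed
  have "continuous_on {e1..e2} \<psi>"
    unfolding \<psi>_def using eta by (intro continuous_intros cG_continuous e2(1)) (auto simp: max_def)
  then obtain e0 where e0: "e1 \<le> e0" "e0 \<le> e2" "\<psi> e0 = 0"
    using IVT'[of \<psi> e1 0 e2] psi1 psi2 e2(2) by blast
  have e0n: "e0 < 0" using e0 e2 by linarith
  have pos: "\<eta> < cG q e0" if q: "q \<in> FB" for q
  proof -
    have mp: "max (cG q e0) \<eta> > 0" using eta by (simp add: less_max_iff_disj)
    have "1 / max (cG q e0) \<eta> \<le> (\<Sum>q\<in>FB. 1 / max (cG q e0) \<eta>)"
      using q eta by (intro member_le_sum) (auto simp: less_max_iff_disj intro!: less_imp_le divide_pos_pos)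
    also have "\<dots> \<le> - e1" using e0 unfolding \<psi>_def by linarith
    finally have "1 / - e1 \<le> max (cG q e0) \<eta>" using ge mp by blast
    thus ?thesis using eta by (simp add: le_max_iff_disj)
  qed
  have pos0: "0 < cG q e0" if "q \<in> FB" for q using pos[OF that] eta by linarith
  have mx: "max (cG q e0) \<eta> = cG q e0" if "q \<in> FB" for q using pos[OF that] by (simp add: max_def)
  have sol: "e0 = - (\<Sum>q\<in>FB. 1 / cG q e0)" using e0(3) mx unfolding \<psi>_def by (simp add: eq_neg_iff_add_eq_0)
  have "eP M L \<mu> EB = e0"
    unfolding eP_def
  proof (rule Least_equality)
    show "e0 < 0 \<and> polaron_eq M L \<mu> EB e0" using e0n sol polaron_eq_cG by blast
    fix e assume "e < 0 \<and> polaron_eq M L \<mu> EB e"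
    hence e: "e < 0" "e = - (\<Sum>q\<in>FB. 1 / cG q e)" using polaron_eq_cG by auto
    show "e0 \<le> e"
    proof (rule ccontr)
      assume "\<not> e0 \<le> e"
      hence lt: "e < e0" by simp
      have "(\<Sum>q\<in>FB. 1 / cG q e) \<le> (\<Sum>q\<in>FB. 1 / cG q e0)"
        using cG_mono[OF _ less_imp_le[OF lt] e0n] pos0 by (intro sum_mono frac_le) auto
      hence "e0 \<le> e" using e(2) sol by linarith
      thus False using lt by simp
    qed
  qed
  thus "eP M L \<mu> EB < 0" "q \<in> FB \<Longrightarrow> 0 < cG q (eP M L \<mu> EB)" "eP M L \<mu> EB = - (\<Sum>q\<in>FB. 1 / cG q (eP M L \<mu> EB))"
    using e0n pos0 sol by auto
qed

text \<open>If the polaron energy lies below -\<mu>, the hypothesis already gives the claim;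
  otherwise \<open>cG_upper\<close> bounds every term of the polaron equation from below.\<close>

lemma eP_lower:
  assumes N: "real (card FB) \<le> \<mu> * (bm + 200 / (kap L)\<^sup>2)"
  shows "real (card FB) / (bm + 200 / (kap L)\<^sup>2) \<le> - eP M L \<mu> EB"
proof -
  let ?e = "eP M L \<mu> EB" and ?b = "bm + 200 / (kap L)\<^sup>2"
  have bp: "?b > 0"
  proof -
    have "bm \<ge> 0" unfolding bm_def using term_pos by (intro sum_nonneg) (auto intro: less_imp_le)
    thus ?thesis using k0 by (simp add: add_nonneg_pos)
  qed
  show ?thesis
  proof (cases "- ?e \<le> \<mu>")
    case True
    have "real (card FB) / ?b = (\<Sum>q\<in>FB. 1 / ?b)" by simp
    also have "\<dots> \<le> (\<Sum>q\<in>FB. 1 / cG q ?e)"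
      using cG_upper[OF _ eP_properties(1) True] eP_properties(2) by (intro sum_mono frac_le) auto
    also have "\<dots> = - ?e" using eP_properties(3) by linarith
    finally show ?thesis .
  next
    case False
    have "real (card FB) / ?b \<le> \<mu>" using N bp by (simp add: pos_divide_le_eq)
    thus ?thesis using False by linarith
  qed
qed

end

section \<open>The trial state\<close>

context polaron_model
begin

definition ee where "ee = eP M L \<mu> EB"
definition z0 where "z0 = E0 L \<mu> + ee"
definition cq where "cq q = 1 / cG q ee"
text \<open>The signs are chosen so that creating the missing fermion restores the filled ball with
  a positive coefficient for every \<open>q\<close>; these weights add up to \<open>- ee\<close> by
  the polaron equation.\<close>

definition ww where "ww = (\<Sum>q\<in>FB. cs (complex_of_real (cq q) * sgn_lat (FB - {q}) q) (unit (q, FB - {q})))"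
definition RR where "RR c = (if c \<in> Cfg (Suc NN) then 1 / (kin M L c - z0) else 0)"
definition cf where "cf = (\<lambda>(q, k). (q - k, insert k (FB - {q})) :: cfg)"

lemma ee0: "ee < 0" using eP_properties(1) by (simp add: ee_def)
lemma cq_pos: "q \<in> FB \<Longrightarrow> 0 < cq q" using eP_properties(2) by (simp add: cq_def ee_def)
lemma sum_cq: "(\<Sum>q\<in>FB. cq q) = - ee" using eP_properties(3) by (simp add: cq_def ee_def)

lemma card_FB: "card FB = Suc NN" by (simp add: Suc_NN FB_def Nmu_def)

lemma ev_ww: "ev ww (p, S) = (if p \<in> FB \<and> S = FB - {p} then complex_of_real (cq p) * sgn_lat (FB - {p}) p else 0)"
proof -
  have "ev ww (p, S) = (\<Sum>q\<in>FB. if q = p then (if S = FB - {p} then complex_of_real (cq p) * sgn_lat (FB - {p}) p else 0) else 0)"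
    unfolding ww_def ev_sum by (rule sum.cong) auto
  also have "\<dots> = (if p \<in> FB then (if S = FB - {p} then complex_of_real (cq p) * sgn_lat (FB - {p}) p else 0) else 0)"
    by (rule sum.delta) simp
  finally show ?thesis by simp
qed

lemma ww_sec: "ww \<in> sec NN"
proof (rule supp_inI)
  fix c :: cfg assume c: "c \<notin> Cfg NN"
  obtain p S where pS: "c = (p, S)" by (cases c)
  have "\<not> (p \<in> FB \<and> S = FB - {p})"
  proof
    assume "p \<in> FB \<and> S = FB - {p}"
    hence "finite S" "card S = NN" using card_FB by auto
    thus False using c pS by (simp add: Cfg_def)
  qed
  thus "ev ww c = 0" unfolding pS ev_ww by (simp only: if_False)
qed

lemma norm_ww: "(norm ww)\<^sup>2 = (\<Sum>q\<in>FB. (cq q)\<^sup>2)"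
proof (rule has_sum_unique[OF norm2_has_sum])
  let ?f = "\<lambda>q. (q, FB - {q}) :: cfg"
  show "((\<lambda>c. (cmod (ev ww c))\<^sup>2) has_sum (\<Sum>q\<in>FB. (cq q)\<^sup>2)) UNIV"
  proof (rule has_sum_finite_neutralI[of "?f ` FB"])
    show "(\<Sum>q\<in>FB. (cq q)\<^sup>2) = (\<Sum>c\<in>?f ` FB. (cmod (ev ww c))\<^sup>2)"
      by (subst sum.reindex) (auto simp: inj_on_def ev_ww norm_mult)
    fix c :: cfg assume c: "c \<in> UNIV - ?f ` FB"
    obtain p S where pS: "c = (p, S)" by (cases c)
    have "\<not> (p \<in> FB \<and> S = FB - {p})" using c by (auto simp: pS)
    thus "(cmod (ev ww c))\<^sup>2 = 0" unfolding pS ev_ww by (simp only: if_False norm_zero power_zero_numeral)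
  qed auto
qed

lemma ev_CC_ww: "ev (CC B ww) (p, S) = (\<Sum>k\<in>B. if k \<in> S \<and> p + k \<in> FB \<and> S - {k} = FB - {p + k}
    then sgn_lat (S - {k}) k * (complex_of_real (cq (p + k)) * sgn_lat (FB - {p + k}) (p + k)) else 0)"
  unfolding CC_def ev_sum by (rule sum.cong) (auto simp: ev_cre cref_def un_def ev_ww)

lemma ev_CC_ww_FB: "finite B \<Longrightarrow> FB \<subseteq> B \<Longrightarrow> ev (CC B ww) (0, FB) = complex_of_real (- ee)"
proof -
  assume B: "finite B" "FB \<subseteq> B"
  have "ev (CC B ww) (0, FB) = (\<Sum>k\<in>B. if k \<in> FB then complex_of_real (cq k) else 0)"
    unfolding ev_CC_ww by (rule sum.cong) auto
  also have "\<dots> = (\<Sum>k\<in>FB. complex_of_real (cq k))" using B by (simp add: sum.If_cases Int_absorb1)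
  finally show ?thesis unfolding sum_cq[symmetric] by simp
qed

lemma ev_CC_ww_cf:
  assumes B: "finite B" "k \<in> B" and q: "q \<in> FB" and k: "k \<notin> FB"
  shows "cmod (ev (CC B ww) (cf (q, k))) = cq q"
proof -
  have iff: "l \<in> insert k (FB - {q}) \<and> q - k + l \<in> FB \<and> insert k (FB - {q}) - {l} = FB - {q - k + l} \<longleftrightarrow> l = k" for l
    using q k by auto
  have "ev (CC B ww) (cf (q, k)) = (\<Sum>l\<in>B. if l = k then sgn_lat (FB - {q}) k * (complex_of_real (cq q) * sgn_lat (FB - {q}) q) else 0)"
    unfolding cf_def prod.case ev_CC_ww iff using q k by (intro sum.cong) auto
  also have "\<dots> = sgn_lat (FB - {q}) k * (complex_of_real (cq q) * sgn_lat (FB - {q}) q)" using B by simp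
  finally show ?thesis using cq_pos[OF q] by (simp add: norm_mult)
qed

lemma ev_CC_ww_0:
  assumes B: "finite B" and c: "c \<notin> insert (0, FB) (cf ` (FB \<times> (B - FB)))"
  shows "ev (CC B ww) c = 0"
proof -
  obtain p S where pS: "c = (p, S)" by (cases c)
  have "\<not> (k \<in> S \<and> p + k \<in> FB \<and> S - {k} = FB - {p + k})" if kB: "k \<in> B" for k
  proof
    assume h: "k \<in> S \<and> p + k \<in> FB \<and> S - {k} = FB - {p + k}"
    hence S: "S = insert k (FB - {p + k})" by blast
    show False
    proof (cases "k \<in> FB")
      case True
      hence "k = p + k" using h by blast
      hence "p = 0" by simp
      thus False using c True S by (simp add: pS insert_absorb)
    next
      case False
      have "c = cf (p + k, k)" by (simp add: pS cf_def S)
      thus False using c h False kB by blast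
    qed
  qed
  thus ?thesis unfolding pS ev_CC_ww by (intro sum.neutral) auto
qed

lemma kin_FB: "kin M L (0, FB) - z0 = - ee" by (simp add: kin_def z0_def E0_def FB_def msq_def)

lemma kin_cf: "q \<in> FB \<Longrightarrow> k \<notin> FB \<Longrightarrow> kin M L (cf (q, k)) - z0 = dG q k ee"
proof -
  assume q: "q \<in> FB" and k: "k \<notin> FB"
  have "(\<Sum>j\<in>FB - {q}. msq L j) = E0 L \<mu> - msq L q" unfolding E0_def FB_def[symmetric] using q by (simp add: sum_diff1)
  thus ?thesis using k by (simp add: kin_def cf_def z0_def dG_def)
qed

lemma cf_Cfg: "q \<in> FB \<Longrightarrow> k \<notin> FB \<Longrightarrow> cf (q, k) \<in> Cfg (Suc NN)"
  using card_FB by (simp add: cf_def Cfg_def)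

lemma FB_Cfg: "(0, FB) \<in> Cfg (Suc NN)" using card_FB by (simp add: Cfg_def)

lemma kin_z0: "c \<in> Cfg (Suc NN) \<Longrightarrow> - ee \<le> kin M L c - z0"
  using kin_ge_E0[OF L mu M0(1), of c] by (simp add: Suc_NN z0_def)

lemma RR_bounds: "0 \<le> RR c" "RR c \<le> 1 / - ee"
proof -
  have p: "0 < - ee" using ee0 by simp
  show "0 \<le> RR c" using kin_z0[of c] p by (auto simp: RR_def)
  show "RR c \<le> 1 / - ee"
  proof (cases "c \<in> Cfg (Suc NN)")
    case True
    have "1 / (kin M L c - z0) \<le> 1 / - ee" by (rule frac_le[OF _ _ p kin_z0[OF True]]) auto
    thus ?thesis using True by (simp add: RR_def)
  next
    case False thus ?thesis using p by (simp add: RR_def)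
  qed
qed

lemma domRR: "x \<in> domf RR" by (rule domf_bounded[of _ _ "1 / - ee"]) (use RR_bounds in \<open>simp add: abs_of_nonneg\<close>)

lemma RR_Dk: "y \<in> sec (Suc NN) \<Longrightarrow> mulf RR y \<in> Dk"
proof -
  assume y: "y \<in> sec (Suc NN)"
  have b: "\<bar>kin M L c * RR c\<bar> \<le> 1 + \<bar>z0\<bar> / - ee" for c
  proof (cases "c \<in> Cfg (Suc NN)")
    case True
    have p: "0 < kin M L c - z0" using kin_z0[OF True] ee0 by linarith
    have "kin M L c * RR c = 1 + z0 * RR c" using True p by (simp add: RR_def field_simps)
    moreover have "\<bar>z0 * RR c\<bar> \<le> \<bar>z0\<bar> * (1 / - ee)" unfolding abs_mult using RR_bounds[of c] by (intro mult_left_mono) auto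
    ultimately show ?thesis by simp
  next
    case False thus ?thesis using ee0 by (simp add: RR_def divide_nonneg_neg)
  qed
  have "mulf RR y \<in> domf (kin M L)"
    unfolding domf_def
  proof (intro CollectI, rule summable_on_comparison_test[OF summable_on_cmult_right[OF ev_summable[of y], of "(1 + \<bar>z0\<bar> / - ee)\<^sup>2"]])
    fix c
    have "\<bar>kin M L c * RR c\<bar> * cmod (ev y c) \<le> (1 + \<bar>z0\<bar> / - ee) * cmod (ev y c)" by (intro mult_right_mono b) auto
    hence "(\<bar>kin M L c * RR c\<bar> * cmod (ev y c))\<^sup>2 \<le> ((1 + \<bar>z0\<bar> / - ee) * cmod (ev y c))\<^sup>2" by (intro power_mono) auto
    thus "(cmod (complex_of_real (kin M L c) * ev (mulf RR y) c))\<^sup>2 \<le> (1 + \<bar>z0\<bar> / - ee)\<^sup>2 * (cmod (ev y c))\<^sup>2"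
      by (simp only: ev_mulf[OF domRR] norm_mult abs_mult mult.assoc power_mult_distrib norm_of_real)
  qed auto
  thus ?thesis using mulf_sec[OF domRR y] by (simp add: Dkin_def)
qed

lemma kin_RR:
  assumes y: "y \<in> sec (Suc NN)" shows "mulf (kin M L) (mulf RR y) - z0 *\<^sub>R mulf RR y = y"
proof (rule ell2_eqI)
  fix c
  have d: "mulf RR y \<in> domf (kin M L)" using RR_Dk[OF y] by (simp add: Dkin_def)
  have "complex_of_real (kin M L c) * (complex_of_real (RR c) * ev y c) - complex_of_real z0 * (complex_of_real (RR c) * ev y c)
    = complex_of_real ((kin M L c - z0) * RR c) * ev y c" by (simp add: algebra_simps)
  also have "\<dots> = ev y c"
  proof (cases "c \<in> Cfg (Suc NN)")
    case True
    thus ?thesis using kin_z0[OF True] ee0 by (simp add: RR_def)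
  next
    case False thus ?thesis using supp_inD[OF y] by simp
  qed
  finally show "ev (mulf (kin M L) (mulf RR y) - z0 *\<^sub>R mulf RR y) c = ev y c"
    by (simp add: ev_mulf[OF d] ev_mulf[OF domRR])
qed

text \<open>The filled ball contributes \<open>ee^2 / - ee\<close>. Every other configuration
  consists of one hole \<open>q\<close> and one particle \<open>k\<close> and arises once:
  \<open>k\<close> is its only element outside \<open>FB\<close>, and the impurity momentum then
  gives \<open>q\<close>.\<close>

lemma trial_form:
  assumes B: "finite B" "FB \<subseteq> B"
  shows "inner (CC B ww) (mulf RR (CC B ww)) = - ee + (\<Sum>q\<in>FB. (cq q)\<^sup>2 * (\<Sum>k\<in>B - FB. 1 / dG q k ee))"
proof (rule has_sum_unique[OF inner_mulf_has_sum[OF domRR]])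
  let ?X = "CC B ww" and ?I = "FB \<times> (B - FB)"
  have cm: "Re (cnj z * z) = (cmod z)\<^sup>2" for z :: complex
    by (metis Re_complex_of_real complex_norm_square mult.commute)
  have inj: "inj_on cf ?I"
  proof (rule inj_onI)
    fix x y assume x: "x \<in> ?I" and y: "y \<in> ?I" and e: "cf x = cf y"
    obtain q k q' k' where qk: "x = (q, k)" "y = (q', k')" by (cases x, cases y)
    have s: "insert k (FB - {q}) = insert k' (FB - {q'})" "q - k = q' - k'" using e by (auto simp: qk cf_def)
    have "k = k'" using s(1) x qk by auto
    thus "x = y" using s(2) by (simp add: qk)
  qed
  have nin: "(0, FB) \<notin> cf ` ?I" by (auto simp: cf_def)
  show "((\<lambda>c. RR c * Re (cnj (ev ?X c) * ev ?X c)) has_sum (- ee + (\<Sum>q\<in>FB. (cq q)\<^sup>2 * (\<Sum>k\<in>B - FB. 1 / dG q k ee)))) UNIV"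
  proof (rule has_sum_finite_neutralI[of "insert (0, FB) (cf ` ?I)"])
    have "(\<Sum>c\<in>insert (0, FB) (cf ` ?I). RR c * Re (cnj (ev ?X c) * ev ?X c))
       = RR (0, FB) * (cmod (ev ?X (0, FB)))\<^sup>2 + (\<Sum>x\<in>?I. RR (cf x) * (cmod (ev ?X (cf x)))\<^sup>2)"
      unfolding cm using B nin by (simp add: sum.reindex[OF inj])
    also have "RR (0, FB) * (cmod (ev ?X (0, FB)))\<^sup>2 = - ee"
      using FB_Cfg ee0 by (simp add: ev_CC_ww_FB[OF B] RR_def kin_FB power2_eq_square)
    also have "(\<Sum>x\<in>?I. RR (cf x) * (cmod (ev ?X (cf x)))\<^sup>2) = (\<Sum>(q, k)\<in>?I. (cq q)\<^sup>2 * (1 / dG q k ee))"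
    proof (rule sum.cong[OF refl])
      fix x assume x: "x \<in> ?I"
      obtain q k where qk: "x = (q, k)" by (cases x)
      have h: "q \<in> FB" "k \<notin> FB" "k \<in> B" using x qk by auto
      have "RR (cf x) = 1 / dG q k ee" using cf_Cfg[OF h(1,2)] kin_cf[OF h(1,2)] by (simp add: RR_def qk)
      moreover have "cmod (ev ?X (cf x)) = cq q" unfolding qk by (rule ev_CC_ww_cf[OF B(1) h(3,1,2)])
      ultimately show "RR (cf x) * (cmod (ev ?X (cf x)))\<^sup>2 = (case x of (q, k) \<Rightarrow> (cq q)\<^sup>2 * (1 / dG q k ee))"
        by (simp add: qk)
    qed
    also have "\<dots> = (\<Sum>q\<in>FB. (cq q)\<^sup>2 * (\<Sum>k\<in>B - FB. 1 / dG q k ee))"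
      unfolding sum.cartesian_product[symmetric] sum_distrib_left ..
    finally show "- ee + (\<Sum>q\<in>FB. (cq q)\<^sup>2 * (\<Sum>k\<in>B - FB. 1 / dG q k ee))
      = (\<Sum>c\<in>insert (0, FB) (cf ` ?I). RR c * Re (cnj (ev ?X c) * ev ?X c))" by simp
    show "RR c * Re (cnj (ev ?X c) * ev ?X c) = 0" if "c \<in> UNIV - insert (0, FB) (cf ` ?I)" for c
      using ev_CC_ww_0[OF B(1), of c] that by simp
  qed (use B in auto)
qed

definition phi where "phi n = mulf RR (CC (Bn n) ww)"
definition theta where "theta n = (\<Sum>q\<in>FB. (cq q)\<^sup>2 * (\<Sum>k\<in>Bn n. tG q ee k)) + ee"

lemma FB_Bn: "FB \<subseteq> Bn n"
proof -
  have "\<mu> \<le> real (n + n0)" using n0_ge[of n] mu by linarith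
  thus ?thesis unfolding FB_def Bn_def by (rule ball_lat_mono)
qed

lemma theta_eq: "theta n = (norm ww)\<^sup>2 / g n - inner (CC (Bn n) ww) (phi n)"
proof -
  have t: "(\<Sum>k\<in>Bn n. tG q ee k) = 1 / g n - (\<Sum>k\<in>Bn n - FB. 1 / dG q k ee)" for q
  proof -
    have "(\<Sum>k\<in>Bn n. if \<mu> < msq L k then 1 / dG q k ee else 0) = (\<Sum>k\<in>Bn n - FB. 1 / dG q k ee)"
      by (simp add: sum.If_cases Int_def Diff_eq FB_iff not_le)
    thus ?thesis unfolding inv_g tG_def sum_subtractf by simp
  qed
  show ?thesis
    unfolding theta_def phi_def trial_form[OF finite_Bn FB_Bn] norm_ww t
    by (simp add: right_diff_distrib sum_subtractf sum_divide_distrib)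
qed

text \<open>The limit is the sum of \<open>(cq q)^2 * cG q ee\<close> plus \<open>ee\<close>. With
  \<open>cq\<close> the reciprocal of \<open>cG\<close>, its vanishing is the polaron equation,
  which explains the weights in \<open>ww\<close>.\<close>

lemma theta_lim: "theta \<longlonglongrightarrow> 0"
proof -
  have "(\<lambda>n. \<Sum>k\<in>Bn n. tG q ee k) \<longlonglongrightarrow> cG q ee" if "q \<in> FB" for q
    unfolding Bn_def cG_def
    by (rule LIMSEQ_ignore_initial_segment[OF sum_ball_lat_tendsto[OF L tG_summable[OF that ee0]]])
  hence "theta \<longlonglongrightarrow> (\<Sum>q\<in>FB. (cq q)\<^sup>2 * cG q ee) + ee"
    unfolding theta_def[abs_def] by (intro tendsto_intros) auto
  moreover have "(\<Sum>q\<in>FB. (cq q)\<^sup>2 * cG q ee) = (\<Sum>q\<in>FB. cq q)"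
  proof (rule sum.cong[OF refl])
    fix q assume "q \<in> FB"
    hence "cG q ee > 0" using eP_properties(2) by (simp add: ee_def)
    thus "(cq q)\<^sup>2 * cG q ee = cq q" by (simp add: cq_def power2_eq_square)
  qed
  ultimately show ?thesis using sum_cq by simp
qed

lemma phi_Dk: "phi n \<in> Dk" unfolding phi_def by (rule RR_Dk[OF CC_sec[OF ww_sec]])

text \<open>By Cauchy-Schwarz \<open>P^2\<close> is at least \<open>\<xi>^2 / W\<close>. With this
  value the form exceeds its \<open>z0\<close> part by \<open>\<xi> - g n * \<xi>^2 / W\<close>, and
  the square of \<open>W - g n * \<xi>\<close> bounds that by \<open>W / g n - \<xi>\<close>, which
  is \<open>theta n\<close>.\<close>

lemma phi_form: "inner (phi n) (An n (phi n)) \<le> z0 * (norm (phi n))\<^sup>2 + theta n"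
proof -
  define \<xi> where "\<xi> = inner (CC (Bn n) ww) (phi n)"
  define W where "W = (norm ww)\<^sup>2"
  define P where "P = norm (AA (Bn n) (phi n))"
  have "CC (Bn n) ww = mulf (kin M L) (phi n) - z0 *\<^sub>R phi n"
    unfolding phi_def by (rule kin_RR[symmetric, OF CC_sec[OF ww_sec]])
  hence 1: "\<xi> = inner (phi n) (mulf (kin M L) (phi n)) - z0 * (norm (phi n))\<^sup>2"
    unfolding \<xi>_def by (simp add: inner_diff_left inner_diff_right inner_commute power2_norm_eq_inner)
  have "0 < (\<Sum>q\<in>FB. (cq q)\<^sup>2)" using cq_pos zero_FB by (intro sum_pos) force+
  hence W0: "W > 0" by (simp add: W_def norm_ww)
  have gp: "g n > 0" by (rule g_pos)
  have "\<bar>\<xi>\<bar> \<le> norm ww * P" unfolding \<xi>_def inner_CC P_def by (rule Cauchy_Schwarz_ineq2)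
  hence "\<bar>\<xi>\<bar>\<^sup>2 \<le> (norm ww * P)\<^sup>2" by (intro power_mono) auto
  hence "\<xi>\<^sup>2 \<le> W * P\<^sup>2" by (simp add: W_def power_mult_distrib)
  hence "g n * \<xi>\<^sup>2 / W \<le> g n * P\<^sup>2" using W0 gp by (simp add: divide_le_eq mult_left_mono mult_ac)
  moreover have "\<xi> - g n * \<xi>\<^sup>2 / W \<le> W / g n - \<xi>"
  proof -
    have "0 \<le> (W - g n * \<xi>)\<^sup>2 / (g n * W)" using gp W0 by simp
    also have "\<dots> = W / g n - \<xi> - (\<xi> - g n * \<xi>\<^sup>2 / W)" using gp W0 by (simp add: field_simps power2_eq_square)
    finally show ?thesis by simp
  qed
  ultimately show ?thesis unfolding An_form theta_eq using 1 by (simp add: \<xi>_def W_def P_def)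
qed

text \<open>A configuration containing \<open>k\<close> has energy at least \<open>msq L k\<close>,
  so the coefficients decay as \<open>convergent_sum_cre\<close> requires; the constant makes up for
  the shift \<open>z0\<close>.\<close>

lemma phi_convergent: "convergent phi"
proof -
  define y where "y k = mulf (\<lambda>c. RR (sh k c)) ww" for k
  define b where "b = 1 + \<bar>1 + z0\<bar> / - ee"
  have b0: "b \<ge> 0" using ee0 by (simp add: b_def divide_nonneg_neg)
  have bd: "\<bar>RR (sh k c)\<bar> \<le> b / (1 + msq L k)" for k c
  proof (cases "sh k c \<in> Cfg (Suc NN)")
    case True
    define T where "T = kin M L (sh k c) - z0"
    have fS: "finite (insert k (snd c))" using True by (simp add: Cfg_def sh_def)
    have T: "- ee \<le> T" "T > 0" using kin_z0[OF True] ee0 by (auto simp: T_def)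
    have "msq L k \<le> (\<Sum>j\<in>insert k (snd c). msq L j)" by (rule member_le_sum) (use fS in auto)
    hence "msq L k \<le> kin M L (sh k c)" using mM[of "fst c - k"] by (simp add: kin_def sh_def)
    hence "1 + msq L k \<le> T + \<bar>1 + z0\<bar>" by (simp add: T_def)
    also have "\<bar>1 + z0\<bar> \<le> \<bar>1 + z0\<bar> / - ee * T"
    proof -
      have "\<bar>1 + z0\<bar> / - ee * - ee \<le> \<bar>1 + z0\<bar> / - ee * T" using T ee0 by (intro mult_left_mono) (auto simp: divide_nonneg_neg)
      thus ?thesis using ee0 by simp
    qed
    finally have "1 + msq L k \<le> b * T" unfolding b_def distrib_right by simp
    moreover have "0 < 1 + msq L k" by (simp add: add_pos_nonneg)
    ultimately have "1 / T \<le> b / (1 + msq L k)" using T by (simp add: field_simps)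
    thus ?thesis using True T by (simp add: RR_def T_def)
  next
    case False thus ?thesis using b0 by (simp add: RR_def)
  qed
  have dom: "ww \<in> domf (\<lambda>c. RR (sh k c))" for k by (rule domf_bounded, rule bd)
  have eq: "mulf RR (CC B ww) = (\<Sum>k\<in>B. cre k (y k))" for B
  proof (rule ell2_eqI)
    fix c
    have "complex_of_real (RR c) * ev (cre k ww) c = ev (cre k (y k)) c" for k
      by (simp add: ev_cre cref_def y_def ev_mulf[OF dom] sh_un mult.left_commute)
    thus "ev (mulf RR (CC B ww)) c = ev (\<Sum>k\<in>B. cre k (y k)) c"
      by (simp add: ev_mulf[OF domRR] CC_def sum_distrib_left)
  qed
  have "convergent (\<lambda>n. \<Sum>l\<in>ball_lat L (real n). cre l (y l))"
  proof (rule convergent_sum_cre[OF L, where N = NN and b = "b * norm ww"])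
    show "y l \<in> sec NN" for l unfolding y_def by (rule mulf_sec[OF dom ww_sec])
    have "norm (y l) \<le> b / (1 + msq L l) * norm ww" for l
      unfolding y_def by (rule norm_mulf_le[OF bd]) (use b0 in \<open>simp add: add_nonneg_nonneg\<close>)
    thus "norm (y l) \<le> b * norm ww / (1 + msq L l)" for l by simp
  qed
  then obtain f where "(\<lambda>n. \<Sum>l\<in>ball_lat L (real n). cre l (y l)) \<longlonglongrightarrow> f" by (auto simp: convergent_def)
  from LIMSEQ_ignore_initial_segment[OF this, of n0] have "phi \<longlonglongrightarrow> f" unfolding phi_def[abs_def] eq Bn_def .
  thus ?thesis by (auto simp: convergent_def)
qed

lemma phi_limit: obtains f where "phi \<longlonglongrightarrow> f" "f \<noteq> 0"
proof -
  obtain f where f: "phi \<longlonglongrightarrow> f" using phi_convergent by (auto simp: convergent_def)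
  \<comment> \<open>The amplitude of the filled ball is \<open>- ee\<close> times the inverse energy
    \<open>1 / - ee\<close> for every cut-off, which keeps the limit away from zero.\<close>
  have "ev (phi n) (0, FB) = 1" for n
    unfolding phi_def ev_mulf[OF domRR] ev_CC_ww_FB[OF finite_Bn FB_Bn]
    using FB_Cfg ee0 by (simp add: RR_def kin_FB)
  hence "(\<lambda>n. 1) \<longlonglongrightarrow> ev f (0, FB)" using tendsto_ev[OF f, of "(0, FB)"] by simp
  hence "ev f (0, FB) = 1" by (simp add: LIMSEQ_const_iff)
  hence "f \<noteq> 0" by auto
  thus ?thesis using that f by blast
qed

end

section \<open>Energy bounds\<close>

lemma ball_card_bounds:
  assumes L: "L > 0" and r: "(kap L)\<^sup>2 \<le> r"
  shows "r / (kap L)\<^sup>2 / 2 \<le> real (card {k. msq L k \<le> r})" "real (card {k. msq L k \<le> r}) \<le> 9 * (r / (kap L)\<^sup>2)"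
proof -
  define \<rho> where "\<rho> = r / (kap L)\<^sup>2"
  have k: "(kap L)\<^sup>2 > 0" using kap_pos[OF L] by simp
  have \<rho>: "\<rho> \<ge> 1" using k r by (simp add: \<rho>_def)
  show "r / (kap L)\<^sup>2 / 2 \<le> real (card {k. msq L k \<le> r})"
    unfolding msq_ball[OF L] \<rho>_def[symmetric] by (rule card_nu_ball_ge) (use \<rho> in simp)
  have "real (card {k. nu k \<le> \<rho>}) \<le> (2 * sqrt \<rho> + 1)\<^sup>2" by (rule card_nu_ball_le) (use \<rho> in simp)
  also have "\<dots> \<le> (3 * sqrt \<rho>)\<^sup>2" using \<rho> by (intro power_mono) auto
  also have "\<dots> = 9 * \<rho>" using \<rho> by (simp add: power_mult_distrib)
  finally show "real (card {k. msq L k \<le> r}) \<le> 9 * (r / (kap L)\<^sup>2)" unfolding msq_ball[OF L] \<rho>_def[symmetric] .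
qed

context polaron_model
begin

text \<open>\<open>Hlim\<close> is an arbitrary choice; the existence of one limit operator shows
  that the choice has the defining properties, and only these are used afterwards.\<close>

lemma Egs_bounds: "ecut \<le> Egs M L \<mu> EB" "Egs M L \<mu> EB \<le> E0 L \<mu> + eP M L \<mu> EB"
proof -
  let ?N = "Suc NN" and ?H = "Hlim M L \<mu> EB"
  obtain D0 A0 where A0: "sa (sec ?N) D0 A0" and conv0: "\<And>z u x. Im z \<noteq> 0 \<Longrightarrow> (\<And>n. u n \<in> Dk) \<Longrightarrow> x \<in> D0 \<Longrightarrow>
     (\<And>n. An n (u n) - cs z (u n) = A0 x - cs z x) \<Longrightarrow> u \<longlonglongrightarrow> x"
    using limit_operator_exists by blast
  define H0 :: op where "H0 = (ev ` D0, \<lambda>\<psi>. ev (A0 (Abs_ell2 \<psi>)))"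
  have r0: "repr_op H0 D0 A0" by (simp add: repr_op_def H0_def ev_inverse)
  have "srs_conv ?N (Hn M L EB ?N) H0"
    unfolding srs_conv_repr[OF repr_Hn sa_Acut r0 A0]
  proof (intro allI impI)
    fix z u x assume z: "Im z \<noteq> 0" and u: "\<forall>n. u n \<in> Dk" and x: "x \<in> D0"
      and e: "\<forall>n. Acut M L EB n (u n) - cs z (u n) = A0 x - cs z x"
    have "(\<lambda>n. u (n + n0)) \<longlonglongrightarrow> x" by (rule conv0[OF z _ x]) (use u e in \<open>auto simp: An_def\<close>)
    thus "u \<longlonglongrightarrow> x" by (rule LIMSEQ_offset)
  qed
  hence "selfadjoint ?N H0 \<and> srs_conv ?N (Hn M L EB ?N) H0" using repr_selfadjoint[OF r0 A0] by blast
  hence H: "selfadjoint ?N ?H" "srs_conv ?N (Hn M L EB ?N) ?H"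
    unfolding Hlim_def Suc_NN[symmetric] by (rule someI2, blast)+
  obtain D A where r: "repr_op ?H D A" and A: "sa (sec ?N) D A" using selfadjoint_repr[OF H(1)] .
  have convA: "u \<longlonglongrightarrow> x" if "Im z \<noteq> 0" "\<And>n. u n \<in> Dk" "x \<in> D" "\<And>n. Acut M L EB n (u n) - cs z (u n) = A x - cs z x" for z u x
    using H(2) that unfolding srs_conv_repr[OF repr_Hn sa_Acut r A] by blast
  have conv: "u \<longlonglongrightarrow> x" if z: "Im z \<noteq> 0" and u: "\<And>n. u n \<in> Dk" and x: "x \<in> D" and e: "\<And>n. An n (u n) - cs z (u n) = A x - cs z x" for z u x
  proof -
    have y: "A x - cs z x \<in> sec ?N" using saD(1,6)[OF A] x csubD(3,6)[OF csub_supp_in] by blast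
    have "\<forall>n. \<exists>v\<in>Dk. Acut M L EB n v - cs z v = A x - cs z x"
      using sa_surj_nonreal[OF csub_supp_in closed_supp_in sa_Acut z y] by blast
    then obtain v where v: "\<And>n. v n \<in> Dk" "\<And>n. Acut M L EB n (v n) - cs z (v n) = A x - cs z x" by metis
    \<comment> \<open>The shifted sequence is extended to all indices: its first \<open>n0\<close>
      members are solutions for the unshifted cut-offs and do not affect the limit.\<close>
    define u' where "u' n = (if n0 \<le> n then u (n - n0) else v n)" for n
    have "Acut M L EB n (u' n) - cs z (u' n) = A x - cs z x" for n
      using v(2)[of n] e[of "n - n0"] by (cases "n0 \<le> n") (simp_all add: u'_def An_def)
    moreover have "u' n \<in> Dk" for n using v(1) u by (simp add: u'_def)
    ultimately have "u' \<longlonglongrightarrow> x" by (intro convA[OF z _ x])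
    from LIMSEQ_ignore_initial_segment[OF this, of n0] show ?thesis by (simp add: u'_def)
  qed
  have low: "ecut * (norm x)\<^sup>2 \<le> inner x (A x)" if "x \<in> D" for x
    by (rule resolvent_limit_lower_bound[OF csub_supp_in closed_supp_in saAn A conv low_An that])
  obtain f where f: "phi \<longlonglongrightarrow> f" "f \<noteq> 0" by (rule phi_limit)
  have up: "\<exists>x\<in>D. inner x (A x) < s' * (norm x)\<^sup>2" if "s' > z0" for s'
    by (rule resolvent_limit_upper_bound[OF csub_supp_in closed_supp_in saAn A conv low_An phi_Dk f theta_lim phi_form that])
  show "ecut \<le> Egs M L \<mu> EB" "Egs M L \<mu> EB \<le> E0 L \<mu> + eP M L \<mu> EB"
    using spectrum_inf_bounds[OF r A low up] unfolding Egs_def Suc_NN z0_def ee_def by auto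
qed

text \<open>\<open>X\<close> is \<open>(kap L)^2\<close> times the low-mode share. The 811 is 810 =
  9 * 9 * 10 from the low-mode error, with the ball of modes up to 10 \<mu> counted by area, plus 1
  from the annulus beyond the Fermi ball.\<close>

lemma elow_upper:
  assumes X: "X = (kap L)\<^sup>2 * low_sum M L \<mu> EB - 5001"
  shows "elow M L \<mu> EB b \<le> (kap L)\<^sup>2 / X * (real (card FB) + 811 * (24 * (1 + 2 * b)) * (\<mu> / (kap L)\<^sup>2) / X)"
proof -
  define k \<rho> a \<delta> where "k = (kap L)\<^sup>2" and "\<rho> = \<mu> / k" and "a = 24 * (1 + 2 * b)" and "\<delta> = \<mu> / X"
  have k: "k > 0" using k0 by (simp add: k_def)
  have \<rho>: "\<rho> \<ge> 1" using km k by (simp add: \<rho>_def k_def)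
  have Xb: "X = k * (low_sum M L \<mu> EB - 5001 / k)" using k by (simp add: X k_def right_diff_distrib)
  have X1: "1 \<le> X" and X2: "X \<le> b * sqrt \<rho>" using b1 b2 by (simp_all add: Xb k_def \<rho>_def)
  have "0 < b * sqrt \<rho>" using X1 X2 by linarith
  hence b0: "b > 0" using \<rho> by (simp add: zero_less_mult_iff)
  have d0: "\<delta> > 0" using mu X1 by (simp add: \<delta>_def)
  have dk: "\<delta> / k = \<rho> / X" by (simp add: \<delta>_def \<rho>_def)
  have sq: "sqrt \<rho> \<le> b * (\<delta> / k)"
  proof -
    have "sqrt \<rho> * X \<le> sqrt \<rho> * (b * sqrt \<rho>)" using X2 \<rho> by (intro mult_left_mono) auto
    also have "\<dots> = b * \<rho>" using \<rho> by (simp add: mult.left_commute)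
    finally show ?thesis using X1 by (simp add: dk pos_le_divide_eq)
  qed
  have sq1: "1 \<le> b * (\<delta> / k)"
  proof -
    have "1 \<le> sqrt \<rho>" using \<rho> by simp
    thus ?thesis using sq by linarith
  qed
  have ann: "finite {k. \<mu> - \<delta> \<le> msq L k \<and> msq L k \<le> \<mu> + \<delta>}"
    "real (card {k. \<mu> - \<delta> \<le> msq L k \<and> msq L k \<le> \<mu> + \<delta>}) \<le> a / k * \<delta>"
    using card_msq_annulus[OF L mu order_refl d0 sq[unfolded k_def \<rho>_def] sq1[unfolded k_def]] by (simp_all add: a_def k_def)
  have lin: "A + B \<le> F + d" if "A \<le> F + e" "e = e'" "B \<le> c" "e' + c = d" for A B F c d e e' :: real using that by linarith
  have "real (card {k. msq L k \<le> \<mu> + \<delta>}) \<le> real (card FB) + a / k * \<delta>"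
  proof -
    have "card {k. msq L k \<le> \<mu> + \<delta>} \<le> card (FB \<union> {k. \<mu> - \<delta> \<le> msq L k \<and> msq L k \<le> \<mu> + \<delta>})"
      using ann(1) d0 by (intro card_mono) (auto simp: FB_iff)
    also have "\<dots> \<le> card FB + card {k. \<mu> - \<delta> \<le> msq L k \<and> msq L k \<le> \<mu> + \<delta>}" by (rule card_Un_le)
    finally show ?thesis using ann(2) by linarith
  qed
  moreover have "a / k * \<delta> = a * \<rho> / X" by (simp add: \<delta>_def \<rho>_def)
  moreover have "9 * (a / k) * real (card {k. msq L k \<le> 10 * \<mu>}) / (X / k) \<le> 810 * a * \<rho> / X"
  proof -
    have "real (card {k. msq L k \<le> 10 * \<mu>}) \<le> 9 * (10 * \<mu> / k)"
      unfolding k_def by (rule ball_card_bounds(2)[OF L]) (use km mu in linarith)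
    hence "9 * a / X * real (card {k. msq L k \<le> 10 * \<mu>}) \<le> 9 * a / X * (9 * (10 * \<mu> / k))"
      using X1 b0 by (intro mult_left_mono) (auto simp: a_def)
    moreover have "9 * (a / k) * real (card {k. msq L k \<le> 10 * \<mu>}) / (X / k) = 9 * a / X * real (card {k. msq L k \<le> 10 * \<mu>})"
      using k by simp
    moreover have "9 * a / X * (9 * (10 * \<mu> / k)) = 810 * a * \<rho> / X" by (simp add: \<rho>_def mult_ac)
    ultimately show ?thesis by linarith
  qed
  moreover have "a * \<rho> / X + 810 * a * \<rho> / X = 811 * a * \<rho> / X" by (simp add: add_divide_distrib[symmetric])
  ultimately have "real (card {k. msq L k \<le> \<mu> + \<delta>}) + 9 * (a / k) * real (card {k. msq L k \<le> 10 * \<mu>}) / (X / k)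
      \<le> real (card FB) + 811 * a * \<rho> / X" by (rule lin)
  hence "(real (card {k. msq L k \<le> \<mu> + \<delta>}) + 9 * (a / k) * real (card {k. msq L k \<le> 10 * \<mu>}) / (X / k)) / (X / k)
      \<le> (real (card FB) + 811 * a * \<rho> / X) / (X / k)" using X1 k by (intro divide_right_mono) auto
  moreover have "elow M L \<mu> EB b = (real (card {k. msq L k \<le> \<mu> + \<delta>}) + 9 * (a / k) * real (card {k. msq L k \<le> 10 * \<mu>}) / (X / k)) / (X / k)"
  proof -
    have "low_sum M L \<mu> EB - 5001 / k = X / k" using k by (simp add: Xb)
    thus ?thesis using k by (simp add: elow_def Let_def k_def[symmetric] a_def \<delta>_def)
  qed
  ultimately have "elow M L \<mu> EB b \<le> (real (card FB) + 811 * a * \<rho> / X) / (X / k)" by (simp only:)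
  also have "\<dots> = k / X * (real (card FB) + 811 * a * \<rho> / X)" by simp
  finally show ?thesis unfolding a_def \<rho>_def k_def .
qed

text \<open>The bounds for \<open>elow\<close> and for \<open>- eP\<close> agree to leading order
  N(\<mu>) \<open>(kap L)^2 / X\<close>, with relative difference of order \<open>1 / X\<close>. The
  5201 is 5001 from \<open>X\<close> plus 200 from \<open>cG_upper\<close>; the factor 2 in
  \<open>C1\<close> trades \<open>\<mu> / (kap L)^2\<close> for twice the particle number.\<close>

lemma energy_gap:
  assumes X: "X = (kap L)\<^sup>2 * low_sum M L \<mu> EB - 5001" and X1: "X \<ge> 5201"
    and C1: "C1 = 2 * 811 * (24 * (1 + 2 * b))"
  shows "\<bar>Egs M L \<mu> EB - E0 L \<mu> - eP M L \<mu> EB\<bar> \<le> (5201 + 2 * C1) / X * \<bar>eP M L \<mu> EB\<bar>"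
proof -
  define k \<rho> N P where "k = (kap L)\<^sup>2" and "\<rho> = \<mu> / k" and "N = real (card FB)" and "P = \<bar>eP M L \<mu> EB\<bar>"
  have k: "k > 0" using k0 by (simp add: k_def)
  have \<rho>: "\<rho> \<ge> 1" using km k by (simp add: \<rho>_def k_def)
  have N: "\<rho> / 2 \<le> N" "N \<le> 9 * \<rho>" using ball_card_bounds[OF L km] by (simp_all add: N_def \<rho>_def k_def FB_def ball_lat_def)
  have X2: "X \<le> b * sqrt \<rho>" using b2 k by (simp add: X k_def \<rho>_def right_diff_distrib)
  have "0 < b * sqrt \<rho>" using X1 X2 by linarith
  hence b0: "b > 0" using \<rho> by (simp add: zero_less_mult_iff)
  have C0: "C1 > 0" using b0 by (simp add: C1)
  have P: "P = - eP M L \<mu> EB" "P > 0" using eP_properties(1) by (simp_all add: P_def)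
  have bm: "bm \<le> low_sum M L \<mu> EB" "0 \<le> bm"
    unfolding bm_def low_sum_def using term_pos mu L by (auto intro!: sum_mono2 sum_nonneg less_imp_le[OF term_pos] simp: FB_iff)
  have kb: "k * bm + 200 \<le> X + 5201" using mult_left_mono[OF bm(1) less_imp_le[OF k]] by (simp add: X k_def)
  have bp: "0 < bm + 200 / k" using bm(2) k by (simp add: add_nonneg_pos)
  have low: "N * k / (X + 5201) \<le> P"
  proof -
    have "N \<le> \<mu> * (bm + 200 / k)"
    proof -
      have "\<mu> * (bm + 200 / k) = \<rho> * (k * bm + 200)" using k by (simp add: \<rho>_def distrib_left)
      moreover have "\<rho> * 9 \<le> \<rho> * (k * bm + 200)" using \<rho> bm k by (intro mult_left_mono) auto
      ultimately show ?thesis using N by linarith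
    qed
    hence "N / (bm + 200 / k) \<le> P" using eP_lower by (simp add: N_def k_def P)
    moreover have "N * k / (X + 5201) \<le> N * k / (k * bm + 200)"
      using kb bm k N \<rho> X1 by (intro divide_left_mono mult_pos_pos) (auto simp: add_nonneg_pos)
    moreover have "N * k / (k * bm + 200) = N / (bm + 200 / k)"
    proof -
      have "k * bm + 200 = k * (bm + 200 / k)" using k by (simp add: distrib_left)
      thus ?thesis using k by simp
    qed
    ultimately show ?thesis by linarith
  qed
  have "elow M L \<mu> EB b \<le> k / X * (N + 811 * (24 * (1 + 2 * b)) * \<rho> / X)"
    using elow_upper[OF X] by (simp add: k_def N_def \<rho>_def)
  also have "\<dots> \<le> k / X * (N + C1 * N / X)"
  proof -
    have "811 * (24 * (1 + 2 * b)) * \<rho> \<le> 811 * (24 * (1 + 2 * b)) * (2 * N)" using N b0 by (intro mult_left_mono) auto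
    also have "\<dots> = C1 * N" by (simp add: C1)
    finally show ?thesis using X1 k by (intro mult_left_mono add_left_mono divide_right_mono) auto
  qed
  also have "\<dots> = (N * k / (X + 5201)) * ((1 + 5201 / X) * (1 + C1 / X))" 
  proof -
    have e: "N + C1 * N / X = N * (1 + C1 / X)" "1 + 5201 / X = (X + 5201) / X" using X1 by (simp_all add: field_simps)
    show ?thesis unfolding e using X1 by simp
  qed
  also have "\<dots> \<le> P * ((1 + 5201 / X) * (1 + C1 / X))" using low X1 C0 by (intro mult_right_mono) auto
  also have "\<dots> \<le> P * (1 + (5201 + 2 * C1) / X)"
  proof (intro mult_left_mono)
    have "5201 / X * (C1 / X) \<le> 1 * (C1 / X)" using X1 C0 by (intro mult_right_mono) auto
    thus "(1 + 5201 / X) * (1 + C1 / X) \<le> 1 + (5201 + 2 * C1) / X" by (simp add: distrib_left distrib_right add_divide_distrib)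
  qed (use P in simp)
  finally have "elow M L \<mu> EB b - P \<le> (5201 + 2 * C1) / X * P" by (simp add: distrib_left mult.commute)
  thus ?thesis using Egs_bounds P unfolding ecut_def P_def by linarith
qed

end

theorem mainTheorem1:
  fixes M :: real
  assumes "M > 1.225"
  shows "\<exists>c0 C. c0 > 0 \<and> C > 0 \<and>
    (\<forall>L \<mu> EB :: real. L > 0 \<longrightarrow> \<mu> > 0 \<longrightarrow> EB < 0 \<longrightarrow> L^2 * \<bar>EB\<bar> \<ge> 1 \<longrightarrow> \<mu> / \<bar>EB\<bar> \<ge> c0 \<longrightarrow>
      \<bar>Egs M L \<mu> EB - E0 L \<mu> - eP M L \<mu> EB\<bar> \<le> C * \<bar>eP M L \<mu> EB\<bar> / ln (\<mu> / \<bar>EB\<bar>))"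
proof -
  \<comment> \<open>2560 is the constant obtained in \<open>xu\<close>: 64 from the lower bound 1/64
    on \<open>\<beta>\<close>, times 5 * 8 from the crude lattice sum.\<close>
  define C1 :: real where "C1 = 2 * 811 * (24 * (1 + 2 * 2560))"
  \<comment> \<open>\<open>y\<close> is at least \<open>ln t / 48\<close>, and at least half of it
    survives the subtraction of 5001; hence 96.\<close>
  define C where "C = 96 * (5201 + 2 * C1)"
  have C: "C > 0" by (simp add: C_def C1_def)
  \<comment> \<open>Once the logarithm is at least 960000, \<open>y\<close> is at least 20000, which
    clears the 2500 of \<open>polaron_model\<close> and makes \<open>X = x - 5001\<close> at least
    5201.\<close>
  have main: "\<bar>Egs M L \<mu> EB - E0 L \<mu> - eP M L \<mu> EB\<bar> \<le> C * \<bar>eP M L \<mu> EB\<bar> / ln (\<mu> / \<bar>EB\<bar>)"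
    if L: "L > 0" and mu: "\<mu> > 0" and EB: "EB < 0" and LE: "L^2 * \<bar>EB\<bar> \<ge> 1" and t: "\<mu> / \<bar>EB\<bar> \<ge> exp 960000" for L \<mu> EB
  proof -
    define k \<rho> \<beta> t m where "k = (kap L)\<^sup>2" and "\<rho> = \<mu> / k" and "\<beta> = \<bar>EB\<bar> / k" and "t = \<mu> / \<bar>EB\<bar>" and "m = mred M"
    have M1: "M > 1" using assms by simp
    have m: "1 \<le> m" "m \<le> 2" using M1 by (simp_all add: m_def mred_def divide_le_eq)
    have k: "k > 0" using kap_pos[OF L] by (simp add: k_def)
    \<comment> \<open>\<open>k\<close> is (2 \<pi> / L)^2, at most 64 / L^2, and L^2 |E_B| is at
      least 1.\<close>
    have \<beta>: "1 / 64 \<le> \<beta>"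
    proof -
      have "pi\<^sup>2 \<le> 4\<^sup>2" using pi_less_4 by (intro power_mono) auto
      have "k * L\<^sup>2 = 4 * pi\<^sup>2" using L by (simp add: k_def kap_def power_divide power_mult_distrib)
      also have "\<dots> \<le> 64" using \<open>pi\<^sup>2 \<le> 4\<^sup>2\<close> by simp
      also have "\<dots> \<le> 64 * \<bar>EB\<bar> * L\<^sup>2" using LE by (simp add: mult_ac)
      finally have "k \<le> 64 * \<bar>EB\<bar>" using L by simp
      thus ?thesis using k by (simp add: \<beta>_def field_simps)
    qed
    have t1: "960001 \<le> t" "exp 960000 \<le> t" using exp_ge_add_one_self[of 960000] t by (simp_all add: t_def)
    have "ln (exp 960000) \<le> ln t" using t1 by (subst ln_le_cancel_iff) auto
    hence lt: "960000 \<le> ln t" by simp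
    have \<rho>t: "\<rho> = t * \<beta>" using EB k by (simp add: \<rho>_def t_def \<beta>_def)
    have \<rho>: "\<rho> \<ge> 1"
    proof -
      have "960001 * (1 / 64) \<le> t * \<beta>" using t1 \<beta> by (intro mult_mono) auto
      thus ?thesis using \<rho>t by linarith
    qed
    have km: "(kap L)\<^sup>2 \<le> \<mu>" using \<rho> k by (simp add: \<rho>_def k_def)
    have EBm: "\<bar>EB\<bar> \<le> \<mu>"
    proof -
      have "1 \<le> \<mu> / \<bar>EB\<bar>" using t1 by (simp add: t_def)
      moreover have "0 < \<bar>EB\<bar>" using EB by simp
      ultimately show ?thesis by (simp only: pos_le_divide_eq mult_1)
    qed
    have resc: "k * (1 / (m * msq L j - EB)) = 1 / (m * nu j + \<beta>)" for j
    proof -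
      have "m * msq L j - EB = k * (m * nu j + \<beta>)" using EB k by (simp add: msq_nu k_def[symmetric] \<beta>_def right_diff_distrib)
      thus ?thesis using k by simp
    qed
    define x where "x = k * low_sum M L \<mu> EB"
    define y where "y = k * (\<Sum>j\<in>ball_lat L \<mu>. 1 / (m * msq L j - EB))"
    have x: "x = (\<Sum>j | nu j \<le> 10 * \<rho>. 1 / (m * nu j + \<beta>))"
      unfolding x_def low_sum_def msq_ball[OF L] sum_distrib_left m_def[symmetric] resc by (simp add: \<rho>_def k_def)
    have y: "y = (\<Sum>j | nu j \<le> \<rho>. 1 / (m * nu j + \<beta>))"
      unfolding y_def ball_lat_def msq_ball[OF L] sum_distrib_left resc by (simp add: \<rho>_def k_def)
    have den: "0 < m * nu j + \<beta>" for j using m \<beta> nu_ge0[of j] by (intro add_nonneg_pos mult_nonneg_nonneg) auto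
    have yx: "y \<le> x" unfolding x y using den \<rho> by (intro sum_mono2) (auto intro: less_imp_le)
    have y48: "ln t / 48 \<le> y"
    proof -
      \<comment> \<open>\<open>lat_sum_log_ge\<close> requires 1/49 where \<open>\<beta>\<close> is
        only known to be at least 1/64, so it is applied with \<open>2 * \<beta>\<close>. This
        halves \<open>t\<close> under the logarithm, and \<open>ln (t / 2)\<close> is still at least
        half of \<open>ln t\<close>.\<close>
      have t2: "\<rho> / (2 * \<beta>) = t / 2" using \<beta> by (simp add: \<rho>t)
      have "ln 2 < (1::real)" using ln_2_less_1 by simp
      have "ln t / 2 \<le> ln (t / 2)" using lt t1 \<open>ln 2 < (1::real)\<close> by (simp add: ln_div)
      hence "ln t / 48 \<le> ln (t / 2) / 24" by simp
      also have "\<dots> \<le> ln (t / 2) / (12 * m)" using m t1 by (intro divide_left_mono) auto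
      also have "\<dots> \<le> (\<Sum>j | nu j \<le> \<rho>. 1 / (m * nu j + 2 * \<beta>))"
        unfolding t2[symmetric] by (rule lat_sum_log_ge[OF m(1)]) (use \<beta> t1 t2 in auto)
      also have "\<dots> \<le> y" unfolding y
      proof (rule sum_mono)
        fix j show "1 / (m * nu j + 2 * \<beta>) \<le> 1 / (m * nu j + \<beta>)" using den[of j] \<beta> by (intro divide_left_mono mult_pos_pos) auto
      qed
      finally show ?thesis .
    qed
    have xu: "x \<le> 2560 * sqrt \<rho>"
    proof -
      have "x \<le> (\<Sum>j | nu j \<le> 10 * \<rho>. 64 * (1 / (1 + nu j)))"
        unfolding x
      proof (rule sum_mono)
        fix j
        have n: "0 \<le> nu j" by (rule nu_ge0)
        have "1 * nu j \<le> m * nu j" using m n by (intro mult_right_mono)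
        hence "1 + nu j \<le> (m * nu j + \<beta>) * 64" using \<beta> n by argo
        hence "(1 + nu j) / 64 \<le> m * nu j + \<beta>" by (simp only: divide_le_eq_numeral zero_less_numeral pos_divide_le_eq)
        hence "1 / (m * nu j + \<beta>) \<le> 1 / ((1 + nu j) / 64)" using n by (intro divide_left_mono mult_pos_pos den) (auto simp: add_pos_nonneg)
        thus "1 / (m * nu j + \<beta>) \<le> 64 * (1 / (1 + nu j))" by simp
      qed
      also have "\<dots> \<le> 64 * (5 * (2 * sqrt (10 * \<rho>) + 1))"
        unfolding sum_distrib_left[symmetric] using \<rho> by (intro mult_left_mono lat_sum_crude) auto
      also have "\<dots> \<le> 2560 * sqrt \<rho>"
      proof -
        have "sqrt (10 * \<rho>) \<le> sqrt ((7 / 2)\<^sup>2 * \<rho>)" using \<rho> by (intro real_sqrt_le_mono mult_right_mono) (auto simp: power2_eq_square)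
        also have "\<dots> = 7 / 2 * sqrt \<rho>" unfolding real_sqrt_mult by simp
        finally have "sqrt (10 * \<rho>) \<le> 7 / 2 * sqrt \<rho>" .
        moreover have "1 \<le> sqrt \<rho>" using \<rho> by simp
        moreover have "64 * (5 * (2 * u + 1)) \<le> 2560 * v" if "u \<le> 7 / 2 * v" "1 \<le> v" for u v :: real using that by argo
        ultimately show ?thesis by blast
      qed
      finally show ?thesis .
    qed
    have y0: "20000 \<le> y" using y48 lt by linarith
    define X where "X = x - 5001"
    have Xb: "(kap L)\<^sup>2 * (low_sum M L \<mu> EB - 5001 / (kap L)\<^sup>2) = X"
      using k by (simp add: X_def x_def k_def right_diff_distrib)
    interpret polaron_model M L \<mu> EB 2560
    proof
      show "1 \<le> (kap L)\<^sup>2 * (low_sum M L \<mu> EB - 5001 / (kap L)\<^sup>2)" unfolding Xb X_def using y0 yx by linarith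
      show "(kap L)\<^sup>2 * (low_sum M L \<mu> EB - 5001 / (kap L)\<^sup>2) \<le> 2560 * sqrt (\<mu> / (kap L)\<^sup>2)"
        unfolding Xb X_def using xu by (simp add: \<rho>_def k_def)
      show "2500 < (kap L)\<^sup>2 * (\<Sum>k\<in>ball_lat L \<mu>. 1 / (mred M * msq L k - EB))"
        using y0 by (simp add: y_def k_def m_def)
    qed (use L assms mu km EB EBm in auto)
    have "\<bar>Egs M L \<mu> EB - E0 L \<mu> - eP M L \<mu> EB\<bar> \<le> (5201 + 2 * C1) / X * \<bar>eP M L \<mu> EB\<bar>"
      by (rule energy_gap[OF _ _ C1_def]) (use y0 yx in \<open>auto simp: X_def x_def k_def\<close>)
    also have "\<dots> \<le> C / ln t * \<bar>eP M L \<mu> EB\<bar>"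
    proof (rule mult_right_mono)
      have "ln t / 96 \<le> X" using y48 y0 yx unfolding X_def by linarith
      hence "(5201 + 2 * C1) / X \<le> (5201 + 2 * C1) / (ln t / 96)" using lt by (intro divide_left_mono mult_pos_pos) (auto simp: C1_def)
      thus "(5201 + 2 * C1) / X \<le> C / ln t" by (simp add: C_def mult.commute)
    qed simp
    finally show ?thesis by (simp add: t_def)
  qed
  show ?thesis by (rule exI[of _ "exp 960000"], rule exI[of _ C]) (use main C in auto)
qed

end
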